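(* Let $f\in M_p$, $1<p<\infty$, $\alpha_i>0$, $n_i\in\mathbb{N}$, $i=1,2$. Then $$\omega_{\alpha_1,\alpha_2}\Big(f,\frac1{n_1},\frac1{n_2}\Big)_{L_p(\mathbb{T}^2)}\asymp\frac1{n_1^{\alpha_1}}\frac1{n_2^{\alpha_2}}\Big\{\sum_{\nu_1=1}^{n_1+1}\sum_{\nu_2=1}^{n_2+1}\nu_1^{\alpha_1p-1}\nu_2^{\alpha_2p-1}\,Y^p_{\nu_1-1,\nu_2-1}(f)_{L_p(\mathbb{T}^2)}\Big\}^{1/p}.$$
   Context: $L_p(\mathbb{T}^2)$, $1<p<\infty$, is the space of measurable functions $f(x,y)$ that are $2\pi$-periodic in each variable with $\|f\|_{L_p(\mathbb{T}^2)}=\big(\int_0^{2\pi}\int_0^{2\pi}|f(x,y)|^p\,dx\,dy\big)^{1/p}<\infty$; $L_p^0(\mathbb{T}^2)$ is the set of $f\in L_p(\mathbb{T}^2)$ with $\int_0^{2\pi}f(x,y)\,dy=0$ for a.e. $x$ and $\int_0^{2\pi}f(x,y)\,dx=0$ for a.e. $y$. $\mathbb{N}=\{1,2,\ldots\}$. The class $M_p$, $1<p<\infty$, is the set of $f\in L_p^0(\mathbb{T}^2)$ whose Fourier series is $\sum_{\nu_1=1}^\infty\sum_{\nu_2=1}^\infty a_{\nu_1,\nu_2}\cos\nu_1x\cos\nu_2y$ with $a_{\nu_1,\nu_2}-a_{\nu_1+1,\nu_2}-a_{\nu_1,\nu_2+1}+a_{\nu_1+1,\nu_2+1}\ge0$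 for all integers $\nu_1,\nu_2\ge1$. For $\alpha_1,\alpha_2>0$ the (fractional) differences are $\Delta_{h_1}^{\alpha_1}(f)=\sum_{\nu=0}^\infty(-1)^\nu\binom{\alpha_1}{\nu}f(x+(\alpha_1-\nu)h_1,y)$ and $\Delta_{h_2}^{\alpha_2}(f)=\sum_{\nu=0}^\infty(-1)^\nu\binom{\alpha_2}{\nu}f(x,y+(\alpha_2-\nu)h_2)$, where $\binom{\alpha}{0}=1$, $\binom{\alpha}{\nu}=\frac{\alpha(\alpha-1)\cdots(\alpha-\nu+1)}{\nu!}$ for $\nu\ge1$. The mixed modulus of smoothness is $\omega_{\alpha_1,\alpha_2}(f,\delta_1,\delta_2)_{L_p(\mathbb{T}^2)}=\sup_{|h_i|\le\delta_i,\,i=1,2}\|\Delta_{h_1}^{\alpha_1}(\Delta_{h_2}^{\alpha_2}(f))\|_{L_p(\mathbb{T}^2)}$. The best angular approximation is $Y_{m_1,m_2}(f)_{L_p(\mathbb{T}^2)}=\inf\|f-T_{m_1,\infty}-T_{\infty,m_2}\|_{L_p(\mathbb{T}^2)}$, the infimum over all $T_{m_1,\infty},T_{\infty,m_2}\in L_p(\mathbb{T}^2)$ such that $T_{m_1,\infty}$ is a trigonometric polynomial of degree at most $m_1$ in $x$ (with coefficients depending on $y$) and $T_{\infty,m_2}$ is a trigonometric polynomial of degree at most $m_2$ in $y$ (with coefficients depending on $x$); $Y^s$ denotes its $s$-th power. $A\asymp B$ means $C^{-1}B\le A\le CB$ with a constant $C>0$ independent of $f,n_1,n_2$ ($C$ may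 depend on $p,\alpha_1,\alpha_2$). *)

theory Defs
  imports "HOL-Analysis.Analysis"
begin

definition period_square :: "(real \<times> real) set" where
  "period_square = {0..2*pi} \<times> {0..2*pi}"

text \<open>Elements of the Lebesgue space are represented by everywhere defined real functions, not by
  equivalence classes. Measurability is Lebesgue measurability on the plane.\<close>

definition Lp_torus :: "real \<Rightarrow> (real \<times> real \<Rightarrow> real) set" where
  "Lp_torus p = {f. f \<in> borel_measurable lebesgue \<and>
     (\<forall>x y. f (x + 2*pi, y) = f (x, y) \<and> f (x, y + 2*pi) = f (x, y)) \<and>
     set_integrable lebesgue period_square (\<lambda>z. \<bar>f z\<bar> powr p)}"

definition Lp_norm :: "real \<Rightarrow> (real \<times> real \<Rightarrow> real) \<Rightarrow> real" where
  "Lp_norm p f = (LINT z:period_square|lebesgue. \<bar>f z\<bar> powr p) powr (1/p)"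

text \<open>By Fubini, almost every section of an element of \<^term>\<open>Lp_torus p\<close> (with
  \<^prop>\<open>1 \<le> p\<close>) is integrable over a period, so the value 0 that the Bochner integral
  assigns to non-integrable functions plays no role here.\<close>

definition Lp0_torus :: "real \<Rightarrow> (real \<times> real \<Rightarrow> real) set" where
  "Lp0_torus p = {f \<in> Lp_torus p.
     (AE x in lebesgue. (LINT y:{0..2*pi}|lebesgue. f (x, y)) = 0) \<and>
     (AE y in lebesgue. (LINT x:{0..2*pi}|lebesgue. f (x, y)) = 0)}"

text \<open>The Fourier series of \<open>f\<close> with respect to the real trigonometric system is
  \<open>\<Sum>k\<ge>1. \<Sum>l\<ge>1. a k l * cos (k x) * cos (l y)\<close>: the coefficient of
  \<open>cos (k x) * cos (l y)\<close> is \<open>a k l\<close> for \<open>k, l \<ge> 1\<close> (the factor \<open>pi\<^sup>2\<close> is the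
  squared norm of this function on the period square), and all other coefficients vanish.
  This is a statement about coefficients only; no convergence is required. The values
  \<open>a 0 l\<close> and \<open>a k 0\<close> are irrelevant.\<close>

definition has_cos_cos_Fourier_series ::
    "(real \<times> real \<Rightarrow> real) \<Rightarrow> (nat \<Rightarrow> nat \<Rightarrow> real) \<Rightarrow> bool" where
  "has_cos_cos_Fourier_series f a \<longleftrightarrow> (\<forall>k l.
     (LINT (x, y):period_square|lebesgue. f (x, y) * (cos (real k * x) * cos (real l * y))) =
        (if k = 0 \<or> l = 0 then 0 else pi^2 * a k l) \<and>
     (LINT (x, y):period_square|lebesgue. f (x, y) * (cos (real k * x) * sin (real l * y))) = 0 \<and>
     (LINT (x, y):period_square|lebesgue. f (x, y) * (sin (real k * x) * cos (real l * y))) = 0 \<and>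
     (LINT (x, y):period_square|lebesgue. f (x, y) * (sin (real k * x) * sin (real l * y))) = 0)"

definition class_M :: "real \<Rightarrow> (real \<times> real \<Rightarrow> real) set" where
  "class_M p = {f \<in> Lp0_torus p. \<exists>a. has_cos_cos_Fourier_series f a \<and>
     (\<forall>k\<ge>1. \<forall>l\<ge>1. a k l - a (k + 1) l - a k (l + 1) + a (k + 1) (l + 1) \<ge> 0)}"

text \<open>For \<open>\<alpha> > 0\<close> the binomial coefficients are absolutely summable, so for \<open>f\<close> in
  \<^term>\<open>Lp_torus p\<close> (with \<^prop>\<open>1 \<le> p\<close>) the series below converge absolutely almost
  everywhere as well as in norm; the pointwise sums therefore represent the norm limits.\<close>

definition frac_diff1 :: "real \<Rightarrow> real \<Rightarrow> (real \<times> real \<Rightarrow> real) \<Rightarrow> real \<times> real \<Rightarrow> real" where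
  "frac_diff1 \<alpha> h f = (\<lambda>(x, y). \<Sum>\<nu>. (-1)^\<nu> * (\<alpha> gchoose \<nu>) * f (x + (\<alpha> - real \<nu>) * h, y))"

definition frac_diff2 :: "real \<Rightarrow> real \<Rightarrow> (real \<times> real \<Rightarrow> real) \<Rightarrow> real \<times> real \<Rightarrow> real" where
  "frac_diff2 \<alpha> h f = (\<lambda>(x, y). \<Sum>\<nu>. (-1)^\<nu> * (\<alpha> gchoose \<nu>) * f (x, y + (\<alpha> - real \<nu>) * h))"

text \<open>The supremum is over a set of reals that is bounded above for \<open>f\<close> in
  \<^term>\<open>Lp_torus p\<close> with \<^prop>\<open>1 \<le> p\<close> and positive orders, since the differences are bounded
  operators uniformly in the steps.\<close>

definition mixed_modulus ::
    "real \<Rightarrow> real \<Rightarrow> real \<Rightarrow> (real \<times> real \<Rightarrow> real) \<Rightarrow> real \<Rightarrow> real \<Rightarrow> real" where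
  "mixed_modulus p \<alpha>1 \<alpha>2 f \<delta>1 \<delta>2 =
     (SUP (h1, h2) \<in> {(h1, h2). \<bar>h1\<bar> \<le> \<delta>1 \<and> \<bar>h2\<bar> \<le> \<delta>2}.
        Lp_norm p (frac_diff1 \<alpha>1 h1 (frac_diff2 \<alpha>2 h2 f)))"

definition trig_poly_in_x :: "nat \<Rightarrow> (real \<times> real \<Rightarrow> real) \<Rightarrow> bool" where
  "trig_poly_in_x m T \<longleftrightarrow> (\<exists>a b. \<forall>x y.
     T (x, y) = (\<Sum>k\<le>m. a k y * cos (real k * x) + b k y * sin (real k * x)))"

definition trig_poly_in_y :: "nat \<Rightarrow> (real \<times> real \<Rightarrow> real) \<Rightarrow> bool" where
  "trig_poly_in_y m T \<longleftrightarrow> (\<exists>a b. \<forall>x y.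
     T (x, y) = (\<Sum>k\<le>m. a k x * cos (real k * y) + b k x * sin (real k * y)))"

definition best_angular_approx ::
    "real \<Rightarrow> nat \<Rightarrow> nat \<Rightarrow> (real \<times> real \<Rightarrow> real) \<Rightarrow> real" where
  "best_angular_approx p m1 m2 f =
     Inf {Lp_norm p (\<lambda>z. f z - S z - T z) | S T.
        S \<in> Lp_torus p \<and> trig_poly_in_x m1 S \<and> T \<in> Lp_torus p \<and> trig_poly_in_y m2 T}"

end

theory Submission
  imports Defs
begin

text \<open>The Fourier coefficients of a function of the class are nonnegative and decreasing in each index, and
  by two-fold Abel summation the function is a limit of sums of products \<open>D_i(x) D_j(y)\<close> of Dirichlet-type
  kernels with nonnegative coefficients. Since \<open>\<bar>D_i(x)\<bar>\<close> is dominated by the sum over \<open>k \<le> i\<close> of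
  \<open>1 / (1 + k \<bar>sin (x/2)\<bar>)\<close>, Schur's test bounds the \<open>L_p\<close> norm of such sums by
  \<open>\<Sum> a_{kl}^p (k l)^{p-2}\<close>. A fractional difference or an angular remainder merely inserts the weights
  \<open>min(1, k/n)\<close> to suitable powers. In the other direction, pairing with blocks of cosines and the dual
  Schur test bound these coefficient sums by the \<open>L_p\<close> norm of the remainder, respectively by the modulus of
  smoothness; for the latter the pairing is averaged over the steps \<open>h\<close>. Hence both sides are comparable to
  \<open>\<Sum> a_{kl}^p (k l)^{p-2} min(1, k/n1)^{\<alpha>1 p} min(1, l/n2)^{\<alpha>2 p}\<close>, the sum over \<open>\<nu>\<close> being a
  power sum that reproduces these weights.\<close>

section \<open>Power sums and a cosine kernel\<close>

text \<open>The hypothesis gives a sign only to the mixed difference of the coefficients;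
  monotonicity in each index and decay are recovered from averages over blocks of coefficients,
  which tend to 0 by dominated convergence. All estimates are proved for finite Abel sums with
  constants independent of their length and are then transferred to \<open>f\<close> by convergence
  in L_p. That convergence rests on the same Schur tests, through an integrable majorant of all Abel
  sums, and on uniqueness of Fourier coefficients. The obstacle on the side of the modulus is that
  the multiplier \<open>(2 * sin (k * h / 2)) powr \<alpha>\<close> is monotone in \<open>k\<close>
  only while \<open>k * h\<close> stays below \<open>pi\<close>, and that it vanishes when
  \<open>k * h\<close> reaches \<open>2 * pi\<close>. From above, frequencies beyond
  \<open>n\<close> therefore use only the boundedness of the difference operator. From below,
  averaging over \<open>h\<close> leaves the term of index 0 of the binomial series dominant at high
  frequencies. The angular remainder is estimated with weights of order \<open>2 * \<alpha>\<close>
  rather than \<open>\<alpha>\<close>, since the sum over the degrees beyond \<open>k\<close> would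
  otherwise produce a logarithm.\<close>

lemma powr_tangent:
  fixes p x l :: real
  assumes "p > 1" "x \<ge> 0" "l \<ge> 0"
  shows "l powr p + p * l powr (p - 1) * (x - l) \<le> x powr p"
proof -
  \<comment> \<open>With the conjugate exponent, Young's inequality for \<open>x\<close> and
    \<open>l powr (p - 1)\<close> is the tangent inequality up to the factor
    \<open>p\<close>.\<close>
  define q where "q = p / (p - 1)"
  have q: "q > 1" "1/p + 1/q = 1" using assms(1) by (auto simp: q_def field_simps)
  have "x * l powr (p-1) \<le> x powr p / p + (l powr (p-1)) powr q / q"
    by (rule Youngs_inequality) (use assms q in auto)
  also have "(l powr (p-1)) powr q = l powr p"
    using assms(1) by (simp add: powr_powr q_def)
  finally have "p * (x * l powr (p-1)) \<le> p * (x powr p / p + l powr p / q)"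
    using assms(1) by (intro mult_left_mono) auto
  also have "\<dots> = x powr p + (p - 1) * l powr p"
    using assms(1) by (simp add: q_def field_simps)
  finally have 1: "p * (x * l powr (p-1)) \<le> x powr p + (p - 1) * l powr p" .
  have "l * l powr (p - 1) = l powr p"
    using assms by (cases "l = 0") (auto simp: powr_mult_base)
  hence "p * l powr (p - 1) * (x - l) = p * (x * l powr (p-1)) - p * l powr p"
    by (metis mult.assoc mult.commute right_diff_distrib')
  moreover have "(p - 1) * l powr p = p * l powr p - l powr p" by (simp add: algebra_simps)
  ultimately show ?thesis using 1 by linarith
qed

text \<open>Summing the tangents at \<open>T / A\<close>, with \<open>T\<close> the weighted sum,
  gives Jensen's inequality even for weights that only add up to at most \<open>A\<close>: the
  missing mass enters with the factor \<open>p\<close>, and \<open>p > 1\<close> gives it the right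
  sign.\<close>

lemma jensen_sum_powr:
  fixes w z :: "'a \<Rightarrow> real"
  assumes "p > 1" "finite I" "\<And>i. i \<in> I \<Longrightarrow> w i \<ge> 0" "\<And>i. i \<in> I \<Longrightarrow> z i \<ge> 0"
    and A: "A > 0" "(\<Sum>i\<in>I. w i) \<le> A"
  shows "(\<Sum>i\<in>I. w i * z i) powr p \<le> A powr (p - 1) * (\<Sum>i\<in>I. w i * z i powr p)"
proof -
  define T where "T = (\<Sum>i\<in>I. w i * z i)"
  define l where "l = T / A"
  have T0: "T \<ge> 0" unfolding T_def using assms by (intro sum_nonneg) auto
  have l0: "l \<ge> 0" using T0 A by (simp add: l_def)
  have "(\<Sum>i\<in>I. w i * (l powr p + p * l powr (p - 1) * (z i - l))) \<le> (\<Sum>i\<in>I. w i * z i powr p)"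
    by (intro sum_mono mult_left_mono powr_tangent) (use assms l0 in auto)
  also have "(\<Sum>i\<in>I. w i * (l powr p + p * l powr (p - 1) * (z i - l))) =
      (\<Sum>i\<in>I. w i) * l powr p + p * l powr (p - 1) * (T - l * (\<Sum>i\<in>I. w i))"
    by (simp add: T_def algebra_simps sum.distrib sum_subtractf sum_distrib_left sum_distrib_right)
  also have "\<dots> = l powr p * ((\<Sum>i\<in>I. w i) + p * (A - (\<Sum>i\<in>I. w i)))"
  proof -
    have "T = l * A" using A by (simp add: l_def)
    moreover have "l * l powr (p - 1) = l powr p"
      using l0 by (cases "l = 0") (auto simp: powr_mult_base)
    ultimately show ?thesis by (simp add: algebra_simps)
  qed
  finally have "l powr p * ((\<Sum>i\<in>I. w i) + p * (A - (\<Sum>i\<in>I. w i))) \<le> (\<Sum>i\<in>I. w i * z i powr p)" .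
  moreover have "A \<le> (\<Sum>i\<in>I. w i) + p * (A - (\<Sum>i\<in>I. w i))"
    using mult_right_mono[of 1 p "A - (\<Sum>i\<in>I. w i)"] assms(1) A by auto
  ultimately have "l powr p * A \<le> (\<Sum>i\<in>I. w i * z i powr p)"
    by (meson mult_left_mono order_trans powr_ge_zero)
  hence "A powr (p - 1) * (l powr p * A) \<le> A powr (p - 1) * (\<Sum>i\<in>I. w i * z i powr p)"
    by (intro mult_left_mono) auto
  moreover have "A powr (p - 1) * (l powr p * A) = T powr p"
    using A T0 by (simp add: l_def powr_divide powr_diff)
  ultimately show ?thesis by (simp add: T_def)
qed

text \<open>Hoelder's inequality for the measure with density \<open>w\<close>. One linear majorant
  \<open>z <= c * z powr p + e\<close>, from the tangent at \<open>(X / A) powr (1 / p)\<close>, is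
  integrated; that point balances the two integrals. For \<open>X = 0\<close> it degenerates, and
  \<open>w * z\<close> vanishes almost everywhere instead.\<close>

lemma holder_nn:
  fixes w z :: "'a \<Rightarrow> real"
  assumes p: "p > 1" and A: "A > 0" and X: "X \<ge> 0"
    and [measurable]: "w \<in> borel_measurable M" "z \<in> borel_measurable M"
    and w0: "\<And>x. w x \<ge> 0" and z0: "\<And>x. z x \<ge> 0"
    and wA: "(\<integral>\<^sup>+x. ennreal (w x) \<partial>M) \<le> ennreal A"
    and wX: "(\<integral>\<^sup>+x. ennreal (w x * z x powr p) \<partial>M) \<le> ennreal X"
  shows "(\<integral>\<^sup>+x. ennreal (w x * z x) \<partial>M) \<le> ennreal (A powr (1 - 1/p) * X powr (1/p))"
proof (cases "X = 0")
  case True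
  have "(\<integral>\<^sup>+x. ennreal (w x * z x powr p) \<partial>M) = 0" using wX True by simp
  hence "AE x in M. ennreal (w x * z x powr p) = 0"
    by (subst (asm) nn_integral_0_iff_AE) auto
  hence "AE x in M. ennreal (w x * z x) = 0"
    by eventually_elim (use w0 z0 in \<open>auto simp: ennreal_eq_0_iff mult_le_0_iff\<close>)
  hence "(\<integral>\<^sup>+x. ennreal (w x * z x) \<partial>M) = 0"
    by (subst nn_integral_0_iff_AE) auto
  thus ?thesis by simp
next
  case False
  hence X0: "X > 0" using X by simp
  define l where "l = (X / A) powr (1/p)"
  have l0: "l > 0" using X0 A by (simp add: l_def)
  define c where "c = l powr (1 - p) / p"
  define e where "e = (1 - 1/p) * l"
  have c0: "c \<ge> 0" "e \<ge> 0" using p l0 by (auto simp: c_def e_def)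
  have ineq: "z x \<le> c * z x powr p + e" for x
  proof -
    have "l powr (1 - p) * (l powr p + p * l powr (p - 1) * (z x - l)) \<le> l powr (1 - p) * z x powr p"
      by (intro mult_left_mono powr_tangent) (use p l0 z0 in auto)
    also have "l powr (1 - p) * (l powr p + p * l powr (p - 1) * (z x - l)) =
       l powr (1 - p + p) + p * l powr (1 - p + (p - 1)) * (z x - l)"
      by (simp only: powr_add) (simp add: algebra_simps)
    also have "\<dots> = l + p * (z x - l)" using l0 by simp
    finally have "p * z x \<le> l powr (1 - p) * z x powr p + (p - 1) * l" by (simp add: algebra_simps)
    hence "z x \<le> (l powr (1 - p) * z x powr p + (p - 1) * l) / p" using p by (simp add: field_simps)
    also have "\<dots> = c * z x powr p + e" using p by (simp add: c_def e_def field_simps)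
    finally show ?thesis .
  qed
  have "(\<integral>\<^sup>+x. ennreal (w x * z x) \<partial>M) \<le> (\<integral>\<^sup>+x. ennreal c * ennreal (w x * z x powr p) + ennreal e * ennreal (w x) \<partial>M)"
  proof (intro nn_integral_mono)
    fix x
    have "w x * z x \<le> w x * (c * z x powr p + e)" using ineq w0 by (intro mult_left_mono) auto
    also have "\<dots> = c * (w x * z x powr p) + e * w x" by (simp add: algebra_simps)
    finally show "ennreal (w x * z x) \<le> ennreal c * ennreal (w x * z x powr p) + ennreal e * ennreal (w x)"
      using c0 w0[of x] by (simp add: ennreal_mult[symmetric] ennreal_plus[symmetric] del: ennreal_plus)
  qed
  also have "\<dots> = ennreal c * (\<integral>\<^sup>+x. ennreal (w x * z x powr p) \<partial>M) + ennreal e * (\<integral>\<^sup>+x. ennreal (w x) \<partial>M)"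
    by (simp add: nn_integral_add nn_integral_cmult)
  also have "\<dots> \<le> ennreal c * ennreal X + ennreal e * ennreal A"
    by (intro add_mono mult_left_mono wA wX) auto
  also have "\<dots> = ennreal (c * X + e * A)"
    using c0 X A by (simp add: ennreal_mult[symmetric] ennreal_plus[symmetric] del: ennreal_plus)
  also have "c * X + e * A = l * A"
  proof -
    have "l powr p = X / A" using p X0 A by (simp add: l_def powr_powr)
    hence "l powr (1 - p) * X = l * A" using l0 X0 A by (simp add: powr_diff field_simps)
    hence "c * X = l * A / p" by (simp add: c_def)
    thus ?thesis using p by (simp add: e_def field_simps)
  qed
  also have "l * A = A powr (1 - 1/p) * X powr (1/p)"
    using A X0 by (simp add: l_def powr_divide powr_diff field_simps)
  finally show ?thesis .
qed

text \<open>For \<open>s >= 1\<close> every term is at most the last one. For \<open>s < 1\<close>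
  concavity of \<open>u powr s\<close> bounds each term by an increment of
  \<open>m powr s / s\<close>. The constant \<open>1 + 1/s\<close> dominates both cases.\<close>

lemma sum_powr_upper:
  fixes s :: real
  assumes "s > 0"
  shows "(\<Sum>k=1..m. real k powr (s - 1)) \<le> (1 + 1/s) * real m powr s"
proof (cases "s \<ge> 1")
  case True
  have "(\<Sum>k=1..m. real k powr (s - 1)) \<le> (\<Sum>k=1..m. real m powr (s - 1))"
    by (intro sum_mono powr_mono2) (use True in auto)
  also have "\<dots> = real m powr s"
    by (cases "m = 0") (auto simp: powr_mult_base)
  also have "\<dots> \<le> (1 + 1/s) * real m powr s"
    using assms mult_right_mono[of 1 "1 + 1/s" "real m powr s"] by auto
  finally show ?thesis .
next
  case False
  have "(\<Sum>k=1..m. real k powr (s - 1)) \<le> (1/s) * real m powr s"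
  proof (induction m)
    case (Suc m)
    have "s * real (Suc m) powr (s - 1) + real m powr s \<le> real (Suc m) powr s"
    proof (cases "m = 0")
      case True thus ?thesis using False by simp
    next
      case m: False
      define u where "u = real m / real (Suc m)"
      have u: "u > 0" using m by (auto simp: u_def)
      have "u powr s * 1 powr (1 - s) \<le> s * u + (1 - s) * 1"
        by (rule Youngs_inequality_0) (use False assms u in auto)
      hence "u powr s \<le> 1 - s * (1 - u)" by (simp add: algebra_simps)
      also have "1 - u = 1 / real (Suc m)" by (simp add: u_def field_simps)
      finally have "real (Suc m) powr s * u powr s \<le> real (Suc m) powr s * (1 - s * (1 / real (Suc m)))"
        by (intro mult_left_mono) auto
      moreover have "real (Suc m) powr s * u powr s = real m powr s"
        by (simp add: u_def powr_divide)
      moreover have "real (Suc m) powr s * (1 - s * (1 / real (Suc m))) = real (Suc m) powr s - s * real (Suc m) powr (s - 1)"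
        by (simp add: powr_diff field_simps)
      ultimately show ?thesis by linarith
    qed
    hence "real (Suc m) powr (s - 1) \<le> (real (Suc m) powr s - real m powr s) / s"
      using assms by (simp add: field_simps)
    with Suc show ?case by (simp add: diff_divide_distrib)
  qed (use assms in auto)
  also have "\<dots> \<le> (1 + 1/s) * real m powr s" using assms by (intro mult_right_mono) auto
  finally show ?thesis .
qed

text \<open>For \<open>s >= 1\<close> the upper half of the range has at least \<open>m / 2\<close>
  terms of size at least \<open>(m / 2) powr (s - 1)\<close>; for \<open>s < 1\<close> the last term
  is the smallest, and there are \<open>m\<close> of them.\<close>

lemma sum_powr_lower:
  fixes s :: real
  assumes "s > 0"
  shows "(real m / 2) powr s \<le> (\<Sum>k=1..m. real k powr (s - 1))"
proof (cases "m = 0")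
  case False
  show ?thesis
  proof (cases "s \<ge> 1")
    case True
    define i where "i = m - m div 2"
    have i: "real i \<ge> real m / 2" "i \<ge> 1" "i \<le> m" using False unfolding i_def by linarith+
    have "(real m / 2) powr s = real m / 2 * (real m / 2) powr (s - 1)"
      using False powr_mult_base[of "real m / 2" "s - 1"] by simp
    also have "\<dots> \<le> real (m + 1 - i) * (real m / 2) powr (s - 1)"
      by (intro mult_right_mono) (use i in \<open>auto simp: i_def\<close>)
    also have "\<dots> = (\<Sum>k=i..m. (real m / 2) powr (s - 1))" using i by (simp add: of_nat_diff)
    also have "\<dots> \<le> (\<Sum>k=i..m. real k powr (s - 1))"
      by (intro sum_mono powr_mono2) (use i True in auto)
    also have "\<dots> \<le> (\<Sum>k=1..m. real k powr (s - 1))"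
      by (intro sum_mono2) (use i in auto)
    finally show ?thesis .
  next
    case s: False
    have "(real m / 2) powr s \<le> real m powr s" using assms by (intro powr_mono2) auto
    also have "\<dots> = (\<Sum>k=1..m. real m powr (s - 1))"
      using False by (simp add: powr_mult_base)
    also have "\<dots> \<le> (\<Sum>k=1..m. real k powr (s - 1))"
      by (intro sum_mono powr_mono2') (use s in auto)
    finally show ?thesis .
  qed
qed auto

text \<open>Discrete comparison with the integral of \<open>x powr (- t - 1)\<close>: the bound
  \<open>1 + y <= exp y\<close> makes each term at most an increment of
  \<open>- (x powr (- t)) / t\<close>, and the increments telescope.\<close>

lemma sum_powr_tail:
  fixes t :: real
  assumes "t > 0" "m \<ge> 1"
  shows "(\<Sum>k=m+1..N. real k powr (- t - 1)) \<le> real m powr (- t) / t"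
proof -
  have "(\<Sum>k=m+1..N. real k powr (- t - 1)) \<le> (real m powr (-t) - real N powr (-t)) / t" if "N \<ge> m" for N
    using that
  proof (induction N rule: dec_induct)
    case base thus ?case by simp
  next
    case (step k)
    define u where "u = real k / real (Suc k)"
    have u: "u > 0" "u \<le> 1" using step assms by (auto simp: u_def)
    have "1 + t * (1 - u) \<le> 1 + (- t) * ln u"
      using mult_left_mono[OF ln_le_minus_one[of u], of t] u assms by (simp add: algebra_simps)
    also have "\<dots> \<le> exp ((- t) * ln u)" by (rule exp_ge_add_one_self)
    also have "\<dots> = u powr (- t)" using u by (simp add: powr_def)
    finally have "real (Suc k) powr (-t) * (1 + t * (1 - u)) \<le> real (Suc k) powr (-t) * u powr (-t)"
      by (intro mult_left_mono) auto
    also have "\<dots> = real k powr (-t)"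
      by (simp add: u_def powr_divide)
    also have "1 - u = 1 / real (Suc k)" by (simp add: u_def field_simps)
    also have "real (Suc k) powr (-t) * (1 + t * (1 / real (Suc k))) =
        real (Suc k) powr (-t) + t * real (Suc k) powr (- t - 1)"
    proof -
      have "real (Suc k) powr (- t - 1) = real (Suc k) powr (-t) / real (Suc k)"
        using powr_diff[of "real (Suc k)" "-t" 1] by (simp add: algebra_simps)
      thus ?thesis by (simp add: distrib_left)
    qed
    finally have "real (Suc k) powr (- t - 1) \<le> (real k powr (-t) - real (Suc k) powr (-t)) / t"
      using assms by (simp add: field_simps)
    with step show ?case by (simp add: diff_divide_distrib)
  qed
  moreover have "(real m powr (-t) - real N powr (-t)) / t \<le> real m powr (- t) / t"
    using assms by (intro divide_right_mono) auto
  moreover have "0 \<le> real m powr (- t) / t" using assms by simp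
  ultimately show ?thesis
    by (cases "N \<ge> m") (force intro: order_trans, simp)
qed

text \<open>The kernel majorises all cosine sums below: a block of cosines of frequency at most \<open>k\<close> is
  \<open>O (k * kern k)\<close>, and \<open>\<bar>sin (x / 2)\<bar>\<close> is a periodic substitute for \<open>\<bar>x\<bar>\<close>.\<close>

definition rho :: "real \<Rightarrow> real" where "rho x = \<bar>sin (x / 2)\<bar>"
definition kern :: "nat \<Rightarrow> real \<Rightarrow> real" where "kern k x = 1 / (1 + real k * rho x)"

lemma rho_bounds [simp]: "0 \<le> rho x" "rho x \<le> 1"
  by (auto simp: rho_def)

lemma kern_pos [simp]: "kern k x > 0" and kern_nonneg [simp]: "kern k x \<ge> 0" and kern_le_1 [simp]: "kern k x \<le> 1"
proof -
  have "1 + real k * rho x \<ge> 1" by simp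
  moreover from this have "1 + real k * rho x > 0" by linarith
  ultimately show "kern k x > 0" "kern k x \<ge> 0" "kern k x \<le> 1"
    unfolding kern_def by (simp_all only: zero_less_divide_iff zero_le_divide_iff divide_le_eq_1) simp_all
qed

lemma borel_measurable_rho [measurable]: "rho \<in> borel_measurable borel"
  unfolding rho_def by measurable

lemma borel_measurable_kern [measurable]: "kern k \<in> borel_measurable borel"
  unfolding kern_def by measurable

lemma kern_le_inv: assumes "rho x > 0" "k \<ge> 1" shows "kern k x \<le> 1 / (real k * rho x)"
  unfolding kern_def using assms by (intro divide_left_mono) (auto intro!: mult_pos_pos add_pos_nonneg)

text \<open>The kernel is bounded by 1 for \<open>k <= 1 / rho x\<close> and by
  \<open>1 / (k * rho x)\<close> beyond. The two ranges give power sums, controlled by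
  \<open>t < 1\<close> and \<open>t > 0\<close> respectively, which meet at the same power of
  \<open>rho x\<close>.\<close>

lemma sum_kern_bound:
  fixes t :: real
  assumes t: "0 < t" "t < 1" and r: "rho x > 0"
  shows "(\<Sum>k=1..N. real k powr (-t) * kern k x) \<le> (1 + 1/(1-t) + 2/t) * rho x powr (t - 1)"
proof -
  define m where "m = nat \<lfloor>1 / rho x\<rfloor>"
  have r1: "1 / rho x \<ge> 1" using r by simp
  have m: "m \<ge> 1" "real m \<le> 1 / rho x" "1 / rho x < real m + 1"
    unfolding m_def using r1 by linarith+
  \<comment> \<open>Rounding \<open>1 / rho x\<close> down loses at most a factor 2, because
    \<open>rho x <= 1\<close> makes it at least 1; this is the origin of the factor
    \<open>2 powr t\<close> below.\<close>
  have m2: "real m \<ge> 1 / (2 * rho x)" 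
  proof -
    have "1 / (2 * rho x) = (1 / rho x) / 2" by simp
    thus ?thesis using m r1 by linarith
  qed
  have "(\<Sum>k=1..N. real k powr (-t) * kern k x) \<le>
     (\<Sum>k\<in>{1..m} \<union> {m+1..N}. real k powr (-t) * kern k x)"
    by (intro sum_mono2) auto
  also have "\<dots> = (\<Sum>k=1..m. real k powr (-t) * kern k x) + (\<Sum>k=m+1..N. real k powr (-t) * kern k x)"
    by (intro sum.union_disjoint) auto
  also have "\<dots> \<le> (\<Sum>k=1..m. real k powr ((1-t)-1)) + (\<Sum>k=m+1..N. real k powr (- t - 1) * (1 / rho x))"
  proof (intro add_mono sum_mono)
    fix k assume "k \<in> {1..m}"
    thus "real k powr (-t) * kern k x \<le> real k powr ((1-t)-1)"
      using mult_left_mono[OF kern_le_1[of k x], of "real k powr (-t)"] by simp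
  next
    fix k assume k: "k \<in> {m+1..N}"
    have "real k powr (-t) * kern k x \<le> real k powr (-t) * (1 / (real k * rho x))"
      by (intro mult_left_mono kern_le_inv) (use k r in auto)
    also have "\<dots> = real k powr (- t - 1) * (1 / rho x)"
      using k powr_diff[of "real k" "-t" 1] by simp
    finally show "real k powr (-t) * kern k x \<le> real k powr (- t - 1) * (1 / rho x)" .
  qed
  also have "\<dots> \<le> (1 + 1/(1-t)) * real m powr (1-t) + (real m powr (-t) / t) * (1 / rho x)"
    unfolding sum_distrib_right[symmetric]
    by (intro add_mono sum_powr_upper mult_right_mono sum_powr_tail) (use t m r in auto)
  also have "\<dots> \<le> (1 + 1/(1-t)) * (1 / rho x) powr (1-t) + ((1 / (2 * rho x)) powr (-t) / t) * (1 / rho x)"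
    using m m2 t r
    by (intro add_mono mult_left_mono mult_right_mono divide_right_mono powr_mono2 powr_mono2') auto
  also have "(1 / rho x) powr (1-t) = rho x powr (t - 1)"
    using r by (simp add: powr_divide powr_diff field_simps)
  also have "(1 / (2 * rho x)) powr (-t) / t * (1 / rho x) = 2 powr t / t * rho x powr (t - 1)"
    using r by (simp add: powr_divide powr_mult powr_diff powr_minus field_simps)
  also have "\<dots> \<le> 2 / t * rho x powr (t - 1)"
    using t powr_mono[of t 1 2] by (intro mult_right_mono divide_right_mono) auto
  finally show ?thesis by (simp add: algebra_simps)
qed

section \<open>Integration over the torus\<close>

abbreviation circ :: "real measure" where "circ \<equiv> lebesgue_on {0..2*pi}"
abbreviation torus :: "(real \<times> real) measure" where "torus \<equiv> lebesgue_on period_square"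

lemma borel_measurable_fst_real [measurable]: "(fst :: real \<times> real \<Rightarrow> real) \<in> borel_measurable borel"
  and borel_measurable_snd_real [measurable]: "(snd :: real \<times> real \<Rightarrow> real) \<in> borel_measurable borel"
  by (intro borel_measurable_continuous_onI continuous_intros)+

lemma period_square_cbox: "period_square = cbox (0, 0) (2*pi, 2*pi)"
  by (auto simp: period_square_def cbox_Pair_eq)

lemma sets_period_square [measurable, simp]: "period_square \<in> sets borel" "period_square \<in> sets lebesgue"
  unfolding period_square_cbox by auto

lemma nn_integral_circ: "(\<integral>\<^sup>+x. f x \<partial>circ) = (\<integral>\<^sup>+x. f x * indicator {0..2*pi} x \<partial>lborel)"
  by (simp add: nn_integral_restrict_space nn_integral_completion)

lemma nn_integral_torus: "(\<integral>\<^sup>+z. f z \<partial>torus) = (\<integral>\<^sup>+z. f z * indicator period_square z \<partial>lborel)"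
  by (simp add: nn_integral_restrict_space nn_integral_completion)

text \<open>Lebesgue measure on the plane is the completion of a product measure, so Tonelli's
  theorem is applied on \<open>lborel\<close> and to Borel functions.\<close>

lemma nn_integral_torus_iterated:
  assumes [measurable]: "f \<in> borel_measurable borel"
  shows "(\<integral>\<^sup>+z. f z \<partial>torus) = (\<integral>\<^sup>+x. (\<integral>\<^sup>+y. f (x, y) \<partial>circ) \<partial>circ)"
proof -
  have "(\<integral>\<^sup>+z. f z \<partial>torus) = (\<integral>\<^sup>+z. f z * indicator period_square z \<partial>(lborel \<Otimes>\<^sub>M lborel))"
    by (simp add: nn_integral_torus lborel_prod)
  also have "\<dots> = (\<integral>\<^sup>+x. (\<integral>\<^sup>+y. f (x, y) * indicator period_square (x, y) \<partial>lborel) \<partial>lborel)"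
    by (rule lborel.nn_integral_fst[symmetric]) (simp add: lborel_prod)
  also have "\<dots> = (\<integral>\<^sup>+x. (\<integral>\<^sup>+y. (f (x, y) * indicator {0..2*pi} y) * indicator {0..2*pi} x \<partial>lborel) \<partial>lborel)"
    by (intro nn_integral_cong) (auto simp: period_square_def indicator_def)
  also have "\<dots> = (\<integral>\<^sup>+x. (\<integral>\<^sup>+y. f (x, y) * indicator {0..2*pi} y \<partial>lborel) * indicator {0..2*pi} x \<partial>lborel)"
    by (intro nn_integral_cong nn_integral_multc) measurable
  finally show ?thesis by (simp add: nn_integral_circ)
qed

lemma measurable_circ [measurable (raw)]: "f \<in> borel_measurable borel \<Longrightarrow> f \<in> borel_measurable circ"
  by (intro measurable_restrict_space1 measurable_completion) simp

lemma measurable_torus [measurable (raw)]: "f \<in> borel_measurable borel \<Longrightarrow> f \<in> borel_measurable torus"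
  by (intro measurable_restrict_space1 measurable_completion) simp

lemma nn_integral_torus_prod:
  fixes u v :: "real \<Rightarrow> ennreal"
  assumes [measurable]: "u \<in> borel_measurable borel" "v \<in> borel_measurable borel"
  shows "(\<integral>\<^sup>+z. u (fst z) * v (snd z) \<partial>torus) = (\<integral>\<^sup>+x. u x \<partial>circ) * (\<integral>\<^sup>+y. v y \<partial>circ)"
proof -
  have "(\<integral>\<^sup>+z. u (fst z) * v (snd z) \<partial>torus) = (\<integral>\<^sup>+x. (\<integral>\<^sup>+y. u x * v y \<partial>circ) \<partial>circ)"
    by (subst nn_integral_torus_iterated) auto
  also have "\<dots> = (\<integral>\<^sup>+x. u x * (\<integral>\<^sup>+y. v y \<partial>circ) \<partial>circ)"
    by (intro nn_integral_cong nn_integral_cmult) auto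
  also have "\<dots> = (\<integral>\<^sup>+x. u x \<partial>circ) * (\<integral>\<^sup>+y. v y \<partial>circ)"
    by (intro nn_integral_multc) auto
  finally show ?thesis .
qed

lemma emeasure_torus_finite: "emeasure torus (space torus) < \<infinity>"
proof -
  have "emeasure torus (space torus) = (\<integral>\<^sup>+z. (\<lambda>x. 1) (fst z) * (\<lambda>y. 1) (snd z) \<partial>torus)" by simp
  also have "\<dots> = (\<integral>\<^sup>+x. 1 \<partial>circ) * (\<integral>\<^sup>+y. 1 \<partial>circ)" by (rule nn_integral_torus_prod) auto
  also have "\<dots> < \<infinity>" by (simp add: emeasure_restrict_space ennreal_mult_less_top)
  finally show ?thesis .
qed

interpretation torus: finite_measure torus
  using emeasure_torus_finite by (intro finite_measureI) auto

interpretation circ: finite_measure circ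
  by (intro finite_measureI) (simp add: emeasure_restrict_space)

text \<open>Up to \<open>pi / 3\<close> the cosine is at least 1/2 and the mean value theorem
  applies; beyond, the sine is at least \<open>sqrt 3 / 2\<close>, which exceeds
  \<open>pi / 4\<close>.\<close>

lemma sin_ge_half: assumes "0 \<le> y" "y \<le> pi / 2" shows "sin y \<ge> y / 2"
proof (cases "y \<le> pi / 3")
  case True
  show ?thesis
  proof (cases "y = 0")
    case False
    hence "0 < y" using assms by simp
    then obtain c where c: "0 < c" "c < y" "sin y - sin 0 = (y - 0) * cos c"
      using MVT2[of 0 y sin cos] by (auto intro: DERIV_sin)
    have "cos c \<ge> cos (pi / 3)" using c True by (intro cos_monotone_0_pi_le) auto
    hence "cos c \<ge> 1 / 2" by (simp add: cos_60)
    thus ?thesis using c mult_left_mono[of "1/2" "cos c" y] \<open>0 < y\<close> by simp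
  qed auto
next
  case False
  have "sin (pi / 3) \<le> sin y" using False assms by (intro sin_monotone_2pi_le) auto
  moreover have "sqrt 3 / 2 \<ge> 17 / 20" using real_le_rsqrt[of "17/10" 3] by (simp add: power2_eq_square)
  moreover have "pi / 4 < 4 / 5" using pi_less_4 pi_approx by simp
  ultimately show ?thesis using assms by (simp add: sin_60)
qed

lemma rho_ge: assumes "0 \<le> x" "x \<le> pi" shows "rho x \<ge> x / 4"
  using sin_ge_half[of "x / 2"] assms by (simp add: rho_def)

lemma rho_reflect: "rho (2 * pi - x) = rho x"
proof -
  have "sin ((2 * pi - x) / 2) = sin (pi - x / 2)" by (simp add: field_simps)
  thus ?thesis by (simp add: rho_def)
qed

lemma kern_reflect: "kern k (2 * pi - x) = kern k x"
  by (simp add: kern_def rho_reflect)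

text \<open>The scale \<open>1 / k\<close> separates two regimes: below it the kernel is bounded and
  \<open>x powr (- s)\<close> is integrable at 0 because \<open>s < 1\<close>; above it the kernel
  decays like \<open>1 / (k * x)\<close> and \<open>x powr (- s - 1)\<close> is integrable at
  infinity because \<open>s > 0\<close>.\<close>

lemma kern_rho_integral:
  fixes s :: real
  assumes s: "0 < s" "s < 1" and k: "k \<ge> 1"
  shows "(\<integral>\<^sup>+x. ennreal (kern k x * rho x powr (- s)) \<partial>circ) \<le>
           ennreal (2 * (4 powr s / (1 - s) + 4 powr (s+1) / s) * real k powr (s - 1))"
proof -
  define f where "f x = ennreal (kern k x * rho x powr (- s))" for x
  define c where "c = 1 / real k"
  have c: "c > 0" using k by (simp add: c_def)
  define phi where "phi x = ennreal (4 powr s) * (ennreal (x powr (-s)) * indicator {0..c} x)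
       + ennreal (4 powr (s+1) / real k) * (ennreal (x powr (-s-1)) * indicator {c..} x)" for x :: real
  have [measurable]: "phi \<in> borel_measurable borel" unfolding phi_def by measurable
  have ptw: "f x \<le> phi x" if "0 < x" "x \<le> pi" for x
  proof -
    have r: "rho x \<ge> x / 4" "rho x > 0" using rho_ge[of x] that by auto
    show ?thesis
    proof (cases "x \<le> c")
      case True
      have "kern k x * rho x powr (- s) \<le> 1 * (x / 4) powr (- s)"
        by (intro mult_mono powr_mono2') (use r s that in auto)
      also have "\<dots> = 4 powr s * x powr (-s)" using that by (simp add: powr_divide powr_minus field_simps)
      finally have "f x \<le> ennreal (4 powr s) * (ennreal (x powr (-s)) * indicator {0..c} x)"
        using True that by (simp add: f_def ennreal_mult[symmetric] ennreal_leI)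
      thus ?thesis by (simp add: phi_def add_increasing2)
    next
      case False
      have "kern k x * rho x powr (- s) \<le> (1 / (real k * rho x)) * rho x powr (- s)"
        by (intro mult_right_mono kern_le_inv) (use r k in auto)
      also have "\<dots> = rho x powr (- s - 1) / real k" using r powr_diff[of "rho x" "-s" 1] by simp
      also have "\<dots> \<le> (x / 4) powr (- s - 1) / real k"
        by (intro divide_right_mono powr_mono2') (use r s that in auto)
      also have "(x / 4) powr (- s - 1) = 4 powr (s+1) * x powr (- s - 1)"
        using that by (simp add: powr_divide powr_minus powr_diff powr_add field_simps)
      finally have "f x \<le> ennreal (4 powr (s+1) / real k) * (ennreal (x powr (-s-1)) * indicator {c..} x)"
        using False that by (simp add: f_def ennreal_mult[symmetric] ennreal_leI)
      thus ?thesis by (simp add: phi_def add_increasing)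
    qed
  qed
  have "(\<integral>\<^sup>+x. f x \<partial>circ) \<le> (\<integral>\<^sup>+x. phi x + phi (2 * pi - x) \<partial>lborel)"
    unfolding nn_integral_circ
  proof (intro nn_integral_mono)
    fix x
    have "f x \<le> phi x + phi (2 * pi - x)" if "x \<in> {0..2*pi}"
    proof -
      \<comment> \<open>The second half of the circle is reflected onto the first. At the two end
        points \<open>rho\<close> is 0, and \<open>0 powr (- s) = 0\<close> makes the integrand
        vanish there.\<close>
      have "x = 0 \<or> x = 2 * pi \<or> (0 < x \<and> x \<le> pi) \<or> (0 < 2 * pi - x \<and> 2 * pi - x \<le> pi)"
        using that by auto
      then consider "x = 0" | "x = 2 * pi" | "0 < x" "x \<le> pi" | "0 < 2 * pi - x" "2 * pi - x \<le> pi" by blast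
      thus ?thesis
      proof cases
        case 3 thus ?thesis using ptw[of x] by (simp add: add_increasing2)
      next
        case 4
        have "f x = f (2 * pi - x)" by (simp add: f_def kern_reflect rho_reflect)
        thus ?thesis using ptw[of "2*pi-x"] 4 by (simp add: add_increasing)
      qed (auto simp: f_def rho_def)
    qed
    thus "f x * indicator {0..2*pi} x \<le> phi x + phi (2 * pi - x)" by (auto simp: indicator_def)
  qed
  also have "\<dots> = (\<integral>\<^sup>+x. phi x \<partial>lborel) + (\<integral>\<^sup>+x. phi (2 * pi - x) \<partial>lborel)"
    by (intro nn_integral_add) auto
  also have "(\<integral>\<^sup>+x. phi (2 * pi - x) \<partial>lborel) = (\<integral>\<^sup>+x. phi x \<partial>lborel)"
    using nn_integral_real_affine[of phi "-1" "2*pi"] by simp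
  also have "(\<integral>\<^sup>+x. phi x \<partial>lborel) =
      ennreal (4 powr s) * ennreal (c powr (-s+1) / (-s+1)) +
      ennreal (4 powr (s+1) / real k) * ennreal (-(c powr (-s-1+1)) / (-s-1+1))"
  proof -
    have 1: "(\<integral>\<^sup>+x. ennreal (x powr (-s)) * indicator {0..c} x \<partial>lborel) = ennreal (c powr (-s+1) / (-s+1))"
      by (rule nn_integral_has_integral_lebesgue') (use has_integral_powr_from_0[of "-s" c] s c in auto)
    have 2: "(\<integral>\<^sup>+x. ennreal (x powr (-s-1)) * indicator {c..} x \<partial>lborel) = ennreal (-(c powr (-s-1+1)) / (-s-1+1))"
      by (rule nn_integral_has_integral_lebesgue') (use has_integral_powr_to_inf[of "-s-1" c] s c in auto)
    show ?thesis unfolding phi_def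
      by (subst nn_integral_add) (simp_all add: nn_integral_cmult 1 2)
  qed
  also have "ennreal (4 powr s) * ennreal (c powr (-s+1) / (-s+1)) +
      ennreal (4 powr (s+1) / real k) * ennreal (-(c powr (-s-1+1)) / (-s-1+1)) =
      ennreal (4 powr s * (c powr (-s+1) / (-s+1)) + 4 powr (s+1) / real k * (-(c powr (-s-1+1)) / (-s-1+1)))"
    using s by (simp add: ennreal_mult[symmetric] ennreal_plus[symmetric] del: ennreal_plus)
  also have "4 powr s * (c powr (-s+1) / (-s+1)) + 4 powr (s+1) / real k * (-(c powr (-s-1+1)) / (-s-1+1)) =
     (4 powr s / (1 - s) + 4 powr (s+1) / s) * real k powr (s - 1)" (is "?a = ?b")
  proof -
    have ck: "c = real k powr (-1)" using k by (simp add: c_def powr_minus_divide)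
    have 1: "c powr (-s+1) = real k powr (s - 1)"
      unfolding ck powr_powr by simp
    have "c powr (-s-1+1) / real k = c powr (-s-1+1) * real k powr (-1)"
      using k by (simp add: powr_minus_divide)
    also have "\<dots> = real k powr (s - 1)"
      unfolding ck powr_powr powr_add[symmetric] by simp
    finally have 3: "c powr (-s-1+1) / real k = real k powr (s - 1)" .
    have 2: "4 powr (s+1) / real k * (-(c powr (-s-1+1)) / (-s-1+1)) = 4 powr (s+1) / s * real k powr (s - 1)"
      unfolding 3[symmetric] using s by simp
    show ?thesis unfolding 2 1 by (simp add: distrib_right)
  qed
  also have "ennreal ?b + ennreal ?b = ennreal (2 * (4 powr s / (1 - s) + 4 powr (s+1) / s) * real k powr (s - 1))"
    using s by (simp add: ennreal_plus[symmetric] del: ennreal_plus)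
  finally show ?thesis by (simp add: f_def)
qed

lemma AE_torus_rho: "AE z in torus. rho (fst z) > 0 \<and> rho (snd z) > 0"
proof -
  define u where "u x = (if rho x = 0 then 1 else 0 :: ennreal)" for x
  have [measurable]: "u \<in> borel_measurable borel" unfolding u_def by measurable
  have u0: "(\<integral>\<^sup>+x. u x \<partial>circ) = 0"
  proof -
    have "(\<integral>\<^sup>+x. u x \<partial>circ) \<le> (\<integral>\<^sup>+x. indicator {0, 2*pi} x \<partial>lborel)"
      unfolding nn_integral_circ
    proof (intro nn_integral_mono)
      fix x
      have "x = 0 \<or> x = 2 * pi" if "0 \<le> x" "x \<le> 2 * pi" "rho x = 0"
      proof (rule ccontr)
        assume "\<not> ?thesis"
        hence "0 < x / 2" "x / 2 < pi" using that by auto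
        hence "sin (x / 2) > 0" by (rule sin_gt_zero)
        thus False using that by (simp add: rho_def)
      qed
      thus "u x * indicator {0..2*pi} x \<le> indicator {0, 2*pi} x"
        by (auto simp: u_def indicator_def)
    qed
    also have "\<dots> = 0" by (simp add: emeasure_lborel_countable)
    finally show ?thesis by simp
  qed
  have "(\<integral>\<^sup>+z. u (fst z) * 1 + 1 * u (snd z) \<partial>torus) = (\<integral>\<^sup>+z. u (fst z) * (\<lambda>_. 1) (snd z) \<partial>torus) + (\<integral>\<^sup>+z. (\<lambda>_. 1) (fst z) * u (snd z) \<partial>torus)"
    by (subst nn_integral_add) auto
  also have "\<dots> = 0"
    by (subst (1 2) nn_integral_torus_prod) (auto simp: u0)
  finally have "AE z in torus. u (fst z) * 1 + 1 * u (snd z) = 0"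
    by (subst (asm) nn_integral_0_iff_AE) auto
  thus ?thesis
    by eventually_elim (auto simp: u_def order.strict_iff_order split: if_splits)
qed

section \<open>Schur tests\<close>

definition kern2 :: "nat \<Rightarrow> nat \<Rightarrow> real \<times> real \<Rightarrow> real" where
  "kern2 k l z = kern k (fst z) * kern l (snd z)"

lemma kern2_nonneg [simp]: "0 \<le> kern2 k l z" and kern2_le_1 [simp]: "kern2 k l z \<le> 1"
  by (auto simp: kern2_def intro!: mult_le_one)

lemma borel_measurable_kern2 [measurable]: "kern2 k l \<in> borel_measurable borel"
  unfolding kern2_def by measurable

definition rho2 :: "real \<times> real \<Rightarrow> real" where "rho2 z = rho (fst z) * rho (snd z)"

lemma rho2_nonneg [simp]: "0 \<le> rho2 z" and rho2_le_1 [simp]: "rho2 z \<le> 1"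
  by (auto simp: rho2_def intro!: mult_le_one)

lemma borel_measurable_rho2 [measurable]: "rho2 \<in> borel_measurable borel"
  unfolding rho2_def by measurable

lemma sum_kern2_bound:
  assumes t: "0 < t" "t < 1"
  shows "\<exists>C>0. \<forall>z N M. rho2 z > 0 \<longrightarrow>
     (\<Sum>k=1..N. \<Sum>l=1..M. (real k * real l) powr (-t) * kern2 k l z) \<le> C * rho2 z powr (t - 1)"
proof -
  define c where "c = 1 + 1/(1-t) + 2/t"
  have c: "c > 0" using t by (auto simp: c_def intro!: add_pos_nonneg)
  have "(\<Sum>k=1..N. \<Sum>l=1..M. (real k * real l) powr (-t) * kern2 k l z) \<le> c^2 * rho2 z powr (t - 1)"
    if "rho2 z > 0" for z N M
  proof -
    have r: "rho (fst z) > 0" "rho (snd z) > 0" using that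
      by (auto simp: rho2_def zero_less_mult_iff order.strict_iff_order)
    have "(\<Sum>k=1..N. \<Sum>l=1..M. (real k * real l) powr (-t) * kern2 k l z) =
      (\<Sum>k=1..N. real k powr (-t) * kern k (fst z)) * (\<Sum>l=1..M. real l powr (-t) * kern l (snd z))"
      by (simp add: kern2_def powr_mult sum_product mult_ac)
    also have "\<dots> \<le> (c * rho (fst z) powr (t - 1)) * (c * rho (snd z) powr (t - 1))"
      unfolding c_def using r t by (intro mult_mono sum_kern_bound sum_nonneg) (auto intro!: mult_nonneg_nonneg add_nonneg_nonneg)
    also have "\<dots> = c^2 * rho2 z powr (t - 1)"
      by (simp add: rho2_def powr_mult power2_eq_square)
    finally show ?thesis .
  qed
  thus ?thesis using c by (intro exI[of _ "c^2"]) auto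
qed

lemma kern2_rho2_integral:
  assumes s: "0 < s" "s < 1"
  shows "\<exists>C>0. \<forall>k\<ge>1. \<forall>l\<ge>1. (\<integral>\<^sup>+z. ennreal (kern2 k l z * rho2 z powr (- s)) \<partial>torus) \<le>
           ennreal (C * (real k * real l) powr (s - 1))"
proof -
  define c where "c = 2 * (4 powr s / (1 - s) + 4 powr (s+1) / s)"
  have c: "c > 0" using s by (auto simp: c_def intro!: add_pos_nonneg mult_pos_pos divide_pos_pos)
  have "(\<integral>\<^sup>+z. ennreal (kern2 k l z * rho2 z powr (- s)) \<partial>torus) \<le> ennreal (c^2 * (real k * real l) powr (s - 1))"
    if "k \<ge> 1" "l \<ge> 1" for k l
  proof -
    have "(\<integral>\<^sup>+z. ennreal (kern2 k l z * rho2 z powr (- s)) \<partial>torus) =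
      (\<integral>\<^sup>+z. ennreal (kern k (fst z) * rho (fst z) powr (-s)) * ennreal (kern l (snd z) * rho (snd z) powr (-s)) \<partial>torus)"
      by (intro nn_integral_cong) (simp add: ennreal_mult[symmetric] kern2_def rho2_def powr_mult mult_ac)
    also have "\<dots> = (\<integral>\<^sup>+x. ennreal (kern k x * rho x powr (- s)) \<partial>circ) * (\<integral>\<^sup>+x. ennreal (kern l x * rho x powr (- s)) \<partial>circ)"
      by (rule nn_integral_torus_prod) auto
    also have "\<dots> \<le> ennreal (c * real k powr (s - 1)) * ennreal (c * real l powr (s - 1))"
      unfolding c_def using s that by (intro mult_mono kern_rho_integral) auto
    also have "\<dots> = ennreal (c^2 * (real k * real l) powr (s - 1))"
      using c by (simp add: ennreal_mult[symmetric] powr_mult power2_eq_square mult_ac)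
    finally show ?thesis .
  qed
  thus ?thesis using c by (intro exI[of _ "c^2"]) auto
qed

lemma AE_torus_rho2: "AE z in torus. rho2 z > 0"
  using AE_torus_rho by eventually_elim (auto simp: rho2_def)

text \<open>Schur's test with the power weight \<open>(k * l) powr (- t)\<close>: Jensen's
  inequality is applied at each point \<open>z\<close> to the weights
  \<open>(k * l) powr (- t) * kern2 k l z\<close>, whose total is bounded by a power of
  \<open>rho2 z\<close>; integration over \<open>z\<close> then returns a power of
  \<open>k * l\<close>.\<close>

lemma schur_series_to_function:
  assumes p: "p > 1"
  shows "\<exists>C>0. \<forall>N b. (\<forall>k l. b k l \<ge> 0) \<longrightarrow>
    (\<integral>\<^sup>+z. ennreal ((\<Sum>k=1..N. \<Sum>l=1..N. b k l * kern2 k l z) powr p) \<partial>torus)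
      \<le> ennreal (C * (\<Sum>k=1..N. \<Sum>l=1..N. b k l powr p * (real k * real l) powr (p - 2)))"
proof -
  \<comment> \<open>This exponent makes the powers match: \<open>(t - 1) * (p - 1) = - t\<close> is
    the power of \<open>rho2\<close> under the integral, and \<open>t * p - 1 = p - 2\<close> is the
    final power of \<open>k * l\<close>.\<close>
  define t where "t = (p - 1) / p"
  have t: "0 < t" "t < 1" using p by (auto simp: t_def)
  obtain c1 where c1: "c1 > 0" "\<And>z N M. rho2 z > 0 \<Longrightarrow>
     (\<Sum>k=1..N. \<Sum>l=1..M. (real k * real l) powr (-t) * kern2 k l z) \<le> c1 * rho2 z powr (t - 1)"
    using sum_kern2_bound[OF t] by blast
  obtain c2 where c2: "c2 > 0" "\<And>k l. k \<ge> 1 \<Longrightarrow> l \<ge> 1 \<Longrightarrow> (\<integral>\<^sup>+z. ennreal (kern2 k l z * rho2 z powr (- t)) \<partial>torus) \<le>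
           ennreal (c2 * (real k * real l) powr (t - 1))"
    using kern2_rho2_integral[OF t] by blast
  define C where "C = c1 powr (p - 1) * c2"
  have "(\<integral>\<^sup>+z. ennreal ((\<Sum>k=1..N. \<Sum>l=1..N. b k l * kern2 k l z) powr p) \<partial>torus)
      \<le> ennreal (C * (\<Sum>k=1..N. \<Sum>l=1..N. b k l powr p * (real k * real l) powr (p - 2)))"
    if b: "\<And>k l. b k l \<ge> 0" for N and b :: "nat \<Rightarrow> nat \<Rightarrow> real"
  proof -
    define I where "I = {1..N} \<times> {1..N}"
    define d where "d k l = c1 powr (p - 1) * (b k l powr p * (real k * real l) powr (t * p - t))" for k l
    have d0: "d k l \<ge> 0" for k l by (simp add: d_def)
    have ptw: "(\<Sum>k=1..N. \<Sum>l=1..N. b k l * kern2 k l z) powr p \<le>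
        (\<Sum>k=1..N. \<Sum>l=1..N. d k l * (kern2 k l z * rho2 z powr (- t)))" if r: "rho2 z > 0" for z
    proof -
      define w where "w i = (case i of (k, l) \<Rightarrow> (real k * real l) powr (-t) * kern2 k l z)" for i
      define y where "y i = (case i of (k, l) \<Rightarrow> b k l * (real k * real l) powr t)" for i
      have "(\<Sum>i\<in>I. w i * y i) powr p \<le> (c1 * rho2 z powr (t - 1)) powr (p - 1) * (\<Sum>i\<in>I. w i * y i powr p)"
      proof (rule jensen_sum_powr[OF p])
        show "(\<Sum>i\<in>I. w i) \<le> c1 * rho2 z powr (t - 1)"
          using c1(2)[OF r, of N N] by (simp add: I_def w_def sum.cartesian_product)
      qed (use b r c1 in \<open>auto simp: I_def w_def y_def\<close>)
      also have "(\<Sum>i\<in>I. w i * y i) = (\<Sum>k=1..N. \<Sum>l=1..N. b k l * kern2 k l z)"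
        unfolding I_def sum.cartesian_product
        by (intro sum.cong) (auto simp: w_def y_def powr_minus field_simps)
      also have "(c1 * rho2 z powr (t - 1)) powr (p - 1) * (\<Sum>i\<in>I. w i * y i powr p) =
          (\<Sum>k=1..N. \<Sum>l=1..N. d k l * (kern2 k l z * rho2 z powr (- t)))"
        unfolding I_def sum.cartesian_product sum_distrib_left
      proof (intro sum.cong refl, safe)
        fix k l assume "k \<in> {1..N}" "l \<in> {1..N}"
        have "(c1 * rho2 z powr (t - 1)) powr (p - 1) = c1 powr (p - 1) * rho2 z powr ((t - 1) * (p - 1))"
          using c1 by (simp add: powr_mult powr_powr)
        also have "(t - 1) * (p - 1) = - t" using p by (simp add: t_def field_simps)
        finally have 1: "(c1 * rho2 z powr (t - 1)) powr (p - 1) = c1 powr (p - 1) * rho2 z powr (- t)" .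
        have 2: "y (k, l) powr p = b k l powr p * (real k * real l) powr (t * p)"
          using b by (simp add: y_def powr_mult powr_powr)
        have "(real k * real l) powr (-t) * (real k * real l) powr (t * p) = (real k * real l) powr (t * p - t)"
          by (simp flip: powr_add)
        thus "(c1 * rho2 z powr (t - 1)) powr (p - 1) * (w (k, l) * y (k, l) powr p) = d k l * (kern2 k l z * rho2 z powr (- t))"
          unfolding 1 2 by (simp add: d_def w_def)
      qed
      finally show ?thesis .
    qed
    have "(\<integral>\<^sup>+z. ennreal ((\<Sum>k=1..N. \<Sum>l=1..N. b k l * kern2 k l z) powr p) \<partial>torus)
       \<le> (\<integral>\<^sup>+z. (\<Sum>k=1..N. \<Sum>l=1..N. ennreal (d k l) * ennreal (kern2 k l z * rho2 z powr (- t))) \<partial>torus)"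
    proof (intro nn_integral_mono_AE, use AE_torus_rho2 in eventually_elim)
      fix z assume "rho2 z > 0"
      hence "ennreal ((\<Sum>k=1..N. \<Sum>l=1..N. b k l * kern2 k l z) powr p) \<le> ennreal (\<Sum>k=1..N. \<Sum>l=1..N. d k l * (kern2 k l z * rho2 z powr (- t)))"
        by (intro ennreal_leI ptw)
      also have "\<dots> = (\<Sum>k=1..N. \<Sum>l=1..N. ennreal (d k l) * ennreal (kern2 k l z * rho2 z powr (- t)))"
        using d0 by (simp add: sum_ennreal[symmetric] sum_nonneg ennreal_mult)
      finally show "ennreal ((\<Sum>k=1..N. \<Sum>l=1..N. b k l * kern2 k l z) powr p) \<le> (\<Sum>k=1..N. \<Sum>l=1..N. ennreal (d k l) * ennreal (kern2 k l z * rho2 z powr (- t)))" .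
    qed
    also have "\<dots> = (\<Sum>k=1..N. \<Sum>l=1..N. ennreal (d k l) * (\<integral>\<^sup>+z. ennreal (kern2 k l z * rho2 z powr (- t)) \<partial>torus))"
      by (simp add: nn_integral_sum nn_integral_cmult)
    also have "\<dots> \<le> (\<Sum>k=1..N. \<Sum>l=1..N. ennreal (d k l) * ennreal (c2 * (real k * real l) powr (t - 1)))"
      by (intro sum_mono mult_left_mono c2) auto
    also have "\<dots> = ennreal (\<Sum>k=1..N. \<Sum>l=1..N. d k l * (c2 * (real k * real l) powr (t - 1)))"
      using d0 c2 by (simp add: sum_ennreal[symmetric] sum_nonneg ennreal_mult)
    also have "(\<Sum>k=1..N. \<Sum>l=1..N. d k l * (c2 * (real k * real l) powr (t - 1))) =
        C * (\<Sum>k=1..N. \<Sum>l=1..N. b k l powr p * (real k * real l) powr (p - 2))"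
      unfolding sum_distrib_left
    proof (intro sum.cong refl)
      fix k l
      have "(real k * real l) powr (t * p - t) * (real k * real l) powr (t - 1) = (real k * real l) powr (p - 2)"
        using p by (simp add: powr_add[symmetric] t_def)
      thus "d k l * (c2 * (real k * real l) powr (t - 1)) = C * (b k l powr p * (real k * real l) powr (p - 2))"
        by (simp add: d_def C_def)
    qed
    finally show ?thesis .
  qed
  thus ?thesis using c1 c2 by (intro exI[of _ C]) (auto simp: C_def)
qed

text \<open>The dual test, with sum and integral exchanged: Hoelder's inequality in \<open>z\<close>
  with weight \<open>kern2 k l z * rho2 z powr (- s)\<close> comes first, the sum over
  \<open>k\<close> and \<open>l\<close> second. The integrability clause ensures that the Bochner
  integrals are not the default value 0.\<close>

lemma schur_function_to_series:
  assumes p: "p > 1"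
  shows "\<exists>C>0. \<forall>g. g \<in> borel_measurable torus \<longrightarrow> integrable torus (\<lambda>z. \<bar>g z\<bar> powr p) \<longrightarrow>
    (\<forall>k\<ge>1. \<forall>l\<ge>1. integrable torus (\<lambda>z. \<bar>g z\<bar> * kern2 k l z)) \<and>
    (\<forall>R. (\<Sum>k=1..R. \<Sum>l=1..R. (real k * real l) powr (p - 2) * (\<integral>z. \<bar>g z\<bar> * kern2 k l z \<partial>torus) powr p)
      \<le> C * (\<integral>z. \<bar>g z\<bar> powr p \<partial>torus))"
proof -
  \<comment> \<open>With this choice \<open>- s + s * p = 1 - s\<close>, so that the factor
    \<open>rho2 powr (s - 1)\<close> from the summation cancels, and
    \<open>(p - 2) + (s - 1) * (p - 1) = - s\<close>, the weight under which the kernels are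
    summed.\<close>
  define s where "s = 1 / p"
  have s: "0 < s" "s < 1" using p by (auto simp: s_def)
  obtain c1 where c1: "c1 > 0" "\<And>z N M. rho2 z > 0 \<Longrightarrow>
     (\<Sum>k=1..N. \<Sum>l=1..M. (real k * real l) powr (-s) * kern2 k l z) \<le> c1 * rho2 z powr (s - 1)"
    using sum_kern2_bound[OF s] by blast
  obtain c2 where c2: "c2 > 0" "\<And>k l. k \<ge> 1 \<Longrightarrow> l \<ge> 1 \<Longrightarrow> (\<integral>\<^sup>+z. ennreal (kern2 k l z * rho2 z powr (- s)) \<partial>torus) \<le>
           ennreal (c2 * (real k * real l) powr (s - 1))"
    using kern2_rho2_integral[OF s] by blast
  define C where "C = c2 powr (p - 1) * c1"
  have "(\<forall>k\<ge>1. \<forall>l\<ge>1. integrable torus (\<lambda>z. \<bar>g z\<bar> * kern2 k l z)) \<and>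
    (\<forall>R. (\<Sum>k=1..R. \<Sum>l=1..R. (real k * real l) powr (p - 2) * (\<integral>z. \<bar>g z\<bar> * kern2 k l z \<partial>torus) powr p)
      \<le> C * (\<integral>z. \<bar>g z\<bar> powr p \<partial>torus))"
    if [measurable]: "g \<in> borel_measurable torus" and int: "integrable torus (\<lambda>z. \<bar>g z\<bar> powr p)" for g
  proof -
    define e where "e k l z = (\<bar>g z\<bar> powr p) * (kern2 k l z * rho2 z powr (1 - s))" for k l z
    have inte: "integrable torus (e k l)" for k l
    proof (rule Bochner_Integration.integrable_bound[OF int])
      show "e k l \<in> borel_measurable torus" unfolding e_def by measurable
      have "kern2 k l z * rho2 z powr (1 - s) \<le> 1" for z
        using s by (intro mult_le_one powr_le1) auto
      thus "AE z in torus. norm (e k l z) \<le> norm (\<bar>g z\<bar> powr p)"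
        using s by (intro AE_I2) (auto simp: e_def abs_mult intro!: mult_left_le)
    qed
    define X where "X k l = (\<integral>z. e k l z \<partial>torus)" for k l
    have e0: "e k l z \<ge> 0" for k l z by (simp add: e_def)
    have X0: "X k l \<ge> 0" for k l unfolding X_def using e0 by (intro Bochner_Integration.integral_nonneg)
    have main: "integrable torus (\<lambda>z. \<bar>g z\<bar> * kern2 k l z) \<and>
       (\<integral>z. \<bar>g z\<bar> * kern2 k l z \<partial>torus) powr p \<le> (c2 * (real k * real l) powr (s - 1)) powr (p - 1) * X k l"
      if kl: "k \<ge> 1" "l \<ge> 1" for k l
    proof -
      define A where "A = c2 * (real k * real l) powr (s - 1)"
      have A: "A > 0" using c2 kl by (auto simp: A_def)
      have wz: "kern2 k l z * rho2 z powr (- s) * (\<bar>g z\<bar> * rho2 z powr s) = \<bar>g z\<bar> * kern2 k l z" if "rho2 z > 0" for z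
        using that by (simp add: powr_minus field_simps)
      have "(\<integral>\<^sup>+z. ennreal (kern2 k l z * rho2 z powr (- s) * (\<bar>g z\<bar> * rho2 z powr s)) \<partial>torus) \<le> ennreal (A powr (1 - 1/p) * X k l powr (1/p))"
      proof (rule holder_nn[OF p A X0])
        show "(\<integral>\<^sup>+z. ennreal (kern2 k l z * rho2 z powr (- s)) \<partial>torus) \<le> ennreal A"
          unfolding A_def by (rule c2) (use kl in auto)
        have "(\<integral>\<^sup>+z. ennreal (kern2 k l z * rho2 z powr (- s) * (\<bar>g z\<bar> * rho2 z powr s) powr p) \<partial>torus) = (\<integral>\<^sup>+z. ennreal (e k l z) \<partial>torus)"
        proof (intro nn_integral_cong arg_cong[of _ _ ennreal])
          fix z
          have "- s + s * p = 1 - s" using p by (simp add: s_def)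
          hence "rho2 z powr (- s) * rho2 z powr (s * p) = rho2 z powr (1 - s)"
            by (metis powr_add)
          thus "kern2 k l z * rho2 z powr (- s) * (\<bar>g z\<bar> * rho2 z powr s) powr p = e k l z"
            by (simp add: e_def powr_mult powr_powr mult_ac)
        qed
        also have "\<dots> = ennreal (X k l)"
          unfolding X_def using inte e0 by (intro nn_integral_eq_integral) auto
        finally show "(\<integral>\<^sup>+z. ennreal (kern2 k l z * rho2 z powr (- s) * (\<bar>g z\<bar> * rho2 z powr s) powr p) \<partial>torus) \<le> ennreal (X k l)" by simp
      qed auto
      also have "(\<integral>\<^sup>+z. ennreal (kern2 k l z * rho2 z powr (- s) * (\<bar>g z\<bar> * rho2 z powr s)) \<partial>torus) = (\<integral>\<^sup>+z. ennreal (\<bar>g z\<bar> * kern2 k l z) \<partial>torus)"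
        by (intro nn_integral_cong_AE, use AE_torus_rho2 in eventually_elim) (simp only: wz)
      finally have le: "(\<integral>\<^sup>+z. ennreal (\<bar>g z\<bar> * kern2 k l z) \<partial>torus) \<le> ennreal (A powr (1 - 1/p) * X k l powr (1/p))" .
      have i: "integrable torus (\<lambda>z. \<bar>g z\<bar> * kern2 k l z)"
        by (rule integrableI_nonneg) (use le in \<open>auto simp: le_less_trans\<close>)
      have "ennreal (\<integral>z. \<bar>g z\<bar> * kern2 k l z \<partial>torus) = (\<integral>\<^sup>+z. ennreal (\<bar>g z\<bar> * kern2 k l z) \<partial>torus)"
        using i by (intro nn_integral_eq_integral[symmetric]) auto
      hence "ennreal (\<integral>z. \<bar>g z\<bar> * kern2 k l z \<partial>torus) \<le> ennreal (A powr (1 - 1/p) * X k l powr (1/p))"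
        using le by simp
      hence "(\<integral>z. \<bar>g z\<bar> * kern2 k l z \<partial>torus) \<le> A powr (1 - 1/p) * X k l powr (1/p)"
        by (subst (asm) ennreal_le_iff) auto
      hence "(\<integral>z. \<bar>g z\<bar> * kern2 k l z \<partial>torus) powr p \<le> (A powr (1 - 1/p) * X k l powr (1/p)) powr p"
        using p by (intro powr_mono2 Bochner_Integration.integral_nonneg) auto
      also have "\<dots> = A powr (p - 1) * X k l"
        using p X0 by (simp add: powr_mult powr_powr left_diff_distrib)
      finally show ?thesis using i by (simp add: A_def)
    qed
    have "(\<Sum>k=1..R. \<Sum>l=1..R. (real k * real l) powr (p - 2) * (\<integral>z. \<bar>g z\<bar> * kern2 k l z \<partial>torus) powr p)
      \<le> C * (\<integral>z. \<bar>g z\<bar> powr p \<partial>torus)" for R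
    proof -
      have "(\<Sum>k=1..R. \<Sum>l=1..R. (real k * real l) powr (p - 2) * (\<integral>z. \<bar>g z\<bar> * kern2 k l z \<partial>torus) powr p) \<le>
         (\<Sum>k=1..R. \<Sum>l=1..R. (real k * real l) powr (p - 2) * ((c2 * (real k * real l) powr (s - 1)) powr (p - 1) * X k l))"
        by (intro sum_mono mult_left_mono) (use main in auto)
      also have "\<dots> = (\<Sum>k=1..R. \<Sum>l=1..R. c2 powr (p - 1) * ((real k * real l) powr (- s) * X k l))"
      proof (intro sum.cong refl)
        fix k l
        have "(p - 2) + (s - 1) * (p - 1) = - s" using p by (simp add: s_def field_simps)
        hence "(real k * real l) powr (p - 2) * (real k * real l) powr ((s - 1) * (p - 1)) = (real k * real l) powr (- s)"
          by (metis powr_add)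
        thus "(real k * real l) powr (p - 2) * ((c2 * (real k * real l) powr (s - 1)) powr (p - 1) * X k l) = c2 powr (p - 1) * ((real k * real l) powr (- s) * X k l)"
          using c2 by (simp add: powr_mult powr_powr mult_ac)
      qed
      also have "\<dots> = c2 powr (p - 1) * (\<integral>z. (\<Sum>k=1..R. \<Sum>l=1..R. (real k * real l) powr (- s) * e k l z) \<partial>torus)"
        using inte by (simp add: sum_distrib_left X_def)
      also have "(\<integral>z. (\<Sum>k=1..R. \<Sum>l=1..R. (real k * real l) powr (- s) * e k l z) \<partial>torus) \<le> (\<integral>z. c1 * \<bar>g z\<bar> powr p \<partial>torus)"
      proof (intro integral_mono_AE)
        show "AE z in torus. (\<Sum>k=1..R. \<Sum>l=1..R. (real k * real l) powr (- s) * e k l z) \<le> c1 * \<bar>g z\<bar> powr p"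
          using AE_torus_rho2
        proof eventually_elim
          fix z assume z: "rho2 z > 0"
          have "(\<Sum>k=1..R. \<Sum>l=1..R. (real k * real l) powr (- s) * e k l z) =
              \<bar>g z\<bar> powr p * rho2 z powr (1 - s) * (\<Sum>k=1..R. \<Sum>l=1..R. (real k * real l) powr (-s) * kern2 k l z)"
            by (simp add: e_def sum_distrib_left mult_ac)
          also have "\<dots> \<le> \<bar>g z\<bar> powr p * rho2 z powr (1 - s) * (c1 * rho2 z powr (s - 1))"
            by (intro mult_left_mono c1 z) auto
          also have "\<dots> = c1 * \<bar>g z\<bar> powr p" using z by (simp add: powr_diff field_simps)
          finally show "(\<Sum>k=1..R. \<Sum>l=1..R. (real k * real l) powr (- s) * e k l z) \<le> c1 * \<bar>g z\<bar> powr p" .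
        qed
      qed (use inte int in auto)
      finally show ?thesis using c2 by (simp add: C_def mult_left_mono mult_ac)
    qed
    thus ?thesis using main by blast
  qed
  thus ?thesis using c1 c2 by (intro exI[of _ C]) (auto simp: C_def)
qed

section \<open>Fractional differences of cosine blocks\<close>

lemma cos_block_telescope:
  fixes x c :: real
  assumes "m \<le> n"
  shows "2 * sin (x / 2) * (\<Sum>k=m..n. cos (real k * x + c)) =
     sin ((real n + 1/2) * x + c) - sin ((real m - 1/2) * x + c)"
  using assms
proof (induction n rule: dec_induct)
  case base
  have "2 * sin (x/2) * cos (real m * x + c) = sin ((real m * x + c) + x/2) - sin ((real m * x + c) - x/2)"
    by (simp add: sin_add sin_diff)
  thus ?case by (simp add: algebra_simps add_divide_distrib)
next
  case (step n)
  have "2 * sin (x/2) * cos (real (Suc n) * x + c) = sin ((real (Suc n) * x + c) + x/2) - sin ((real (Suc n) * x + c) - x/2)"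
    by (simp add: sin_add sin_diff)
  also have "(real (Suc n) * x + c) + x/2 = (real (Suc n) + 1/2) * x + c" by (simp add: algebra_simps)
  also have "(real (Suc n) * x + c) - x/2 = (real n + 1/2) * x + c" by (simp add: algebra_simps add_divide_distrib)
  finally show ?case using step by (simp add: sum.nat_ivl_Suc' algebra_simps)
qed

text \<open>The trivial bound by the number of terms and the bound \<open>1 / rho x\<close> from the
  telescoped sum combine to \<open>S * (1 + real n * rho x) <= 2 * real n\<close>, one estimate for
  all \<open>x\<close>. The phase \<open>c\<close> covers sines and translated cosines.\<close>

lemma cos_block_bound:
  assumes "m \<ge> 1"
  shows "\<bar>\<Sum>k=m..n. cos (real k * x + c)\<bar> \<le> 2 * (real n * kern n x)"
proof (cases "m \<le> n")
  case True
  define S where "S = \<bar>\<Sum>k=m..n. cos (real k * x + c)\<bar>"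
  have "S \<le> (\<Sum>k=m..n. 1)" unfolding S_def by (intro order_trans[OF sum_abs] sum_mono) auto
  also have "\<dots> \<le> real n" using assms by (simp add: of_nat_diff)
  finally have 1: "S \<le> real n" .
  have "2 * rho x * S = \<bar>2 * sin (x / 2) * (\<Sum>k=m..n. cos (real k * x + c))\<bar>"
    by (simp add: rho_def S_def abs_mult)
  also have "\<dots> = \<bar>sin ((real n + 1/2) * x + c) - sin ((real m - 1/2) * x + c)\<bar>"
    using cos_block_telescope[OF True, of x c] by simp
  also have "\<dots> \<le> 2"
    using abs_sin_le_one[of "(real n + 1/2) * x + c"] abs_sin_le_one[of "(real m - 1/2) * x + c"] by linarith
  finally have "rho x * S \<le> 1" by simp
  hence "S + real n * (rho x * S) \<le> 2 * real n" using 1 mult_left_mono[of "rho x * S" 1 "real n"] by simp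
  hence "S * (1 + real n * rho x) \<le> 2 * real n" by (simp add: algebra_simps)
  moreover have "1 + real n * rho x > 0" by (simp add: add_pos_nonneg)
  ultimately have "S \<le> 2 * real n / (1 + real n * rho x)" by (simp add: pos_le_divide_eq)
  thus ?thesis by (simp add: S_def kern_def)
qed auto

lemma index_kern_mono: assumes "j \<le> i" shows "real j * kern j x \<le> real i * kern i x"
proof -
  have pos: "1 + real j * rho x > 0" "1 + real i * rho x > 0" by (simp_all add: add_pos_nonneg)
  have "real j * (1 + real i * rho x) \<le> real i * (1 + real j * rho x)"
    using assms by (simp add: algebra_simps)
  thus ?thesis using pos by (simp add: kern_def field_simps)
qed

lemma sum_by_parts:
  fixes m c :: "nat \<Rightarrow> real"
  shows "(\<Sum>k=1..Suc i. m k * c k) = m (Suc i) * (\<Sum>k=1..Suc i. c k) - (\<Sum>j=1..i. (m (Suc j) - m j) * (\<Sum>k=1..j. c k))"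
  by (induction i) (simp_all add: algebra_simps)

text \<open>Summation by parts: since the multipliers increase, their total variation is at most the
  last one, so the boundary term and the variation each cost \<open>m i * B\<close>.\<close>

lemma abel_increasing:
  fixes m c :: "nat \<Rightarrow> real"
  assumes m: "\<And>k. 1 \<le> k \<Longrightarrow> k < i \<Longrightarrow> m k \<le> m (Suc k)" and m0: "m 1 \<ge> 0" and i: "i \<ge> 1"
    and B: "\<And>j. 1 \<le> j \<Longrightarrow> j \<le> i \<Longrightarrow> \<bar>\<Sum>k=1..j. c k\<bar> \<le> B"
  shows "\<bar>\<Sum>k=1..i. m k * c k\<bar> \<le> 2 * m i * B"
proof -
  obtain n where n: "i = Suc n" using i by (cases i) auto
  have B0: "B \<ge> 0" using B[of 1] i by force
  have tel: "(\<Sum>j=1..n. m (Suc j) - m j) = m i - m 1" using n by (simp add: sum_Suc_diff)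
  have mi: "m i \<ge> m 1" unfolding n
  proof -
    have "0 \<le> (\<Sum>j=1..n. m (Suc j) - m j)" by (intro sum_nonneg) (use m n in auto)
    thus "m (Suc n) \<ge> m 1" using tel n by simp
  qed
  have "\<bar>\<Sum>k=1..i. m k * c k\<bar> \<le> \<bar>m i * (\<Sum>k=1..i. c k)\<bar> + \<bar>\<Sum>j=1..n. (m (Suc j) - m j) * (\<Sum>k=1..j. c k)\<bar>"
    unfolding n sum_by_parts by linarith
  also have "\<bar>m i * (\<Sum>k=1..i. c k)\<bar> \<le> m i * B"
    unfolding abs_mult using B[of i] i mi m0 by (intro mult_mono) auto
  also have "\<bar>\<Sum>j=1..n. (m (Suc j) - m j) * (\<Sum>k=1..j. c k)\<bar> \<le> (\<Sum>j=1..n. (m (Suc j) - m j) * B)"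
    by (intro order_trans[OF sum_abs] sum_mono) (use m n B in \<open>auto simp: abs_mult intro!: mult_mono\<close>)
  also have "\<dots> = (m i - m 1) * B" using tel by (simp flip: sum_distrib_right)
  also have "\<dots> \<le> m i * B" using m0 B0 by (intro mult_right_mono) auto
  finally show ?thesis by (simp add: mult_ac)
qed

section \<open>Binomial coefficients of fractional order and the multiplier of the
  difference\<close>

definition diff_coeff :: "real \<Rightarrow> nat \<Rightarrow> real" where "diff_coeff \<alpha> v = (-1)^v * (\<alpha> gchoose v)"

lemma diff_coeff_0 [simp]: "diff_coeff \<alpha> 0 = 1" by (simp add: diff_coeff_def)

text \<open>The asymptotic formula for binomial coefficients yields decay of order
  \<open>v powr (- \<alpha> - 1)\<close>. Only boundedness of the quotient is extracted from it,
  which also covers natural \<open>\<alpha>\<close>, where the limit is 0.\<close>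

lemma summable_diff_coeff:
  assumes "\<alpha> > 0"
  shows "summable (\<lambda>v. \<bar>diff_coeff \<alpha> v\<bar>)"
proof -
  have "(\<lambda>n. (\<alpha> gchoose n) / ((-1)^n / exp ((\<alpha>+1) * ln (real n)))) \<longlonglongrightarrow> inverse (Gamma (- \<alpha>))"
    using gbinomial_asymptotic[of \<alpha>] by simp
  hence "Bseq (\<lambda>n. (\<alpha> gchoose n) / ((-1)^n / exp ((\<alpha>+1) * ln (real n))))"
    by (intro convergent_imp_Bseq convergentI)
  then obtain K where K: "K > 0" "\<And>n. norm ((\<alpha> gchoose n) / ((-1)^n / exp ((\<alpha>+1) * ln (real n)))) \<le> K"
    by (elim BseqE) auto
  have bd: "norm \<bar>diff_coeff \<alpha> n\<bar> \<le> K * real n powr (- \<alpha> - 1)" if "n \<ge> 1" for n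
  proof -
    have "norm ((\<alpha> gchoose n) / ((-1)^n / exp ((\<alpha>+1) * ln (real n)))) = \<bar>diff_coeff \<alpha> n\<bar> * exp ((\<alpha>+1) * ln (real n))"
      by (simp add: diff_coeff_def abs_mult)
    also have "\<dots> = \<bar>diff_coeff \<alpha> n\<bar> * real n powr (\<alpha> + 1)" using that by (simp add: powr_def)
    finally have E: "norm ((\<alpha> gchoose n) / ((-1)^n / exp ((\<alpha>+1) * ln (real n)))) = \<bar>diff_coeff \<alpha> n\<bar> * real n powr (\<alpha> + 1)" .
    have "\<bar>diff_coeff \<alpha> n\<bar> * real n powr (\<alpha> + 1) \<le> K" using K(2)[of n] unfolding E .
    hence "\<bar>diff_coeff \<alpha> n\<bar> * real n powr (\<alpha> + 1) * real n powr (- \<alpha> - 1) \<le> K * real n powr (- \<alpha> - 1)"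
      by (intro mult_right_mono) auto
    moreover have "real n powr (\<alpha> + 1) * real n powr (- \<alpha> - 1) = 1"
      using that by (simp add: powr_add[symmetric])
    ultimately show ?thesis unfolding mult.assoc by simp
  qed
  have "summable (\<lambda>n. K * real n powr (- \<alpha> - 1))"
    by (rule summable_mult) (use assms summable_real_powr_iff[of "- \<alpha> - 1"] in linarith)
  thus ?thesis by (rule summable_comparison_test'[OF _ bd])
qed

definition diff_coeff_sum :: "real \<Rightarrow> real" where "diff_coeff_sum \<alpha> = (\<Sum>v. \<bar>diff_coeff \<alpha> v\<bar>)"

lemma diff_coeff_sum_ge_1: assumes "\<alpha> > 0" shows "diff_coeff_sum \<alpha> \<ge> 1"
  using sum_le_suminf[OF summable_diff_coeff[OF assms], of "{0}"] by (simp add: diff_coeff_sum_def)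

lemma summable_diff_coeff_mult:
  assumes "\<alpha> > 0" "\<And>v. \<bar>u v\<bar> \<le> B"
  shows "summable (\<lambda>v. diff_coeff \<alpha> v * u v)"
proof (rule summable_comparison_test'[where N = 0 and g = "\<lambda>v. \<bar>diff_coeff \<alpha> v\<bar> * B"])
  show "summable (\<lambda>v. \<bar>diff_coeff \<alpha> v\<bar> * B)" by (intro summable_mult2 summable_diff_coeff assms)
  show "norm (diff_coeff \<alpha> v * u v) \<le> \<bar>diff_coeff \<alpha> v\<bar> * B" for v
    using assms(2)[of v] by (auto simp: abs_mult intro: mult_left_mono)
qed

text \<open>Abel's limit argument along a radius: absolute summability makes the series uniformly
  convergent on the closed segment, so its value at the end is the limit of the values inside the
  disc, where the complex binomial theorem holds. At \<open>z = 1\<close> the power is continuous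
  because \<open>\<alpha> > 0\<close>.\<close>

lemma binomial_series_unit_circle:
  fixes z :: complex
  assumes \<alpha>: "\<alpha> > 0" and z: "norm z = 1"
  shows "(\<lambda>v. of_real (diff_coeff \<alpha> v) * z ^ v) sums ((1 - z) powr of_real \<alpha>)"
proof -
  define f where "f v r = of_real (diff_coeff \<alpha> v) * (of_real r * z) ^ v" for v and r :: real
  have bound: "norm (f v r) \<le> \<bar>diff_coeff \<alpha> v\<bar>" if "r \<in> {0..1}" for v r
    using that z by (auto simp: f_def norm_mult norm_power mult_left_le power_le_one)
  have ul: "uniform_limit {0..1} (\<lambda>n r. \<Sum>v<n. f v r) (\<lambda>r. \<Sum>v. f v r) sequentially"
    by (rule Weierstrass_m_test[OF bound summable_diff_coeff[OF \<alpha>]])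
  have "continuous_on {0..1} (\<lambda>r. \<Sum>v. f v r)"
    by (rule uniform_limit_theorem[OF _ ul]) (auto simp: f_def intro!: always_eventually continuous_intros)
  hence lim1: "((\<lambda>r. \<Sum>v. f v r) \<longlongrightarrow> (\<Sum>v. f v 1)) (at 1 within {0..1})"
    by (simp add: continuous_on_def)
  have eq: "(\<Sum>v. f v r) = (1 - of_real r * z) powr of_real \<alpha>" if "0 \<le> r" "r < 1" for r
  proof -
    have "norm (- (of_real r * z)) < 1" using that z by (simp add: norm_mult)
    from gen_binomial_complex[OF this, of "of_real \<alpha>"]
    have "(\<lambda>n. (of_real \<alpha> gchoose n) * (- (of_real r * z)) ^ n) sums (1 + - (of_real r * z)) powr of_real \<alpha>" .
    moreover have "(of_real \<alpha> gchoose n :: complex) = of_real (\<alpha> gchoose n)" for n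
      by (simp add: gbinomial_prod_rev)
    ultimately have "(\<lambda>n. f n r) sums (1 - of_real r * z) powr of_real \<alpha>"
      unfolding f_def diff_coeff_def by (subst (asm) power_minus) (simp add: mult_ac)
    thus ?thesis by (simp add: sums_iff)
  qed
  have nt: "at (1::real) within {0..1} \<noteq> bot"
    by (simp add: at_within_Icc_at_left)
  have "((\<lambda>r. (1 - of_real r * z) powr of_real \<alpha>) \<longlongrightarrow> (1 - of_real 1 * z) powr of_real \<alpha>) (at 1 within {0..1})"
  proof (rule tendsto_powr_complex')
    show "1 - complex_of_real 1 * z \<notin> \<real>\<^sub>\<le>\<^sub>0 \<or> 1 - complex_of_real 1 * z = 0 \<and> 0 < Re (complex_of_real \<alpha>)"
    proof (cases "z = 1")
      case False
      have "Re z \<le> 1" using complex_Re_le_cmod[of z] z by simp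
      moreover have "Re z \<noteq> 1"
      proof
        assume "Re z = 1"
        moreover from this have "Im z = 0" using z cmod_power2[of z] by simp
        ultimately show False using False by (simp add: complex_eq_iff)
      qed
      ultimately show ?thesis by (auto simp: complex_nonpos_Reals_iff)
    qed (use \<alpha> in auto)
  qed (intro tendsto_intros)+
  moreover have "eventually (\<lambda>r. (1 - of_real r * z) powr of_real \<alpha> = (\<Sum>v. f v r)) (at 1 within {0..1})"
    unfolding eventually_at_filter by (intro always_eventually) (auto simp: eq)
  ultimately have lim2: "((\<lambda>r. \<Sum>v. f v r) \<longlongrightarrow> (1 - z) powr of_real \<alpha>) (at 1 within {0..1})"
    by (subst (asm) tendsto_cong) auto
  have "(\<Sum>v. f v 1) = (1 - z) powr of_real \<alpha>" by (rule tendsto_unique[OF nt lim1 lim2])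
  moreover have "summable (\<lambda>v. f v 1)"
    by (rule summable_comparison_test'[where N = 0, OF summable_diff_coeff[OF \<alpha>]]) (use bound[of 1] in auto)
  ultimately show ?thesis by (simp add: f_def sums_iff)
qed

text \<open>In polar form \<open>1 - cis t\<close> is \<open>2 * sin (t / 2)\<close> times
  \<open>cis ((t - pi) / 2)\<close>, and this angle lies between \<open>- pi / 2\<close> and
  \<open>pi / 2\<close>, inside the range of the principal logarithm.\<close>

lemma Ln_one_minus_cis:
  assumes t: "0 < t" "t < 2 * pi"
  shows "Ln (1 - cis t) = of_real (ln (2 * sin (t / 2))) + \<i> * of_real ((t - pi) / 2)"
proof -
  define a where "a = 2 * sin (t / 2)"
  have a: "a > 0" unfolding a_def using t sin_gt_zero[of "t/2"] by auto
  have "cos t = 1 - 2 * (sin (t/2))^2" using cos_double_sin[of "t/2"] by simp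
  moreover have "sin t = 2 * sin (t/2) * cos (t/2)" using sin_double[of "t/2"] by simp
  moreover have "cos ((t - pi) / 2) = sin (t / 2)" "sin ((t - pi) / 2) = - cos (t / 2)"
    by (simp_all add: diff_divide_distrib cos_diff sin_diff)
  ultimately have "1 - cis t = of_real a * cis ((t - pi) / 2)"
    by (simp add: complex_eq_iff a_def power2_eq_square)
  also have "\<dots> = exp (of_real (ln a) + \<i> * of_real ((t - pi) / 2))"
    using a by (simp add: exp_add exp_of_real cis_conv_exp)
  finally show ?thesis using t by (intro Ln_unique) (auto simp: a_def)
qed

text \<open>Real part of the binomial series at \<open>cis th\<close>, multiplied by
  \<open>cis c\<close>. The principal branch is what confines \<open>th\<close> to one
  period.\<close>

lemma diff_coeff_cos_sums:
  assumes \<alpha>: "\<alpha> > 0" and th: "0 \<le> th" "th < 2 * pi"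
  shows "(\<lambda>v. diff_coeff \<alpha> v * cos (real v * th + c)) sums
     ((2 * sin (th / 2)) powr \<alpha> * cos (c + \<alpha> * (th - pi) / 2))"
proof -
  define a where "a = 2 * sin (th / 2)"
  have pw: "(1 - cis th) powr of_real \<alpha> = of_real (a powr \<alpha>) * cis (\<alpha> * (th - pi) / 2)"
  proof (cases "th = 0")
    case True thus ?thesis by (simp add: a_def)
  next
    case False
    hence a: "a > 0" unfolding a_def using th sin_gt_zero[of "th/2"] by auto
    have "Ln (1 - cis th) = of_real (ln a) + \<i> * of_real ((th - pi) / 2)"
      unfolding a_def by (rule Ln_one_minus_cis) (use th False in auto)
    moreover have "cos th \<noteq> 1" using cos_double_sin[of "th/2"] a by (simp add: a_def)
    hence "1 - cis th \<noteq> 0" by (auto simp: complex_eq_iff)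
    ultimately have "(1 - cis th) powr of_real \<alpha> = exp (of_real \<alpha> * (of_real (ln a) + \<i> * of_real ((th - pi) / 2)))"
      by (simp add: powr_def)
    also have "\<dots> = exp (of_real (\<alpha> * ln a)) * cis (\<alpha> * (th - pi) / 2)"
      by (simp add: exp_add[symmetric] cis_conv_exp distrib_left mult_ac)
    also have "exp (of_real (\<alpha> * ln a)) = (of_real (a powr \<alpha>) :: complex)"
      using a by (simp add: powr_def flip: exp_of_real)
    finally show ?thesis .
  qed
  have "(\<lambda>v. of_real (diff_coeff \<alpha> v) * cis th ^ v) sums ((1 - cis th) powr of_real \<alpha>)"
    by (rule binomial_series_unit_circle[OF \<alpha>]) simp
  hence "(\<lambda>v. of_real (diff_coeff \<alpha> v) * cis th ^ v * cis c) sums ((1 - cis th) powr of_real \<alpha> * cis c)"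
    by (rule sums_mult2)
  hence "(\<lambda>v. Re (of_real (diff_coeff \<alpha> v) * cis th ^ v * cis c)) sums Re ((1 - cis th) powr of_real \<alpha> * cis c)"
    by (rule sums_Re)
  moreover have "Re (of_real (diff_coeff \<alpha> v) * cis th ^ v * cis c) = diff_coeff \<alpha> v * cos (real v * th + c)" for v
    unfolding Complex.DeMoivre mult.assoc cis_mult by simp
  moreover have "Re ((1 - cis th) powr of_real \<alpha> * cis c) = a powr \<alpha> * cos (c + \<alpha> * (th - pi) / 2)"
    unfolding pw mult.assoc cis_mult by (subst add.commute) simp
  ultimately show ?thesis by (simp add: a_def)
qed

definition fdiff1 :: "real \<Rightarrow> real \<Rightarrow> (real \<Rightarrow> real) \<Rightarrow> real \<Rightarrow> real" where
  "fdiff1 \<alpha> h u x = (\<Sum>v. diff_coeff \<alpha> v * u (x + (\<alpha> - real v) * h))"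

text \<open>The phase \<open>\<alpha> * pi / 2\<close> is that of a derivative of order
  \<open>\<alpha>\<close>. The translation by \<open>\<alpha> * h / 2\<close> arises because the
  samples \<open>x + (\<alpha> - v) * h\<close> are not centred at \<open>x\<close>.\<close>

lemma fdiff1_cos:
  assumes \<alpha>: "\<alpha> > 0" and th: "0 \<le> real k * h" "real k * h < 2 * pi"
  shows "fdiff1 \<alpha> h (\<lambda>x. cos (real k * x)) x =
     (2 * sin (real k * h / 2)) powr \<alpha> * cos (real k * (x + \<alpha> * h / 2) + \<alpha> * pi / 2)"
proof -
  have "cos (real v * (real k * h) + - (real k * x + real k * \<alpha> * h)) = cos (real k * (x + (\<alpha> - real v) * h))" for v
    by (subst cos_minus[symmetric]) (simp add: algebra_simps)
  with diff_coeff_cos_sums[OF \<alpha> th, of "- (real k * x + real k * \<alpha> * h)"]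
  have "fdiff1 \<alpha> h (\<lambda>x. cos (real k * x)) x = (2 * sin (real k * h / 2)) powr \<alpha> *
     cos (- (real k * x + real k * \<alpha> * h) + \<alpha> * (real k * h - pi) / 2)"
    by (simp add: fdiff1_def sums_iff)
  also have "- (real k * x + real k * \<alpha> * h) + \<alpha> * (real k * h - pi) / 2 = - (real k * (x + \<alpha> * h / 2) + \<alpha> * pi / 2)"
    by (simp add: field_simps)
  also have "cos \<dots> = cos (real k * (x + \<alpha> * h / 2) + \<alpha> * pi / 2)" by (rule cos_minus)
  finally show ?thesis .
qed

lemma fdiff1_sum:
  assumes "\<alpha> > 0" "finite A" "\<And>k. k \<in> A \<Longrightarrow> (\<And>x. \<bar>u k x\<bar> \<le> B k)"
  shows "fdiff1 \<alpha> h (\<lambda>x. \<Sum>k\<in>A. c k * u k x) x = (\<Sum>k\<in>A. c k * fdiff1 \<alpha> h (u k) x)"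
proof -
  have s: "summable (\<lambda>v. diff_coeff \<alpha> v * u k (x + (\<alpha> - real v) * h))" if "k \<in> A" for k
    using assms that by (intro summable_diff_coeff_mult[where B = "B k"]) auto
  have "fdiff1 \<alpha> h (\<lambda>x. \<Sum>k\<in>A. c k * u k x) x = (\<Sum>v. \<Sum>k\<in>A. c k * (diff_coeff \<alpha> v * u k (x + (\<alpha> - real v) * h)))"
    unfolding fdiff1_def by (simp add: sum_distrib_left mult_ac)
  also have "\<dots> = (\<Sum>k\<in>A. \<Sum>v. c k * (diff_coeff \<alpha> v * u k (x + (\<alpha> - real v) * h)))"
    by (intro suminf_sum summable_mult s)
  also have "\<dots> = (\<Sum>k\<in>A. c k * fdiff1 \<alpha> h (u k) x)"
    unfolding fdiff1_def by (intro sum.cong refl suminf_mult s)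
  finally show ?thesis .
qed

text \<open>The Dirichlet kernel without its constant term; \<open>m > 0\<close> gives what remains
  of it after a polynomial of degree \<open>m\<close> has been removed.\<close>

definition cos_sum :: "nat \<Rightarrow> nat \<Rightarrow> real \<Rightarrow> real" where "cos_sum m i x = (\<Sum>k=m+1..i. cos (real k * x))"

lemma cos_sum_bound: "\<bar>cos_sum m i x\<bar> \<le> 2 * (real i * kern i x)"
proof -
  have "1 \<le> m + 1" by simp
  from cos_block_bound[OF this, where n = i and x = x and c = 0] show ?thesis unfolding cos_sum_def add_0_right .
qed

lemma fdiff1_cos_sum:
  assumes "\<alpha> > 0"
  shows "fdiff1 \<alpha> h (cos_sum m i) x = (\<Sum>k=m+1..i. fdiff1 \<alpha> h (\<lambda>x. cos (real k * x)) x)"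
  using fdiff1_sum[OF assms, of "{m+1..i}" "\<lambda>k x. cos (real k * x)" "\<lambda>_. 1" h "\<lambda>_. 1" x]
  by (simp add: cos_sum_def[abs_def])

text \<open>For frequencies up to \<open>n\<close> all \<open>k * \<bar>h\<bar>\<close> are at most
  1, and for positive \<open>h\<close> the multiplier
  \<open>(2 * sin (k * h / 2)) powr \<alpha>\<close> then increases with \<open>k\<close>. Summation
  by parts bounds the whole sum by the largest multiplier, at most
  \<open>(i / n) powr \<alpha>\<close>, times a block bound.\<close>

lemma fdiff1_cos_sum_low:
  assumes \<alpha>: "\<alpha> > 0" and n: "n \<ge> 1" and i: "i \<le> n" and h: "\<bar>h\<bar> \<le> 1 / real n"
  shows "\<bar>fdiff1 \<alpha> h (cos_sum 0 i) x\<bar> \<le> 4 * (1 + \<alpha>) * (real i / real n) powr \<alpha> * (real i * kern i x)"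
proof (cases "i = 0")
  case True
  thus ?thesis by (simp add: cos_sum_def[abs_def] fdiff1_def)
next
  case i0: False
  have pos: "\<bar>fdiff1 \<alpha> h (cos_sum 0 i) x\<bar> \<le> 4 * (1 + \<alpha>) * (real i / real n) powr \<alpha> * (real i * kern i x)"
    if h: "0 \<le> h" "h \<le> 1 / real n" for h x
  proof -
    define x2 where "x2 = x + \<alpha> * h / 2"
    define m where "m k = (2 * sin (real k * h / 2)) powr \<alpha>" for k :: nat
    have kh: "real k * h \<le> 1" if "k \<le> i" for k
    proof -
      have "real k * h \<le> real n * (1 / real n)" using h that i by (intro mult_mono) auto
      thus ?thesis using n by simp
    qed
    have pi3: "pi > 3" by (rule pi_gt3)
    have "fdiff1 \<alpha> h (cos_sum 0 i) x = (\<Sum>k=1..i. m k * cos (real k * x2 + \<alpha> * pi / 2))"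
      unfolding fdiff1_cos_sum[OF \<alpha>]
    proof (intro sum.cong)
      fix k assume "k \<in> {1..i}"
      hence "real k * h < 2 * pi" using kh[of k] pi3 by simp
      thus "fdiff1 \<alpha> h (\<lambda>x. cos (real k * x)) x = m k * cos (real k * x2 + \<alpha> * pi / 2)"
        using fdiff1_cos[OF \<alpha>, of k h x] h by (simp add: m_def x2_def)
    qed auto
    also have "\<bar>\<dots>\<bar> \<le> 2 * m i * (2 * (real i * kern i x2))"
    proof (rule abel_increasing)
      fix k assume k: "1 \<le> k" "k < i"
      have "- (pi / 2) \<le> real k * h / 2" by (rule order_trans[of _ 0]) (use h in auto)
      hence "sin (real k * h / 2) \<le> sin (real (Suc k) * h / 2)"
        using kh[of "Suc k"] k pi3 h mult_right_mono[of "real k" "real (Suc k)" h] by (intro sin_monotone_2pi_le) auto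
      moreover have "sin (real k * h / 2) \<ge> 0"
        using kh[of k] k pi3 h by (intro sin_ge_zero) auto
      ultimately show "m k \<le> m (Suc k)" unfolding m_def using \<alpha> by (intro powr_mono2) auto
    next
      fix j assume j: "1 \<le> j" "j \<le> i"
      have "\<bar>\<Sum>k=1..j. cos (real k * x2 + \<alpha> * pi / 2)\<bar> \<le> 2 * (real j * kern j x2)"
        by (rule cos_block_bound) simp
      also have "\<dots> \<le> 2 * (real i * kern i x2)" using index_kern_mono[of j i x2] j by simp
      finally show "\<bar>\<Sum>k=1..j. cos (real k * x2 + \<alpha> * pi / 2)\<bar> \<le> 2 * (real i * kern i x2)" .
    qed (use i0 in \<open>auto simp: m_def\<close>)
    also have "\<dots> = 4 * m i * (real i * kern i x2)" by simp
    also have "\<dots> \<le> 4 * (real i / real n) powr \<alpha> * (real i * ((1 + \<alpha>) * kern i x))"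
    proof (intro mult_mono mult_left_mono)
      have "sin (real i * h / 2) \<le> real i * h / 2" using h by (intro sin_x_le_x) auto
      also have "real i * h \<le> real i * (1 / real n)" using h by (intro mult_left_mono) auto
      finally have "2 * sin (real i * h / 2) \<le> real i / real n" by simp
      moreover have "sin (real i * h / 2) \<ge> 0"
        using kh[of i] pi3 h by (intro sin_ge_zero) auto
      ultimately show "m i \<le> (real i / real n) powr \<alpha>"
        unfolding m_def using \<alpha> by (intro powr_mono2) auto
      \<comment> \<open>The kernel is wanted at \<open>x\<close> but arises at the translated point
        \<open>x2\<close>. As \<open>rho\<close> is Lipschitz with constant 1/2 and
        \<open>i * h <= 1\<close>, the change of point costs at most the factor
        \<open>1 + \<alpha>\<close>.\<close>
      have "\<bar>rho x - rho x2\<bar> \<le> \<bar>sin (x / 2) - sin (x2 / 2)\<bar>" by (simp add: rho_def)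
      also have "\<dots> \<le> \<bar>x / 2 - x2 / 2\<bar>"
        using sin_diff_sin[of "x/2" "x2/2"] abs_sin_x_le_abs_x[of "(x/2 - x2/2)/2"]
          abs_cos_le_one[of "(x/2 + x2/2)/2"]
          mult_mono[of "\<bar>sin ((x/2 - x2/2)/2)\<bar>" "\<bar>(x/2 - x2/2)/2\<bar>" "\<bar>cos ((x/2 + x2/2)/2)\<bar>" 1]
        by (simp add: abs_mult)
      also have "\<dots> = \<alpha> * h / 4" using h \<alpha> by (simp add: x2_def abs_mult field_simps)
      finally have "rho x \<le> rho x2 + \<alpha> * h / 4" by linarith
      hence "real i * rho x \<le> real i * (rho x2 + \<alpha> * h / 4)" by (intro mult_left_mono) auto
      also have "\<dots> = real i * rho x2 + \<alpha> * (real i * h) / 4" by (simp add: algebra_simps)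
      also have "\<alpha> * (real i * h) \<le> \<alpha> * 1" using kh[of i] \<alpha> by (intro mult_left_mono) auto
      finally have "1 + real i * rho x \<le> 1 + real i * rho x2 + \<alpha>" using \<alpha> by simp
      also have "\<dots> \<le> (1 + \<alpha>) * (1 + real i * rho x2)" using \<alpha> by (simp add: algebra_simps)
      finally have 1: "1 + real i * rho x \<le> (1 + \<alpha>) * (1 + real i * rho x2)" .
      have pos: "1 + real i * rho x > 0" "1 + real i * rho x2 > 0" by (simp_all add: add_pos_nonneg)
      show "kern i x2 \<le> (1 + \<alpha>) * kern i x" unfolding kern_def using 1 pos by (simp add: field_simps)
    qed (auto simp: m_def)
    also have "\<dots> = 4 * (1 + \<alpha>) * (real i / real n) powr \<alpha> * (real i * kern i x)"
      by (simp only: mult_ac)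
    finally show ?thesis .
  qed
  show ?thesis
  proof (cases "h \<ge> 0")
    case True thus ?thesis using pos[of h x] h by simp
  next
    case False
    \<comment> \<open>Negative steps reduce to positive ones: as the kernel is even, reversing both
      \<open>h\<close> and \<open>x\<close> leaves the difference unchanged.\<close>
    have even: "cos_sum 0 i (- y) = cos_sum 0 i y" for y by (simp add: cos_sum_def)
    have "fdiff1 \<alpha> h (cos_sum 0 i) x = fdiff1 \<alpha> (- h) (cos_sum 0 i) (- x)"
      unfolding fdiff1_def by (intro suminf_cong) (subst even[symmetric], simp)
    moreover have "kern i (- x) = kern i x" by (simp add: kern_def rho_def)
    ultimately show ?thesis using pos[of "-h" "-x"] h False by simp
  qed
qed

section \<open>Periodic functions and Lp spaces\<close>

lemma
  fixes v :: "'a::euclidean_space"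
  shows distr_lebesgue_translate: "distr lebesgue lebesgue (\<lambda>z. z + v) = lebesgue"
    and measurable_lebesgue_translate: "(\<lambda>z. z + v) \<in> lebesgue \<rightarrow>\<^sub>M lebesgue"
proof -
  have eq: "(\<lambda>x. v + (\<Sum>j\<in>Basis. (1 * (x \<bullet> j)) *\<^sub>R j)) = (\<lambda>z. z + v)"
    by (simp add: euclidean_representation add.commute)
  show "(\<lambda>z. z + v) \<in> lebesgue \<rightarrow>\<^sub>M lebesgue"
    using lebesgue_affine_measurable[of "\<lambda>_. 1" v] unfolding eq by simp
  show "distr lebesgue lebesgue (\<lambda>z. z + v) = lebesgue"
    using lebesgue_affine_euclidean[of "\<lambda>_. 1" v] unfolding eq by (simp add: density_1)
qed

lemma nn_integral_lebesgue_translate: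
  fixes v :: "'a::euclidean_space" and f :: "'a \<Rightarrow> ennreal"
  assumes "f \<in> borel_measurable lebesgue"
  shows "(\<integral>\<^sup>+z. f (z + v) \<partial>lebesgue) = (\<integral>\<^sup>+z. f z \<partial>lebesgue)"
  using nn_integral_distr[OF measurable_lebesgue_translate, of f v] assms
  by (simp add: distr_lebesgue_translate)

lemma AE_lebesgue_translate:
  fixes v :: "'a::euclidean_space"
  assumes "AE z in lebesgue. P z"
  shows "AE z in lebesgue. P (z + v)"
proof -
  have "AE z in distr lebesgue lebesgue (\<lambda>z. z + v). P z"
    unfolding distr_lebesgue_translate by fact
  thus ?thesis by (rule AE_distrD[OF measurable_lebesgue_translate])
qed

lemma borel_measurable_lebesgue_translate [measurable (raw)]:
  fixes v :: "'a::euclidean_space"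
  assumes "f \<in> borel_measurable lebesgue"
  shows "(\<lambda>z. f (z + v)) \<in> borel_measurable lebesgue"
  using measurable_compose[OF measurable_lebesgue_translate assms] .

definition axes :: "(real \<times> real) set" where "axes = {(1, 0), (0, 1)}"

text \<open>The value type is arbitrary because periodicity is also used for \<open>ennreal\<close>
  functions and for predicates.\<close>

definition periodic2 :: "(real \<times> real \<Rightarrow> 'b) \<Rightarrow> bool" where
  "periodic2 f \<longleftrightarrow> (\<forall>e\<in>axes. \<forall>z. f (z + (2 * pi) *\<^sub>R e) = f z)"

lemma periodic2D: "periodic2 f \<Longrightarrow> e \<in> axes \<Longrightarrow> f (z + (2 * pi) *\<^sub>R e) = f z"
  unfolding periodic2_def by blast

lemma periodic2_int:
  assumes "periodic2 f" "e \<in> axes"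
  shows "f (z + (2 * pi * real_of_int m) *\<^sub>R e) = f z"
proof -
  have nat: "f (z + (2 * pi * real n) *\<^sub>R e) = f z" for n z
  proof (induction n)
    case (Suc n)
    have "z + (2 * pi * real (Suc n)) *\<^sub>R e = (z + (2 * pi * real n) *\<^sub>R e) + (2 * pi) *\<^sub>R e"
      by (simp add: algebra_simps)
    thus ?case using Suc periodic2D[OF assms] by metis
  qed simp
  show ?thesis
  proof (cases "m \<ge> 0")
    case True
    thus ?thesis using nat[of z "nat m"] by simp
  next
    case False
    hence "f ((z + (2 * pi * real_of_int m) *\<^sub>R e) + (2 * pi * real (nat (- m))) *\<^sub>R e) = f (z + (2 * pi * real_of_int m) *\<^sub>R e)"
      by (intro nat)
    moreover have "(z + (2 * pi * real_of_int m) *\<^sub>R e) + (2 * pi * real (nat (- m))) *\<^sub>R e = z"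
      using False by (simp add: algebra_simps)
    ultimately show ?thesis by simp
  qed
qed

lemma periodic2_translate: "periodic2 f \<Longrightarrow> periodic2 (\<lambda>z. f (z + v))"
  unfolding periodic2_def
proof (intro ballI allI)
  fix e z assume *: "\<forall>e\<in>axes. \<forall>z. f (z + (2 * pi) *\<^sub>R e) = f z" "e \<in> axes"
  have "z + (2 * pi) *\<^sub>R e + v = (z + v) + (2 * pi) *\<^sub>R e" by (simp add: add_ac)
  thus "f (z + (2 * pi) *\<^sub>R e + v) = f (z + v)" using * by metis
qed

lemma periodic2_comp: "periodic2 f \<Longrightarrow> periodic2 (\<lambda>z. g (f z))"
  by (simp add: periodic2_def)

text \<open>Its translates by periods tile the plane without overlap, so that cutting and moving
  pieces is exact; the closed square differs from it by a null set.\<close>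

definition half_open_square :: "(real \<times> real) set" where "half_open_square = {0..<2*pi} \<times> {0..<2*pi}"

lemma sets_half_open_square [measurable, simp]: "half_open_square \<in> sets borel" "half_open_square \<in> sets lebesgue"
proof -
  show 1: "half_open_square \<in> sets borel" unfolding half_open_square_def by (simp add: borel_prod[symmetric])
  thus "half_open_square \<in> sets lebesgue" by simp
qed

lemma nn_integral_torus_half_open_square: "(\<integral>\<^sup>+z. f z \<partial>torus) = (\<integral>\<^sup>+z. f z * indicator half_open_square z \<partial>lebesgue)"
proof -
  have n1: "{2*pi} \<times> (UNIV :: real set) \<in> null_sets (lborel \<Otimes>\<^sub>M lborel)"
    by (rule null_setsI) (auto simp: lborel.emeasure_pair_measure_Times)
  have n2: "(UNIV :: real set) \<times> {2*pi} \<in> null_sets (lborel \<Otimes>\<^sub>M lborel)"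
    by (rule null_setsI) (auto simp: lborel.emeasure_pair_measure_Times)
  have "AE z in lborel. z \<notin> {2*pi} \<times> (UNIV :: real set) \<and> z \<notin> (UNIV :: real set) \<times> {2*pi}"
    using AE_not_in[OF n1] AE_not_in[OF n2] unfolding lborel_prod by eventually_elim simp
  hence "AE z in lebesgue. z \<notin> {2*pi} \<times> (UNIV :: real set) \<and> z \<notin> (UNIV :: real set) \<times> {2*pi}"
    by (rule AE_completion)
  hence "AE z in lebesgue. f z * indicator period_square z = f z * indicator half_open_square z"
    by eventually_elim (auto simp: period_square_def half_open_square_def indicator_def)
  hence "(\<integral>\<^sup>+z. f z * indicator period_square z \<partial>lebesgue) = (\<integral>\<^sup>+z. f z * indicator half_open_square z \<partial>lebesgue)"
    by (rule nn_integral_cong_AE)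
  thus ?thesis by (simp add: nn_integral_restrict_space)
qed

text \<open>After a change of variables the domain is a translated square. The part of it that
  protrudes beyond \<open>2 * pi\<close> along \<open>e\<close> is moved back by one period and
  fills the strip that the translate left uncovered.\<close>

lemma nn_integral_torus_translate_axis:
  fixes f :: "real \<times> real \<Rightarrow> ennreal"
  assumes f [measurable]: "f \<in> borel_measurable lebesgue" and periodic2: "periodic2 f" and e: "e \<in> axes"
  shows "(\<integral>\<^sup>+z. f (z + s *\<^sub>R e) \<partial>torus) = (\<integral>\<^sup>+z. f z \<partial>torus)"
proof -
  have main: "(\<integral>\<^sup>+z. f (z + s *\<^sub>R e) \<partial>torus) = (\<integral>\<^sup>+z. f z \<partial>torus)" if s: "0 \<le> s" "s < 2 * pi" for s
  proof -
    define H where "H = {z :: real \<times> real. z \<bullet> e < s}"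
    have H [measurable]: "H \<in> sets borel" unfolding H_def by measurable
    have Hl [measurable]: "H \<in> sets lebesgue" using H by simp
    have meas: "(\<lambda>z. f z * indicator half_open_square (z - s *\<^sub>R e)) \<in> borel_measurable lebesgue"
      using borel_measurable_lebesgue_translate[of "indicator half_open_square :: _ \<Rightarrow> ennreal" "- (s *\<^sub>R e)"] by simp
    have meas2: "(\<lambda>z. f z * (indicator half_open_square (z - (2 * pi) *\<^sub>R e) * indicator H (z - (2*pi) *\<^sub>R e))) \<in> borel_measurable lebesgue"
      using borel_measurable_lebesgue_translate[of "\<lambda>z. indicator half_open_square z * indicator H z :: ennreal" "- ((2*pi) *\<^sub>R e)"] by simp
    have "(\<integral>\<^sup>+z. f (z + s *\<^sub>R e) \<partial>torus) = (\<integral>\<^sup>+z. f (z + s *\<^sub>R e) * indicator half_open_square ((z + s *\<^sub>R e) - s *\<^sub>R e) \<partial>lebesgue)"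
      by (simp add: nn_integral_torus_half_open_square)
    also have "\<dots> = (\<integral>\<^sup>+z. f z * indicator half_open_square (z - s *\<^sub>R e) \<partial>lebesgue)"
      by (rule nn_integral_lebesgue_translate[OF meas])
    also have "\<dots> = (\<integral>\<^sup>+z. f z * (indicator half_open_square z * indicator (- H) z) + f z * (indicator half_open_square (z - (2 * pi) *\<^sub>R e) * indicator H (z - (2*pi) *\<^sub>R e)) \<partial>lebesgue)"
    proof (intro nn_integral_cong)
      fix z
      have "indicator half_open_square (z - s *\<^sub>R e) = (indicator half_open_square z * indicator (- H) z + indicator half_open_square (z - (2 * pi) *\<^sub>R e) * indicator H (z - (2*pi) *\<^sub>R e) :: ennreal)"
        using e s by (cases z) (auto simp: axes_def half_open_square_def H_def indicator_def)
      thus "f z * indicator half_open_square (z - s *\<^sub>R e) = f z * (indicator half_open_square z * indicator (- H) z) + f z * (indicator half_open_square (z - (2 * pi) *\<^sub>R e) * indicator H (z - (2*pi) *\<^sub>R e))"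
        by (simp add: distrib_left)
    qed
    also have "\<dots> = (\<integral>\<^sup>+z. f z * (indicator half_open_square z * indicator (- H) z) \<partial>lebesgue) + (\<integral>\<^sup>+z. f z * (indicator half_open_square (z - (2 * pi) *\<^sub>R e) * indicator H (z - (2*pi) *\<^sub>R e)) \<partial>lebesgue)"
      by (rule nn_integral_add) (use meas2 in auto)
    also have "(\<integral>\<^sup>+z. f z * (indicator half_open_square (z - (2 * pi) *\<^sub>R e) * indicator H (z - (2*pi) *\<^sub>R e)) \<partial>lebesgue) =
      (\<integral>\<^sup>+z. f (z + (2*pi) *\<^sub>R e) * (indicator half_open_square ((z + (2*pi) *\<^sub>R e) - (2 * pi) *\<^sub>R e) * indicator H ((z + (2*pi) *\<^sub>R e) - (2*pi) *\<^sub>R e)) \<partial>lebesgue)"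
      by (rule nn_integral_lebesgue_translate[OF meas2, symmetric])
    also have "\<dots> = (\<integral>\<^sup>+z. f z * (indicator half_open_square z * indicator H z) \<partial>lebesgue)"
      by (intro nn_integral_cong) (simp only: periodic2D[OF periodic2 e] add_diff_cancel_right')
    also have "(\<integral>\<^sup>+z. f z * (indicator half_open_square z * indicator (- H) z) \<partial>lebesgue) + \<dots> = (\<integral>\<^sup>+z. f z * (indicator half_open_square z * indicator (- H) z) + f z * (indicator half_open_square z * indicator H z) \<partial>lebesgue)"
      by (rule nn_integral_add[symmetric]) auto
    also have "\<dots> = (\<integral>\<^sup>+z. f z * indicator half_open_square z \<partial>lebesgue)"
      by (intro nn_integral_cong) (auto simp: indicator_def)
    finally show ?thesis by (simp add: nn_integral_torus_half_open_square)
  qed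
  define m where "m = \<lfloor>s / (2 * pi)\<rfloor>"
  define s' where "s' = s - 2 * pi * real_of_int m"
  have "real_of_int m \<le> s / (2 * pi)" "s / (2 * pi) < real_of_int m + 1" unfolding m_def by linarith+
  hence s': "0 \<le> s'" "s' < 2 * pi" unfolding s'_def by (simp_all add: field_simps)
  have "f (z + s *\<^sub>R e) = f (z + s' *\<^sub>R e)" for z
  proof -
    have "z + s *\<^sub>R e = (z + s' *\<^sub>R e) + (2 * pi * real_of_int m) *\<^sub>R e"
      by (simp add: s'_def algebra_simps)
    thus ?thesis using periodic2_int[OF periodic2 e, of "z + s' *\<^sub>R e" m] by metis
  qed
  thus ?thesis using main[OF s'] by simp
qed

lemma nn_integral_torus_translate:
  fixes f :: "real \<times> real \<Rightarrow> ennreal"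
  assumes [measurable]: "f \<in> borel_measurable lebesgue" and periodic2: "periodic2 f"
  shows "(\<integral>\<^sup>+z. f (z + v) \<partial>torus) = (\<integral>\<^sup>+z. f z \<partial>torus)"
proof -
  have v: "z + v = (z + fst v *\<^sub>R (1, 0)) + snd v *\<^sub>R (0, 1)" for z :: "real \<times> real"
    by (simp add: prod_eq_iff)
  have "(\<integral>\<^sup>+z. f (z + v) \<partial>torus) = (\<integral>\<^sup>+z. f (z + snd v *\<^sub>R (0, 1)) \<partial>torus)"
    unfolding v
    by (rule nn_integral_torus_translate_axis[where f = "\<lambda>z. f (z + snd v *\<^sub>R (0, 1))"])
       (auto intro: periodic2_translate periodic2 simp: axes_def)
  also have "\<dots> = (\<integral>\<^sup>+z. f z \<partial>torus)"
    by (rule nn_integral_torus_translate_axis) (auto intro: periodic2 simp: axes_def)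
  finally show ?thesis .
qed

text \<open>Countably many translates of the exceptional set by period vectors still form a null
  set, and the floors of the coordinates divided by \<open>2 * pi\<close> determine the translate
  that moves a given point into the square.\<close>

lemma AE_torus_periodic:
  assumes "AE z in torus. P z" and periodic2: "periodic2 P"
  shows "AE z in lebesgue. P z"
proof -
  have AE1: "AE z in lebesgue. z \<in> period_square \<longrightarrow> P z"
    using assms(1) by (subst (asm) AE_restrict_space_iff) auto
  have sh: "P (z + ((2 * pi * real_of_int m) *\<^sub>R (1, 0) + (2 * pi * real_of_int n) *\<^sub>R (0, 1))) = P z" for z and m n :: int
    using periodic2_int[OF periodic2, of "(0, 1)" "z + (2 * pi * real_of_int m) *\<^sub>R (1, 0)" n] periodic2_int[OF periodic2, of "(1, 0)" z m]
    by (simp add: axes_def add.assoc)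
  have "AE z in lebesgue. \<forall>m n :: int. z + ((2 * pi * real_of_int m) *\<^sub>R (1, 0) + (2 * pi * real_of_int n) *\<^sub>R (0, 1)) \<in> period_square \<longrightarrow> P z"
    unfolding AE_all_countable
  proof (intro allI)
    fix m n :: int
    show "AE z in lebesgue. z + ((2 * pi * real_of_int m) *\<^sub>R (1, 0) + (2 * pi * real_of_int n) *\<^sub>R (0, 1)) \<in> period_square \<longrightarrow> P z"
      using AE_lebesgue_translate[OF AE1, of "(2 * pi * real_of_int m) *\<^sub>R (1, 0) + (2 * pi * real_of_int n) *\<^sub>R (0, 1)"]
      by eventually_elim (simp only: sh)
  qed
  thus ?thesis
  proof eventually_elim
    fix z :: "real \<times> real"
    assume *: "\<forall>m n :: int. z + ((2 * pi * real_of_int m) *\<^sub>R (1, 0) + (2 * pi * real_of_int n) *\<^sub>R (0, 1)) \<in> period_square \<longrightarrow> P z"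
    have fl: "0 \<le> x + 2 * pi * real_of_int (- \<lfloor>x / (2 * pi)\<rfloor>) \<and> x + 2 * pi * real_of_int (- \<lfloor>x / (2 * pi)\<rfloor>) \<le> 2 * pi" for x :: real
    proof -
      have "real_of_int \<lfloor>x / (2 * pi)\<rfloor> \<le> x / (2 * pi)" "x / (2 * pi) < real_of_int \<lfloor>x / (2 * pi)\<rfloor> + 1" by linarith+
      from mult_right_mono[OF this(1), of "2 * pi"] mult_strict_right_mono[OF this(2), of "2 * pi"]
      show ?thesis by (simp add: algebra_simps)
    qed
    show "P z"
      using *[rule_format, of "- \<lfloor>fst z / (2 * pi)\<rfloor>" "- \<lfloor>snd z / (2 * pi)\<rfloor>"] fl[of "fst z"] fl[of "snd z"]
      by (cases z) (simp add: period_square_def)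
  qed
qed

text \<open>The \<open>p\<close>-th power of the norm, which avoids roots until the end. Constants
  depending on \<open>p\<close> are free, so the quasi-triangle inequality
  \<open>powr_add_le\<close> with factor \<open>2 powr p\<close> stands in for Minkowski's
  inequality.\<close>

definition Lp_int :: "real \<Rightarrow> (real \<times> real \<Rightarrow> real) \<Rightarrow> real" where
  "Lp_int p g = (\<integral>z. \<bar>g z\<bar> powr p \<partial>torus)"

lemma Lp_int_nonneg [simp]: "Lp_int p g \<ge> 0" by (simp add: Lp_int_def)

lemma Lp_norm_Lp_int: "Lp_norm p g = Lp_int p g powr (1 / p)"
  by (simp add: Lp_norm_def Lp_int_def set_lebesgue_integral_def integral_restrict_space)

lemma Lp_torus_iff:
  "f \<in> Lp_torus p \<longleftrightarrow> f \<in> borel_measurable lebesgue \<and> periodic2 f \<and> integrable torus (\<lambda>z. \<bar>f z\<bar> powr p)"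
proof -
  have "(\<forall>x y. f (x + 2*pi, y) = f (x, y) \<and> f (x, y + 2*pi) = f (x, y)) \<longleftrightarrow> periodic2 f"
    by (auto simp: periodic2_def axes_def)
  moreover have "set_integrable lebesgue period_square (\<lambda>z. \<bar>f z\<bar> powr p) \<longleftrightarrow> integrable torus (\<lambda>z. \<bar>f z\<bar> powr p)"
    by (simp add: set_integrable_def integrable_restrict_space)
  ultimately show ?thesis unfolding Lp_torus_def by blast
qed

lemma Lp_torusD:
  assumes "f \<in> Lp_torus p"
  shows "f \<in> borel_measurable lebesgue" "periodic2 f" "integrable torus (\<lambda>z. \<bar>f z\<bar> powr p)" "f \<in> borel_measurable torus"
    "(\<integral>\<^sup>+z. ennreal (\<bar>f z\<bar> powr p) \<partial>torus) = ennreal (Lp_int p f)"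
proof -
  show *: "f \<in> borel_measurable lebesgue" "periodic2 f" "integrable torus (\<lambda>z. \<bar>f z\<bar> powr p)"
    using assms by (auto simp: Lp_torus_iff)
  show "f \<in> borel_measurable torus" using *(1) by (rule measurable_restrict_space1)
  show "(\<integral>\<^sup>+z. ennreal (\<bar>f z\<bar> powr p) \<partial>torus) = ennreal (Lp_int p f)"
    unfolding Lp_int_def using *(3) by (intro nn_integral_eq_integral) auto
qed

lemma Lp_torusI:
  assumes "f \<in> borel_measurable lebesgue" "periodic2 f" "(\<integral>\<^sup>+z. ennreal (\<bar>f z\<bar> powr p) \<partial>torus) \<le> ennreal X" "X \<ge> 0"
  shows "f \<in> Lp_torus p" "Lp_int p f \<le> X"
proof -
  have [measurable]: "f \<in> borel_measurable torus" using assms(1) by (rule measurable_restrict_space1)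
  have "integrable torus (\<lambda>z. \<bar>f z\<bar> powr p)"
    by (rule integrableI_nonneg) (use assms(3) in \<open>auto simp: le_less_trans\<close>)
  thus *: "f \<in> Lp_torus p" using assms by (simp add: Lp_torus_iff)
  show "Lp_int p f \<le> X" using Lp_torusD(5)[OF *] assms by (simp add: ennreal_le_iff)
qed

lemma powr_add_le:
  fixes p x y :: real
  assumes "p > 0"
  shows "\<bar>x + y\<bar> powr p \<le> 2 powr p * (\<bar>x\<bar> powr p + \<bar>y\<bar> powr p)"
proof -
  have "\<bar>x + y\<bar> powr p \<le> (2 * max \<bar>x\<bar> \<bar>y\<bar>) powr p"
    using assms by (intro powr_mono2) auto
  also have "\<dots> = 2 powr p * max \<bar>x\<bar> \<bar>y\<bar> powr p" by (simp add: powr_mult)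
  also have "max \<bar>x\<bar> \<bar>y\<bar> powr p \<le> \<bar>x\<bar> powr p + \<bar>y\<bar> powr p" by (simp add: max_def)
  finally show ?thesis by simp
qed

lemma Lp_torus_add:
  assumes "p > 0" "f \<in> Lp_torus p" "g \<in> Lp_torus p"
  shows "(\<lambda>z. f z + g z) \<in> Lp_torus p" "Lp_int p (\<lambda>z. f z + g z) \<le> 2 powr p * (Lp_int p f + Lp_int p g)"
proof -
  note [measurable] = Lp_torusD(1,4)[OF assms(2)] Lp_torusD(1,4)[OF assms(3)]
  have "(\<integral>\<^sup>+z. ennreal (\<bar>f z + g z\<bar> powr p) \<partial>torus) \<le>
     (\<integral>\<^sup>+z. ennreal (2 powr p) * (ennreal (\<bar>f z\<bar> powr p) + ennreal (\<bar>g z\<bar> powr p)) \<partial>torus)"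
    by (intro nn_integral_mono)
       (simp add: ennreal_mult[symmetric] ennreal_plus[symmetric] powr_add_le assms ennreal_leI del: ennreal_plus)
  also have "\<dots> = ennreal (2 powr p) * (ennreal (Lp_int p f) + ennreal (Lp_int p g))"
    by (simp add: nn_integral_cmult nn_integral_add Lp_torusD(5)[OF assms(2)] Lp_torusD(5)[OF assms(3)])
  also have "\<dots> = ennreal (2 powr p * (Lp_int p f + Lp_int p g))"
    by (simp add: ennreal_mult[symmetric] ennreal_plus[symmetric] del: ennreal_plus)
  finally have *: "(\<integral>\<^sup>+z. ennreal (\<bar>f z + g z\<bar> powr p) \<partial>torus) \<le> ennreal (2 powr p * (Lp_int p f + Lp_int p g))" .
  have "periodic2 (\<lambda>z. f z + g z)" using Lp_torusD(2)[OF assms(2)] Lp_torusD(2)[OF assms(3)] by (simp add: periodic2_def)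
  from Lp_torusI[OF _ this *]
  show "(\<lambda>z. f z + g z) \<in> Lp_torus p" "Lp_int p (\<lambda>z. f z + g z) \<le> 2 powr p * (Lp_int p f + Lp_int p g)" by simp_all
qed

lemma Lp_torus_minus:
  assumes "g \<in> Lp_torus p"
  shows "(\<lambda>z. - g z) \<in> Lp_torus p" "Lp_int p (\<lambda>z. - g z) = Lp_int p g"
  using assms by (auto simp: Lp_torus_iff Lp_int_def periodic2_def)

lemma Lp_torus_diff:
  assumes "p > 0" "f \<in> Lp_torus p" "g \<in> Lp_torus p"
  shows "(\<lambda>z. f z - g z) \<in> Lp_torus p" "Lp_int p (\<lambda>z. f z - g z) \<le> 2 powr p * (Lp_int p f + Lp_int p g)"
  using Lp_torus_add[OF assms(1,2) Lp_torus_minus(1)[OF assms(3)]] Lp_torus_minus(2)[OF assms(3)] by simp_all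

lemma Lp_torus_translate:
  assumes "f \<in> Lp_torus p"
  shows "(\<lambda>z. f (z + v)) \<in> Lp_torus p" "Lp_int p (\<lambda>z. f (z + v)) = Lp_int p f"
proof -
  note [measurable] = Lp_torusD(1,4)[OF assms]
  have eq: "(\<integral>\<^sup>+z. ennreal (\<bar>f (z + v)\<bar> powr p) \<partial>torus) = ennreal (Lp_int p f)"
    using nn_integral_torus_translate[of "\<lambda>z. ennreal (\<bar>f z\<bar> powr p)" v] Lp_torusD(2)[OF assms] Lp_torusD(5)[OF assms]
    by (simp add: periodic2_def)
  show *: "(\<lambda>z. f (z + v)) \<in> Lp_torus p"
    by (rule Lp_torusI(1)[where X = "Lp_int p f"]) (use eq periodic2_translate[OF Lp_torusD(2)[OF assms]] in auto)
  show "Lp_int p (\<lambda>z. f (z + v)) = Lp_int p f"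
    using Lp_torusD(5)[OF *] eq by simp
qed

section \<open>Fractional differences in Lp\<close>

text \<open>A direction vector as parameter lets each estimate be proved once for both
  variables.\<close>

definition fdiff :: "real \<times> real \<Rightarrow> real \<Rightarrow> real \<Rightarrow> (real \<times> real \<Rightarrow> real) \<Rightarrow> real \<times> real \<Rightarrow> real" where
  "fdiff e \<alpha> h f z = (\<Sum>v. diff_coeff \<alpha> v * f (z + ((\<alpha> - real v) * h) *\<^sub>R e))"

lemma frac_diff1_eq: "frac_diff1 \<alpha> h f = fdiff (1, 0) \<alpha> h f"
  by (auto simp: frac_diff1_def fdiff_def diff_coeff_def fun_eq_iff)

lemma frac_diff2_eq: "frac_diff2 \<alpha> h f = fdiff (0, 1) \<alpha> h f"
  by (auto simp: frac_diff2_def fdiff_def diff_coeff_def fun_eq_iff)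

lemma periodic2_fdiff: "periodic2 f \<Longrightarrow> periodic2 (fdiff e \<alpha> h f)"
  unfolding periodic2_def
proof (intro ballI allI)
  fix e' z assume *: "\<forall>e\<in>axes. \<forall>z. f (z + (2 * pi) *\<^sub>R e) = f z" "e' \<in> axes"
  have "f (z + (2 * pi) *\<^sub>R e' + t) = f (z + t)" for t
  proof -
    have "z + (2 * pi) *\<^sub>R e' + t = (z + t) + (2 * pi) *\<^sub>R e'" by (simp add: add_ac)
    thus ?thesis using * by metis
  qed
  thus "fdiff e \<alpha> h f (z + (2 * pi) *\<^sub>R e') = fdiff e \<alpha> h f z" by (simp only: fdiff_def)
qed

lemma borel_measurable_fdiff_lebesgue:
  assumes "f \<in> borel_measurable lebesgue"
  shows "fdiff e \<alpha> h f \<in> borel_measurable lebesgue"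
  unfolding fdiff_def[abs_def]
  by (intro borel_measurable_suminf borel_measurable_times borel_measurable_const borel_measurable_lebesgue_translate assms)

text \<open>Jensen's inequality for an infinite series, obtained from its partial sums. Finiteness
  of \<open>W z\<close>, the series of \<open>p\<close>-th powers, gives absolute convergence of the
  difference at \<open>z\<close>; where \<open>W z\<close> is infinite the estimate is trivial, as
  its factor is positive.\<close>

lemma fdiff_pointwise_bound:
  fixes g :: "real \<times> real \<Rightarrow> real" and e z :: "real \<times> real" and h \<alpha> p :: real
  assumes p: "p > 1" and \<alpha>: "\<alpha> > 0"
  defines "W \<equiv> \<lambda>z. (\<Sum>v. ennreal (\<bar>diff_coeff \<alpha> v\<bar> * \<bar>g (z + ((\<alpha> - real v) * h) *\<^sub>R e)\<bar> powr p))"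
  shows "W z < \<infinity> \<Longrightarrow> summable (\<lambda>v. \<bar>diff_coeff \<alpha> v * g (z + ((\<alpha> - real v) * h) *\<^sub>R e)\<bar>)"
    and "ennreal (\<bar>fdiff e \<alpha> h g z\<bar> powr p) \<le> ennreal (diff_coeff_sum \<alpha> powr (p - 1)) * W z"
proof -
  define y where "y v = \<bar>g (z + ((\<alpha> - real v) * h) *\<^sub>R e)\<bar>" for v
  define b where "b v = \<bar>diff_coeff \<alpha> v\<bar>" for v
  have y0: "y v \<ge> 0" and b0: "b v \<ge> 0" for v by (simp_all add: y_def b_def)
  have S: "diff_coeff_sum \<alpha> \<ge> 1" by (rule diff_coeff_sum_ge_1[OF \<alpha>])
  have sb: "summable b" unfolding b_def by (rule summable_diff_coeff[OF \<alpha>])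
  have W: "W z = (\<Sum>v. ennreal (b v * y v powr p))" by (simp add: W_def b_def y_def)
  have main: "summable (\<lambda>v. b v * y v) \<and> (\<Sum>v. b v * y v) powr p \<le> diff_coeff_sum \<alpha> powr (p - 1) * (\<Sum>v. b v * y v powr p)"
    if fin: "W z < \<infinity>"
  proof -
    have sr: "summable (\<lambda>v. b v * y v powr p)"
      using fin unfolding W by (intro summable_suminf_not_top) (auto simp: b0)
    define R where "R = (\<Sum>v. b v * y v powr p)"
    have R0: "R \<ge> 0" unfolding R_def using sr b0 by (intro suminf_nonneg) auto
    have part: "(\<Sum>v<n. b v * y v) powr p \<le> diff_coeff_sum \<alpha> powr (p - 1) * R" for n
    proof -
      have "(\<Sum>v<n. b v * y v) powr p \<le> diff_coeff_sum \<alpha> powr (p - 1) * (\<Sum>v<n. b v * y v powr p)"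
      proof (rule jensen_sum_powr[OF p])
        show "(\<Sum>v<n. b v) \<le> diff_coeff_sum \<alpha>"
          unfolding diff_coeff_sum_def b_def[symmetric] by (rule sum_le_suminf[OF sb]) (auto simp: b0)
      qed (use S y0 b0 in auto)
      also have "\<dots> \<le> diff_coeff_sum \<alpha> powr (p - 1) * R"
        unfolding R_def using sr b0 by (intro mult_left_mono sum_le_suminf) auto
      finally show ?thesis .
    qed
    have part': "(\<Sum>v<n. b v * y v) \<le> (diff_coeff_sum \<alpha> powr (p - 1) * R) powr (1 / p)" for n
    proof -
      have "((\<Sum>v<n. b v * y v) powr p) powr (1 / p) \<le> (diff_coeff_sum \<alpha> powr (p - 1) * R) powr (1 / p)"
        using part p by (intro powr_mono2) auto
      thus ?thesis using p by (simp add: powr_powr sum_nonneg b0 y0)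
    qed
    have s: "summable (\<lambda>v. b v * y v)"
      by (rule summableI_nonneg_bounded[OF _ part']) (simp add: b0 y0)
    have "(\<Sum>v. b v * y v) \<le> (diff_coeff_sum \<alpha> powr (p - 1) * R) powr (1 / p)"
      by (rule suminf_le_const[OF s part'])
    hence "(\<Sum>v. b v * y v) powr p \<le> ((diff_coeff_sum \<alpha> powr (p - 1) * R) powr (1 / p)) powr p"
      using p s b0 y0 by (intro powr_mono2 suminf_nonneg) auto
    also have "\<dots> = diff_coeff_sum \<alpha> powr (p - 1) * R" using p R0 by (simp add: powr_powr)
    finally show ?thesis using s by (simp add: R_def)
  qed
  have eq: "\<bar>diff_coeff \<alpha> v * g (z + ((\<alpha> - real v) * h) *\<^sub>R e)\<bar> = b v * y v" for v
    by (simp add: b_def y_def abs_mult)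
  show "summable (\<lambda>v. \<bar>diff_coeff \<alpha> v * g (z + ((\<alpha> - real v) * h) *\<^sub>R e)\<bar>)" if "W z < \<infinity>"
    unfolding eq using main[OF that] by simp
  show "ennreal (\<bar>fdiff e \<alpha> h g z\<bar> powr p) \<le> ennreal (diff_coeff_sum \<alpha> powr (p - 1)) * W z"
  proof (cases "W z < \<infinity>")
    case False
    hence "W z = \<infinity>" by (simp add: less_top[symmetric])
    thus ?thesis using S by (simp add: ennreal_mult_top)
  next
    case True
    note m = main[OF True]
    have "\<bar>fdiff e \<alpha> h g z\<bar> \<le> (\<Sum>v. \<bar>diff_coeff \<alpha> v * g (z + ((\<alpha> - real v) * h) *\<^sub>R e)\<bar>)"
      unfolding fdiff_def by (rule summable_rabs) (use m in \<open>simp add: eq\<close>)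
    hence "\<bar>fdiff e \<alpha> h g z\<bar> powr p \<le> (\<Sum>v. b v * y v) powr p"
      unfolding eq using p by (intro powr_mono2) auto
    also have "\<dots> \<le> diff_coeff_sum \<alpha> powr (p - 1) * (\<Sum>v. b v * y v powr p)" using m by simp
    finally have "ennreal (\<bar>fdiff e \<alpha> h g z\<bar> powr p) \<le> ennreal (diff_coeff_sum \<alpha> powr (p - 1) * (\<Sum>v. b v * y v powr p))"
      by (rule ennreal_leI)
    also have "\<dots> = ennreal (diff_coeff_sum \<alpha> powr (p - 1)) * ennreal (\<Sum>v. b v * y v powr p)"
      by (intro ennreal_mult suminf_nonneg)
         (use True b0 in \<open>auto simp: W intro!: summable_suminf_not_top\<close>)
    also have "ennreal (\<Sum>v. b v * y v powr p) = W z"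
      unfolding W by (rule suminf_ennreal[symmetric])
         (use True b0 in \<open>auto simp: W\<close>)
    finally show ?thesis .
  qed
qed

text \<open>By translation invariance all samples of \<open>g\<close> have the same integral, so the
  result depends neither on the step nor on the direction.\<close>

lemma fdiff_weighted_integral:
  assumes "\<alpha> > 0" "g \<in> Lp_torus p"
  shows "(\<integral>\<^sup>+z. (\<Sum>v. ennreal (\<bar>diff_coeff \<alpha> v\<bar> * \<bar>g (z + ((\<alpha> - real v) * h) *\<^sub>R e)\<bar> powr p)) \<partial>torus) = ennreal (diff_coeff_sum \<alpha> * Lp_int p g)"
proof -
  note [measurable] = Lp_torusD(1,4)[OF assms(2)]
  have m [measurable]: "(\<lambda>z. g (z + v)) \<in> borel_measurable torus" for v
    by (rule measurable_restrict_space1) measurable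
  have "(\<integral>\<^sup>+z. (\<Sum>v. ennreal (\<bar>diff_coeff \<alpha> v\<bar> * \<bar>g (z + ((\<alpha> - real v) * h) *\<^sub>R e)\<bar> powr p)) \<partial>torus) =
      (\<Sum>v. (\<integral>\<^sup>+z. ennreal (\<bar>diff_coeff \<alpha> v\<bar> * \<bar>g (z + ((\<alpha> - real v) * h) *\<^sub>R e)\<bar> powr p) \<partial>torus))"
    by (rule nn_integral_suminf) measurable
  also have "\<dots> = (\<Sum>v. ennreal (\<bar>diff_coeff \<alpha> v\<bar> * Lp_int p g))"
  proof (intro suminf_cong)
    fix v
    have "(\<integral>\<^sup>+z. ennreal (\<bar>diff_coeff \<alpha> v\<bar> * \<bar>g (z + ((\<alpha> - real v) * h) *\<^sub>R e)\<bar> powr p) \<partial>torus) =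
      ennreal \<bar>diff_coeff \<alpha> v\<bar> * (\<integral>\<^sup>+z. ennreal (\<bar>g (z + ((\<alpha> - real v) * h) *\<^sub>R e)\<bar> powr p) \<partial>torus)"
      by (simp add: ennreal_mult nn_integral_cmult)
    also have "(\<integral>\<^sup>+z. ennreal (\<bar>g (z + ((\<alpha> - real v) * h) *\<^sub>R e)\<bar> powr p) \<partial>torus) = ennreal (Lp_int p g)"
      using Lp_torusD(5)[OF Lp_torus_translate(1)[OF assms(2)]] Lp_torus_translate(2)[OF assms(2)] by simp
    finally show "(\<integral>\<^sup>+z. ennreal (\<bar>diff_coeff \<alpha> v\<bar> * \<bar>g (z + ((\<alpha> - real v) * h) *\<^sub>R e)\<bar> powr p) \<partial>torus) = ennreal (\<bar>diff_coeff \<alpha> v\<bar> * Lp_int p g)"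
      by (simp add: ennreal_mult)
  qed
  also have "\<dots> = ennreal (\<Sum>v. \<bar>diff_coeff \<alpha> v\<bar> * Lp_int p g)"
    using summable_mult2[OF summable_diff_coeff[OF assms(1)], of "Lp_int p g"] by (intro suminf_ennreal2) auto
  also have "(\<Sum>v. \<bar>diff_coeff \<alpha> v\<bar> * Lp_int p g) = diff_coeff_sum \<alpha> * Lp_int p g"
    unfolding diff_coeff_sum_def by (rule suminf_mult2[symmetric]) (rule summable_diff_coeff[OF assms(1)])
  finally show ?thesis .
qed

lemma fdiff_Lp_torus:
  assumes p: "p > 1" and \<alpha>: "\<alpha> > 0" and g: "g \<in> Lp_torus p"
  shows "fdiff e \<alpha> h g \<in> Lp_torus p" "Lp_int p (fdiff e \<alpha> h g) \<le> diff_coeff_sum \<alpha> powr p * Lp_int p g"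
proof -
  note [measurable] = Lp_torusD(1,4)[OF g]
  have S: "diff_coeff_sum \<alpha> \<ge> 1" by (rule diff_coeff_sum_ge_1[OF \<alpha>])
  have m [measurable]: "(\<lambda>z. g (z + v)) \<in> borel_measurable torus" for v
    by (rule measurable_restrict_space1) measurable
  have "(\<integral>\<^sup>+z. ennreal (\<bar>fdiff e \<alpha> h g z\<bar> powr p) \<partial>torus) \<le>
     (\<integral>\<^sup>+z. ennreal (diff_coeff_sum \<alpha> powr (p - 1)) * (\<Sum>v. ennreal (\<bar>diff_coeff \<alpha> v\<bar> * \<bar>g (z + ((\<alpha> - real v) * h) *\<^sub>R e)\<bar> powr p)) \<partial>torus)"
    by (intro nn_integral_mono fdiff_pointwise_bound(2)[OF p \<alpha>])
  also have "\<dots> = ennreal (diff_coeff_sum \<alpha> powr (p - 1)) * ennreal (diff_coeff_sum \<alpha> * Lp_int p g)"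
    by (subst nn_integral_cmult) (auto simp: fdiff_weighted_integral[OF \<alpha> g])
  also have "\<dots> = ennreal (diff_coeff_sum \<alpha> powr (p - 1) * (diff_coeff_sum \<alpha> * Lp_int p g))"
    using S by (simp add: ennreal_mult)
  also have "diff_coeff_sum \<alpha> powr (p - 1) * (diff_coeff_sum \<alpha> * Lp_int p g) = diff_coeff_sum \<alpha> powr p * Lp_int p g"
  proof -
    have "diff_coeff_sum \<alpha> powr (p - 1) * diff_coeff_sum \<alpha> = diff_coeff_sum \<alpha> powr p"
      using powr_mult_base[of "diff_coeff_sum \<alpha>" "p - 1"] S by (simp add: mult.commute)
    thus ?thesis by (simp add: mult.assoc[symmetric])
  qed
  finally have *: "(\<integral>\<^sup>+z. ennreal (\<bar>fdiff e \<alpha> h g z\<bar> powr p) \<partial>torus) \<le> ennreal (diff_coeff_sum \<alpha> powr p * Lp_int p g)" .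
  from Lp_torusI[OF borel_measurable_fdiff_lebesgue[OF Lp_torusD(1)[OF g]] periodic2_fdiff[OF Lp_torusD(2)[OF g]] *]
  show "fdiff e \<alpha> h g \<in> Lp_torus p" "Lp_int p (fdiff e \<alpha> h g) \<le> diff_coeff_sum \<alpha> powr p * Lp_int p g" by simp_all
qed

text \<open>Since \<open>fdiff\<close> is a pointwise \<open>suminf\<close>, its linearity is
  available only where the series converge. This is established almost everywhere on the whole plane
  and not just in the square, because an outer difference samples an inner one at arbitrary
  translates.\<close>

lemma fdiff_AE_summable:
  assumes p: "p > 1" and \<alpha>: "\<alpha> > 0" and g: "g \<in> Lp_torus p"
  shows "AE z in lebesgue. summable (\<lambda>v. diff_coeff \<alpha> v * g (z + ((\<alpha> - real v) * h) *\<^sub>R e))"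
proof -
  note [measurable] = Lp_torusD(1,4)[OF g]
  have m [measurable]: "(\<lambda>z. g (z + v)) \<in> borel_measurable torus" for v
    by (rule measurable_restrict_space1) measurable
  define W where "W z = (\<Sum>v. ennreal (\<bar>diff_coeff \<alpha> v\<bar> * \<bar>g (z + ((\<alpha> - real v) * h) *\<^sub>R e)\<bar> powr p))" for z
  have [measurable]: "W \<in> borel_measurable torus" unfolding W_def by measurable
  have "(\<integral>\<^sup>+z. W z \<partial>torus) \<noteq> \<infinity>"
    unfolding W_def fdiff_weighted_integral[OF \<alpha> g] by simp
  hence "AE z in torus. W z \<noteq> \<infinity>" by (intro nn_integral_PInf_AE) auto
  moreover have "periodic2 W"
  proof -
    have gp: "periodic2 (\<lambda>z. g (z + v))" for v by (rule periodic2_translate) (rule Lp_torusD(2)[OF g])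
    show ?thesis
      unfolding periodic2_def
    proof (intro ballI allI)
      fix e' :: "real \<times> real" and z assume "e' \<in> axes"
      hence "g (z + (2 * pi) *\<^sub>R e' + v) = g (z + v)" for v
        using periodic2D[OF gp[of v], of e' z] by simp
      thus "W (z + (2 * pi) *\<^sub>R e') = W z" by (simp only: W_def)
    qed
  qed
  ultimately have "AE z in lebesgue. W z \<noteq> \<infinity>"
    using periodic2_comp[of W "\<lambda>w. w \<noteq> \<infinity>"] by (intro AE_torus_periodic)
  thus ?thesis
  proof eventually_elim
    fix z assume "W z \<noteq> \<infinity>"
    hence "summable (\<lambda>v. \<bar>diff_coeff \<alpha> v * g (z + ((\<alpha> - real v) * h) *\<^sub>R e)\<bar>)"
      by (intro fdiff_pointwise_bound(1)[OF p \<alpha>]) (simp add: W_def less_top)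
    thus "summable (\<lambda>v. diff_coeff \<alpha> v * g (z + ((\<alpha> - real v) * h) *\<^sub>R e))" by (rule summable_rabs_cancel)
  qed
qed

lemma fdiff_add_AE:
  assumes "p > 1" "\<alpha> > 0" "f \<in> Lp_torus p" "g \<in> Lp_torus p"
  shows "AE z in lebesgue. fdiff e \<alpha> h (\<lambda>z. f z + g z) z = fdiff e \<alpha> h f z + fdiff e \<alpha> h g z"
  using fdiff_AE_summable[OF assms(1,2,3), of h e] fdiff_AE_summable[OF assms(1,2,4), of h e]
proof eventually_elim
  fix z assume "summable (\<lambda>v. diff_coeff \<alpha> v * f (z + ((\<alpha> - real v) * h) *\<^sub>R e))" "summable (\<lambda>v. diff_coeff \<alpha> v * g (z + ((\<alpha> - real v) * h) *\<^sub>R e))"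
  from suminf_add[OF this] show "fdiff e \<alpha> h (\<lambda>z. f z + g z) z = fdiff e \<alpha> h f z + fdiff e \<alpha> h g z"
    by (simp add: fdiff_def distrib_left)
qed

lemma fdiff_cong_AE:
  assumes "AE z in lebesgue. f z = g z"
  shows "AE z in lebesgue. fdiff e \<alpha> h f z = fdiff e \<alpha> h g z"
proof -
  have "AE z in lebesgue. \<forall>v. f (z + ((\<alpha> - real v) * h) *\<^sub>R e) = g (z + ((\<alpha> - real v) * h) *\<^sub>R e)"
    unfolding AE_all_countable by (intro allI AE_lebesgue_translate[OF assms])
  thus ?thesis by eventually_elim (simp add: fdiff_def)
qed

lemma Lp_int_cong_AE:
  assumes "AE z in lebesgue. f z = g z" "f \<in> borel_measurable lebesgue" "g \<in> borel_measurable lebesgue"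
  shows "Lp_int p f = Lp_int p g"
proof -
  have [measurable]: "f \<in> borel_measurable torus" "g \<in> borel_measurable torus"
    using assms(2,3) by (auto intro: measurable_restrict_space1)
  have "AE z in torus. f z = g z" using assms(1) by (subst AE_restrict_space_iff) auto
  thus ?thesis unfolding Lp_int_def by (intro integral_cong_AE) auto
qed

text \<open>The summands are treated differently on purpose: \<open>f\<close> keeps its difference,
  while \<open>g\<close> will be an approximation error of which only the norm is known to be
  small.\<close>

lemma Lp_int_frac_diff_add:
  assumes p: "p > 1" and \<alpha>: "\<alpha>1 > 0" "\<alpha>2 > 0" and f: "f \<in> Lp_torus p" and g: "g \<in> Lp_torus p"
  shows "Lp_int p (frac_diff1 \<alpha>1 h1 (frac_diff2 \<alpha>2 h2 (\<lambda>z. f z + g z))) \<le>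
     2 powr p * (Lp_int p (frac_diff1 \<alpha>1 h1 (frac_diff2 \<alpha>2 h2 f)) + diff_coeff_sum \<alpha>1 powr p * diff_coeff_sum \<alpha>2 powr p * Lp_int p g)"
proof -
  let ?D1 = "fdiff (1, 0) \<alpha>1 h1" and ?D2 = "fdiff (0, 1) \<alpha>2 h2"
  have p0: "p > 0" using p by simp
  note L1 = fdiff_Lp_torus[OF p \<alpha>(1)] and L2 = fdiff_Lp_torus[OF p \<alpha>(2)]
  note fg = Lp_torus_add(1)[OF p0 f g]
  have 1: "AE z in lebesgue. ?D2 (\<lambda>z. f z + g z) z = ?D2 f z + ?D2 g z"
    by (rule fdiff_add_AE[OF p \<alpha>(2) f g])
  have "AE z in lebesgue. ?D1 (?D2 (\<lambda>z. f z + g z)) z = ?D1 (?D2 f) z + ?D1 (?D2 g) z"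
    using fdiff_cong_AE[OF 1, of "(1,0)" \<alpha>1 h1] fdiff_add_AE[OF p \<alpha>(1) L2(1)[OF f] L2(1)[OF g], of "(1,0)" h1 "(0,1)" h2 "(0,1)" h2]
    by eventually_elim simp
  hence "Lp_int p (?D1 (?D2 (\<lambda>z. f z + g z))) = Lp_int p (\<lambda>z. ?D1 (?D2 f) z + ?D1 (?D2 g) z)"
    by (intro Lp_int_cong_AE Lp_torusD(1)[OF L1(1)[OF L2(1)[OF fg]]]
        Lp_torusD(1)[OF Lp_torus_add(1)[OF p0 L1(1)[OF L2(1)[OF f]] L1(1)[OF L2(1)[OF g]]]])
  also have "\<dots> \<le> 2 powr p * (Lp_int p (?D1 (?D2 f)) + Lp_int p (?D1 (?D2 g)))"
    by (rule Lp_torus_add(2)[OF p0 L1(1)[OF L2(1)[OF f]] L1(1)[OF L2(1)[OF g]]])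
  also have "Lp_int p (?D1 (?D2 g)) \<le> diff_coeff_sum \<alpha>1 powr p * (diff_coeff_sum \<alpha>2 powr p * Lp_int p g)"
    by (rule order_trans[OF L1(2)[OF L2(1)[OF g]] mult_left_mono[OF L2(2)[OF g]]]) simp
  finally show ?thesis by (simp add: frac_diff1_eq frac_diff2_eq mult.assoc)
qed

lemma Lp_torus_bounded:
  fixes g :: "real \<times> real \<Rightarrow> real"
  assumes "p > 0" "g \<in> borel_measurable borel" "periodic2 g" "\<And>z. \<bar>g z\<bar> \<le> B"
  shows "g \<in> Lp_torus p"
proof -
  have "(\<integral>\<^sup>+z. ennreal (\<bar>g z\<bar> powr p) \<partial>torus) \<le> (\<integral>\<^sup>+z. ennreal (B powr p) \<partial>torus)"
    using assms(1,4) by (intro nn_integral_mono ennreal_leI powr_mono2) auto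
  also have "\<dots> = ennreal (B powr p) * emeasure torus (space torus)" by simp
  also have "\<dots> = ennreal (B powr p * measure torus (space torus))"
    by (simp add: torus.emeasure_eq_measure ennreal_mult)
  finally show ?thesis
    by (intro Lp_torusI(1)[where X = "B powr p * measure torus (space torus)"] assms measurable_completion) (auto simp: assms)
qed

section \<open>Finite sums of products of functions of one variable\<close>

definition periodic1 :: "(real \<Rightarrow> real) \<Rightarrow> bool" where "periodic1 u \<longleftrightarrow> (\<forall>x. u (x + 2 * pi) = u x)"

lemma periodic2_tensor_sum:
  assumes "\<And>i. i \<in> A \<Longrightarrow> periodic1 (u i)" "\<And>i. i \<in> A \<Longrightarrow> periodic1 (w i)"
  shows "periodic2 (\<lambda>z. \<Sum>i\<in>A. c i * (u i (fst z) * w i (snd z)))"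
  using assms by (auto simp: periodic2_def periodic1_def axes_def intro!: sum.cong)

text \<open>Boundedness of the factor that is differenced makes its series converge at every point,
  so for these sums the identities hold everywhere and not merely almost everywhere.\<close>

lemma fdiff_tensor_sum:
  assumes \<alpha>: "\<alpha> > 0" and A: "finite A"
  shows "(\<And>i. i \<in> A \<Longrightarrow> (\<And>x. \<bar>u i x\<bar> \<le> B i)) \<Longrightarrow>
      fdiff (1, 0) \<alpha> h (\<lambda>z. \<Sum>i\<in>A. c i * (u i (fst z) * w i (snd z))) = (\<lambda>z. \<Sum>i\<in>A. c i * (fdiff1 \<alpha> h (u i) (fst z) * w i (snd z)))"
    and "(\<And>i. i \<in> A \<Longrightarrow> (\<And>x. \<bar>w i x\<bar> \<le> B i)) \<Longrightarrow>
      fdiff (0, 1) \<alpha> h (\<lambda>z. \<Sum>i\<in>A. c i * (u i (fst z) * w i (snd z))) = (\<lambda>z. \<Sum>i\<in>A. c i * (u i (fst z) * fdiff1 \<alpha> h (w i) (snd z)))"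
proof -
  assume *: "\<And>i. i \<in> A \<Longrightarrow> (\<And>x. \<bar>u i x\<bar> \<le> B i)"
  show "fdiff (1, 0) \<alpha> h (\<lambda>z. \<Sum>i\<in>A. c i * (u i (fst z) * w i (snd z))) = (\<lambda>z. \<Sum>i\<in>A. c i * (fdiff1 \<alpha> h (u i) (fst z) * w i (snd z)))"
  proof
    fix z
    show "fdiff (1, 0) \<alpha> h (\<lambda>z. \<Sum>i\<in>A. c i * (u i (fst z) * w i (snd z))) z = (\<Sum>i\<in>A. c i * (fdiff1 \<alpha> h (u i) (fst z) * w i (snd z)))"
      using fdiff1_sum[OF \<alpha> A *, where h = h and c = "\<lambda>i. c i * w i (snd z)" and x = "fst z"]
      by (simp add: fdiff_def fdiff1_def mult_ac)
  qed
next
  assume *: "\<And>i. i \<in> A \<Longrightarrow> (\<And>x. \<bar>w i x\<bar> \<le> B i)"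
  show "fdiff (0, 1) \<alpha> h (\<lambda>z. \<Sum>i\<in>A. c i * (u i (fst z) * w i (snd z))) = (\<lambda>z. \<Sum>i\<in>A. c i * (u i (fst z) * fdiff1 \<alpha> h (w i) (snd z)))"
  proof
    fix z
    show "fdiff (0, 1) \<alpha> h (\<lambda>z. \<Sum>i\<in>A. c i * (u i (fst z) * w i (snd z))) z = (\<Sum>i\<in>A. c i * (u i (fst z) * fdiff1 \<alpha> h (w i) (snd z)))"
      using fdiff1_sum[OF \<alpha> A *, where h = h and c = "\<lambda>i. c i * u i (fst z)" and x = "snd z"]
      by (simp add: fdiff_def fdiff1_def mult_ac)
  qed
qed

lemma borel_measurable_fdiff1 [measurable]:
  assumes [measurable]: "u \<in> borel_measurable borel"
  shows "fdiff1 \<alpha> h u \<in> borel_measurable borel"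
  unfolding fdiff1_def[abs_def] by measurable

lemma periodic1_fdiff1: "periodic1 u \<Longrightarrow> periodic1 (fdiff1 \<alpha> h u)"
  unfolding periodic1_def
proof
  fix x assume *: "\<forall>x. u (x + 2 * pi) = u x"
  have "u (x + 2 * pi + t) = u (x + t)" for t using *[rule_format, of "x + t"] by (simp add: add_ac)
  thus "fdiff1 \<alpha> h u (x + 2 * pi) = fdiff1 \<alpha> h u x" by (simp add: fdiff1_def)
qed

lemma fdiff1_bound:
  assumes "\<alpha> > 0" "\<And>x. \<bar>u x\<bar> \<le> B"
  shows "\<bar>fdiff1 \<alpha> h u x\<bar> \<le> diff_coeff_sum \<alpha> * B"
proof -
  have 1: "\<bar>diff_coeff \<alpha> v * u y\<bar> \<le> \<bar>diff_coeff \<alpha> v\<bar> * B" for v y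
    unfolding abs_mult by (intro mult_left_mono assms) auto
  have s2: "summable (\<lambda>v. \<bar>diff_coeff \<alpha> v\<bar> * B)" by (intro summable_mult2 summable_diff_coeff assms)
  have s1: "summable (\<lambda>v. \<bar>diff_coeff \<alpha> v * u (x + (\<alpha> - real v) * h)\<bar>)"
    by (rule summable_comparison_test'[OF s2, of 0]) (simp add: 1)
  have "\<bar>fdiff1 \<alpha> h u x\<bar> \<le> (\<Sum>v. \<bar>diff_coeff \<alpha> v * u (x + (\<alpha> - real v) * h)\<bar>)"
    unfolding fdiff1_def by (rule summable_rabs[OF s1])
  also have "\<dots> \<le> (\<Sum>v. \<bar>diff_coeff \<alpha> v\<bar> * B)" by (rule suminf_le[OF 1 s1 s2])
  also have "\<dots> = diff_coeff_sum \<alpha> * B" unfolding diff_coeff_sum_def by (rule suminf_mult2[symmetric, OF summable_diff_coeff[OF assms(1)]])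
  finally show ?thesis .
qed

section \<open>Upper bounds by weighted coefficients\<close>

text \<open>\<open>psi n k powr \<alpha>\<close> is the size of the multiplier of a difference of order \<open>\<alpha>\<close> and step \<open>1 / n\<close> at
  frequency \<open>k\<close>; \<open>coeff_sum\<close> is the Hardy-Littlewood norm of the coefficients weighted by it. Both sides of
  the theorem are compared with \<open>coeff_sum\<close>. Since \<open>n = 0\<close> gives \<open>psi n k = 0\<close>, the index is shifted where
  polynomials of degree \<open>m\<close> are removed.\<close>

definition psi :: "nat \<Rightarrow> nat \<Rightarrow> real" where "psi n k = min 1 (real k / real n)"
text \<open>A majorant of Dirichlet kernels in the form of a partial sum over \<open>k <= i\<close>;
  this form lets an exchange of summations turn the coefficients of the kernels into tail
  sums.\<close>

definition kern_sum :: "nat \<Rightarrow> real \<Rightarrow> nat \<Rightarrow> real \<Rightarrow> real" where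
  "kern_sum n a i x = (\<Sum>k=1..i. psi n k powr a * kern k x)"
text \<open>For positive \<open>k\<close> and \<open>l\<close> this is the coefficient of
  \<open>cos (k * x) * cos (l * y)\<close> in
  \<open>tensor_sum d N (cos_sum 0) (cos_sum 0)\<close>.\<close>

definition tail_sum :: "(nat \<Rightarrow> nat \<Rightarrow> real) \<Rightarrow> nat \<Rightarrow> nat \<Rightarrow> nat \<Rightarrow> real" where
  "tail_sum d N k l = (\<Sum>i=k..N. \<Sum>j=l..N. d i j)"
definition coeff_sum :: "real \<Rightarrow> (nat \<Rightarrow> nat \<Rightarrow> real) \<Rightarrow> nat \<Rightarrow> nat \<Rightarrow> nat \<Rightarrow> real \<Rightarrow> real \<Rightarrow> real" where
  "coeff_sum p A N n1 n2 a1 a2 = (\<Sum>k=1..N. \<Sum>l=1..N. A k l powr p * (real k * real l) powr (p - 2) *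
     (psi n1 k powr (a1 * p) * psi n2 l powr (a2 * p)))"
definition tensor_sum :: "(nat \<Rightarrow> nat \<Rightarrow> real) \<Rightarrow> nat \<Rightarrow> (nat \<Rightarrow> real \<Rightarrow> real) \<Rightarrow> (nat \<Rightarrow> real \<Rightarrow> real) \<Rightarrow> real \<times> real \<Rightarrow> real" where
  "tensor_sum d N u w = (\<lambda>z. \<Sum>t\<in>{1..N} \<times> {1..N}. d (fst t) (snd t) * (u (fst t) (fst z) * w (snd t) (snd z)))"
text \<open>The bound may depend on the index, because only finite sums are formed from a
  family.\<close>

definition nice_family :: "(nat \<Rightarrow> real \<Rightarrow> real) \<Rightarrow> bool" where
  "nice_family u \<longleftrightarrow> (\<forall>i. u i \<in> borel_measurable borel \<and> periodic1 (u i)) \<and> (\<exists>B. \<forall>i x. \<bar>u i x\<bar> \<le> B i)"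

lemma psi_nonneg [simp]: "psi n k \<ge> 0" and psi_le_1 [simp]: "psi n k \<le> 1"
  by (auto simp: psi_def)

lemma tensor_sum_double: "tensor_sum d N u w z = (\<Sum>i=1..N. \<Sum>j=1..N. d i j * (u i (fst z) * w j (snd z)))"
  by (simp add: tensor_sum_def sum.cartesian_product case_prod_unfold)

lemma tensor_sum_add1: "tensor_sum d N (\<lambda>i x. u i x + u' i x) w z = tensor_sum d N u w z + tensor_sum d N u' w z"
  by (simp add: tensor_sum_def algebra_simps sum.distrib)

lemma tensor_sum_add2: "tensor_sum d N u (\<lambda>i x. w i x + w' i x) z = tensor_sum d N u w z + tensor_sum d N u w' z"
  by (simp add: tensor_sum_def algebra_simps sum.distrib)

lemma tensor_sum_fd1: assumes "\<alpha> > 0" "nice_family u" shows "fdiff (1, 0) \<alpha> h (tensor_sum d N u w) = tensor_sum d N (\<lambda>i. fdiff1 \<alpha> h (u i)) w"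
proof -
  obtain B where B: "\<bar>u i x\<bar> \<le> B i" for i x using assms(2) unfolding nice_family_def by blast
  show ?thesis unfolding tensor_sum_def
    by (rule fdiff_tensor_sum(1)[OF assms(1), where B = "\<lambda>t. B (fst t)"]) (auto simp: B)
qed

lemma tensor_sum_fd2: assumes "\<alpha> > 0" "nice_family w" shows "fdiff (0, 1) \<alpha> h (tensor_sum d N u w) = tensor_sum d N u (\<lambda>i. fdiff1 \<alpha> h (w i))"
proof -
  obtain B where B: "\<bar>w i x\<bar> \<le> B i" for i x using assms(2) unfolding nice_family_def by blast
  show ?thesis unfolding tensor_sum_def
    by (rule fdiff_tensor_sum(2)[OF assms(1), where B = "\<lambda>t. B (snd t)"]) (auto simp: B)
qed

lemma borel_measurable_tensor_sum:
  assumes "nice_family u" "nice_family w"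
  shows "tensor_sum d N u w \<in> borel_measurable borel"
proof -
  have [measurable]: "u i \<in> borel_measurable borel" "w i \<in> borel_measurable borel" for i
    using assms by (auto simp: nice_family_def)
  show ?thesis unfolding tensor_sum_def by measurable
qed

lemma tensor_sum_Lp:
  assumes "p > 0" "nice_family u" "nice_family w"
  shows "tensor_sum d N u w \<in> Lp_torus p"
proof -
  obtain B where B: "\<bar>u i x\<bar> \<le> B i" for i x using assms(2) unfolding nice_family_def by blast
  obtain B' where B': "\<bar>w i x\<bar> \<le> B' i" for i x using assms(3) unfolding nice_family_def by blast
  have B0: "B i \<ge> 0" for i using B[of i 0] by linarith
  show ?thesis
  proof (rule Lp_torus_bounded[OF assms(1) borel_measurable_tensor_sum[OF assms(2,3)]])
    show "periodic2 (tensor_sum d N u w)" unfolding tensor_sum_def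
      by (rule periodic2_tensor_sum) (use assms in \<open>auto simp: nice_family_def\<close>)
    show "\<bar>tensor_sum d N u w z\<bar> \<le> (\<Sum>t\<in>{1..N} \<times> {1..N}. \<bar>d (fst t) (snd t)\<bar> * (B (fst t) * B' (snd t)))" for z
      unfolding tensor_sum_def
      by (intro order_trans[OF sum_abs] sum_mono) (auto simp: abs_mult B B' B0 intro!: mult_left_mono mult_mono)
  qed
qed

lemma periodic1_cos_sum: "periodic1 (cos_sum m i)"
  unfolding periodic1_def cos_sum_def
proof (intro allI sum.cong refl)
  fix x k
  have "cos (real k * (x + 2 * pi)) = cos (real k * x + 2 * pi * real k)" by (simp add: algebra_simps)
  also have "\<dots> = cos (real k * x)" by (simp add: cos_add cos_integer_2pi sin_integer_2pi)
  finally show "cos (real k * (x + 2 * pi)) = cos (real k * x)" .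
qed

lemma borel_measurable_cos_sum [measurable]: "cos_sum m i \<in> borel_measurable borel"
  unfolding cos_sum_def[abs_def] by measurable

lemma nice_family_cos_sum: "nice_family (\<lambda>i. cos_sum (m i) (r i))"
proof -
  have "\<bar>cos_sum (m i) (r i) x\<bar> \<le> 2 * real (r i)" for i x
    using cos_sum_bound[of "m i" "r i" x] mult_left_le[of "kern (r i) x" "real (r i)"] by auto
  thus ?thesis unfolding nice_family_def using periodic1_cos_sum by (intro conjI exI[of _ "\<lambda>i. 2 * real (r i)"]) auto
qed

lemma nice_family_fdiff1: assumes "\<alpha> > 0" "nice_family u" shows "nice_family (\<lambda>i. fdiff1 \<alpha> h (u i))"
proof -
  obtain B where B: "\<bar>u i x\<bar> \<le> B i" for i x using assms(2) unfolding nice_family_def by blast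
  show ?thesis unfolding nice_family_def
    using assms(2) fdiff1_bound[OF assms(1) B]
    by (intro conjI exI[of _ "\<lambda>i. diff_coeff_sum \<alpha> * B i"] allI periodic1_fdiff1 borel_measurable_fdiff1) (auto simp: nice_family_def)
qed

lemma kern_sum_nonneg [simp]: "kern_sum n a i x \<ge> 0" unfolding kern_sum_def by (intro sum_nonneg) auto

lemma kern_sum_mono: "i \<le> j \<Longrightarrow> kern_sum n a i x \<le> kern_sum n a j x"
  unfolding kern_sum_def by (intro sum_mono2) auto

lemma kern_antimono: assumes "k \<le> i" shows "kern i x \<le> kern k x"
proof -
  have "1 + real k * rho x \<le> 1 + real i * rho x" using assms by (simp add: mult_right_mono)
  thus ?thesis unfolding kern_def by (intro divide_left_mono mult_pos_pos) (auto simp: add_pos_nonneg)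
qed

text \<open>The indices \<open>k\<close> between \<open>i / 2\<close> and \<open>i\<close> are at
  least \<open>i / 2\<close> in number; on them \<open>psi n k\<close> is at least half of
  \<open>psi n i\<close>, and \<open>kern k x\<close> is at least \<open>kern i x\<close>. The
  factor \<open>2 powr (a + 1)\<close> collects these losses.\<close>

lemma kern_sum_lower:
  assumes a: "a > 0"
  shows "psi n i powr a * (real i * kern i x) \<le> 2 powr (a + 1) * kern_sum n a i x"
proof (cases "i = 0")
  case False
  define m where "m = i - i div 2"
  have m: "real i / 2 \<le> real m" "m \<ge> 1" "m \<le> i" "real (i + 1 - m) \<ge> real i / 2"
    using False unfolding m_def by linarith+
  have "(\<Sum>k=m..i. (psi n i / 2) powr a * kern i x) \<le> (\<Sum>k=m..i. psi n k powr a * kern k x)"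
  proof (intro sum_mono mult_mono powr_mono2 kern_antimono)
    fix k assume "k \<in> {m..i}"
    hence k: "real i / 2 \<le> real k" using m by auto
    hence "real i / real n / 2 \<le> real k / real n" using divide_right_mono[OF k, of "real n"] by simp
    moreover have "min 1 u / 2 \<le> min 1 v" if "u / 2 \<le> v" for u v :: real using that by auto
    ultimately show "psi n i / 2 \<le> psi n k" unfolding psi_def by blast
  qed (use a in auto)
  also have "\<dots> \<le> kern_sum n a i x" unfolding kern_sum_def using m by (intro sum_mono2) auto
  also have "(\<Sum>k=m..i. (psi n i / 2) powr a * kern i x) = real (i + 1 - m) * ((psi n i / 2) powr a * kern i x)"
    using m by simp
  finally have 1: "real (i + 1 - m) * ((psi n i / 2) powr a * kern i x) \<le> kern_sum n a i x" .
  have "real i / 2 * ((psi n i / 2) powr a * kern i x) \<le> real (i + 1 - m) * ((psi n i / 2) powr a * kern i x)"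
    using m by (intro mult_right_mono) auto
  with 1 have "real i / 2 * ((psi n i / 2) powr a * kern i x) \<le> kern_sum n a i x" by linarith
  hence "2 powr (a + 1) * (real i / 2 * ((psi n i / 2) powr a * kern i x)) \<le> 2 powr (a + 1) * kern_sum n a i x"
    by (intro mult_left_mono) auto
  moreover have "2 powr (a + 1) * (real i / 2 * ((psi n i / 2) powr a * kern i x)) = psi n i powr a * (real i * kern i x)"
    by (simp add: powr_add powr_divide)
  ultimately show ?thesis by (simp only:)
qed simp

lemma cos_sum_kern_sum:
  assumes "a > 0" "n \<ge> 1" "n \<le> i"
  shows "\<bar>cos_sum m i x\<bar> \<le> 2 * 2 powr (a + 1) * kern_sum n a i x"
proof -
  have "psi n i = 1" using assms by (simp add: psi_def)
  thus ?thesis using kern_sum_lower[OF assms(1), of n i x] cos_sum_bound[of m i x] by simp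
qed

lemma sum_partial_sums:
  fixes c f :: "nat \<Rightarrow> real"
  shows "(\<Sum>i=1..N. c i * (\<Sum>k=1..i. f k)) = (\<Sum>k=1..N. (\<Sum>i=k..N. c i) * f k)"
proof (induction N)
  case (Suc N)
  have "(\<Sum>k=1..Suc N. (\<Sum>i=k..Suc N. c i) * f k) = (\<Sum>k=1..N. (\<Sum>i=k..Suc N. c i) * f k) + c (Suc N) * f (Suc N)"
    by simp
  also have "(\<Sum>k=1..N. (\<Sum>i=k..Suc N. c i) * f k) = (\<Sum>k=1..N. (\<Sum>i=k..N. c i) * f k) + c (Suc N) * (\<Sum>k=1..N. f k)"
    by (simp add: sum.distrib[symmetric] sum_distrib_left algebra_simps)
  finally show ?case using Suc by (simp add: algebra_simps)
qed simp

text \<open>Exchanging \<open>i\<close> with \<open>k\<close> and \<open>j\<close> with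
  \<open>l\<close> undoes the twofold Abel summation: \<open>d\<close> gets summed over all indices
  from \<open>k\<close> and \<open>l\<close> on.\<close>

lemma sum_partial_sums2:
  fixes d :: "nat \<Rightarrow> nat \<Rightarrow> real"
  shows "(\<Sum>i=1..N. \<Sum>j=1..N. d i j * ((\<Sum>k=1..i. f k) * (\<Sum>l=1..j. g l))) = (\<Sum>k=1..N. \<Sum>l=1..N. tail_sum d N k l * (f k * g l))"
proof -
  have aux: "(\<Sum>j=1..N. d i j * (F * G j)) = (\<Sum>j=1..N. d i j * G j) * F" for i and F :: real and G
    by (simp add: sum_distrib_left mult_ac)
  have "(\<Sum>i=1..N. \<Sum>j=1..N. d i j * ((\<Sum>k=1..i. f k) * (\<Sum>l=1..j. g l))) = (\<Sum>i=1..N. (\<Sum>j=1..N. d i j * (\<Sum>l=1..j. g l)) * (\<Sum>k=1..i. f k))"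
    by (intro sum.cong refl aux)
  also have "\<dots> = (\<Sum>k=1..N. (\<Sum>i=k..N. \<Sum>l=1..N. (\<Sum>j=l..N. d i j) * g l) * f k)"
    by (simp only: sum_partial_sums)
  also have "\<dots> = (\<Sum>k=1..N. \<Sum>l=1..N. tail_sum d N k l * (f k * g l))"
  proof (intro sum.cong refl)
    fix k
    have "(\<Sum>i=k..N. \<Sum>l=1..N. (\<Sum>j=l..N. d i j) * g l) = (\<Sum>l=1..N. tail_sum d N k l * g l)"
      by (subst sum.swap) (simp add: tail_sum_def sum_distrib_right)
    thus "(\<Sum>i=k..N. \<Sum>l=1..N. (\<Sum>j=l..N. d i j) * g l) * f k = (\<Sum>l=1..N. tail_sum d N k l * (f k * g l))"
      by (simp add: sum_distrib_left sum_distrib_right mult_ac)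
  qed
  finally show ?thesis .
qed

lemma tail_sum_nonneg: assumes "\<And>i j. d i j \<ge> 0" shows "tail_sum d N k l \<ge> 0"
  unfolding tail_sum_def by (intro sum_nonneg assms)

text \<open>As \<open>d\<close> is nonnegative, absolute values can be taken inside the sums; the
  cancellation that matters is already contained in the bounds on the kernels \<open>u i\<close> and
  \<open>w j\<close>.\<close>

lemma tensor_sum_pointwise:
  assumes d: "\<And>i j. d i j \<ge> 0" and c: "c1 \<ge> 0" "c2 \<ge> 0"
    and u: "\<And>i x. \<bar>u i x\<bar> \<le> c1 * kern_sum n1 a1 i x" and w: "\<And>i x. \<bar>w i x\<bar> \<le> c2 * kern_sum n2 a2 i x"
  shows "\<bar>tensor_sum d N u w z\<bar> \<le> c1 * c2 * (\<Sum>k=1..N. \<Sum>l=1..N. (tail_sum d N k l * (psi n1 k powr a1 * psi n2 l powr a2)) * kern2 k l z)"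
proof -
  have "\<bar>tensor_sum d N u w z\<bar> \<le> (\<Sum>i=1..N. \<bar>\<Sum>j=1..N. d i j * (u i (fst z) * w j (snd z))\<bar>)"
    unfolding tensor_sum_double by (rule sum_abs)
  also have "\<dots> \<le> (\<Sum>i=1..N. \<Sum>j=1..N. \<bar>d i j * (u i (fst z) * w j (snd z))\<bar>)"
    by (intro sum_mono sum_abs)
  also have "\<dots> \<le> (\<Sum>i=1..N. \<Sum>j=1..N. d i j * ((c1 * kern_sum n1 a1 i (fst z)) * (c2 * kern_sum n2 a2 j (snd z))))"
    unfolding abs_mult by (intro sum_mono mult_mono u w) (use d c in auto)
  also have "\<dots> = c1 * c2 * (\<Sum>i=1..N. \<Sum>j=1..N. d i j * (kern_sum n1 a1 i (fst z) * kern_sum n2 a2 j (snd z)))"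
    by (simp add: sum_distrib_left mult_ac)
  also have "(\<Sum>i=1..N. \<Sum>j=1..N. d i j * (kern_sum n1 a1 i (fst z) * kern_sum n2 a2 j (snd z))) =
     (\<Sum>k=1..N. \<Sum>l=1..N. (tail_sum d N k l * (psi n1 k powr a1 * psi n2 l powr a2)) * kern2 k l z)"
    unfolding kern_sum_def sum_partial_sums2 by (simp add: kern2_def mult_ac)
  finally show ?thesis .
qed

text \<open>The common source of the upper estimates. The families \<open>u\<close> and
  \<open>w\<close> stay abstract so that truncated and differenced kernels can be inserted alike;
  the constant is chosen before all of them.\<close>

lemma tensor_sum_Lp_int_bound:
  assumes p: "p > 1"
  shows "\<exists>C>0. \<forall>d N n1 n2 a1 a2 c1 c2 u w. (\<forall>i j. d i j \<ge> 0) \<longrightarrow> c1 \<ge> 0 \<longrightarrow> c2 \<ge> 0 \<longrightarrow> nice_family u \<longrightarrow> nice_family w \<longrightarrow>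
     (\<forall>i x. \<bar>u i x\<bar> \<le> c1 * kern_sum n1 a1 i x) \<longrightarrow> (\<forall>i x. \<bar>w i x\<bar> \<le> c2 * kern_sum n2 a2 i x) \<longrightarrow>
     Lp_int p (tensor_sum d N u w) \<le> (c1 * c2) powr p * C * coeff_sum p (tail_sum d N) N n1 n2 a1 a2"
proof -
  obtain C where C: "C > 0" "\<And>N b. (\<And>k l. b k l \<ge> 0) \<Longrightarrow>
    (\<integral>\<^sup>+z. ennreal ((\<Sum>k=1..N. \<Sum>l=1..N. b k l * kern2 k l z) powr p) \<partial>torus)
      \<le> ennreal (C * (\<Sum>k=1..N. \<Sum>l=1..N. b k l powr p * (real k * real l) powr (p - 2)))"
    using schur_series_to_function[OF p] by blast
  have "Lp_int p (tensor_sum d N u w) \<le> (c1 * c2) powr p * C * coeff_sum p (tail_sum d N) N n1 n2 a1 a2"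
    if d: "\<And>i j. d i j \<ge> 0" and c: "c1 \<ge> 0" "c2 \<ge> 0" and n: "nice_family u" "nice_family w"
      and u: "\<And>i x. \<bar>u i x\<bar> \<le> c1 * kern_sum n1 a1 i x" and w: "\<And>i x. \<bar>w i x\<bar> \<le> c2 * kern_sum n2 a2 i x"
    for d N n1 n2 a1 a2 c1 c2 u w
  proof -
    define b where "b k l = tail_sum d N k l * (psi n1 k powr a1 * psi n2 l powr a2)" for k l
    have A0: "tail_sum d N k l \<ge> 0" for k l by (rule tail_sum_nonneg) (rule d)
    have b0: "b k l \<ge> 0" for k l unfolding b_def using A0 by simp
    define X where "X = C * (\<Sum>k=1..N. \<Sum>l=1..N. b k l powr p * (real k * real l) powr (p - 2))"
    have X0: "X \<ge> 0" unfolding X_def using C by (intro mult_nonneg_nonneg sum_nonneg) auto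
    have "(\<integral>\<^sup>+z. ennreal (\<bar>tensor_sum d N u w z\<bar> powr p) \<partial>torus) \<le>
       (\<integral>\<^sup>+z. ennreal ((c1 * c2) powr p) * ennreal ((\<Sum>k=1..N. \<Sum>l=1..N. b k l * kern2 k l z) powr p) \<partial>torus)"
    proof (intro nn_integral_mono)
      fix z
      have "\<bar>tensor_sum d N u w z\<bar> powr p \<le> (c1 * c2 * (\<Sum>k=1..N. \<Sum>l=1..N. b k l * kern2 k l z)) powr p"
        unfolding b_def using p by (intro powr_mono2 tensor_sum_pointwise[OF d c u w]) auto
      also have "\<dots> = (c1 * c2) powr p * (\<Sum>k=1..N. \<Sum>l=1..N. b k l * kern2 k l z) powr p"
        using c b0 by (intro powr_mult)
      finally show "ennreal (\<bar>tensor_sum d N u w z\<bar> powr p) \<le> ennreal ((c1 * c2) powr p) * ennreal ((\<Sum>k=1..N. \<Sum>l=1..N. b k l * kern2 k l z) powr p)"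
        by (simp add: ennreal_mult[symmetric] ennreal_leI)
    qed
    also have "\<dots> = ennreal ((c1 * c2) powr p) * (\<integral>\<^sup>+z. ennreal ((\<Sum>k=1..N. \<Sum>l=1..N. b k l * kern2 k l z) powr p) \<partial>torus)"
      by (intro nn_integral_cmult) measurable
    also have "\<dots> \<le> ennreal ((c1 * c2) powr p) * ennreal X"
      unfolding X_def by (intro mult_left_mono C(2) b0) auto
    also have "\<dots> = ennreal ((c1 * c2) powr p * X)" using X0 by (simp add: ennreal_mult)
    finally have le: "(\<integral>\<^sup>+z. ennreal (\<bar>tensor_sum d N u w z\<bar> powr p) \<partial>torus) \<le> ennreal ((c1 * c2) powr p * X)" .
    have Lp: "tensor_sum d N u w \<in> Lp_torus p" using p n by (intro tensor_sum_Lp) auto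
    have "Lp_int p (tensor_sum d N u w) \<le> (c1 * c2) powr p * X"
      by (rule Lp_torusI(2)[OF Lp_torusD(1,2)[OF Lp] le]) (use X0 in simp)
    also have "X = C * coeff_sum p (tail_sum d N) N n1 n2 a1 a2"
      unfolding X_def coeff_sum_def b_def using A0 by (simp add: powr_mult powr_powr mult_ac)
    finally show ?thesis by simp
  qed
  thus ?thesis using C(1) by (intro exI[of _ C]) blast
qed

text \<open>A kernel \<open>cos_sum m i\<close> is empty unless \<open>i >= m + 1\<close>, and there
  \<open>psi (m + 1) i = 1\<close>. Hence weights of any positive order can be inserted at the cost
  of a constant; the order is fixed only where the sum over the degrees is formed.\<close>

lemma Lp_int_angle_remainder:
  assumes p: "p > 1" and a: "a1 > 0" "a2 > 0"
  shows "\<exists>C>0. \<forall>d N m1 m2. (\<forall>i j. d i j \<ge> 0) \<longrightarrow>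
     Lp_int p (tensor_sum d N (cos_sum m1) (cos_sum m2)) \<le> C * coeff_sum p (tail_sum d N) N (m1 + 1) (m2 + 1) a1 a2"
proof -
  obtain C where C: "C > 0" "\<And>d N n1 n2 a1 a2 c1 c2 u w. (\<And>i j. d i j \<ge> 0) \<Longrightarrow> c1 \<ge> 0 \<Longrightarrow> c2 \<ge> 0 \<Longrightarrow> nice_family u \<Longrightarrow> nice_family w \<Longrightarrow>
     (\<And>i x. \<bar>u i x\<bar> \<le> c1 * kern_sum n1 a1 i x) \<Longrightarrow> (\<And>i x. \<bar>w i x\<bar> \<le> c2 * kern_sum n2 a2 i x) \<Longrightarrow>
     Lp_int p (tensor_sum d N u w) \<le> (c1 * c2) powr p * C * coeff_sum p (tail_sum d N) N n1 n2 a1 a2"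
    using tensor_sum_Lp_int_bound[OF p] by blast
  have th: "\<bar>cos_sum m i x\<bar> \<le> 2 * 2 powr (a + 1) * kern_sum (m + 1) a i x" if "a > 0" for a m i x
    using cos_sum_kern_sum[OF that, of "m + 1" i m x] by (cases "i \<ge> m + 1") (auto simp: cos_sum_def)
  define c where "c a = 2 * 2 powr (a + 1)" for a :: real
  have c: "c a > 0" for a by (simp add: c_def)
  show ?thesis
  proof (intro exI[of _ "(c a1 * c a2) powr p * C"] conjI allI impI)
    show "(c a1 * c a2) powr p * C > 0" using C(1) c[of a1] c[of a2] by simp
    fix d :: "nat \<Rightarrow> nat \<Rightarrow> real" and N m1 m2 assume "\<forall>i j. d i j \<ge> 0"
    thus "Lp_int p (tensor_sum d N (cos_sum m1) (cos_sum m2)) \<le> (c a1 * c a2) powr p * C * coeff_sum p (tail_sum d N) N (m1 + 1) (m2 + 1) a1 a2"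
      unfolding c_def using a th by (intro C(2) nice_family_cos_sum) auto
  qed
qed

text \<open>The multiplier is under control only for frequencies up to \<open>n\<close>. Beyond
  \<open>n\<close> the difference is not evaluated at all: there \<open>psi\<close> is 1, and
  boundedness of the operator on L_p suffices. Splitting in both variables gives four sums of
  products.\<close>

lemma Lp_int_frac_diff_poly:
  assumes p: "p > 1" and \<alpha>: "\<alpha>1 > 0" "\<alpha>2 > 0"
  shows "\<exists>C>0. \<forall>d N n1 n2 h1 h2. (\<forall>i j. d i j \<ge> 0) \<longrightarrow> n1 \<ge> 1 \<longrightarrow> n2 \<ge> 1 \<longrightarrow> \<bar>h1\<bar> \<le> 1 / real n1 \<longrightarrow> \<bar>h2\<bar> \<le> 1 / real n2 \<longrightarrow>
     Lp_int p (frac_diff1 \<alpha>1 h1 (frac_diff2 \<alpha>2 h2 (tensor_sum d N (cos_sum 0) (cos_sum 0)))) \<le> C * coeff_sum p (tail_sum d N) N n1 n2 \<alpha>1 \<alpha>2"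
proof -
  obtain C where C: "C > 0" "\<And>d N n1 n2 a1 a2 c1 c2 u w. (\<And>i j. d i j \<ge> 0) \<Longrightarrow> c1 \<ge> 0 \<Longrightarrow> c2 \<ge> 0 \<Longrightarrow> nice_family u \<Longrightarrow> nice_family w \<Longrightarrow>
     (\<And>i x. \<bar>u i x\<bar> \<le> c1 * kern_sum n1 a1 i x) \<Longrightarrow> (\<And>i x. \<bar>w i x\<bar> \<le> c2 * kern_sum n2 a2 i x) \<Longrightarrow>
     Lp_int p (tensor_sum d N u w) \<le> (c1 * c2) powr p * C * coeff_sum p (tail_sum d N) N n1 n2 a1 a2"
    using tensor_sum_Lp_int_bound[OF p] by blast
  \<comment> \<open>This is the constant of the low-frequency bound; it also dominates the constant
    \<open>2 * 2 powr (a + 1)\<close> of the high frequencies.\<close>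
  define c where "c a = 4 * (1 + a) * 2 powr (a + 1)" for a :: real
  have low: "\<bar>fdiff1 a h (cos_sum 0 (min i n)) x\<bar> \<le> c a * kern_sum n a i x"
    if "a > 0" "n \<ge> 1" "\<bar>h\<bar> \<le> 1 / real n" for a h i n x
  proof -
    define m where "m = min i n"
    have m: "m \<le> n" "m \<le> i" by (auto simp: m_def)
    have ps: "psi n m = real m / real n" using m that by (simp add: psi_def)
    have "\<bar>fdiff1 a h (cos_sum 0 m) x\<bar> \<le> 4 * (1 + a) * (psi n m powr a * (real m * kern m x))"
      using fdiff1_cos_sum_low[OF that(1,2) m(1) that(3), of x] by (simp add: ps mult.assoc)
    also have "\<dots> \<le> 4 * (1 + a) * (2 powr (a + 1) * kern_sum n a m x)"
      using kern_sum_lower[OF that(1), of n m x] that by (intro mult_left_mono) auto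
    also have "\<dots> \<le> 4 * (1 + a) * (2 powr (a + 1) * kern_sum n a i x)"
      using kern_sum_mono[OF m(2), of n a x] that by (intro mult_left_mono) auto
    finally show ?thesis by (simp add: m_def c_def)
  qed
  have high: "\<bar>cos_sum n i x\<bar> \<le> c a * kern_sum n a i x" if "a > 0" "n \<ge> 1" for a i n x
  proof (cases "i \<le> n")
    case False
    have "\<bar>cos_sum n i x\<bar> \<le> 2 * 2 powr (a + 1) * kern_sum n a i x"
      using False that by (intro cos_sum_kern_sum) auto
    also have "\<dots> \<le> c a * kern_sum n a i x" unfolding c_def using that by (intro mult_right_mono) auto
    finally show ?thesis .
  qed (use that in \<open>auto simp: cos_sum_def c_def\<close>)
  have cpos: "c a > 0" if "a > 0" for a using that by (simp add: c_def)
  define K where "K = 2 powr p * (2 powr p * (1 + diff_coeff_sum \<alpha>1 powr p) + 2 powr p * (diff_coeff_sum \<alpha>2 powr p * (1 + diff_coeff_sum \<alpha>1 powr p)))"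
  have K: "K > 0" unfolding K_def by (intro mult_pos_pos add_pos_nonneg) auto
  define C' where "C' = K * ((c \<alpha>1 * c \<alpha>2) powr p * C)"
  have C': "C' > 0" unfolding C'_def using K C(1) cpos[OF \<alpha>(1)] cpos[OF \<alpha>(2)] by simp
  have "Lp_int p (frac_diff1 \<alpha>1 h1 (frac_diff2 \<alpha>2 h2 (tensor_sum d N (cos_sum 0) (cos_sum 0)))) \<le> C' * coeff_sum p (tail_sum d N) N n1 n2 \<alpha>1 \<alpha>2"
    if d: "\<And>i j. d i j \<ge> 0" and n: "n1 \<ge> 1" "n2 \<ge> 1" and h: "\<bar>h1\<bar> \<le> 1 / real n1" "\<bar>h2\<bar> \<le> 1 / real n2"
    for d N n1 n2 h1 h2
  proof -
    \<comment> \<open>\<open>e0\<close> and \<open>f0\<close> already contain the difference,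
      \<open>e1\<close> and \<open>f1\<close> do not; for the latter the operator is applied to the
      whole sum and costs a power of \<open>diff_coeff_sum\<close>.\<close>
    define e0 e1 f0 f1 where e_defs: "e0 = (\<lambda>i. fdiff1 \<alpha>1 h1 (cos_sum 0 (min i n1)))" "e1 = (\<lambda>i. cos_sum n1 i)"
      "f0 = (\<lambda>i. fdiff1 \<alpha>2 h2 (cos_sum 0 (min i n2)))" "f1 = (\<lambda>i. cos_sum n2 i)"
    have nice_family: "nice_family e0" "nice_family e1" "nice_family f0" "nice_family f1"
      unfolding e_defs by (intro nice_family_fdiff1 \<alpha> nice_family_cos_sum)+
    define Z where "Z = (c \<alpha>1 * c \<alpha>2) powr p * C * coeff_sum p (tail_sum d N) N n1 n2 \<alpha>1 \<alpha>2"
    have bnd: "\<bar>e0 i x\<bar> \<le> c \<alpha>1 * kern_sum n1 \<alpha>1 i x" "\<bar>e1 i x\<bar> \<le> c \<alpha>1 * kern_sum n1 \<alpha>1 i x"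
      "\<bar>f0 i x\<bar> \<le> c \<alpha>2 * kern_sum n2 \<alpha>2 i x" "\<bar>f1 i x\<bar> \<le> c \<alpha>2 * kern_sum n2 \<alpha>2 i x" for i x
      unfolding e_defs using low high \<alpha> n h by auto
    have cn: "c \<alpha>1 \<ge> 0" "c \<alpha>2 \<ge> 0" using cpos \<alpha> by (auto simp: less_imp_le)
    have Z: "Lp_int p (tensor_sum d N e0 f0) \<le> Z" "Lp_int p (tensor_sum d N e1 f0) \<le> Z" "Lp_int p (tensor_sum d N e0 f1) \<le> Z" "Lp_int p (tensor_sum d N e1 f1) \<le> Z"
      unfolding Z_def by (intro C(2) d cn nice_family bnd)+
    have split: "fdiff1 a h (cos_sum 0 i) x = fdiff1 a h (cos_sum 0 (min i n)) x + fdiff1 a h (cos_sum n i) x" if "a > 0" for a h i n x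
    proof -
      have "{0+1..i} = {0+1..min i n} \<union> {n+1..i}" by auto
      moreover have "sum f ({0+1..min i n} \<union> {n+1..i}) = sum f {0+1..min i n} + sum f {n+1..i}" for f :: "nat \<Rightarrow> real"
        by (rule sum.union_disjoint) auto
      ultimately show ?thesis unfolding fdiff1_cos_sum[OF that] by simp
    qed
    have s1: "(\<lambda>i. fdiff1 \<alpha>1 h1 (cos_sum 0 i)) = (\<lambda>i x. e0 i x + fdiff1 \<alpha>1 h1 (e1 i) x)"
      and s2: "(\<lambda>i. fdiff1 \<alpha>2 h2 (cos_sum 0 i)) = (\<lambda>i x. f0 i x + fdiff1 \<alpha>2 h2 (f1 i) x)"
      unfolding e_defs by (intro ext split \<alpha>)+
    have nd: "nice_family (\<lambda>i. cos_sum m i)" for m by (rule nice_family_cos_sum)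
    have p0: "p > 0" using p by simp
    note L = tensor_sum_Lp[OF p0]
    let ?D1 = "fdiff (1, 0) \<alpha>1 h1" and ?D2 = "fdiff (0, 1) \<alpha>2 h2"
    note L00 = L[OF nice_family(1,3)] and L10 = fdiff_Lp_torus(1)[OF p \<alpha>(1) L[OF nice_family(2,3)]]
      and L01 = fdiff_Lp_torus(1)[OF p \<alpha>(2) L[OF nice_family(1,4)]]
      and L11 = fdiff_Lp_torus(1)[OF p \<alpha>(1) fdiff_Lp_torus(1)[OF p \<alpha>(2) L[OF nice_family(2,4)]]]
    have "frac_diff1 \<alpha>1 h1 (frac_diff2 \<alpha>2 h2 (tensor_sum d N (cos_sum 0) (cos_sum 0))) = tensor_sum d N (\<lambda>i. fdiff1 \<alpha>1 h1 (cos_sum 0 i)) (\<lambda>i. fdiff1 \<alpha>2 h2 (cos_sum 0 i))"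
      unfolding frac_diff1_eq frac_diff2_eq by (simp only: tensor_sum_fd2[OF \<alpha>(2) nd] tensor_sum_fd1[OF \<alpha>(1) nd])
    also have "\<dots> = (\<lambda>z. (tensor_sum d N e0 f0 z + ?D1 (tensor_sum d N e1 f0) z) + (?D2 (tensor_sum d N e0 f1) z + ?D1 (?D2 (tensor_sum d N e1 f1)) z))"
    proof
      fix z
      show "tensor_sum d N (\<lambda>i. fdiff1 \<alpha>1 h1 (cos_sum 0 i)) (\<lambda>i. fdiff1 \<alpha>2 h2 (cos_sum 0 i)) z =
        (tensor_sum d N e0 f0 z + ?D1 (tensor_sum d N e1 f0) z) + (?D2 (tensor_sum d N e0 f1) z + ?D1 (?D2 (tensor_sum d N e1 f1)) z)"
        using tensor_sum_add1[of d N e0 "\<lambda>i. fdiff1 \<alpha>1 h1 (e1 i)" "\<lambda>i. fdiff1 \<alpha>2 h2 (cos_sum 0 i)" z]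
          tensor_sum_add2[of d N e0 f0 "\<lambda>i. fdiff1 \<alpha>2 h2 (f1 i)" z]
          tensor_sum_add2[of d N "\<lambda>i. fdiff1 \<alpha>1 h1 (e1 i)" f0 "\<lambda>i. fdiff1 \<alpha>2 h2 (f1 i)" z]
        unfolding s1[symmetric] s2[symmetric] tensor_sum_fd2[OF \<alpha>(2) nice_family(4)] tensor_sum_fd1[OF \<alpha>(1) nice_family(2)]
        by linarith
    qed
    finally have eq: "frac_diff1 \<alpha>1 h1 (frac_diff2 \<alpha>2 h2 (tensor_sum d N (cos_sum 0) (cos_sum 0))) = (\<lambda>z. (tensor_sum d N e0 f0 z + ?D1 (tensor_sum d N e1 f0) z) + (?D2 (tensor_sum d N e0 f1) z + ?D1 (?D2 (tensor_sum d N e1 f1)) z))" .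
    have "Lp_int p (frac_diff1 \<alpha>1 h1 (frac_diff2 \<alpha>2 h2 (tensor_sum d N (cos_sum 0) (cos_sum 0)))) \<le> 2 powr p * (Lp_int p (\<lambda>z. tensor_sum d N e0 f0 z + ?D1 (tensor_sum d N e1 f0) z) + Lp_int p (\<lambda>z. ?D2 (tensor_sum d N e0 f1) z + ?D1 (?D2 (tensor_sum d N e1 f1)) z))"
      unfolding eq by (rule Lp_torus_add(2)[OF p0 Lp_torus_add(1)[OF p0 L00 L10] Lp_torus_add(1)[OF p0 L01 L11]])
    also have "\<dots> \<le> 2 powr p * (2 powr p * (Lp_int p (tensor_sum d N e0 f0) + Lp_int p (?D1 (tensor_sum d N e1 f0))) + 2 powr p * (Lp_int p (?D2 (tensor_sum d N e0 f1)) + Lp_int p (?D1 (?D2 (tensor_sum d N e1 f1)))))"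
      by (rule mult_left_mono[OF add_mono[OF Lp_torus_add(2)[OF p0 L00 L10] Lp_torus_add(2)[OF p0 L01 L11]]]) simp
    also have "\<dots> \<le> 2 powr p * (2 powr p * (Z + diff_coeff_sum \<alpha>1 powr p * Z) + 2 powr p * (diff_coeff_sum \<alpha>2 powr p * Z + diff_coeff_sum \<alpha>1 powr p * (diff_coeff_sum \<alpha>2 powr p * Z)))"
    proof (intro mult_left_mono add_mono Z)
      show "Lp_int p (?D1 (tensor_sum d N e1 f0)) \<le> diff_coeff_sum \<alpha>1 powr p * Z"
        by (rule order_trans[OF fdiff_Lp_torus(2)[OF p \<alpha>(1) L[OF nice_family(2,3)]] mult_left_mono[OF Z(2)]]) auto
      show "Lp_int p (?D2 (tensor_sum d N e0 f1)) \<le> diff_coeff_sum \<alpha>2 powr p * Z"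
        by (rule order_trans[OF fdiff_Lp_torus(2)[OF p \<alpha>(2) L[OF nice_family(1,4)]] mult_left_mono[OF Z(3)]]) auto
      have "Lp_int p (?D2 (tensor_sum d N e1 f1)) \<le> diff_coeff_sum \<alpha>2 powr p * Z"
        by (rule order_trans[OF fdiff_Lp_torus(2)[OF p \<alpha>(2) L[OF nice_family(2,4)]] mult_left_mono[OF Z(4)]]) auto
      from mult_left_mono[OF this]
      show "Lp_int p (?D1 (?D2 (tensor_sum d N e1 f1))) \<le> diff_coeff_sum \<alpha>1 powr p * (diff_coeff_sum \<alpha>2 powr p * Z)"
        by (intro order_trans[OF fdiff_Lp_torus(2)[OF p \<alpha>(1) fdiff_Lp_torus(1)[OF p \<alpha>(2) L[OF nice_family(2,4)]]]]) auto
    qed auto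
    also have "\<dots> = K * Z" by (simp add: K_def algebra_simps)
    finally show ?thesis by (simp add: C'_def Z_def mult.assoc)
  qed
  thus ?thesis using C' by (intro exI[of _ C']) blast
qed

section \<open>Orthogonality and testing\<close>

lemma integrable_circ_continuous: "continuous_on UNIV u \<Longrightarrow> integrable circ (u :: real \<Rightarrow> real)"
  by (rule continuous_imp_integrable_real, erule continuous_on_subset) auto

lemma integral_circ_cos:
  fixes c :: real
  shows "(\<integral>x. cos (of_int m * x + c) \<partial>circ) = (if m = 0 then 2 * pi * cos c else 0)"
proof (cases "m = 0")
  case True
  thus ?thesis by (simp add: measure_restrict_space)
next
  case False
  define F where "F x = sin (of_int m * x + c) / of_int m" for x :: real
  have "((\<lambda>x. cos (of_int m * x + c)) has_integral (F (2*pi) - F 0)) {0..2*pi}"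
  proof (rule fundamental_theorem_of_calculus)
    fix x :: real
    have "(F has_real_derivative cos (of_int m * x + c)) (at x within {0..2*pi})"
      unfolding F_def using False by (auto intro!: derivative_eq_intros)
    thus "(F has_vector_derivative cos (of_int m * x + c)) (at x within {0..2*pi})"
      by (simp add: has_real_derivative_iff_has_vector_derivative)
  qed simp
  moreover have "F (2*pi) = F 0"
  proof -
    have "sin (of_int m * (2 * pi) + c) = sin (2 * pi * of_int m) * cos c + cos (2 * pi * of_int m) * sin c"
      by (simp add: sin_add mult_ac)
    also have "\<dots> = sin c" by (simp add: sin_integer_2pi cos_integer_2pi)
    finally show ?thesis by (simp add: F_def)
  qed
  ultimately have "integral {0..2*pi} (\<lambda>x. cos (of_int m * x + c)) = 0" by (simp add: integral_unique)
  moreover have "integrable circ (\<lambda>x. cos (of_int m * x + c))"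
    by (intro integrable_circ_continuous continuous_intros)
  ultimately have "(\<integral>x. cos (of_int m * x + c) \<partial>circ) = 0"
    by (subst lebesgue_integral_eq_integral) auto
  thus ?thesis using False by simp
qed

text \<open>The phase \<open>- (pi / 2)\<close> turns a cosine into a sine, so that one formula
  contains all orthogonality relations. For \<open>k = l = 0\<close> the term with the sum of the
  frequencies would contribute as well.\<close>

lemma integral_circ_cos_cos:
  assumes "k + l \<noteq> (0::nat)"
  shows "(\<integral>x. cos (real k * x + s) * cos (real l * x + t) \<partial>circ) = (if k = l then pi * cos (s - t) else 0)"
proof -
  have i: "integrable circ (\<lambda>x. cos (of_int m * x + c))" for m :: int and c :: real
    by (intro integrable_circ_continuous continuous_intros)
  have "(\<integral>x. cos (real k * x + s) * cos (real l * x + t) \<partial>circ) =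
    (\<integral>x. (cos (of_int (int k - int l) * x + (s - t)) + cos (of_int (int k + int l) * x + (s + t))) / 2 \<partial>circ)"
  proof (intro Bochner_Integration.integral_cong refl)
    fix x
    have "of_int (int k - int l) * x + (s - t) = (real k * x + s) - (real l * x + t)"
         "of_int (int k + int l) * x + (s + t) = (real k * x + s) + (real l * x + t)"
      by (simp_all add: algebra_simps)
    thus "cos (real k * x + s) * cos (real l * x + t) = (cos (of_int (int k - int l) * x + (s - t)) + cos (of_int (int k + int l) * x + (s + t))) / 2"
      by (simp only: cos_times_cos)
  qed
  also have "\<dots> = ((\<integral>x. cos (of_int (int k - int l) * x + (s - t)) \<partial>circ) + (\<integral>x. cos (of_int (int k + int l) * x + (s + t)) \<partial>circ)) / 2"
    by (simp only: integral_divide_zero Bochner_Integration.integral_add[OF i i])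
  also have "\<dots> = (if k = l then pi * cos (s - t) else 0)"
    unfolding integral_circ_cos using assms by auto
  finally show ?thesis .
qed

lemma integral_circ_lborel:
  fixes f :: "real \<Rightarrow> real"
  assumes "f \<in> borel_measurable borel"
  shows "(\<integral>x. f x \<partial>circ) = (\<integral>x. indicator {0..2*pi} x * f x \<partial>lborel)"
proof -
  have "(\<integral>x. f x \<partial>circ) = (\<integral>x. indicator {0..2*pi} x *\<^sub>R f x \<partial>lebesgue)"
    by (rule integral_restrict_space) simp
  also have "\<dots> = (\<integral>x. indicator {0..2*pi} x *\<^sub>R f x \<partial>lborel)"
    by (rule integral_completion) (use assms in simp)
  finally show ?thesis by simp
qed

lemma integral_torus_prod:
  fixes u v :: "real \<Rightarrow> real"
  assumes u: "continuous_on UNIV u" and v: "continuous_on UNIV v"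
  shows "integrable torus (\<lambda>z. u (fst z) * v (snd z))"
    and "(\<integral>z. u (fst z) * v (snd z) \<partial>torus) = (\<integral>x. u x \<partial>circ) * (\<integral>y. v y \<partial>circ)"
proof -
  have c: "continuous_on (cbox (0, 0) (2*pi, 2*pi)) (\<lambda>z :: real \<times> real. u (fst z) * v (snd z))"
    by (intro continuous_intros continuous_on_compose2[OF u] continuous_on_compose2[OF v]) auto
  show i: "integrable torus (\<lambda>z. u (fst z) * v (snd z))"
    unfolding period_square_cbox by (rule continuous_imp_integrable[OF c])
  have mu [measurable]: "u \<in> borel_measurable borel" "v \<in> borel_measurable borel"
    using u v by (auto intro: borel_measurable_continuous_onI)
  have m: "(\<lambda>z. indicator period_square z *\<^sub>R (u (fst z) * v (snd z))) \<in> borel_measurable (borel :: (real \<times> real) measure)"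
    by measurable
  have i2: "integrable lborel (\<lambda>z. indicator period_square z *\<^sub>R (u (fst z) * v (snd z)))"
    using i m by (simp add: integrable_restrict_space integrable_completion)
  have "(\<integral>z. u (fst z) * v (snd z) \<partial>torus) = (\<integral>z. indicator period_square z *\<^sub>R (u (fst z) * v (snd z)) \<partial>lborel)"
    using m by (simp add: integral_restrict_space integral_completion)
  also have "\<dots> = (\<integral>x. (\<integral>y. indicator period_square (x, y) *\<^sub>R (u x * v y) \<partial>lborel) \<partial>lborel)"
    using lborel_pair.integral_fst'[of "\<lambda>z. indicator period_square z *\<^sub>R (u (fst z) * v (snd z))"] i2
    by (simp add: lborel_prod)
  also have "\<dots> = (\<integral>x. (\<integral>y. (indicator {0..2*pi} x * u x) * (indicator {0..2*pi} y * v y) \<partial>lborel) \<partial>lborel)"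
    by (intro Bochner_Integration.integral_cong refl) (auto simp: period_square_def indicator_def)
  also have "\<dots> = (\<integral>x. u x \<partial>circ) * (\<integral>y. v y \<partial>circ)"
    by (simp add: integral_circ_lborel)
  finally show "(\<integral>z. u (fst z) * v (snd z) \<partial>torus) = (\<integral>x. u x \<partial>circ) * (\<integral>y. v y \<partial>circ)" .
qed

text \<open>Fubini's theorem for a function that is only Lebesgue measurable on the plane, such as a
  trigonometric polynomial in \<open>x\<close> whose coefficients depend on \<open>y\<close>. A
  Borel representative is integrated, almost all of whose sections agree almost everywhere with the
  given continuous ones.\<close>

lemma integral_torus_zero:
  fixes f :: "real \<times> real \<Rightarrow> real"
  assumes f: "integrable torus f"
    and sec: "(\<forall>y. continuous_on UNIV (\<lambda>x. f (x, y)) \<and> (\<integral>x. f (x, y) \<partial>circ) = 0) \<or>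
              (\<forall>x. continuous_on UNIV (\<lambda>y. f (x, y)) \<and> (\<integral>y. f (x, y) \<partial>circ) = 0)"
  shows "(\<integral>z. f z \<partial>torus) = 0"
proof -
  define F where "F z = indicator period_square z * f z" for z
  have iF: "integrable lebesgue F" using f by (simp add: F_def[abs_def] integrable_restrict_space)
  obtain G where G [measurable]: "G \<in> borel_measurable lborel" and FG: "AE z in lborel. F z = G z"
    using completion_ex_borel_measurable_real[of F lborel] iF by auto
  have FGl: "AE z in lebesgue. F z = G z" by (rule AE_completion[OF FG])
  have mG: "G \<in> borel_measurable lebesgue" by (rule measurable_completion) (rule G)
  have "integrable lebesgue G"
    by (rule integrable_cong_AE[THEN iffD1, OF _ mG FGl iF]) (use iF in auto)
  hence iG: "integrable (lborel \<Otimes>\<^sub>M lborel) G"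
    by (subst (asm) integrable_completion) (auto simp: lborel_prod)
  have "(\<integral>z. f z \<partial>torus) = (\<integral>z. F z \<partial>lebesgue)" by (simp add: F_def integral_restrict_space)
  also have "\<dots> = (\<integral>z. G z \<partial>lebesgue)"
    using iF FGl by (intro integral_cong_AE) (auto intro: measurable_completion)
  also have "\<dots> = (\<integral>z. G z \<partial>(lborel \<Otimes>\<^sub>M lborel))" by (simp add: integral_completion lborel_prod)
  also have "\<dots> = 0"
    using sec
  proof
    assume *: "\<forall>y. continuous_on UNIV (\<lambda>x. f (x, y)) \<and> (\<integral>x. f (x, y) \<partial>circ) = 0"
    have FG2: "AE z in lborel \<Otimes>\<^sub>M lborel. F z = G z" unfolding lborel_prod by (rule FG)
    have "AE z in distr (lborel \<Otimes>\<^sub>M lborel) (lborel \<Otimes>\<^sub>M lborel) (\<lambda>(x, y). (y, x)). F z = G z"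
      using FG2 by (subst lborel_pair.distr_pair_swap[symmetric])
    hence "AE z in lborel \<Otimes>\<^sub>M lborel. F (case z of (x, y) \<Rightarrow> (y, x)) = G (case z of (x, y) \<Rightarrow> (y, x))"
      by (rule AE_distrD[OF measurable_pair_swap'])
    from lborel_pair.AE_pair[OF this]
    have "AE y in lborel. AE x in lborel. F (x, y) = G (x, y)" by simp
    hence ae: "AE y in lborel. (\<integral>x. G (x, y) \<partial>lborel) = 0"
    proof eventually_elim
      fix y assume ae: "AE x in lborel. F (x, y) = G (x, y)"
      have [measurable]: "(\<lambda>x. f (x, y)) \<in> borel_measurable borel"
        using * by (auto intro: borel_measurable_continuous_onI)
      have Fy: "F (x, y) = indicator {0..2*pi} y * (indicator {0..2*pi} x * f (x, y))" for x
        by (auto simp: F_def period_square_def indicator_def)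
      have [measurable]: "(\<lambda>x. F (x, y)) \<in> borel_measurable borel" unfolding Fy by measurable
      have [measurable]: "(\<lambda>x. G (x, y)) \<in> borel_measurable borel"
        using G by (simp add: lborel_prod[symmetric] borel_prod[symmetric])
      have "(\<integral>x. G (x, y) \<partial>lborel) = (\<integral>x. F (x, y) \<partial>lborel)"
        using ae by (intro integral_cong_AE) auto
      also have "\<dots> = indicator {0..2*pi} y * (\<integral>x. f (x, y) \<partial>circ)"
        by (simp add: Fy integral_circ_lborel)
      finally show "(\<integral>x. G (x, y) \<partial>lborel) = 0" using * by simp
    qed
    have "(\<integral>z. G z \<partial>(lborel \<Otimes>\<^sub>M lborel)) = (\<integral>y. (\<integral>x. G (x, y) \<partial>lborel) \<partial>lborel)"
      using lborel_pair.integral_snd[of "\<lambda>x y. G (x, y)"] iG by simp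
    also have "\<dots> = (\<integral>y. 0 \<partial>(lborel :: real measure))"
      using ae lborel.borel_measurable_lebesgue_integral[of "\<lambda>y x. G (x, y)" lborel] G
      by (intro integral_cong_AE) (auto simp: lborel_prod split_beta')
    finally show ?thesis by simp
  next
    assume *: "\<forall>x. continuous_on UNIV (\<lambda>y. f (x, y)) \<and> (\<integral>y. f (x, y) \<partial>circ) = 0"
    have "AE x in lborel. AE y in lborel. F (x, y) = G (x, y)"
      by (rule lborel_pair.AE_pair) (unfold lborel_prod, rule FG)
    hence ae: "AE x in lborel. (\<integral>y. G (x, y) \<partial>lborel) = 0"
    proof eventually_elim
      fix x assume ae: "AE y in lborel. F (x, y) = G (x, y)"
      have [measurable]: "(\<lambda>y. f (x, y)) \<in> borel_measurable borel"
        using * by (auto intro: borel_measurable_continuous_onI)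
      have Fx: "F (x, y) = indicator {0..2*pi} x * (indicator {0..2*pi} y * f (x, y))" for y
        by (auto simp: F_def period_square_def indicator_def)
      have [measurable]: "(\<lambda>y. F (x, y)) \<in> borel_measurable borel" unfolding Fx by measurable
      have [measurable]: "(\<lambda>y. G (x, y)) \<in> borel_measurable borel"
        using G by (simp add: lborel_prod[symmetric] borel_prod[symmetric])
      have "(\<integral>y. G (x, y) \<partial>lborel) = (\<integral>y. F (x, y) \<partial>lborel)"
        using ae by (intro integral_cong_AE) auto
      also have "\<dots> = indicator {0..2*pi} x * (\<integral>y. f (x, y) \<partial>circ)"
        by (simp add: Fx integral_circ_lborel)
      finally show "(\<integral>y. G (x, y) \<partial>lborel) = 0" using * by simp
    qed
    have "(\<integral>z. G z \<partial>(lborel \<Otimes>\<^sub>M lborel)) = (\<integral>x. (\<integral>y. G (x, y) \<partial>lborel) \<partial>lborel)"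
      by (rule lborel_pair.integral_fst'[symmetric, OF iG])
    also have "\<dots> = (\<integral>x. 0 \<partial>(lborel :: real measure))"
      using ae lborel.borel_measurable_lebesgue_integral[of "\<lambda>x y. G (x, y)" lborel] G
      by (intro integral_cong_AE) (auto simp: lborel_prod split_beta')
    finally show ?thesis by simp
  qed
  finally show ?thesis .
qed

lemma integrable_Lp_mult_bounded:
  assumes p: "p \<ge> 1" and f: "f \<in> Lp_torus p" and g: "g \<in> borel_measurable torus" and B: "\<And>z. \<bar>g z\<bar> \<le> B"
  shows "integrable torus (\<lambda>z. f z * g z)"
proof (rule Bochner_Integration.integrable_bound)
  note [measurable] = Lp_torusD(4)[OF f] g
  show "integrable torus (\<lambda>z. B * (1 + \<bar>f z\<bar> powr p))"
    using Lp_torusD(3)[OF f] by auto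
  show "(\<lambda>z. f z * g z) \<in> borel_measurable torus" by measurable
  have "\<bar>x\<bar> \<le> 1 + \<bar>x\<bar> powr p" for x :: real
  proof (cases "\<bar>x\<bar> \<le> 1")
    case False
    hence "\<bar>x\<bar> powr 1 \<le> \<bar>x\<bar> powr p" using p by (intro powr_mono) auto
    thus ?thesis using False by simp
  qed (simp add: add_increasing2)
  moreover have "B \<ge> 0" using B[of undefined] by linarith
  ultimately have "\<bar>f z\<bar> * \<bar>g z\<bar> \<le> (1 + \<bar>f z\<bar> powr p) * B" for z
    by (intro mult_mono B) (auto simp: add_nonneg_nonneg)
  moreover have "1 + \<bar>f z\<bar> powr p \<ge> 0" for z by (simp add: add_nonneg_nonneg)
  ultimately show "AE z in torus. norm (f z * g z) \<le> norm (B * (1 + \<bar>f z\<bar> powr p))"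
    using \<open>B \<ge> 0\<close> by (intro AE_I2) (simp only: real_norm_def abs_mult abs_of_nonneg mult.commute[of B])
qed

text \<open>The block from \<open>block_start K\<close> to \<open>K\<close> has at least
  \<open>K / 2\<close> members, none below \<open>K / 2\<close>. Averages of decreasing coefficients
  over it dominate the coefficient at \<open>K\<close>, while low frequencies remain
  untouched.\<close>

definition block_start :: "nat \<Rightarrow> nat" where "block_start K = K - K div 2"

lemma block_start: "K \<ge> 1 \<Longrightarrow> block_start K \<ge> 1" "block_start K \<le> K" "real K / 2 \<le> real (block_start K)" "real K / 2 \<le> real (K + 1 - block_start K)"
  unfolding block_start_def by (linarith, linarith, linarith, linarith)

text \<open>Division by \<open>K\<close> makes the block at most \<open>2 * kern K x\<close>
  whatever the phase, which is the form that \<open>schur_function_to_series\<close> can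
  use.\<close>

definition test_block :: "nat \<Rightarrow> real \<Rightarrow> real \<Rightarrow> real" where
  "test_block K c x = (\<Sum>k=block_start K..K. cos (real k * x + c)) / real K"

lemma test_block_bound: assumes "K \<ge> 1" shows "\<bar>test_block K c x\<bar> \<le> 2 * kern K x"
  using cos_block_bound[OF block_start(1)[OF assms], where n = K and x = x and c = c] assms
  by (simp add: test_block_def abs_divide divide_le_eq mult_ac)

lemma continuous_on_test_block [continuous_intros]: "continuous_on S (test_block K c)"
  unfolding test_block_def by (cases "K = 0") (auto intro!: continuous_intros)

lemma borel_measurable_test_block [measurable]: "test_block K c \<in> borel_measurable borel"
  unfolding test_block_def[abs_def] by measurable

lemma has_cos_cosD:
  assumes "has_cos_cos_Fourier_series f a"
  shows "(\<integral>z. f z * (cos (real k * fst z) * cos (real l * snd z)) \<partial>torus) = (if k = 0 \<or> l = 0 then 0 else pi^2 * a k l)"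
    "(\<integral>z. f z * (cos (real k * fst z) * sin (real l * snd z)) \<partial>torus) = 0"
    "(\<integral>z. f z * (sin (real k * fst z) * cos (real l * snd z)) \<partial>torus) = 0"
    "(\<integral>z. f z * (sin (real k * fst z) * sin (real l * snd z)) \<partial>torus) = 0"
  using assms unfolding has_cos_cos_Fourier_series_def
  by (simp_all add: set_lebesgue_integral_def integral_restrict_space case_prod_unfold)

text \<open>On every section the integral in the variable of the polynomial vanishes, whatever the
  coefficients are, because \<open>k\<close> exceeds the degree; \<open>integral_torus_zero\<close>
  then handles the other variable.\<close>

lemma trig_poly_orthogonal:
  assumes p: "p \<ge> 1" and k: "k > m" and v: "v \<in> borel_measurable borel" "\<And>y. \<bar>v y\<bar> \<le> B"
  shows "S \<in> Lp_torus p \<Longrightarrow> trig_poly_in_x m S \<Longrightarrow> (\<integral>z. S z * (cos (real k * fst z) * v (snd z)) \<partial>torus) = 0"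
    and "S \<in> Lp_torus p \<Longrightarrow> trig_poly_in_y m S \<Longrightarrow> (\<integral>z. S z * (v (fst z) * cos (real k * snd z)) \<partial>torus) = 0"
proof -
  note [measurable] = v(1)
  have int1: "(\<integral>x. (\<Sum>j\<le>m. A j * cos (real j * x) + B j * sin (real j * x)) * (cos (real k * x) * c) \<partial>circ) = 0" for A B :: "nat \<Rightarrow> real" and c
  proof -
    have "(\<integral>x. (\<Sum>j\<le>m. A j * cos (real j * x) + B j * sin (real j * x)) * (cos (real k * x) * c) \<partial>circ) =
      (\<integral>x. (\<Sum>j\<le>m. (c * A j) * (cos (real j * x + 0) * cos (real k * x + 0)) + (c * B j) * (cos (real j * x + - (pi/2)) * cos (real k * x + 0))) \<partial>circ)"
    proof (intro Bochner_Integration.integral_cong refl)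
      fix x
      have "cos (real j * x + - (pi/2)) = sin (real j * x)" for j by (simp add: cos_diff)
      thus "(\<Sum>j\<le>m. A j * cos (real j * x) + B j * sin (real j * x)) * (cos (real k * x) * c) =
        (\<Sum>j\<le>m. (c * A j) * (cos (real j * x + 0) * cos (real k * x + 0)) + (c * B j) * (cos (real j * x + - (pi/2)) * cos (real k * x + 0)))"
        by (simp only: sum_distrib_right add_0_right) (simp add: algebra_simps)
    qed
    also have "\<dots> = (\<Sum>j\<le>m. (c * A j) * (\<integral>x. cos (real j * x + 0) * cos (real k * x + 0) \<partial>circ) + (c * B j) * (\<integral>x. cos (real j * x + - (pi/2)) * cos (real k * x + 0) \<partial>circ))"
    proof -
      have i: "integrable circ (\<lambda>x. cos (real j * x) * cos (real k * x))"
        "integrable circ (\<lambda>x. cos (real j * x - pi / 2) * cos (real k * x))" for j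
        by (intro integrable_circ_continuous continuous_intros)+
      show ?thesis
        by (subst Bochner_Integration.integral_sum) (auto intro!: sum.cong integrable_mult_right Bochner_Integration.integrable_add i simp: Bochner_Integration.integral_add i)
    qed
    also have "\<dots> = 0"
      using k by (intro sum.neutral ballI) (subst (1 2) integral_circ_cos_cos, auto)
    finally show ?thesis .
  qed
  show "(\<integral>z. S z * (cos (real k * fst z) * v (snd z)) \<partial>torus) = 0" if S: "S \<in> Lp_torus p" "trig_poly_in_x m S"
  proof (rule integral_torus_zero)
    show "integrable torus (\<lambda>z. S z * (cos (real k * fst z) * v (snd z)))"
    proof (rule integrable_Lp_mult_bounded[OF p S(1)])
      show "\<bar>cos (real k * fst z) * v (snd z)\<bar> \<le> 1 * B" for z :: "real \<times> real"
        unfolding abs_mult by (intro mult_mono v) auto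
    qed measurable
    obtain A B where AB: "\<And>x y. S (x, y) = (\<Sum>j\<le>m. A j y * cos (real j * x) + B j y * sin (real j * x))"
      using S(2) unfolding trig_poly_in_x_def by blast
    show "(\<forall>y. continuous_on UNIV (\<lambda>x. S (x, y) * (cos (real k * fst (x, y)) * v (snd (x, y)))) \<and>
         (\<integral>x. S (x, y) * (cos (real k * fst (x, y)) * v (snd (x, y))) \<partial>circ) = 0) \<or>
      (\<forall>x. continuous_on UNIV (\<lambda>y. S (x, y) * (cos (real k * fst (x, y)) * v (snd (x, y)))) \<and>
         (\<integral>y. S (x, y) * (cos (real k * fst (x, y)) * v (snd (x, y))) \<partial>circ) = 0)"
      by (rule disjI1) (auto simp: AB int1 intro!: continuous_intros)
  qed
  show "(\<integral>z. S z * (v (fst z) * cos (real k * snd z)) \<partial>torus) = 0" if S: "S \<in> Lp_torus p" "trig_poly_in_y m S"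
  proof (rule integral_torus_zero)
    show "integrable torus (\<lambda>z. S z * (v (fst z) * cos (real k * snd z)))"
    proof (rule integrable_Lp_mult_bounded[OF p S(1)])
      show "\<bar>v (fst z) * cos (real k * snd z)\<bar> \<le> B * 1" for z :: "real \<times> real"
        unfolding abs_mult using v(2)[of 0] by (intro mult_mono v) auto
    qed measurable
    obtain A B where AB: "\<And>x y. S (x, y) = (\<Sum>j\<le>m. A j x * cos (real j * y) + B j x * sin (real j * y))"
      using S(2) unfolding trig_poly_in_y_def by blast
    show "(\<forall>y. continuous_on UNIV (\<lambda>x. S (x, y) * (v (fst (x, y)) * cos (real k * snd (x, y)))) \<and>
         (\<integral>x. S (x, y) * (v (fst (x, y)) * cos (real k * snd (x, y))) \<partial>circ) = 0) \<or>
      (\<forall>x. continuous_on UNIV (\<lambda>y. S (x, y) * (v (fst (x, y)) * cos (real k * snd (x, y)))) \<and>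
         (\<integral>y. S (x, y) * (v (fst (x, y)) * cos (real k * snd (x, y))) \<partial>circ) = 0)"
      using int1 by (intro disjI2) (auto simp: AB mult.commute[of "v _"] intro!: continuous_intros)
  qed
qed

section \<open>Sign, monotonicity and decay of the coefficients\<close>

definition mono_coeffs :: "(nat \<Rightarrow> nat \<Rightarrow> real) \<Rightarrow> bool" where
  "mono_coeffs a \<longleftrightarrow> (\<forall>k\<ge>1. \<forall>l\<ge>1. 0 \<le> a k l \<and> a (k + 1) l \<le> a k l \<and> a k (l + 1) \<le> a k l \<and>
      0 \<le> a k l - a (k + 1) l - a k (l + 1) + a (k + 1) (l + 1)) \<and>
     (\<forall>l\<ge>1. (\<lambda>k. a k l) \<longlonglongrightarrow> 0) \<and> (\<forall>k\<ge>1. (\<lambda>l. a k l) \<longlonglongrightarrow> 0)"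

lemma mono_coeffs_antimono:
  assumes "mono_coeffs a" "1 \<le> k" "k \<le> k'" "1 \<le> l" "l \<le> l'"
  shows "a k' l' \<le> a k l"
proof -
  have "a k' l \<le> a k l" using assms(3)
  proof (induction k' rule: dec_induct)
    case (step i)
    have "a (i + 1) l \<le> a i l" using assms step by (auto simp: mono_coeffs_def)
    thus ?case using step by simp
  qed simp
  moreover have "a k' l' \<le> a k' l" using assms(5)
  proof (induction l' rule: dec_induct)
    case (step i)
    have "1 \<le> k'" "1 \<le> i" using assms step by auto
    hence "a k' (i + 1) \<le> a k' i" using assms(1) by (auto simp: mono_coeffs_def)
    thus ?case using step by simp
  qed simp
  ultimately show ?thesis by simp
qed

text \<open>A negative value \<open>x k\<close> would persist, so that every later block average
  would be at most \<open>x k / 2\<close>. Once the sequence is known to be nonnegative, twice the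
  block average dominates its last term.\<close>

lemma antimono_average_null:
  fixes x :: "nat \<Rightarrow> real"
  assumes dec: "\<And>k. k \<ge> 1 \<Longrightarrow> x (k + 1) \<le> x k"
    and avg: "(\<lambda>K. (\<Sum>k=block_start K..K. x k) / real K) \<longlonglongrightarrow> 0"
  shows "k \<ge> 1 \<Longrightarrow> x k \<ge> 0" "x \<longlonglongrightarrow> 0"
proof -
  have mono: "x j \<le> x i" if "1 \<le> i" "i \<le> j" for i j
    using that(2)
  proof (induction j rule: dec_induct)
    case (step j)
    thus ?case using dec[of j] that(1) by simp
  qed simp
  show nn: "x k \<ge> 0" if "k \<ge> 1" for k
  proof (rule ccontr)
    assume "\<not> x k \<ge> 0"
    hence neg: "x k < 0" by simp
    have "eventually (\<lambda>K. (\<Sum>k=block_start K..K. x k) / real K \<le> x k / 2) sequentially"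
      using eventually_ge_at_top[of "2 * k"]
    proof eventually_elim
      fix K assume K: "2 * k \<le> K"
      hence K1: "K \<ge> 1" using that by simp
      have "(\<Sum>i=block_start K..K. x i) \<le> (\<Sum>i=block_start K..K. x k)"
        by (intro sum_mono mono that) (use K in \<open>auto simp: block_start_def\<close>)
      also have "\<dots> = real (K + 1 - block_start K) * x k" by simp
      also have "\<dots> \<le> real K / 2 * x k" using neg block_start(4)[of K] by (intro mult_right_mono_neg) auto
      finally have "(\<Sum>i=block_start K..K. x i) / real K \<le> (real K / 2 * x k) / real K" by (intro divide_right_mono) auto
      thus "(\<Sum>k=block_start K..K. x k) / real K \<le> x k / 2" using K1 by simp
    qed
    hence "0 \<le> x k / 2" using avg by (intro tendsto_upperbound[OF avg]) auto
    thus False using neg by simp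
  qed
  show "x \<longlonglongrightarrow> 0"
  proof (rule tendsto_sandwich[where f = "\<lambda>_. 0" and h = "\<lambda>K. 2 * ((\<Sum>k=block_start K..K. x k) / real K)"])
    show "eventually (\<lambda>K. 0 \<le> x K) sequentially"
      using eventually_ge_at_top[of 1] by eventually_elim (rule nn)
    show "eventually (\<lambda>K. x K \<le> 2 * ((\<Sum>k=block_start K..K. x k) / real K)) sequentially"
      using eventually_ge_at_top[of 1]
    proof eventually_elim
      fix K :: nat assume K: "1 \<le> K"
      have "real K / 2 * x K \<le> real (K + 1 - block_start K) * x K" using nn[OF K] block_start(4)[of K] by (intro mult_right_mono) auto
      also have "\<dots> = (\<Sum>i=block_start K..K. x K)" by simp
      also have "\<dots> \<le> (\<Sum>i=block_start K..K. x i)" by (intro sum_mono mono) (use block_start(1)[OF K] in auto)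
      finally have "(real K / 2 * x K) / real K \<le> (\<Sum>i=block_start K..K. x i) / real K" by (intro divide_right_mono) auto
      moreover have "(real K / 2 * x K) / real K = x K / 2" using K by simp
      ultimately show "x K \<le> 2 * ((\<Sum>k=block_start K..K. x k) / real K)" by linarith
    qed
    show "(\<lambda>K. 2 * ((\<Sum>k=block_start K..K. x k) / real K)) \<longlonglongrightarrow> 0" using tendsto_mult_left[OF avg, of 2] by simp
  qed simp
qed

lemma kern_tendsto_0: assumes "rho x > 0" shows "(\<lambda>K. kern K x) \<longlonglongrightarrow> 0"
proof -
  have "filterlim (\<lambda>K. rho x * real K) at_top sequentially"
    by (rule filterlim_tendsto_pos_mult_at_top[OF tendsto_const assms filterlim_real_sequentially])
  hence "filterlim (\<lambda>K. 1 + rho x * real K) at_top sequentially"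
    by (rule filterlim_tendsto_add_at_top[OF tendsto_const])
  hence "(\<lambda>K. inverse (1 + rho x * real K)) \<longlonglongrightarrow> 0"
    by (rule tendsto_inverse_0_at_top)
  thus ?thesis by (simp add: kern_def divide_inverse mult.commute)
qed

text \<open>A Riemann-Lebesgue argument shows that block averages of the coefficients in one index
  tend to 0. The hypothesis makes \<open>a k l - a k (l + 1)\<close> decreasing in \<open>k\<close>,
  so these differences are nonnegative, and symmetrically in the other index. The same reasoning
  applied to \<open>a\<close> itself then gives its sign and its limits.\<close>

lemma class_M_coeffs:
  assumes p: "p > 1" and f: "f \<in> class_M p"
  shows "\<exists>a. has_cos_cos_Fourier_series f a \<and> mono_coeffs a"
proof -
  obtain a where a: "has_cos_cos_Fourier_series f a"
    and d: "\<And>k l. k \<ge> 1 \<Longrightarrow> l \<ge> 1 \<Longrightarrow> a k l - a (k + 1) l - a k (l + 1) + a (k + 1) (l + 1) \<ge> 0"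
    using f unfolding class_M_def by blast
  have fL: "f \<in> Lp_torus p" using f by (auto simp: class_M_def Lp0_torus_def)
  note [measurable] = Lp_torusD(4)[OF fL]
  have p1: "p \<ge> 1" using p by simp
  have int: "integrable torus (\<lambda>z. f z * g z)" if "g \<in> borel_measurable torus" "\<And>z. \<bar>g z\<bar> \<le> B" for g B
    by (rule integrable_Lp_mult_bounded[OF p1 fL that])
  have absf: "integrable torus (\<lambda>z. \<bar>f z\<bar>)" using int[of "\<lambda>_. 1" 1] by simp
  \<comment> \<open>\<open>X\<close> will be one of the two coordinates. Where
    \<open>rho (X z) > 0\<close> the test function is at most \<open>2 * kern K (X z)\<close>, which
    tends to 0, and \<open>2 * \<bar>f z\<bar>\<close> is an integrable majorant.\<close>
  have lim: "(\<lambda>K. \<integral>z. f z * (test_block K 0 (X z) * v z) \<partial>torus) \<longlonglongrightarrow> 0"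
    if X [measurable]: "X \<in> borel_measurable borel" and v [measurable]: "v \<in> borel_measurable borel"
      and v1: "\<And>z. \<bar>v z\<bar> \<le> 1" and AE: "AE z in torus. rho (X z) > 0" for X v :: "real \<times> real \<Rightarrow> real"
  proof -
    have "(\<lambda>K. \<integral>z. f z * (test_block (Suc K) 0 (X z) * v z) \<partial>torus) \<longlonglongrightarrow> (\<integral>z. 0 \<partial>torus)"
    proof (rule integral_dominated_convergence[where w = "\<lambda>z. 2 * \<bar>f z\<bar>"])
      show "AE z in torus. (\<lambda>K. f z * (test_block (Suc K) 0 (X z) * v z)) \<longlonglongrightarrow> 0"
        using AE
      proof eventually_elim
        fix z assume r: "rho (X z) > 0"
        show "(\<lambda>K. f z * (test_block (Suc K) 0 (X z) * v z)) \<longlonglongrightarrow> 0"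
        proof (rule Lim_null_comparison)
          show "eventually (\<lambda>K. norm (f z * (test_block (Suc K) 0 (X z) * v z)) \<le> \<bar>f z\<bar> * (2 * kern (Suc K) (X z))) sequentially"
          proof (intro always_eventually allI)
            fix K
            have "\<bar>test_block (Suc K) 0 (X z)\<bar> * \<bar>v z\<bar> \<le> 2 * kern (Suc K) (X z) * 1"
              by (intro mult_mono test_block_bound v1) auto
            thus "norm (f z * (test_block (Suc K) 0 (X z) * v z)) \<le> \<bar>f z\<bar> * (2 * kern (Suc K) (X z))"
              by (simp add: abs_mult mult_left_mono)
          qed
          have "(\<lambda>K. kern (Suc K) (X z)) \<longlonglongrightarrow> 0" using kern_tendsto_0[OF r] by (rule LIMSEQ_Suc)
          from tendsto_mult_left[OF tendsto_mult_left[OF this, of 2], of "\<bar>f z\<bar>"]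
          show "(\<lambda>K. \<bar>f z\<bar> * (2 * kern (Suc K) (X z))) \<longlonglongrightarrow> 0" by simp
        qed
      qed
      show "AE z in torus. norm (f z * (test_block (Suc K) 0 (X z) * v z)) \<le> 2 * \<bar>f z\<bar>" for K
      proof (intro AE_I2)
        fix z
        have "\<bar>test_block (Suc K) 0 (X z)\<bar> \<le> 2"
          using test_block_bound[of "Suc K" 0 "X z"] kern_le_1[of "Suc K" "X z"] by linarith
        hence "\<bar>test_block (Suc K) 0 (X z)\<bar> * \<bar>v z\<bar> \<le> 2 * 1" by (intro mult_mono v1) auto
        from mult_left_mono[OF this, of "\<bar>f z\<bar>"]
        show "norm (f z * (test_block (Suc K) 0 (X z) * v z)) \<le> 2 * \<bar>f z\<bar>" unfolding real_norm_def abs_mult by linarith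
      qed
    next
      show "(\<lambda>z. f z * (test_block (Suc K) 0 (X z) * v z)) \<in> borel_measurable torus" for K
        by (intro borel_measurable_times Lp_torusD(4)[OF fL] measurable_torus) measurable
      show "integrable torus (\<lambda>z. 2 * \<bar>f z\<bar>)" using absf by (rule integrable_mult_right)
    qed simp
    hence "(\<lambda>K. \<integral>z. f z * (test_block (Suc K) 0 (X z) * v z) \<partial>torus) \<longlonglongrightarrow> 0" by simp
    thus ?thesis by (rule LIMSEQ_imp_Suc)
  qed
  have avg1: "(\<lambda>K. (\<Sum>k=block_start K..K. a k l) / real K) \<longlonglongrightarrow> 0" if l: "l \<ge> 1" for l
  proof -
    have "eventually (\<lambda>K. (\<integral>z. f z * (test_block K 0 (fst z) * cos (real l * snd z)) \<partial>torus) / pi^2 = (\<Sum>k=block_start K..K. a k l) / real K) sequentially"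
      using eventually_ge_at_top[of 1]
    proof eventually_elim
      fix K :: nat assume K: "1 \<le> K"
      have "(\<integral>z. f z * (test_block K 0 (fst z) * cos (real l * snd z)) \<partial>torus) =
        (\<integral>z. (\<Sum>k=block_start K..K. f z * (cos (real k * fst z) * cos (real l * snd z))) / real K \<partial>torus)"
        by (intro Bochner_Integration.integral_cong refl) (simp add: test_block_def sum_distrib_right sum_distrib_left)
      also have "\<dots> = (\<Sum>k=block_start K..K. \<integral>z. f z * (cos (real k * fst z) * cos (real l * snd z)) \<partial>torus) / real K"
        by (subst Bochner_Integration.integral_sum[symmetric]) (auto intro!: int[where B = 1] simp: abs_mult mult_le_one)
      also have "\<dots> = (\<Sum>k=block_start K..K. pi^2 * a k l) / real K"
        using l block_start(1)[OF K] by (intro arg_cong2[of _ _ _ _ "(/)"] sum.cong refl) (auto simp: has_cos_cosD(1)[OF a])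
      finally show "(\<integral>z. f z * (test_block K 0 (fst z) * cos (real l * snd z)) \<partial>torus) / pi^2 = (\<Sum>k=block_start K..K. a k l) / real K"
        by (simp add: sum_distrib_left[symmetric])
    qed
    moreover have "(\<lambda>K. (\<integral>z. f z * (test_block K 0 (fst z) * cos (real l * snd z)) \<partial>torus) / pi^2) \<longlonglongrightarrow> 0"
      by (rule tendsto_divide_zero[OF lim]) (use AE_torus_rho in auto)
    ultimately show ?thesis by (rule Lim_transform_eventually[rotated])
  qed
  have avg2: "(\<lambda>K. (\<Sum>l=block_start K..K. a k l) / real K) \<longlonglongrightarrow> 0" if k: "k \<ge> 1" for k
  proof -
    have "eventually (\<lambda>K. (\<integral>z. f z * (test_block K 0 (snd z) * cos (real k * fst z)) \<partial>torus) / pi^2 = (\<Sum>l=block_start K..K. a k l) / real K) sequentially"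
      using eventually_ge_at_top[of 1]
    proof eventually_elim
      fix K :: nat assume K: "1 \<le> K"
      have "(\<integral>z. f z * (test_block K 0 (snd z) * cos (real k * fst z)) \<partial>torus) =
        (\<integral>z. (\<Sum>l=block_start K..K. f z * (cos (real k * fst z) * cos (real l * snd z))) / real K \<partial>torus)"
        by (intro Bochner_Integration.integral_cong refl) (simp add: test_block_def sum_distrib_right sum_distrib_left mult_ac)
      also have "\<dots> = (\<Sum>l=block_start K..K. \<integral>z. f z * (cos (real k * fst z) * cos (real l * snd z)) \<partial>torus) / real K"
        by (subst Bochner_Integration.integral_sum[symmetric]) (auto intro!: int[where B = 1] simp: abs_mult mult_le_one)
      also have "\<dots> = (\<Sum>l=block_start K..K. pi^2 * a k l) / real K"
        using k block_start(1)[OF K] by (intro arg_cong2[of _ _ _ _ "(/)"] sum.cong refl) (auto simp: has_cos_cosD(1)[OF a])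
      finally show "(\<integral>z. f z * (test_block K 0 (snd z) * cos (real k * fst z)) \<partial>torus) / pi^2 = (\<Sum>l=block_start K..K. a k l) / real K"
        by (simp add: sum_distrib_left[symmetric])
    qed
    moreover have "(\<lambda>K. (\<integral>z. f z * (test_block K 0 (snd z) * cos (real k * fst z)) \<partial>torus) / pi^2) \<longlonglongrightarrow> 0"
      by (rule tendsto_divide_zero[OF lim]) (use AE_torus_rho in auto)
    ultimately show ?thesis by (rule Lim_transform_eventually[rotated])
  qed
  have dec2: "a k (l + 1) \<le> a k l" if "k \<ge> 1" "l \<ge> 1" for k l
  proof -
    have "(\<lambda>K. (\<Sum>k=block_start K..K. a k l) / real K - (\<Sum>k=block_start K..K. a k (l + 1)) / real K) \<longlonglongrightarrow> 0 - 0"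
      by (intro tendsto_diff avg1) (use that in auto)
    hence "0 \<le> a k l - a k (l + 1)"
    proof (intro antimono_average_null(1)[where x = "\<lambda>k. a k l - a k (l + 1)" and k = k])
      fix k :: nat assume "k \<ge> 1"
      thus "a (k + 1) l - a (k + 1) (l + 1) \<le> a k l - a k (l + 1)" using d[of k l] that by linarith
    qed (use that in \<open>simp_all only: sum_subtractf diff_divide_distrib diff_zero\<close>)
    thus ?thesis by simp
  qed
  have dec1: "a (k + 1) l \<le> a k l" if "k \<ge> 1" "l \<ge> 1" for k l
  proof -
    have "(\<lambda>K. (\<Sum>l=block_start K..K. a k l) / real K - (\<Sum>l=block_start K..K. a (k + 1) l) / real K) \<longlonglongrightarrow> 0 - 0"
      by (intro tendsto_diff avg2) (use that in auto)
    hence "0 \<le> a k l - a (k + 1) l"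
    proof (intro antimono_average_null(1)[where x = "\<lambda>l. a k l - a (k + 1) l" and k = l])
      fix l :: nat assume "l \<ge> 1"
      thus "a k (l + 1) - a (k + 1) (l + 1) \<le> a k l - a (k + 1) l" using d[of k l] that by linarith
    qed (use that in \<open>simp_all only: sum_subtractf diff_divide_distrib diff_zero\<close>)
    thus ?thesis by simp
  qed
  have "mono_coeffs a" unfolding mono_coeffs_def
    using antimono_average_null[OF dec1 avg1] antimono_average_null[OF dec2 avg2] dec1 dec2 d by auto
  thus ?thesis using a by blast
qed

text \<open>The condition \<open>2 * m1 < k\<close> places the whole block of \<open>k\<close> above
  \<open>m1\<close>, and likewise for \<open>l\<close>, so that \<open>S\<close> and
  \<open>T\<close> are orthogonal to the product of the two blocks. Monotonicity bounds
  \<open>a k l\<close> by the block average, and the dual Schur test sums the results.\<close>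

lemma lower_bound_angle:
  assumes p: "p > 1"
  shows "\<exists>C>0. \<forall>f a S T m1 m2 R. f \<in> Lp_torus p \<longrightarrow> has_cos_cos_Fourier_series f a \<longrightarrow> mono_coeffs a \<longrightarrow>
     S \<in> Lp_torus p \<longrightarrow> trig_poly_in_x m1 S \<longrightarrow> T \<in> Lp_torus p \<longrightarrow> trig_poly_in_y m2 T \<longrightarrow>
     (\<Sum>k=1..R. \<Sum>l=1..R. if 2 * m1 < k \<and> 2 * m2 < l then a k l powr p * (real k * real l) powr (p - 2) else 0)
       \<le> C * Lp_int p (\<lambda>z. f z - S z - T z)"
proof -
  obtain C where C: "C > 0" "\<And>g. g \<in> borel_measurable torus \<Longrightarrow> integrable torus (\<lambda>z. \<bar>g z\<bar> powr p) \<Longrightarrow>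
    (\<forall>k\<ge>1. \<forall>l\<ge>1. integrable torus (\<lambda>z. \<bar>g z\<bar> * kern2 k l z)) \<and>
    (\<forall>R. (\<Sum>k=1..R. \<Sum>l=1..R. (real k * real l) powr (p - 2) * (\<integral>z. \<bar>g z\<bar> * kern2 k l z \<partial>torus) powr p)
      \<le> C * (\<integral>z. \<bar>g z\<bar> powr p \<partial>torus))"
    using schur_function_to_series[OF p] by blast
  \<comment> \<open>One factor 4 comes from the two block lengths, at least \<open>K / 2\<close> and
    \<open>L / 2\<close>, the other from the bounds \<open>2 * kern\<close> of the two test
    functions, and \<open>pi^2\<close> from the normalisation of the coefficients.\<close>
  define c where "c = 16 / pi^2"
  have c: "c > 0" by (simp add: c_def)
  have "(\<Sum>k=1..R. \<Sum>l=1..R. if 2 * m1 < k \<and> 2 * m2 < l then a k l powr p * (real k * real l) powr (p - 2) else 0)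
       \<le> c powr p * C * Lp_int p (\<lambda>z. f z - S z - T z)"
    if f: "f \<in> Lp_torus p" and a: "has_cos_cos_Fourier_series f a" "mono_coeffs a"
      and S: "S \<in> Lp_torus p" "trig_poly_in_x m1 S" and T: "T \<in> Lp_torus p" "trig_poly_in_y m2 T"
    for f a S T m1 m2 R
  proof -
    define g where "g z = f z - S z - T z" for z
    have p0: "p > 0" and p1: "p \<ge> 1" using p by auto
    have g: "g \<in> Lp_torus p"
      unfolding g_def[abs_def] by (intro Lp_torus_diff p0 f S T)
    note G = C(2)[OF Lp_torusD(4,3)[OF g]]
    have int: "integrable torus (\<lambda>z. u z * (cos (real k * fst z) * cos (real l * snd z)))" if "u \<in> Lp_torus p" for u k l
      by (rule integrable_Lp_mult_bounded[OF p1 that, where B = 1]) (auto simp: abs_mult mult_le_one)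
    have coef: "(\<integral>z. g z * (cos (real k * fst z) * cos (real l * snd z)) \<partial>torus) = pi^2 * a k l"
      if "k > m1" "l > m2" for k l
    proof -
      have "(\<integral>z. g z * (cos (real k * fst z) * cos (real l * snd z)) \<partial>torus) =
        (\<integral>z. f z * (cos (real k * fst z) * cos (real l * snd z)) \<partial>torus)
         - (\<integral>z. S z * (cos (real k * fst z) * cos (real l * snd z)) \<partial>torus)
         - (\<integral>z. T z * (cos (real k * fst z) * cos (real l * snd z)) \<partial>torus)"
        unfolding g_def left_diff_distrib
        by (simp add: Bochner_Integration.integral_diff Bochner_Integration.integrable_diff int f S T)
      also have "(\<integral>z. S z * (cos (real k * fst z) * cos (real l * snd z)) \<partial>torus) = 0"
        by (rule trig_poly_orthogonal(1)[OF p1 that(1) _ _ S, where B = 1]) auto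
      also have "(\<integral>z. T z * (cos (real k * fst z) * cos (real l * snd z)) \<partial>torus) = 0"
        by (rule trig_poly_orthogonal(2)[OF p1 that(2) _ _ T, where B = 1 and v = "\<lambda>x. cos (real k * x)"]) auto
      also have "(\<integral>z. f z * (cos (real k * fst z) * cos (real l * snd z)) \<partial>torus) = pi^2 * a k l"
        using that by (simp add: has_cos_cosD(1)[OF a(1)])
      finally show ?thesis by simp
    qed
    have main: "a K L \<le> c * (\<integral>z. \<bar>g z\<bar> * kern2 K L z \<partial>torus)" if KL: "2 * m1 < K" "2 * m2 < L" for K L
    proof -
      have K1: "K \<ge> 1" "L \<ge> 1" using KL by auto
      have hK: "block_start K > m1" "block_start L > m2" using KL by (auto simp: block_start_def)
      note gi = G[THEN conjunct1, rule_format, OF K1]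
      have gW: "integrable torus (\<lambda>z. g z * (test_block K 0 (fst z) * test_block L 0 (snd z)))"
      proof (rule integrable_Lp_mult_bounded[OF p1 g])
        have "\<bar>test_block K 0 x\<bar> \<le> 2" "\<bar>test_block L 0 x\<bar> \<le> 2" for x
          using test_block_bound[OF K1(1), of 0 x] kern_le_1[of K x] test_block_bound[OF K1(2), of 0 x] kern_le_1[of L x] by linarith+
        thus "\<bar>test_block K 0 (fst z) * test_block L 0 (snd z)\<bar> \<le> 2 * 2" for z
          unfolding abs_mult by (intro mult_mono) auto
      qed measurable
      have "pi^2 / 4 * a K L \<le> (\<Sum>k=block_start K..K. \<Sum>l=block_start L..L. pi^2 * a k l) / (real K * real L)"
      proof -
        have aK: "a K L \<ge> 0" using a(2) K1 by (auto simp: mono_coeffs_def)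
        have "real K / 2 * (real L / 2) * (pi^2 * a K L) \<le> real (K + 1 - block_start K) * real (L + 1 - block_start L) * (pi^2 * a K L)"
          by (intro mult_right_mono mult_mono block_start) (use aK in auto)
        also have "\<dots> = (\<Sum>k=block_start K..K. \<Sum>l=block_start L..L. pi^2 * a K L)" by simp
        also have "\<dots> \<le> (\<Sum>k=block_start K..K. \<Sum>l=block_start L..L. pi^2 * a k l)"
          by (intro sum_mono mult_left_mono mono_coeffs_antimono[OF a(2)]) (use block_start(1)[OF K1(1)] block_start(1)[OF K1(2)] in auto)
        finally show ?thesis using K1 by (simp add: field_simps)
      qed
      also have "\<dots> = (\<Sum>k=block_start K..K. \<Sum>l=block_start L..L. \<integral>z. g z * (cos (real k * fst z) * cos (real l * snd z)) \<partial>torus) / (real K * real L)"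
        using hK by (intro arg_cong2[of _ _ _ _ "(/)"] sum.cong refl coef[symmetric]) auto
      also have "\<dots> = (\<integral>z. (\<Sum>k=block_start K..K. \<Sum>l=block_start L..L. g z * (cos (real k * fst z) * cos (real l * snd z))) / (real K * real L) \<partial>torus)"
        by (simp add: int[OF g])
      also have "\<dots> = (\<integral>z. g z * (test_block K 0 (fst z) * test_block L 0 (snd z)) \<partial>torus)"
      proof (intro Bochner_Integration.integral_cong refl)
        fix z
        have "(\<Sum>k=block_start K..K. \<Sum>l=block_start L..L. g z * (cos (real k * fst z) * cos (real l * snd z))) =
          g z * ((\<Sum>k=block_start K..K. cos (real k * fst z)) * (\<Sum>l=block_start L..L. cos (real l * snd z)))"
          by (subst sum_product) (simp only: sum_distrib_left)
        thus "(\<Sum>k=block_start K..K. \<Sum>l=block_start L..L. g z * (cos (real k * fst z) * cos (real l * snd z))) / (real K * real L) = g z * (test_block K 0 (fst z) * test_block L 0 (snd z))"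
          by (simp add: test_block_def)
      qed
      also have "\<dots> \<le> (\<integral>z. 4 * (\<bar>g z\<bar> * kern2 K L z) \<partial>torus)"
      proof (rule integral_mono[OF gW])
        show "integrable torus (\<lambda>z. 4 * (\<bar>g z\<bar> * kern2 K L z))" using gi by simp
        fix z
        have "\<bar>test_block K 0 (fst z)\<bar> * \<bar>test_block L 0 (snd z)\<bar> \<le> (2 * kern K (fst z)) * (2 * kern L (snd z))"
          by (intro mult_mono test_block_bound K1) auto
        hence "\<bar>g z\<bar> * (\<bar>test_block K 0 (fst z)\<bar> * \<bar>test_block L 0 (snd z)\<bar>) \<le> \<bar>g z\<bar> * ((2 * kern K (fst z)) * (2 * kern L (snd z)))"
          by (intro mult_left_mono) auto
        also have "\<dots> = 4 * (\<bar>g z\<bar> * kern2 K L z)" by (simp add: kern2_def)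
        finally show "g z * (test_block K 0 (fst z) * test_block L 0 (snd z)) \<le> 4 * (\<bar>g z\<bar> * kern2 K L z)"
          using abs_ge_self[of "g z * (test_block K 0 (fst z) * test_block L 0 (snd z))"] by (simp add: abs_mult)
      qed
      also have "\<dots> = 4 * (\<integral>z. \<bar>g z\<bar> * kern2 K L z \<partial>torus)" by simp
      finally show ?thesis by (simp add: c_def field_simps)
    qed
    have "(\<Sum>k=1..R. \<Sum>l=1..R. if 2 * m1 < k \<and> 2 * m2 < l then a k l powr p * (real k * real l) powr (p - 2) else 0)
      \<le> (\<Sum>k=1..R. \<Sum>l=1..R. c powr p * ((real k * real l) powr (p - 2) * (\<integral>z. \<bar>g z\<bar> * kern2 k l z \<partial>torus) powr p))"
    proof (intro sum_mono)
      fix k l assume kl: "k \<in> {1..R}" "l \<in> {1..R}"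
      show "(if 2 * m1 < k \<and> 2 * m2 < l then a k l powr p * (real k * real l) powr (p - 2) else 0)
         \<le> c powr p * ((real k * real l) powr (p - 2) * (\<integral>z. \<bar>g z\<bar> * kern2 k l z \<partial>torus) powr p)"
      proof (cases "2 * m1 < k \<and> 2 * m2 < l")
        case True
        have i0: "(\<integral>z. \<bar>g z\<bar> * kern2 k l z \<partial>torus) \<ge> 0" by (intro Bochner_Integration.integral_nonneg) auto
        have "a k l powr p \<le> (c * (\<integral>z. \<bar>g z\<bar> * kern2 k l z \<partial>torus)) powr p"
        proof (rule powr_mono2)
          show "0 \<le> a k l" using a(2) kl by (simp add: mono_coeffs_def)
          show "a k l \<le> c * (\<integral>z. \<bar>g z\<bar> * kern2 k l z \<partial>torus)" using main[of k l] True by blast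
        qed (use p0 in simp)
        also have "\<dots> = c powr p * (\<integral>z. \<bar>g z\<bar> * kern2 k l z \<partial>torus) powr p"
          using c i0 by (intro powr_mult)
        finally have "a k l powr p * (real k * real l) powr (p - 2) \<le> (c powr p * (\<integral>z. \<bar>g z\<bar> * kern2 k l z \<partial>torus) powr p) * (real k * real l) powr (p - 2)"
          by (intro mult_right_mono) auto
        also have "\<dots> = c powr p * ((real k * real l) powr (p - 2) * (\<integral>z. \<bar>g z\<bar> * kern2 k l z \<partial>torus) powr p)"
          by (simp only: mult.assoc mult.commute[of "(real k * real l) powr (p - 2)"])
        finally show ?thesis using True by simp
      qed auto
    qed
    also have "\<dots> = c powr p * (\<Sum>k=1..R. \<Sum>l=1..R. (real k * real l) powr (p - 2) * (\<integral>z. \<bar>g z\<bar> * kern2 k l z \<partial>torus) powr p)"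
      by (simp add: sum_distrib_left)
    also have "\<dots> \<le> c powr p * (C * (\<integral>z. \<bar>g z\<bar> powr p \<partial>torus))"
      using G[THEN conjunct2] by (intro mult_left_mono) auto
    finally show ?thesis by (simp add: Lp_int_def g_def mult.assoc)
  qed
  thus ?thesis using C(1) c by (intro exI[of _ "c powr p * C"]) auto
qed

section \<open>Lower bound for the modulus\<close>

text \<open>Multipliers of the difference operator shifted back by \<open>\<alpha> * h\<close>; unlike the factor in
  \<open>diff_coeff_cos_sums\<close> they are controlled for every \<open>h\<close>, not only for \<open>k * h < 2 * pi\<close>.\<close>

definition multiplier :: "real \<Rightarrow> real \<Rightarrow> nat \<Rightarrow> real \<Rightarrow> real" where
  "multiplier \<alpha> c k h = (\<Sum>v. diff_coeff \<alpha> v * cos (real v * (real k * h) + c))"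

lemma summable_multiplier: "\<alpha> > 0 \<Longrightarrow> summable (\<lambda>v. diff_coeff \<alpha> v * cos (real v * (real k * h) + c))"
  by (rule summable_diff_coeff_mult[where B = 1]) auto

lemma multiplier_bound: assumes "\<alpha> > 0" shows "\<bar>multiplier \<alpha> c k h\<bar> \<le> diff_coeff_sum \<alpha>"
proof -
  have le: "\<bar>diff_coeff \<alpha> v * cos (real v * (real k * h) + c)\<bar> \<le> \<bar>diff_coeff \<alpha> v\<bar>" for v
    using abs_cos_le_one by (simp add: abs_mult mult_left_le)
  have s: "summable (\<lambda>v. \<bar>diff_coeff \<alpha> v * cos (real v * (real k * h) + c)\<bar>)"
    by (rule summable_comparison_test'[OF summable_diff_coeff[OF assms], of 0]) (simp add: le)
  have "\<bar>multiplier \<alpha> c k h\<bar> \<le> (\<Sum>v. \<bar>diff_coeff \<alpha> v * cos (real v * (real k * h) + c)\<bar>)"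
    unfolding multiplier_def by (rule summable_rabs[OF s])
  also have "\<dots> \<le> diff_coeff_sum \<alpha>" unfolding diff_coeff_sum_def by (rule suminf_le[OF le s summable_diff_coeff[OF assms]])
  finally show ?thesis .
qed

lemma borel_measurable_multiplier [measurable]: "multiplier \<alpha> c k \<in> borel_measurable borel"
  unfolding multiplier_def[abs_def] by measurable

text \<open>After the translation by \<open>\<alpha> * h\<close> the samples are
  \<open>x - v * h\<close>, and the addition formula separates \<open>x\<close> from
  \<open>h\<close> for every step. The phase \<open>- (pi / 2)\<close> stands for the sine.\<close>

lemma fdiff1_cos_shifted:
  assumes "\<alpha> > 0"
  shows "fdiff1 \<alpha> h (\<lambda>x. cos (real k * x)) (x - \<alpha> * h) =
    multiplier \<alpha> 0 k h * cos (real k * x + 0) + multiplier \<alpha> (- (pi / 2)) k h * cos (real k * x + - (pi / 2))"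
proof -
  have "cos (real k * (x - \<alpha> * h + (\<alpha> - real v) * h)) =
     cos (real v * (real k * h) + 0) * cos (real k * x + 0) + cos (real v * (real k * h) + - (pi / 2)) * cos (real k * x + - (pi / 2))" for v
  proof -
    have "real k * (x - \<alpha> * h + (\<alpha> - real v) * h) = real k * x - real v * (real k * h)" by (simp add: algebra_simps)
    thus ?thesis by (simp add: cos_diff)
  qed
  hence "fdiff1 \<alpha> h (\<lambda>x. cos (real k * x)) (x - \<alpha> * h) =
    (\<Sum>v. diff_coeff \<alpha> v * cos (real v * (real k * h) + 0) * cos (real k * x + 0) + diff_coeff \<alpha> v * cos (real v * (real k * h) + - (pi / 2)) * cos (real k * x + - (pi / 2)))"
    unfolding fdiff1_def by (simp only: distrib_left mult.assoc)
  also have "\<dots> = (\<Sum>v. diff_coeff \<alpha> v * cos (real v * (real k * h) + 0) * cos (real k * x + 0)) + (\<Sum>v. diff_coeff \<alpha> v * cos (real v * (real k * h) + - (pi / 2)) * cos (real k * x + - (pi / 2)))"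
    by (intro suminf_add[symmetric] summable_mult2 summable_multiplier assms)
  also have "\<dots> = multiplier \<alpha> 0 k h * cos (real k * x + 0) + multiplier \<alpha> (- (pi / 2)) k h * cos (real k * x + - (pi / 2))"
    unfolding multiplier_def by (intro arg_cong2[of _ _ _ _ "(+)"] suminf_mult2[symmetric] summable_multiplier assms)
  finally show ?thesis .
qed

text \<open>Changing the phase \<open>c\<close> of the test cosine rotates the complex multiplier
  before its real part is taken; this freedom is used later to make the pairing positive.\<close>

lemma fdiff1_cos_pairing:
  assumes \<alpha>: "\<alpha> > 0" and k: "k \<ge> 1" "l \<ge> 1"
  shows "continuous_on UNIV (\<lambda>x. fdiff1 \<alpha> h (\<lambda>x. cos (real k * x)) (x - \<alpha> * h))"
    and "(\<integral>x. fdiff1 \<alpha> h (\<lambda>x. cos (real k * x)) (x - \<alpha> * h) * cos (real l * x + c) \<partial>circ) = (if k = l then pi * multiplier \<alpha> c k h else 0)"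
proof -
  show "continuous_on UNIV (\<lambda>x. fdiff1 \<alpha> h (\<lambda>x. cos (real k * x)) (x - \<alpha> * h))"
    unfolding fdiff1_cos_shifted[OF \<alpha>] by (intro continuous_intros)
  define P R where PR: "P = multiplier \<alpha> 0 k h" "R = multiplier \<alpha> (- (pi / 2)) k h"
  have i: "integrable circ (\<lambda>x. C * (cos (real k * x + s) * cos (real l * x + t)))" for C s t
    by (intro integrable_circ_continuous continuous_intros)
  have "(\<integral>x. fdiff1 \<alpha> h (\<lambda>x. cos (real k * x)) (x - \<alpha> * h) * cos (real l * x + c) \<partial>circ) =
    (\<integral>x. P * (cos (real k * x + 0) * cos (real l * x + c)) + R * (cos (real k * x + - (pi/2)) * cos (real l * x + c)) \<partial>circ)"
    unfolding fdiff1_cos_shifted[OF \<alpha>] PR by (simp only: distrib_right mult.assoc)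
  also have "\<dots> = P * (\<integral>x. cos (real k * x + 0) * cos (real l * x + c) \<partial>circ) + R * (\<integral>x. cos (real k * x + - (pi/2)) * cos (real l * x + c) \<partial>circ)"
    by (simp only: Bochner_Integration.integral_add[OF i i] integral_mult_right_zero)
  also have "\<dots> = (if k = l then pi * (P * cos (0 - c) + R * cos (- (pi/2) - c)) else 0)"
    using k by (subst (1 2) integral_circ_cos_cos) (auto simp: distrib_left)
  also have "P * cos (0 - c) + R * cos (- (pi/2) - c) = multiplier \<alpha> c k h"
  proof -
    have "cos (- (pi/2) - c) = - sin c" by (simp add: cos_diff)
    hence "P * cos (0 - c) + R * cos (- (pi/2) - c) = P * cos c + R * (- sin c)" by simp
    also have "\<dots> = (\<Sum>v. diff_coeff \<alpha> v * cos (real v * (real k * h) + 0) * cos c) + (\<Sum>v. diff_coeff \<alpha> v * cos (real v * (real k * h) + - (pi / 2)) * (- sin c))"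
      unfolding PR multiplier_def by (intro arg_cong2[of _ _ _ _ "(+)"] suminf_mult2 summable_multiplier \<alpha>)
    also have "\<dots> = (\<Sum>v. diff_coeff \<alpha> v * cos (real v * (real k * h) + 0) * cos c + diff_coeff \<alpha> v * cos (real v * (real k * h) + - (pi / 2)) * (- sin c))"
      by (intro suminf_add summable_mult2 summable_multiplier \<alpha>)
    also have "\<dots> = multiplier \<alpha> c k h"
      unfolding multiplier_def by (intro suminf_cong) (simp add: cos_add cos_diff algebra_simps)
    finally show ?thesis .
  qed
  finally show "(\<integral>x. fdiff1 \<alpha> h (\<lambda>x. cos (real k * x)) (x - \<alpha> * h) * cos (real l * x + c) \<partial>circ) = (if k = l then pi * multiplier \<alpha> c k h else 0)" .
qed

text \<open>By orthogonality only the frequencies of the test block survive the pairing, hence the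
  value 0 outside it.\<close>

definition test_coeff :: "real \<Rightarrow> nat \<Rightarrow> real \<Rightarrow> real \<Rightarrow> nat \<Rightarrow> real" where
  "test_coeff \<alpha> K c h k = (if block_start K \<le> k \<and> k \<le> K then multiplier \<alpha> c k h else 0)"

lemma fdiff1_cos_sum_pairing:
  assumes \<alpha>: "\<alpha> > 0" and K: "K \<ge> 1"
  shows "continuous_on UNIV (\<lambda>x. fdiff1 \<alpha> h (cos_sum 0 i) (x - \<alpha> * h))"
    and "(\<integral>x. fdiff1 \<alpha> h (cos_sum 0 i) (x - \<alpha> * h) * test_block K c x \<partial>circ) = pi / real K * (\<Sum>k=1..i. test_coeff \<alpha> K c h k)"
proof -
  let ?U = "\<lambda>k x. fdiff1 \<alpha> h (\<lambda>x. cos (real k * x)) (x - \<alpha> * h)"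
  have U: "continuous_on UNIV (?U k)" if "k \<ge> 1" for k
    by (rule fdiff1_cos_pairing(1)[OF \<alpha> that order_refl])
  show "continuous_on UNIV (\<lambda>x. fdiff1 \<alpha> h (cos_sum 0 i) (x - \<alpha> * h))"
    unfolding fdiff1_cos_sum[OF \<alpha>] by (intro continuous_on_sum U) auto
  have i: "integrable circ (\<lambda>x. ?U k x * cos (real l * x + c))" if "k \<ge> 1" for k l
    by (intro integrable_circ_continuous continuous_on_mult U that continuous_intros)
  have hK: "block_start K \<ge> 1" by (rule block_start(1)[OF K])
  have "(\<integral>x. fdiff1 \<alpha> h (cos_sum 0 i) (x - \<alpha> * h) * test_block K c x \<partial>circ) =
    (\<integral>x. (\<Sum>k=1..i. \<Sum>l=block_start K..K. ?U k x * cos (real l * x + c)) / real K \<partial>circ)"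
    unfolding fdiff1_cos_sum[OF \<alpha>] test_block_def by (simp add: sum_product)
  also have "\<dots> = (\<Sum>k=1..i. \<Sum>l=block_start K..K. (\<integral>x. ?U k x * cos (real l * x + c) \<partial>circ)) / real K"
  proof -
    have 1: "(\<integral>x. (\<Sum>l=block_start K..K. ?U k x * cos (real l * x + c)) \<partial>circ) = (\<Sum>l=block_start K..K. (\<integral>x. ?U k x * cos (real l * x + c) \<partial>circ))" if "k \<ge> 1" for k
      by (rule Bochner_Integration.integral_sum) (rule i[OF that])
    have 2: "(\<integral>x. (\<Sum>k=1..i. \<Sum>l=block_start K..K. ?U k x * cos (real l * x + c)) \<partial>circ) = (\<Sum>k=1..i. (\<integral>x. (\<Sum>l=block_start K..K. ?U k x * cos (real l * x + c)) \<partial>circ))"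
      by (rule Bochner_Integration.integral_sum) (rule Bochner_Integration.integrable_sum, rule i, simp)
    show ?thesis unfolding integral_divide_zero 2
      by (intro arg_cong2[of _ _ _ _ "(/)"] sum.cong refl 1) auto
  qed
  also have "(\<Sum>k=1..i. \<Sum>l=block_start K..K. (\<integral>x. ?U k x * cos (real l * x + c) \<partial>circ)) = (\<Sum>k=1..i. pi * test_coeff \<alpha> K c h k)"
  proof (intro sum.cong refl)
    fix k assume k: "k \<in> {1..i}"
    have "(\<Sum>l=block_start K..K. (\<integral>x. ?U k x * cos (real l * x + c) \<partial>circ)) = (\<Sum>l=block_start K..K. if k = l then pi * multiplier \<alpha> c k h else 0)"
      by (intro sum.cong refl fdiff1_cos_pairing(2)[OF \<alpha>]) (use k hK in auto)
    also have "\<dots> = pi * test_coeff \<alpha> K c h k" by (simp add: test_coeff_def sum.delta')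
    finally show "(\<Sum>l=block_start K..K. (\<integral>x. ?U k x * cos (real l * x + c) \<partial>circ)) = pi * test_coeff \<alpha> K c h k" .
  qed
  also have "(\<Sum>k=1..i. pi * test_coeff \<alpha> K c h k) / real K = pi / real K * (\<Sum>k=1..i. test_coeff \<alpha> K c h k)"
    by (simp add: sum_distrib_left sum_divide_distrib)
  finally show "(\<integral>x. fdiff1 \<alpha> h (cos_sum 0 i) (x - \<alpha> * h) * test_block K c x \<partial>circ) = pi / real K * (\<Sum>k=1..i. test_coeff \<alpha> K c h k)" .
qed

text \<open>The steps \<open>h1\<close> and \<open>h2\<close> enter only through products of one
  factor each, and the coefficients \<open>tail_sum d N k l\<close> do not depend on them; this is
  what allows averaging over the two steps separately.\<close>

lemma tensor_sum_pairing:
  fixes h1 h2 :: real and N :: nat and d :: "nat \<Rightarrow> nat \<Rightarrow> real"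
  assumes \<alpha>: "\<alpha>1 > 0" "\<alpha>2 > 0" and KL: "K \<ge> 1" "L \<ge> 1"
  defines "g \<equiv> tensor_sum d N (\<lambda>i x. fdiff1 \<alpha>1 h1 (cos_sum 0 i) (x - \<alpha>1 * h1)) (\<lambda>j y. fdiff1 \<alpha>2 h2 (cos_sum 0 j) (y - \<alpha>2 * h2))"
  shows "(\<integral>z. g z * (test_block K c1 (fst z) * test_block L c2 (snd z)) \<partial>torus) =
    pi^2 / (real K * real L) * (\<Sum>k=1..N. \<Sum>l=1..N. tail_sum d N k l * (test_coeff \<alpha>1 K c1 h1 k * test_coeff \<alpha>2 L c2 h2 l))"
proof -
  define u where "u i x = fdiff1 \<alpha>1 h1 (cos_sum 0 i) (x - \<alpha>1 * h1) * test_block K c1 x" for i x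
  define v where "v j y = fdiff1 \<alpha>2 h2 (cos_sum 0 j) (y - \<alpha>2 * h2) * test_block L c2 y" for j y
  have cu: "continuous_on UNIV (u i)" "continuous_on UNIV (v i)" for i
    unfolding u_def v_def by (intro continuous_on_mult fdiff1_cos_sum_pairing(1)[OF \<alpha>(1) KL(1)] fdiff1_cos_sum_pairing(1)[OF \<alpha>(2) KL(2)] continuous_on_test_block)+
  have i: "integrable torus (\<lambda>z. d i j * (u i (fst z) * v j (snd z)))" for i j
    by (intro integrable_mult_right integral_torus_prod(1) cu)
  have "(\<integral>z. g z * (test_block K c1 (fst z) * test_block L c2 (snd z)) \<partial>torus) = (\<integral>z. (\<Sum>i=1..N. \<Sum>j=1..N. d i j * (u i (fst z) * v j (snd z))) \<partial>torus)"
    by (intro Bochner_Integration.integral_cong refl)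
       (simp add: g_def tensor_sum_double u_def v_def sum_distrib_left mult_ac)
  also have "\<dots> = (\<Sum>i=1..N. \<Sum>j=1..N. d i j * (\<integral>z. u i (fst z) * v j (snd z) \<partial>torus))"
  proof -
    have 1: "(\<integral>z. (\<Sum>j=1..N. d i j * (u i (fst z) * v j (snd z))) \<partial>torus) = (\<Sum>j=1..N. (\<integral>z. d i j * (u i (fst z) * v j (snd z)) \<partial>torus))" for i
      by (rule Bochner_Integration.integral_sum) (rule i)
    have 2: "(\<integral>z. (\<Sum>i=1..N. \<Sum>j=1..N. d i j * (u i (fst z) * v j (snd z))) \<partial>torus) = (\<Sum>i=1..N. (\<integral>z. (\<Sum>j=1..N. d i j * (u i (fst z) * v j (snd z))) \<partial>torus))"
      by (rule Bochner_Integration.integral_sum) (rule Bochner_Integration.integrable_sum, rule i)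
    show ?thesis unfolding 2 1 integral_mult_right_zero ..
  qed
  also have "\<dots> = (\<Sum>i=1..N. \<Sum>j=1..N. pi^2 / (real K * real L) * (d i j * ((\<Sum>k=1..i. test_coeff \<alpha>1 K c1 h1 k) * (\<Sum>l=1..j. test_coeff \<alpha>2 L c2 h2 l))))"
  proof (intro sum.cong refl)
    fix i j
    have "(\<integral>z. u i (fst z) * v j (snd z) \<partial>torus) = (pi / real K * (\<Sum>k=1..i. test_coeff \<alpha>1 K c1 h1 k)) * (pi / real L * (\<Sum>l=1..j. test_coeff \<alpha>2 L c2 h2 l))"
      unfolding integral_torus_prod(2)[OF cu(1) cu(2)] unfolding u_def v_def
      by (simp only: fdiff1_cos_sum_pairing(2)[OF \<alpha>(1) KL(1)] fdiff1_cos_sum_pairing(2)[OF \<alpha>(2) KL(2)])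
    thus "d i j * (\<integral>z. u i (fst z) * v j (snd z) \<partial>torus) = pi^2 / (real K * real L) * (d i j * ((\<Sum>k=1..i. test_coeff \<alpha>1 K c1 h1 k) * (\<Sum>l=1..j. test_coeff \<alpha>2 L c2 h2 l)))"
      by (simp add: power2_eq_square)
  qed
  also have "\<dots> = pi^2 / (real K * real L) * (\<Sum>i=1..N. \<Sum>j=1..N. d i j * ((\<Sum>k=1..i. test_coeff \<alpha>1 K c1 h1 k) * (\<Sum>l=1..j. test_coeff \<alpha>2 L c2 h2 l)))"
    by (simp only: sum_distrib_left)
  finally show ?thesis unfolding sum_partial_sums2 .
qed

text \<open>A mean over steps comparable to \<open>\<delta>\<close>; smaller steps are left out
  because the multiplier of a fixed frequency becomes too small there.\<close>

definition step_mean :: "real \<Rightarrow> (real \<Rightarrow> real) \<Rightarrow> real" where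
  "step_mean \<delta> f = (\<integral>h. f h \<partial>(lebesgue_on {\<delta>/2..\<delta>})) / (\<delta> / 2)"

lemma finite_measure_interval: "finite_measure (lebesgue_on {a..b::real})"
  by (intro finite_measureI) (simp add: emeasure_restrict_space emeasure_lborel_Icc_eq)

lemma integrable_interval_bounded:
  fixes f :: "real \<Rightarrow> real"
  assumes "f \<in> borel_measurable borel" "\<And>h. \<bar>f h\<bar> \<le> B"
  shows "integrable (lebesgue_on {a..b}) f"
proof -
  interpret finite_measure "lebesgue_on {a..b}" by (rule finite_measure_interval)
  show ?thesis
    by (rule integrable_const_bound[where B = B]) (use assms in \<open>auto intro!: measurable_restrict_space1 measurable_completion\<close>)
qed

lemma step_mean_lower:
  assumes d: "\<delta> > 0" and f: "f \<in> borel_measurable borel" "\<And>h. \<bar>f h\<bar> \<le> B" and ge: "\<And>h. \<delta>/2 \<le> h \<Longrightarrow> h \<le> \<delta> \<Longrightarrow> c \<le> f h"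
  shows "c \<le> step_mean \<delta> f"
proof -
  interpret finite_measure "lebesgue_on {\<delta>/2..\<delta>}" by (rule finite_measure_interval)
  have "c * (\<delta> / 2) = (\<integral>h. c \<partial>(lebesgue_on {\<delta>/2..\<delta>}))" using d by (simp add: measure_restrict_space)
  also have "\<dots> \<le> (\<integral>h. f h \<partial>(lebesgue_on {\<delta>/2..\<delta>}))"
    by (intro integral_mono_AE integrable_interval_bounded[OF f]) (use ge in \<open>auto intro!: AE_I2\<close>)
  finally show ?thesis using d by (simp add: step_mean_def pos_le_divide_eq)
qed

text \<open>The mean is positive and preserves constants, so an affine inequality valid at every
  step survives averaging. Linearity in the functions \<open>f t\<close> is essential, which is why
  \<open>p\<close>-th powers have to be linearised beforehand.\<close>

lemma step_mean_sum_upper: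
  assumes d: "\<delta> > 0" and T: "finite T"
    and f: "\<And>t. t \<in> T \<Longrightarrow> f t \<in> borel_measurable borel" "\<And>t h. t \<in> T \<Longrightarrow> \<bar>f t h\<bar> \<le> B t"
    and le: "\<And>h. \<delta>/2 \<le> h \<Longrightarrow> h \<le> \<delta> \<Longrightarrow> b + (\<Sum>t\<in>T. D t * f t h) \<le> X"
  shows "b + (\<Sum>t\<in>T. D t * step_mean \<delta> (f t)) \<le> X"
proof -
  interpret finite_measure "lebesgue_on {\<delta>/2..\<delta>}" by (rule finite_measure_interval)
  let ?M = "lebesgue_on {\<delta>/2..\<delta>}"
  have i: "integrable ?M (f t)" if "t \<in> T" for t
    by (rule integrable_interval_bounded[OF f(1)[OF that] f(2)[OF that]])
  have i2: "integrable ?M (\<lambda>h. \<Sum>t\<in>T. D t * f t h)"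
    by (intro Bochner_Integration.integrable_sum integrable_mult_right i)
  have m: "(\<integral>h. b \<partial>?M) = b * (\<delta> / 2)" "(\<integral>h. X \<partial>?M) = X * (\<delta> / 2)" using d by (simp_all add: measure_restrict_space)
  have "(\<integral>h. b + (\<Sum>t\<in>T. D t * f t h) \<partial>?M) \<le> (\<integral>h. X \<partial>?M)"
    by (intro integral_mono_AE Bochner_Integration.integrable_add i2) (use le in \<open>auto intro!: AE_I2\<close>)
  also have "(\<integral>h. b + (\<Sum>t\<in>T. D t * f t h) \<partial>?M) = b * (\<delta> / 2) + (\<integral>h. (\<Sum>t\<in>T. D t * f t h) \<partial>?M)"
    by (subst Bochner_Integration.integral_add) (use i2 in \<open>simp_all only: m finite_measure.integrable_const[OF finite_measure_interval]\<close>)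
  also have "(\<integral>h. (\<Sum>t\<in>T. D t * f t h) \<partial>?M) = (\<Sum>t\<in>T. D t * (\<integral>h. f t h \<partial>?M))"
    by (subst Bochner_Integration.integral_sum) (auto intro!: integrable_mult_right i)
  finally have "b * (\<delta> / 2) + (\<Sum>t\<in>T. D t * (\<integral>h. f t h \<partial>?M)) \<le> X * (\<delta> / 2)" unfolding m .
  hence "(b * (\<delta> / 2) + (\<Sum>t\<in>T. D t * (\<integral>h. f t h \<partial>?M))) / (\<delta> / 2) \<le> X"
    using d by (simp add: pos_divide_le_eq)
  moreover have "(b * (\<delta> / 2) + (\<Sum>t\<in>T. D t * (\<integral>h. f t h \<partial>?M))) / (\<delta> / 2) = b + (\<Sum>t\<in>T. D t * step_mean \<delta> (f t))"
    unfolding add_divide_distrib step_mean_def sum_divide_distrib times_divide_eq_right using d by simp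
  ultimately show ?thesis by simp
qed

text \<open>One step is averaged at a time: with \<open>h2\<close> fixed the expression is linear in
  the functions \<open>f t\<close>, and afterwards it is linear in the functions
  \<open>g t\<close>.\<close>

lemma step_mean_double_sum_upper:
  assumes d: "\<delta>1 > 0" "\<delta>2 > 0" and T: "finite T"
    and f: "\<And>t. t \<in> T \<Longrightarrow> f t \<in> borel_measurable borel" "\<And>t h. t \<in> T \<Longrightarrow> \<bar>f t h\<bar> \<le> B t"
    and g: "\<And>t. t \<in> T \<Longrightarrow> g t \<in> borel_measurable borel" "\<And>t h. t \<in> T \<Longrightarrow> \<bar>g t h\<bar> \<le> B' t"
    and le: "\<And>h1 h2. \<delta>1/2 \<le> h1 \<Longrightarrow> h1 \<le> \<delta>1 \<Longrightarrow> \<delta>2/2 \<le> h2 \<Longrightarrow> h2 \<le> \<delta>2 \<Longrightarrow> b + (\<Sum>t\<in>T. D t * (f t h1 * g t h2)) \<le> X"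
  shows "b + (\<Sum>t\<in>T. D t * (step_mean \<delta>1 (f t) * step_mean \<delta>2 (g t))) \<le> X"
proof -
  have "b + (\<Sum>t\<in>T. (D t * step_mean \<delta>1 (f t)) * step_mean \<delta>2 (g t)) \<le> X"
  proof (rule step_mean_sum_upper[OF d(2) T g])
    fix h2 assume h2: "\<delta>2/2 \<le> h2" "h2 \<le> \<delta>2"
    have "b + (\<Sum>t\<in>T. (D t * g t h2) * step_mean \<delta>1 (f t)) \<le> X"
      by (rule step_mean_sum_upper[OF d(1) T f]) (use le h2 in \<open>simp_all add: mult_ac\<close>)
    thus "b + (\<Sum>t\<in>T. (D t * step_mean \<delta>1 (f t)) * g t h2) \<le> X" by (simp add: mult_ac)
  qed
  thus ?thesis by (simp add: mult_ac)
qed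

lemma step_mean_cos_bound:
  fixes \<delta> w :: real
  assumes d: "\<delta> > 0" and w: "w > 0"
  shows "\<bar>\<integral>h. cos (w * h) \<partial>(lebesgue_on {\<delta>/2..\<delta>})\<bar> \<le> 2 / w"
proof -
  have "((\<lambda>h. cos (w * h)) has_integral (sin (w * \<delta>) / w - sin (w * (\<delta>/2)) / w)) {\<delta>/2..\<delta>}"
  proof (rule fundamental_theorem_of_calculus)
    fix x
    have "((\<lambda>x. sin (w * x) / w) has_real_derivative cos (w * x)) (at x within {\<delta>/2..\<delta>})"
      using w by (auto intro!: derivative_eq_intros)
    thus "((\<lambda>x. sin (w * x) / w) has_vector_derivative cos (w * x)) (at x within {\<delta>/2..\<delta>})"
      by (simp add: has_real_derivative_iff_has_vector_derivative)
  qed (use d in simp)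
  moreover have "integrable (lebesgue_on {\<delta>/2..\<delta>}) (\<lambda>h. cos (w * h))"
    by (intro continuous_imp_integrable_real continuous_intros)
  ultimately have "(\<integral>h. cos (w * h) \<partial>(lebesgue_on {\<delta>/2..\<delta>})) = (sin (w * \<delta>) - sin (w * (\<delta>/2))) / w"
    by (subst lebesgue_integral_eq_integral) (auto simp: integral_unique diff_divide_distrib)
  moreover have "\<bar>sin (w * \<delta>) - sin (w * (\<delta>/2))\<bar> \<le> 2"
    using abs_sin_le_one[of "w * \<delta>"] abs_sin_le_one[of "w * (\<delta>/2)"] by linarith
  ultimately show ?thesis using w by (simp only: abs_divide abs_of_pos divide_right_mono less_imp_le)
qed

text \<open>The term \<open>v = 0\<close> of the multiplier is the constant 1, with integral
  \<open>\<delta> / 2\<close>. The other cosines oscillate in \<open>h\<close> and have integrals of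
  modulus at most \<open>2 / k\<close>; together they contribute at most
  \<open>diff_coeff_sum \<alpha> * (2 / k)\<close>, which is at most half of the main term.\<close>

lemma step_mean_multiplier_high:
  assumes \<alpha>: "\<alpha> > 0" and d: "\<delta> > 0" and k: "k \<ge> 1" "real k * \<delta> \<ge> 8 * diff_coeff_sum \<alpha>"
  shows "1 / 2 \<le> step_mean \<delta> (multiplier \<alpha> 0 k)"
proof -
  let ?M = "lebesgue_on {\<delta>/2..\<delta>}"
  interpret finite_measure ?M by (rule finite_measure_interval)
  define q where "q v = (\<integral>h. cos (real v * (real k * h) + 0) \<partial>?M)" for v :: nat
  have mM: "measure ?M (space ?M) = \<delta> / 2" using d by (simp add: measure_restrict_space)
  have i: "integrable ?M (\<lambda>h. cos (real v * (real k * h) + 0))" for v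
    by (intro continuous_imp_integrable_real continuous_intros)
  have S: "diff_coeff_sum \<alpha> \<ge> 1" by (rule diff_coeff_sum_ge_1[OF \<alpha>])
  have "(\<integral>h. multiplier \<alpha> 0 k h \<partial>?M) = (\<Sum>v. \<integral>h. diff_coeff \<alpha> v * cos (real v * (real k * h) + 0) \<partial>?M)"
    unfolding multiplier_def
  proof (rule integral_suminf)
    show "integrable ?M (\<lambda>h. diff_coeff \<alpha> v * cos (real v * (real k * h) + 0))" for v
      by (intro integrable_mult_right i)
    have le: "norm (diff_coeff \<alpha> v * cos (real v * (real k * h) + 0)) \<le> \<bar>diff_coeff \<alpha> v\<bar>" for v h
      using abs_cos_le_one by (simp add: abs_mult mult_left_le)
    show "AE h in ?M. summable (\<lambda>v. norm (diff_coeff \<alpha> v * cos (real v * (real k * h) + 0)))"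
      by (intro AE_I2 summable_comparison_test'[OF summable_diff_coeff[OF \<alpha>], of 0]) (use le in simp)
    show "summable (\<lambda>v. \<integral>h. norm (diff_coeff \<alpha> v * cos (real v * (real k * h) + 0)) \<partial>?M)"
    proof (rule summable_comparison_test'[OF summable_mult2[OF summable_diff_coeff[OF \<alpha>], of "\<delta> / 2"], of 0])
      fix v
      have "(\<integral>h. norm (diff_coeff \<alpha> v * cos (real v * (real k * h) + 0)) \<partial>?M) \<le> (\<integral>h. \<bar>diff_coeff \<alpha> v\<bar> \<partial>?M)"
        by (rule integral_mono) (use le i in \<open>auto intro!: integrable_norm integrable_mult_right simp del: norm_mult\<close>)
      also have "\<dots> = \<bar>diff_coeff \<alpha> v\<bar> * (\<delta> / 2)" unfolding lebesgue_integral_const mM by simp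
      moreover have "0 \<le> (\<integral>h. norm (diff_coeff \<alpha> v * cos (real v * (real k * h) + 0)) \<partial>?M)"
        by (intro Bochner_Integration.integral_nonneg) (rule norm_ge_zero)
      ultimately show "norm (\<integral>h. norm (diff_coeff \<alpha> v * cos (real v * (real k * h) + 0)) \<partial>?M) \<le> \<bar>diff_coeff \<alpha> v\<bar> * (\<delta> / 2)"
        by (subst real_norm_def[of "\<integral>h. norm (diff_coeff \<alpha> v * cos (real v * (real k * h) + 0)) \<partial>?M"]) linarith
    qed
  qed
  hence eq: "(\<integral>h. multiplier \<alpha> 0 k h \<partial>?M) = (\<Sum>v. diff_coeff \<alpha> v * q v)" by (simp add: q_def)
  have q0: "q 0 = \<delta> / 2" unfolding q_def using mM by simp
  have qv: "\<bar>q v\<bar> \<le> 2 / real k" if "v \<ge> 1" for v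
  proof -
    have "\<bar>q v\<bar> \<le> 2 / (real v * real k)"
      using step_mean_cos_bound[OF d, of "real v * real k"] that k by (simp add: q_def mult.assoc)
    also have "\<dots> \<le> 2 / (1 * real k)" using that k by (intro divide_left_mono mult_right_mono mult_pos_pos) auto
    finally show ?thesis by simp
  qed
  have bnd: "\<bar>diff_coeff \<alpha> (Suc v) * q (Suc v)\<bar> \<le> \<bar>diff_coeff \<alpha> (Suc v)\<bar> * (2 / real k)" for v
    unfolding abs_mult by (intro mult_left_mono qv) auto
  have sS: "summable (\<lambda>v. \<bar>diff_coeff \<alpha> (Suc v)\<bar>)" using summable_diff_coeff[OF \<alpha>] by (subst summable_Suc_iff)
  have s3: "summable (\<lambda>v. \<bar>diff_coeff \<alpha> (Suc v)\<bar> * (2 / real k))" by (rule summable_mult2[OF sS])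
  have s2: "summable (\<lambda>v. \<bar>diff_coeff \<alpha> (Suc v) * q (Suc v)\<bar>)"
    by (rule summable_comparison_test'[OF s3, of 0]) (use bnd in simp)
  have "summable (\<lambda>v. diff_coeff \<alpha> v * q v)"
    using summable_rabs_cancel[OF s2] by (subst (asm) summable_Suc_iff)
  from suminf_split_head[OF this]
  have "(\<Sum>v. diff_coeff \<alpha> v * q v) = \<delta> / 2 + (\<Sum>v. diff_coeff \<alpha> (Suc v) * q (Suc v))" by (simp add: q0)
  moreover have "\<bar>\<Sum>v. diff_coeff \<alpha> (Suc v) * q (Suc v)\<bar> \<le> diff_coeff_sum \<alpha> * (2 / real k)"
  proof -
    have "\<bar>\<Sum>v. diff_coeff \<alpha> (Suc v) * q (Suc v)\<bar> \<le> (\<Sum>v. \<bar>diff_coeff \<alpha> (Suc v) * q (Suc v)\<bar>)" by (rule summable_rabs[OF s2])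
    also have "\<dots> \<le> (\<Sum>v. \<bar>diff_coeff \<alpha> (Suc v)\<bar> * (2 / real k))" by (rule suminf_le[OF bnd s2 s3])
    also have "\<dots> = (\<Sum>v. \<bar>diff_coeff \<alpha> (Suc v)\<bar>) * (2 / real k)" by (rule suminf_mult2[symmetric, OF sS])
    also have "\<dots> \<le> diff_coeff_sum \<alpha> * (2 / real k)"
      using suminf_split_head[OF summable_diff_coeff[OF \<alpha>]] by (intro mult_right_mono) (auto simp: diff_coeff_sum_def)
    finally show ?thesis .
  qed
  moreover have "diff_coeff_sum \<alpha> * (2 / real k) \<le> \<delta> / 4" using k by (simp add: field_simps)
  ultimately have "\<delta> / 4 \<le> (\<integral>h. multiplier \<alpha> 0 k h \<partial>?M)" unfolding eq by linarith
  hence "\<delta> / 4 / (\<delta> / 2) \<le> step_mean \<delta> (multiplier \<alpha> 0 k)" unfolding step_mean_def using d by (intro divide_right_mono) auto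
  thus ?thesis using d by simp
qed

text \<open>The multiplier may vanish at individual steps, so it is averaged over the steps. Frequencies
  between \<open>n\<close> and \<open>C * n\<close>, where the average has no usable lower bound, are replaced by \<open>K0 = n\<close>,
  which monotonicity of the coefficients permits.\<close>

lemma test_multipliers:
  assumes \<alpha>: "\<alpha> > 0"
  shows "\<exists>\<epsilon> C c. 0 < \<epsilon> \<and> \<epsilon> \<le> 1 \<and> (1::nat) \<le> C \<and> 0 < c \<and> (\<forall>n\<ge>1. \<forall>K\<ge>1. \<exists>K0 \<phi>. 1 \<le> K0 \<and> K0 \<le> K \<and> K \<le> C * K0 \<and>
     (\<forall>k. block_start K0 \<le> k \<and> k \<le> K0 \<longrightarrow> c * psi n K powr \<alpha> \<le> step_mean (\<epsilon> / real n) (multiplier \<alpha> \<phi> k)))"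
proof -
  \<comment> \<open>Steps up to \<open>\<epsilon> / n\<close> keep
    \<open>\<alpha> * k * h / 2\<close> below \<open>pi / 3\<close> for \<open>k <= n\<close>, so
    that the cosine left over in the multiplier is at least 1/2; \<open>\<epsilon> <= 1\<close>
    keeps the steps admissible for the modulus at \<open>1 / n\<close>.\<close>
  define \<epsilon> where "\<epsilon> = min 1 (1 / \<alpha>)"
  have e: "0 < \<epsilon>" "\<epsilon> \<le> 1" "\<alpha> * \<epsilon> \<le> 1" using \<alpha> by (auto simp: \<epsilon>_def min_def field_simps)
  have S: "diff_coeff_sum \<alpha> \<ge> 1" by (rule diff_coeff_sum_ge_1[OF \<alpha>])
  \<comment> \<open>If \<open>K >= C * n\<close>, every \<open>k\<close> in the block of
    \<open>K\<close> is at least \<open>C * n / 2\<close>, hence \<open>k * (\<epsilon> / n) >= C *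
    \<epsilon> / 2 >= 8 * diff_coeff_sum \<alpha>\<close>, the threshold of
    \<open>step_mean_multiplier_high\<close>.\<close>
  define C where "C = nat \<lceil>16 * diff_coeff_sum \<alpha> / \<epsilon>\<rceil> + 1"
  have C: "1 \<le> C" "real C \<ge> 16 * diff_coeff_sum \<alpha> / \<epsilon>" unfolding C_def by linarith+
  define c where "c = min ((\<epsilon> / 8) powr \<alpha> / 2) (1 / 2)"
  have c: "0 < c" "c \<le> (\<epsilon> / 8) powr \<alpha> / 2" "c \<le> 1 / 2" using e by (auto simp: c_def)
  \<comment> \<open>The phase \<open>\<alpha> * pi / 2\<close> cancels the rotation of the
    multiplier up to the small angle \<open>\<alpha> * k * h / 2\<close>; thus the bound holds at
    every single step of the interval and not only on average.\<close>
  have low: "c * (real K0 / real n) powr \<alpha> \<le> step_mean (\<epsilon> / real n) (multiplier \<alpha> (\<alpha> * pi / 2) k)"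
    if n: "n \<ge> 1" and K0: "K0 \<le> n" and k: "block_start K0 \<le> k" "k \<le> K0" "K0 \<ge> 1" for n K0 k
  proof (rule step_mean_lower)
    define \<delta> where "\<delta> = \<epsilon> / real n"
    show d: "0 < \<epsilon> / real n" using e n by simp
    show "multiplier \<alpha> (\<alpha> * pi / 2) k \<in> borel_measurable borel" by measurable
    show "\<bar>multiplier \<alpha> (\<alpha> * pi / 2) k h\<bar> \<le> diff_coeff_sum \<alpha>" for h by (rule multiplier_bound[OF \<alpha>])
    fix h assume h: "\<epsilon> / real n / 2 \<le> h" "h \<le> \<epsilon> / real n"
    define th where "th = real k * h"
    have "real k \<le> real n" using k K0 by simp
    hence "th \<le> real n * (\<epsilon> / real n)" unfolding th_def using h d by (intro mult_mono) auto
    hence th1: "th \<le> \<epsilon>" using n by simp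
    have kern2: "real K0 / 2 \<le> real k" using block_start(3)[of K0] k by linarith
    have "real K0 / 2 * (\<epsilon> / real n / 2) \<le> th" unfolding th_def using kern2 h d by (intro mult_mono) auto
    hence th2: "\<epsilon> / 4 * (real K0 / real n) \<le> th" by (simp add: mult_ac)
    have th0: "0 \<le> th" using th2 e by (intro order_trans[OF _ th2]) auto
    have pi3: "pi > 3" by (rule pi_gt3)
    have "multiplier \<alpha> (\<alpha> * pi / 2) k h = (2 * sin (th / 2)) powr \<alpha> * cos (\<alpha> * pi / 2 + \<alpha> * (th - pi) / 2)"
      using diff_coeff_cos_sums[OF \<alpha>, of th "\<alpha> * pi / 2"] th0 th1 e pi3 by (simp add: multiplier_def sums_iff th_def)
    also have "\<alpha> * pi / 2 + \<alpha> * (th - pi) / 2 = \<alpha> * th / 2" by (simp add: field_simps)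
    finally have eq: "multiplier \<alpha> (\<alpha> * pi / 2) k h = (2 * sin (th / 2)) powr \<alpha> * cos (\<alpha> * th / 2)" .
    have "\<alpha> * th \<le> \<alpha> * \<epsilon>" using th1 \<alpha> by (intro mult_left_mono) auto
    hence "\<alpha> * th / 2 \<le> pi / 3" using e pi3 by linarith
    hence "cos (pi / 3) \<le> cos (\<alpha> * th / 2)"
      using th0 \<alpha> by (intro cos_monotone_0_pi_le) auto
    hence cos: "1 / 2 \<le> cos (\<alpha> * th / 2)" by (simp add: cos_60)
    have "th / 4 \<le> sin (th / 2)" using sin_ge_half[of "th / 2"] th0 th1 e pi3 by simp
    hence "\<epsilon> / 8 * (real K0 / real n) \<le> 2 * sin (th / 2)" using th2 by simp
    hence "(\<epsilon> / 8 * (real K0 / real n)) powr \<alpha> \<le> (2 * sin (th / 2)) powr \<alpha>"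
      using \<alpha> e by (intro powr_mono2) auto
    hence "(\<epsilon> / 8 * (real K0 / real n)) powr \<alpha> * (1 / 2) \<le> multiplier \<alpha> (\<alpha> * pi / 2) k h"
      unfolding eq using cos by (intro mult_mono) auto
    moreover have "(\<epsilon> / 8 * (real K0 / real n)) powr \<alpha> * (1 / 2) = (\<epsilon> / 8) powr \<alpha> / 2 * (real K0 / real n) powr \<alpha>"
      using e by (subst powr_mult) auto
    moreover have "c * (real K0 / real n) powr \<alpha> \<le> (\<epsilon> / 8) powr \<alpha> / 2 * (real K0 / real n) powr \<alpha>"
      by (intro mult_right_mono c) auto
    ultimately show "c * (real K0 / real n) powr \<alpha> \<le> multiplier \<alpha> (\<alpha> * pi / 2) k h" by linarith
  qed
  have "\<exists>K0 \<phi>. 1 \<le> K0 \<and> K0 \<le> K \<and> K \<le> C * K0 \<and>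
     (\<forall>k. block_start K0 \<le> k \<and> k \<le> K0 \<longrightarrow> c * psi n K powr \<alpha> \<le> step_mean (\<epsilon> / real n) (multiplier \<alpha> \<phi> k))"
    if n: "n \<ge> 1" and K: "K \<ge> 1" for n K
  proof -
    consider "K \<le> n" | "n < K" "K < C * n" | "n < K" "C * n \<le> K" by linarith
    thus ?thesis
    proof cases
      case 1
      have "psi n K = real K / real n" using 1 n by (simp add: psi_def)
      thus ?thesis using 1 low[OF n 1] K C by (intro exI[of _ K] exI[of _ "\<alpha> * pi / 2"]) auto
    next
      case 2
      have "psi n K powr \<alpha> \<le> 1" using \<alpha> by (intro powr_le1) auto
      hence "c * psi n K powr \<alpha> \<le> c * (real n / real n) powr \<alpha>" using c n by (intro mult_left_mono) auto
      thus ?thesis using 2 low[OF n order_refl] n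
        by (intro exI[of _ n] exI[of _ "\<alpha> * pi / 2"]) (auto intro: order_trans)
    next
      case 3
      have "c * psi n K powr \<alpha> \<le> 1 / 2 * 1" using \<alpha> c by (intro mult_mono powr_le1) auto
      moreover have "1 / 2 \<le> step_mean (\<epsilon> / real n) (multiplier \<alpha> 0 k)" if k: "block_start K \<le> k" for k
      proof (rule step_mean_multiplier_high[OF \<alpha>])
        show "0 < \<epsilon> / real n" using e n by simp
        show "k \<ge> 1" using block_start(1)[OF K] k by simp
        have "real C * real n / 2 \<le> real K / 2" using 3 by (simp flip: of_nat_mult)
        also have "\<dots> \<le> real k" using block_start(3)[of K] k by linarith
        finally have "real C * real n / 2 * (\<epsilon> / real n) \<le> real k * (\<epsilon> / real n)" using e by (intro mult_right_mono) auto
        moreover have "real C * real n / 2 * (\<epsilon> / real n) = real C * \<epsilon> / 2" using n by simp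
        moreover have "16 * diff_coeff_sum \<alpha> \<le> real C * \<epsilon>" using C(2) e by (simp add: pos_divide_le_eq)
        ultimately show "8 * diff_coeff_sum \<alpha> \<le> real k * (\<epsilon> / real n)" by linarith
      qed
      ultimately show ?thesis using K C by (intro exI[of _ K] exI[of _ 0]) force
    qed
  qed
  thus ?thesis using e C c by blast
qed

lemma tail_sum_antimono:
  assumes "\<And>i j. d i j \<ge> 0" "k \<le> k'" "l \<le> l'"
  shows "tail_sum d N k' l' \<le> tail_sum d N k l"
proof -
  have "tail_sum d N k' l' \<le> (\<Sum>i=k'..N. \<Sum>j=l..N. d i j)"
    unfolding tail_sum_def by (intro sum_mono sum_mono2) (use assms in auto)
  also have "\<dots> \<le> tail_sum d N k l"
    unfolding tail_sum_def by (intro sum_mono2 sum_nonneg) (use assms in auto)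
  finally show ?thesis .
qed

text \<open>The price of testing with a block at \<open>K0\<close> instead of \<open>K\<close>: the
  dual Schur test is to be applied with \<open>kern K\<close>, and the two indices are
  comparable.\<close>

lemma kern_rescale: assumes "K \<le> C * K0" "1 \<le> C" shows "kern K0 x \<le> real C * kern K x"
proof -
  have "real K * rho x \<le> real (C * K0) * rho x" using assms(1) by (intro mult_right_mono of_nat_mono) auto
  hence "1 + real K * rho x \<le> real C * (1 + real K0 * rho x)" using assms by (simp add: algebra_simps)
  moreover have "1 + real K * rho x > 0" "1 + real K0 * rho x > 0" by (simp_all add: add_pos_nonneg)
  ultimately show ?thesis by (simp add: kern_def field_simps)
qed

lemma borel_measurable_test_coeff: "(\<lambda>h. test_coeff \<alpha> K c h k) \<in> borel_measurable borel"
  unfolding test_coeff_def by (cases "block_start K \<le> k \<and> k \<le> K") auto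

lemma test_coeff_bound: "\<alpha> > 0 \<Longrightarrow> \<bar>test_coeff \<alpha> K c h k\<bar> \<le> diff_coeff_sum \<alpha>"
  using multiplier_bound[of \<alpha> c k h] diff_coeff_sum_ge_1[of \<alpha>] by (auto simp: test_coeff_def)

lemma step_mean_test_coeff: "step_mean \<delta> (\<lambda>h. test_coeff \<alpha> K c h k) = (if block_start K \<le> k \<and> k \<le> K then step_mean \<delta> (multiplier \<alpha> c k) else 0)"
  by (auto simp: step_mean_def test_coeff_def)

text \<open>Testing against cosine blocks gives, for every pair of steps, a bound on a sum of \<open>p\<close>-th powers of
  linear functionals. Replacing each power by its tangent at the averaged value makes the sum linear, so
  that the average over the steps can be taken inside.\<close>

lemma modulus_lower_poly:
  assumes p: "p > 1" and \<alpha>: "\<alpha>1 > 0" "\<alpha>2 > 0"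
  shows "\<exists>C>0. \<forall>d N n1 n2 X. (\<forall>i j. d i j \<ge> 0) \<longrightarrow> n1 \<ge> 1 \<longrightarrow> n2 \<ge> 1 \<longrightarrow>
     (\<forall>h1 h2. \<bar>h1\<bar> \<le> 1 / real n1 \<longrightarrow> \<bar>h2\<bar> \<le> 1 / real n2 \<longrightarrow> Lp_int p (frac_diff1 \<alpha>1 h1 (frac_diff2 \<alpha>2 h2 (tensor_sum d N (cos_sum 0) (cos_sum 0)))) \<le> X) \<longrightarrow>
     coeff_sum p (tail_sum d N) N n1 n2 \<alpha>1 \<alpha>2 \<le> C * X"
proof -
  obtain C where C: "C > 0" "\<And>g. g \<in> borel_measurable torus \<Longrightarrow> integrable torus (\<lambda>z. \<bar>g z\<bar> powr p) \<Longrightarrow>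
    (\<forall>k\<ge>1. \<forall>l\<ge>1. integrable torus (\<lambda>z. \<bar>g z\<bar> * kern2 k l z)) \<and>
    (\<forall>R. (\<Sum>k=1..R. \<Sum>l=1..R. (real k * real l) powr (p - 2) * (\<integral>z. \<bar>g z\<bar> * kern2 k l z \<partial>torus) powr p)
      \<le> C * (\<integral>z. \<bar>g z\<bar> powr p \<partial>torus))"
    using schur_function_to_series[OF p] by blast
  obtain \<epsilon>1 C1 c1 where 1: "0 < \<epsilon>1" "\<epsilon>1 \<le> 1" "1 \<le> C1" "0 < c1"
    "\<And>n K. n \<ge> 1 \<Longrightarrow> K \<ge> 1 \<Longrightarrow> \<exists>K0 \<phi>. 1 \<le> K0 \<and> K0 \<le> K \<and> K \<le> C1 * K0 \<and>
     (\<forall>k. block_start K0 \<le> k \<and> k \<le> K0 \<longrightarrow> c1 * psi n K powr \<alpha>1 \<le> step_mean (\<epsilon>1 / real n) (multiplier \<alpha>1 \<phi> k))"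
    using test_multipliers[OF \<alpha>(1)] by blast
  obtain \<epsilon>2 C2 c2 where 2: "0 < \<epsilon>2" "\<epsilon>2 \<le> 1" "1 \<le> C2" "0 < c2"
    "\<And>n K. n \<ge> 1 \<Longrightarrow> K \<ge> 1 \<Longrightarrow> \<exists>K0 \<phi>. 1 \<le> K0 \<and> K0 \<le> K \<and> K \<le> C2 * K0 \<and>
     (\<forall>k. block_start K0 \<le> k \<and> k \<le> K0 \<longrightarrow> c2 * psi n K powr \<alpha>2 \<le> step_mean (\<epsilon>2 / real n) (multiplier \<alpha>2 \<phi> k))"
    using test_multipliers[OF \<alpha>(2)] by blast
  \<comment> \<open>Each test block contributes a factor 2, \<open>C1\<close> and \<open>C2\<close>
    come from the change of index in the kernels, and \<open>pi^2\<close> from the normalisation of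
    the pairing.\<close>
  define D where "D = 4 * real C1 * real C2 / pi^2"
  have D: "D > 0" unfolding D_def using 1 2 by simp
  define c where "c = c1 * c2"
  have c: "c > 0" using 1 2 by (simp add: c_def)
  have p0: "p > 0" using p by simp
  have "coeff_sum p (tail_sum d N) N n1 n2 \<alpha>1 \<alpha>2 \<le> (4 / c) powr p * (D powr p * C) * X"
    if d: "\<And>i j. d i j \<ge> 0" and n: "n1 \<ge> 1" "n2 \<ge> 1"
      and X: "\<And>h1 h2. \<bar>h1\<bar> \<le> 1 / real n1 \<Longrightarrow> \<bar>h2\<bar> \<le> 1 / real n2 \<Longrightarrow> Lp_int p (frac_diff1 \<alpha>1 h1 (frac_diff2 \<alpha>2 h2 (tensor_sum d N (cos_sum 0) (cos_sum 0)))) \<le> X"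
    for d N n1 n2 X
  proof -
    have "\<forall>K\<in>{1..}. \<exists>x. 1 \<le> fst x \<and> fst x \<le> K \<and> K \<le> C1 * fst x \<and>
     (\<forall>k. block_start (fst x) \<le> k \<and> k \<le> fst x \<longrightarrow> c1 * psi n1 K powr \<alpha>1 \<le> step_mean (\<epsilon>1 / real n1) (multiplier \<alpha>1 (snd x) k))"
      using 1(5)[OF n(1)] by (metis atLeast_iff fst_conv snd_conv)
    then obtain s1 where s1: "\<And>K. K \<ge> 1 \<Longrightarrow> 1 \<le> fst (s1 K) \<and> fst (s1 K) \<le> K \<and> K \<le> C1 * fst (s1 K) \<and>
     (\<forall>k. block_start (fst (s1 K)) \<le> k \<and> k \<le> fst (s1 K) \<longrightarrow> c1 * psi n1 K powr \<alpha>1 \<le> step_mean (\<epsilon>1 / real n1) (multiplier \<alpha>1 (snd (s1 K)) k))"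
      by (subst (asm) bchoice_iff) auto
    have "\<forall>K\<in>{1..}. \<exists>x. 1 \<le> fst x \<and> fst x \<le> K \<and> K \<le> C2 * fst x \<and>
     (\<forall>k. block_start (fst x) \<le> k \<and> k \<le> fst x \<longrightarrow> c2 * psi n2 K powr \<alpha>2 \<le> step_mean (\<epsilon>2 / real n2) (multiplier \<alpha>2 (snd x) k))"
      using 2(5)[OF n(2)] by (metis atLeast_iff fst_conv snd_conv)
    then obtain s2 where s2: "\<And>K. K \<ge> 1 \<Longrightarrow> 1 \<le> fst (s2 K) \<and> fst (s2 K) \<le> K \<and> K \<le> C2 * fst (s2 K) \<and>
     (\<forall>k. block_start (fst (s2 K)) \<le> k \<and> k \<le> fst (s2 K) \<longrightarrow> c2 * psi n2 K powr \<alpha>2 \<le> step_mean (\<epsilon>2 / real n2) (multiplier \<alpha>2 (snd (s2 K)) k))"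
      by (subst (asm) bchoice_iff) auto
    define K0 where "K0 K = fst (s1 K)" for K
    define L0 where "L0 K = fst (s2 K)" for K
    define \<phi>1 where "\<phi>1 K = snd (s1 K)" for K
    define \<phi>2 where "\<phi>2 K = snd (s2 K)" for K
    note K0 = s1[folded K0_def \<phi>1_def] and L0 = s2[folded L0_def \<phi>2_def]
    define \<delta>1 \<delta>2 where \<delta>: "\<delta>1 = \<epsilon>1 / real n1" "\<delta>2 = \<epsilon>2 / real n2"
    have \<delta>0: "\<delta>1 > 0" "\<delta>2 > 0" using 1 2 n by (auto simp: \<delta>)
    have \<delta>n: "\<delta>1 \<le> 1 / real n1" "\<delta>2 \<le> 1 / real n2" using 1 2 n by (auto simp: \<delta> intro: divide_right_mono)
    define P where "P = {1..N} \<times> {1..N}"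
    define a where "a r = tail_sum d N (fst r) (snd r)" for r
    define F1 where "F1 s r h = test_coeff \<alpha>1 (K0 (fst s)) (\<phi>1 (fst s)) h (fst r)" for s r :: "nat \<times> nat" and h
    define F2 where "F2 s r h = test_coeff \<alpha>2 (L0 (snd s)) (\<phi>2 (snd s)) h (snd r)" for s r :: "nat \<times> nat" and h
    define q where "q s = real (K0 (fst s)) * real (L0 (snd s))" for s :: "nat \<times> nat"
    define u where "u s = (real (fst s) * real (snd s)) powr (p - 2)" for s :: "nat \<times> nat"
    \<comment> \<open>\<open>Lf s h1 h2\<close> is the pairing with the test blocks of
      \<open>s\<close>, divided by \<open>pi^2\<close>, and \<open>Af s\<close> is its average over
      both steps; the product form lets the average act on each factor.\<close>
    define Lf where "Lf s h1 h2 = (\<Sum>r\<in>P. a r * (F1 s r h1 * F2 s r h2)) / q s" for s h1 h2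
    define Af where "Af s = (\<Sum>r\<in>P. a r * (step_mean \<delta>1 (F1 s r) * step_mean \<delta>2 (F2 s r))) / q s" for s
    have EF1: "step_mean \<delta>1 (F1 s r) = (if block_start (K0 (fst s)) \<le> fst r \<and> fst r \<le> K0 (fst s) then step_mean \<delta>1 (multiplier \<alpha>1 (\<phi>1 (fst s)) (fst r)) else 0)" for s r
      unfolding F1_def[abs_def] step_mean_test_coeff ..
    have EF2: "step_mean \<delta>2 (F2 s r) = (if block_start (L0 (snd s)) \<le> snd r \<and> snd r \<le> L0 (snd s) then step_mean \<delta>2 (multiplier \<alpha>2 (\<phi>2 (snd s)) (snd r)) else 0)" for s r
      unfolding F2_def[abs_def] step_mean_test_coeff ..
    have a0: "a r \<ge> 0" for r unfolding a_def by (rule tail_sum_nonneg) (rule d)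
    have u0: "u s \<ge> 0" for s by (simp add: u_def)
    have q0: "q s > 0" if "s \<in> P" for s
    proof -
      have "K0 (fst s) > 0" "L0 (snd s) > 0" using that K0[of "fst s"] L0[of "snd s"] by (auto simp: P_def)
      thus ?thesis by (simp add: q_def)
    qed
    \<comment> \<open>On the block both averaged factors are bounded below, and \<open>a\<close> is
      at least \<open>a s\<close> because the block indices do not exceed \<open>s\<close>; off the
      block one factor is 0. The 4 compares \<open>q s\<close> with the number of index pairs in the
      block.\<close>
    have Afl: "c / 4 * (a s * (psi n1 (fst s) powr \<alpha>1 * psi n2 (snd s) powr \<alpha>2)) \<le> Af s" if s: "s \<in> P" for s
    proof -
      define K L where KL: "K = fst s" "L = snd s"
      have KL1: "K \<ge> 1" "L \<ge> 1" "K \<le> N" "L \<le> N" using s by (auto simp: P_def KL)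
      note k0 = K0[OF KL1(1)] and l0 = L0[OF KL1(2)]
      define I where "I = {block_start (K0 K)..K0 K} \<times> {block_start (L0 L)..L0 L}"
      define w where "w = c1 * psi n1 K powr \<alpha>1 * (c2 * psi n2 L powr \<alpha>2)"
      have w0: "w \<ge> 0" unfolding w_def using 1 2 by simp
      have hf0: "block_start (K0 K) \<ge> 1" "block_start (L0 L) \<ge> 1" using block_start(1)[of "K0 K"] block_start(1)[of "L0 L"] k0 l0 by simp_all
      have sub: "I \<subseteq> P" unfolding I_def P_def using hf0 k0 l0 KL1 by auto
      have EE: "step_mean \<delta>1 (F1 s r) * step_mean \<delta>2 (F2 s r) \<ge> (if r \<in> I then w else 0)" for r
      proof (cases "r \<in> I")
        case True
        hence "c1 * psi n1 K powr \<alpha>1 \<le> step_mean \<delta>1 (F1 s r)" "c2 * psi n2 L powr \<alpha>2 \<le> step_mean \<delta>2 (F2 s r)"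
          using k0 l0 by (auto simp: EF1 EF2 I_def KL[symmetric] simp flip: \<delta>)
        moreover have "0 \<le> c1 * psi n1 K powr \<alpha>1" "0 \<le> c2 * psi n2 L powr \<alpha>2" using 1 2 by auto
        ultimately show ?thesis using True unfolding w_def by (auto intro!: mult_mono)
      next
        case False
        hence "step_mean \<delta>1 (F1 s r) = 0 \<or> step_mean \<delta>2 (F2 s r) = 0"
          by (auto simp: EF1 EF2 I_def KL[symmetric] mem_Times_iff)
        thus ?thesis using False by auto
      qed
      have "(\<Sum>r\<in>I. a s * w) \<le> (\<Sum>r\<in>I. a r * (step_mean \<delta>1 (F1 s r) * step_mean \<delta>2 (F2 s r)))"
      proof (intro sum_mono mult_mono)
        fix r assume r: "r \<in> I"
        show "a s \<le> a r" unfolding a_def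
          by (rule tail_sum_antimono[OF d]) (use r k0 l0 in \<open>auto simp: I_def KL[symmetric]\<close>)
        show "w \<le> step_mean \<delta>1 (F1 s r) * step_mean \<delta>2 (F2 s r)" using EE[of r] r by simp
      qed (use a0 w0 in auto)
      also have "\<dots> \<le> (\<Sum>r\<in>P. a r * (step_mean \<delta>1 (F1 s r) * step_mean \<delta>2 (F2 s r)))"
      proof (intro sum_mono2 sub)
        fix r assume "r \<in> P - I"
        thus "0 \<le> a r * (step_mean \<delta>1 (F1 s r) * step_mean \<delta>2 (F2 s r))" using EE[of r] a0 by auto
      qed (simp add: P_def)
      also have "\<dots> = Af s * q s" using q0[OF s] by (simp add: Af_def)
      also have "(\<Sum>r\<in>I. a s * w) = real (card I) * (a s * w)" by simp
      finally have le: "real (card I) * (a s * w) \<le> Af s * q s" .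
      have "q s / 4 = real (K0 K) / 2 * (real (L0 L) / 2)" by (simp add: q_def KL)
      also have "\<dots> \<le> real (K0 K + 1 - block_start (K0 K)) * real (L0 L + 1 - block_start (L0 L))"
        by (intro mult_mono block_start) auto
      also have "\<dots> = real (card I)" by (simp add: I_def card_cartesian_product)
      finally have "q s / 4 * (a s * w) \<le> real (card I) * (a s * w)" using a0 w0 by (intro mult_right_mono) auto
      hence "q s * (a s * w / 4) \<le> q s * Af s" using le by (simp add: mult_ac)
      hence "a s * w / 4 \<le> Af s" using q0[OF s] by simp
      thus ?thesis by (simp add: w_def c_def KL mult_ac)
    qed
    have Af0: "Af s \<ge> 0" if "s \<in> P" for s
      using c a0 by (intro order_trans[OF _ Afl[OF that]] mult_nonneg_nonneg) auto
    define Y where "Y = D powr p * C * X"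
    have upper: "(\<Sum>s\<in>P. u s * \<bar>Lf s h1 h2\<bar> powr p) \<le> Y"
      if h: "\<delta>1/2 \<le> h1" "h1 \<le> \<delta>1" "\<delta>2/2 \<le> h2" "h2 \<le> \<delta>2" for h1 h2
    proof -
      have hb: "\<bar>h1\<bar> \<le> 1 / real n1" "\<bar>h2\<bar> \<le> 1 / real n2" using h \<delta>0 \<delta>n by auto
      let ?G = "frac_diff1 \<alpha>1 h1 (frac_diff2 \<alpha>2 h2 (tensor_sum d N (cos_sum 0) (cos_sum 0)))"
      have nd: "nice_family (\<lambda>i. cos_sum m i)" for m by (rule nice_family_cos_sum)
      have G: "?G = tensor_sum d N (\<lambda>i. fdiff1 \<alpha>1 h1 (cos_sum 0 i)) (\<lambda>i. fdiff1 \<alpha>2 h2 (cos_sum 0 i))"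
        unfolding frac_diff1_eq frac_diff2_eq by (simp only: tensor_sum_fd2[OF \<alpha>(2) nd] tensor_sum_fd1[OF \<alpha>(1) nd])
      have GL: "?G \<in> Lp_torus p" unfolding G by (intro tensor_sum_Lp p0 nice_family_fdiff1 \<alpha> nd)
      \<comment> \<open>This is the difference translated by
        \<open>(- \<alpha>1 * h1, - \<alpha>2 * h2)\<close>, the form required by the pairing
        formula; translation leaves the norm unchanged.\<close>
      define g where "g = tensor_sum d N (\<lambda>i x. fdiff1 \<alpha>1 h1 (cos_sum 0 i) (x - \<alpha>1 * h1)) (\<lambda>j y. fdiff1 \<alpha>2 h2 (cos_sum 0 j) (y - \<alpha>2 * h2))"
      have gG: "g = (\<lambda>z. ?G (z + (- \<alpha>1 * h1, - \<alpha>2 * h2)))" unfolding G by (simp add: g_def tensor_sum_def)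
      have gL: "g \<in> Lp_torus p" and gI: "Lp_int p g = Lp_int p ?G"
        unfolding gG by (rule Lp_torus_translate[OF GL])+
      note CC = C(2)[OF Lp_torusD(4,3)[OF gL]]
      have bound: "\<bar>Lf s h1 h2\<bar> \<le> D * (\<integral>z. \<bar>g z\<bar> * kern2 (fst s) (snd s) z \<partial>torus)" if s: "s \<in> P" for s
      proof -
        define K L where KL: "K = fst s" "L = snd s"
        have KL1: "K \<ge> 1" "L \<ge> 1" using s by (auto simp: P_def KL)
        note k0 = K0[OF KL1(1)] and l0 = L0[OF KL1(2)]
        have k01: "K0 K \<ge> 1" "L0 L \<ge> 1" using k0 l0 by auto
        have "(\<integral>z. g z * (test_block (K0 K) (\<phi>1 K) (fst z) * test_block (L0 L) (\<phi>2 L) (snd z)) \<partial>torus) = pi^2 * Lf s h1 h2"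
          unfolding g_def tensor_sum_pairing[OF \<alpha> k01]
          by (simp add: Lf_def P_def a_def F1_def F2_def q_def KL sum.cartesian_product case_prod_unfold)
        moreover have "norm (\<integral>z. g z * (test_block (K0 K) (\<phi>1 K) (fst z) * test_block (L0 L) (\<phi>2 L) (snd z)) \<partial>torus)
          \<le> (\<integral>z. 4 * real C1 * real C2 * (\<bar>g z\<bar> * kern2 K L z) \<partial>torus)"
        proof (rule order_trans[OF integral_norm_bound], rule integral_mono[OF integrable_norm])
          show "integrable torus (\<lambda>z. g z * (test_block (K0 K) (\<phi>1 K) (fst z) * test_block (L0 L) (\<phi>2 L) (snd z)))"
          proof (rule integrable_Lp_mult_bounded[OF _ gL])
            have "\<bar>test_block (K0 K) x y\<bar> \<le> 2" "\<bar>test_block (L0 L) x y\<bar> \<le> 2" for x y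
              using test_block_bound[OF k01(1), of x y] kern_le_1[of "K0 K" y] test_block_bound[OF k01(2), of x y] kern_le_1[of "L0 L" y] by linarith+
            thus "\<bar>test_block (K0 K) (\<phi>1 K) (fst z) * test_block (L0 L) (\<phi>2 L) (snd z)\<bar> \<le> 2 * 2" for z
              unfolding abs_mult by (intro mult_mono) auto
          qed (use p in auto)
          show "integrable torus (\<lambda>z. 4 * real C1 * real C2 * (\<bar>g z\<bar> * kern2 K L z))"
            using CC KL1 by (intro integrable_mult_right) auto
          fix z :: "real \<times> real"
          have "\<bar>test_block (K0 K) (\<phi>1 K) (fst z)\<bar> \<le> 2 * (real C1 * kern K (fst z))"
            using test_block_bound[OF k01(1), of "\<phi>1 K" "fst z"] kern_rescale[of K C1 "K0 K" "fst z"] k0 1(3) by simp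
          moreover have "\<bar>test_block (L0 L) (\<phi>2 L) (snd z)\<bar> \<le> 2 * (real C2 * kern L (snd z))"
            using test_block_bound[OF k01(2), of "\<phi>2 L" "snd z"] kern_rescale[of L C2 "L0 L" "snd z"] l0 2(3) by simp
          ultimately have "\<bar>test_block (K0 K) (\<phi>1 K) (fst z)\<bar> * \<bar>test_block (L0 L) (\<phi>2 L) (snd z)\<bar> \<le> (2 * (real C1 * kern K (fst z))) * (2 * (real C2 * kern L (snd z)))"
            by (intro mult_mono) auto
          hence "\<bar>g z\<bar> * (\<bar>test_block (K0 K) (\<phi>1 K) (fst z)\<bar> * \<bar>test_block (L0 L) (\<phi>2 L) (snd z)\<bar>) \<le> \<bar>g z\<bar> * ((2 * (real C1 * kern K (fst z))) * (2 * (real C2 * kern L (snd z))))"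
            by (intro mult_left_mono) auto
          thus "norm (g z * (test_block (K0 K) (\<phi>1 K) (fst z) * test_block (L0 L) (\<phi>2 L) (snd z))) \<le> 4 * real C1 * real C2 * (\<bar>g z\<bar> * kern2 K L z)"
            by (simp add: abs_mult kern2_def mult_ac)
        qed
        ultimately have "pi^2 * \<bar>Lf s h1 h2\<bar> \<le> 4 * real C1 * real C2 * (\<integral>z. \<bar>g z\<bar> * kern2 K L z \<partial>torus)"
          by (simp add: abs_mult)
        thus ?thesis by (simp add: D_def KL[symmetric] field_simps)
      qed
      have i0: "(\<integral>z. \<bar>g z\<bar> * kern2 k l z \<partial>torus) \<ge> 0" for k l by (intro Bochner_Integration.integral_nonneg) auto
      have "(\<Sum>s\<in>P. u s * \<bar>Lf s h1 h2\<bar> powr p) \<le> (\<Sum>s\<in>P. u s * (D * (\<integral>z. \<bar>g z\<bar> * kern2 (fst s) (snd s) z \<partial>torus)) powr p)"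
        by (intro sum_mono mult_left_mono powr_mono2 bound u0) (use p0 in auto)
      also have "\<dots> = (\<Sum>s\<in>P. D powr p * (u s * (\<integral>z. \<bar>g z\<bar> * kern2 (fst s) (snd s) z \<partial>torus) powr p))"
        using D i0 by (intro sum.cong refl) (simp add: powr_mult)
      also have "\<dots> = D powr p * (\<Sum>k=1..N. \<Sum>l=1..N. (real k * real l) powr (p - 2) * (\<integral>z. \<bar>g z\<bar> * kern2 k l z \<partial>torus) powr p)"
        by (simp add: sum_distrib_left[symmetric] P_def sum.cartesian_product case_prod_unfold u_def)
      also have "\<dots> \<le> D powr p * (C * Lp_int p g)"
        using CC unfolding Lp_int_def by (intro mult_left_mono) auto
      also have "\<dots> \<le> D powr p * (C * X)"
        unfolding gI using X[OF hb] C(1) by (intro mult_left_mono) auto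
      finally show ?thesis by (simp add: Y_def mult.assoc)
    qed
    \<comment> \<open>The tangents to the \<open>p\<close>-th power at \<open>Af s\<close> are split
      into a constant part \<open>b\<close> and a linear part with coefficients \<open>Dt\<close>. A
      tangent is exact at its base point, so averaging the linear part gives back the sum of
      \<open>u s * Af s powr p\<close>.\<close>
    define b where "b = (\<Sum>s\<in>P. u s * (Af s powr p - p * Af s powr (p - 1) * Af s))"
    define Dt where "Dt t = u (fst t) * (p * Af (fst t) powr (p - 1)) * a (snd t) / q (fst t)" for t :: "(nat \<times> nat) \<times> (nat \<times> nat)"
    have expand: "(\<Sum>s\<in>P. u s * (p * Af s powr (p - 1)) * ((\<Sum>r\<in>P. a r * Z s r) / q s)) = (\<Sum>t\<in>P\<times>P. Dt t * Z (fst t) (snd t))" for Z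
      unfolding sum.cartesian_product[symmetric, where g = "\<lambda>s r. Dt (s, r) * Z s r", unfolded case_prod_unfold, simplified]
      by (intro sum.cong refl) (simp add: Dt_def sum_distrib_left sum_divide_distrib mult_ac)
    have "b + (\<Sum>t\<in>P\<times>P. Dt t * (step_mean \<delta>1 (F1 (fst t) (snd t)) * step_mean \<delta>2 (F2 (fst t) (snd t)))) \<le> Y"
    proof (rule step_mean_double_sum_upper[OF \<delta>0])
      show "finite (P \<times> P)" by (simp add: P_def)
      show "F1 (fst t) (snd t) \<in> borel_measurable borel" "F2 (fst t) (snd t) \<in> borel_measurable borel" for t
        unfolding F1_def[abs_def] F2_def[abs_def] by (rule borel_measurable_test_coeff)+
      show "\<bar>F1 (fst t) (snd t) h\<bar> \<le> diff_coeff_sum \<alpha>1" "\<bar>F2 (fst t) (snd t) h\<bar> \<le> diff_coeff_sum \<alpha>2" for t h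
        unfolding F1_def F2_def by (intro test_coeff_bound \<alpha>)+
      fix h1 h2 assume h: "\<delta>1/2 \<le> h1" "h1 \<le> \<delta>1" "\<delta>2/2 \<le> h2" "h2 \<le> \<delta>2"
      have "b + (\<Sum>t\<in>P\<times>P. Dt t * (F1 (fst t) (snd t) h1 * F2 (fst t) (snd t) h2)) = (\<Sum>s\<in>P. u s * (Af s powr p + p * Af s powr (p - 1) * (Lf s h1 h2 - Af s)))"
        unfolding expand[of "\<lambda>s r. F1 s r h1 * F2 s r h2", symmetric] b_def Lf_def sum.distrib[symmetric]
        by (intro sum.cong refl) (simp add: algebra_simps)
      also have "\<dots> \<le> (\<Sum>s\<in>P. u s * \<bar>Lf s h1 h2\<bar> powr p)"
      proof (intro sum_mono mult_left_mono u0)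
        fix s assume s: "s \<in> P"
        have "p * Af s powr (p - 1) * (Lf s h1 h2 - Af s) \<le> p * Af s powr (p - 1) * (\<bar>Lf s h1 h2\<bar> - Af s)"
          using p0 by (intro mult_left_mono) auto
        thus "Af s powr p + p * Af s powr (p - 1) * (Lf s h1 h2 - Af s) \<le> \<bar>Lf s h1 h2\<bar> powr p"
          using powr_tangent[OF p, of "\<bar>Lf s h1 h2\<bar>" "Af s"] Af0[OF s] by simp
      qed
      also have "\<dots> \<le> Y" by (rule upper[OF h])
      finally show "b + (\<Sum>t\<in>P\<times>P. Dt t * (F1 (fst t) (snd t) h1 * F2 (fst t) (snd t) h2)) \<le> Y" .
    qed
    moreover have "b + (\<Sum>t\<in>P\<times>P. Dt t * (step_mean \<delta>1 (F1 (fst t) (snd t)) * step_mean \<delta>2 (F2 (fst t) (snd t)))) = (\<Sum>s\<in>P. u s * Af s powr p)"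
      unfolding expand[of "\<lambda>s r. step_mean \<delta>1 (F1 s r) * step_mean \<delta>2 (F2 s r)", symmetric] b_def Af_def[symmetric] sum.distrib[symmetric]
      by (intro sum.cong refl) (simp add: algebra_simps)
    ultimately have main: "(\<Sum>s\<in>P. u s * Af s powr p) \<le> Y" by simp
    have "coeff_sum p (tail_sum d N) N n1 n2 \<alpha>1 \<alpha>2 = (\<Sum>s\<in>P. u s * (a s * (psi n1 (fst s) powr \<alpha>1 * psi n2 (snd s) powr \<alpha>2)) powr p)"
      unfolding coeff_sum_def P_def sum.cartesian_product case_prod_unfold using a0
      by (intro sum.cong refl) (simp add: powr_mult powr_powr u_def a_def mult_ac)
    also have "\<dots> \<le> (\<Sum>s\<in>P. u s * (4 / c * Af s) powr p)"
    proof (intro sum_mono mult_left_mono powr_mono2 u0)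
      fix s assume s: "s \<in> P"
      show "a s * (psi n1 (fst s) powr \<alpha>1 * psi n2 (snd s) powr \<alpha>2) \<le> 4 / c * Af s"
        using Afl[OF s] c by (simp add: field_simps)
    qed (use p0 a0 in auto)
    also have "\<dots> = (\<Sum>s\<in>P. (4 / c) powr p * (u s * Af s powr p))"
    proof (intro sum.cong refl)
      fix s assume "s \<in> P"
      have "(4 / c * Af s) powr p = (4 / c) powr p * Af s powr p" by (rule powr_mult)
      thus "u s * (4 / c * Af s) powr p = (4 / c) powr p * (u s * Af s powr p)" by simp
    qed
    also have "\<dots> = (4 / c) powr p * (\<Sum>s\<in>P. u s * Af s powr p)" by (simp add: sum_distrib_left)
    also have "\<dots> \<le> (4 / c) powr p * Y" by (intro mult_left_mono main) auto
    finally show ?thesis by (simp add: Y_def mult.assoc)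
  qed
  thus ?thesis using C(1) D c by (intro exI[of _ "(4 / c) powr p * (D powr p * C)"]) auto
qed

section \<open>Fourier uniqueness and convergence\<close>

text \<open>Abel means of the series with terms \<open>- sin (n * t) / n\<close>, whose sum has
  slope 1/2 between its jumps. The closed form as an argument of a complex number bounds all of them
  by \<open>pi\<close> at once.\<close>

definition sawtooth :: "real \<Rightarrow> real \<Rightarrow> real" where "sawtooth r t = Im (Ln (1 - of_real r * cis t))"

text \<open>Imaginary part of the logarithmic series; its term of index 0 is 0 by the convention on
  division by zero.\<close>

lemma sawtooth_sums:
  assumes "0 \<le> r" "r < 1"
  shows "(\<lambda>n. - (r ^ n * sin (real n * t) / real n)) sums sawtooth r t"
proof -
  have "norm (- (of_real r * cis t)) < 1" using assms by (simp add: norm_mult)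
  from sums_Im[OF Ln_series'[OF this]]
  have "(\<lambda>n. Im (- ((of_real r * cis t) ^ n) / of_nat n)) sums sawtooth r t" by (simp add: sawtooth_def)
  moreover have "Im (- ((of_real r * cis t) ^ n) / of_nat n) = - (r ^ n * sin (real n * t) / real n)" for n
  proof -
    have "(of_real r * cis t) ^ n = of_real (r ^ n) * cis (real n * t)"
      by (simp add: power_mult_distrib Complex.DeMoivre)
    moreover have "Im (- (of_real (r ^ n) * cis (real n * t)) / of_real (real n)) = - (r ^ n * sin (real n * t) / real n)"
      unfolding Im_divide_of_real by (simp del: of_real_power)
    ultimately show ?thesis by simp
  qed
  ultimately show ?thesis by (simp only:)
qed

lemma sawtooth_coeff_bound:
  fixes r y :: real
  assumes "0 \<le> r"
  shows "\<bar>r ^ n * sin y / real n\<bar> \<le> r ^ n"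
proof -
  have "\<bar>sin y\<bar> \<le> max 1 (real n)" by (rule order_trans[OF abs_sin_le_one]) simp
  hence "\<bar>sin y\<bar> / real n \<le> 1" by (cases "n = 0") (auto simp: divide_le_eq max_def split: if_splits)
  hence "r ^ n * (\<bar>sin y\<bar> / real n) \<le> r ^ n * 1" using assms by (intro mult_left_mono) auto
  thus ?thesis using assms by (simp add: abs_mult)
qed

lemma sawtooth_bound: assumes "0 \<le> r" "r < 1" shows "\<bar>sawtooth r t\<bar> \<le> pi"
proof -
  have "1 - of_real r * cis t \<noteq> 0"
  proof
    assume "1 - of_real r * cis t = 0"
    hence "norm (of_real r * cis t) = norm (1 :: complex)" by simp
    thus False using assms by (simp add: norm_mult)
  qed
  thus ?thesis unfolding sawtooth_def using mpi_less_Im_Ln Im_Ln_le_pi by (simp add: abs_le_iff less_imp_le minus_le_iff)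
qed

text \<open>Off the multiples of \<open>2 * pi\<close> the number \<open>1 - cis t\<close> has
  positive real part, so the principal logarithm is continuous there; negative \<open>t\<close> is
  moved by one period.\<close>

lemma sawtooth_limit:
  assumes t: "0 < t \<and> t < 2 * pi \<or> - 2 * pi < t \<and> t < 0"
    and r: "r \<longlonglongrightarrow> 1"
  shows "(\<lambda>n. sawtooth (r n) t) \<longlonglongrightarrow> (if t > 0 then (t - pi) / 2 else (t + pi) / 2)"
proof -
  have pos: "(\<lambda>n. sawtooth (r n) t) \<longlonglongrightarrow> (t - pi) / 2" if t: "0 < t" "t < 2 * pi" for t
  proof -
    have "cos t < 1"
    proof -
      have "sin (t / 2) > 0" using t by (intro sin_gt_zero) auto
      hence "(sin (t/2))^2 > 0" by simp
      thus ?thesis using cos_double_sin[of "t/2"] by simp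
    qed
    hence "1 - of_real 1 * cis t \<notin> \<real>\<^sub>\<le>\<^sub>0" by (auto simp: complex_nonpos_Reals_iff)
    hence "(\<lambda>n. Ln (1 - of_real (r n) * cis t)) \<longlonglongrightarrow> Ln (1 - of_real 1 * cis t)"
      by (intro tendsto_Ln tendsto_intros r)
    from tendsto_Im[OF this]
    have "(\<lambda>n. sawtooth (r n) t) \<longlonglongrightarrow> Im (Ln (1 - cis t))" by (simp add: sawtooth_def)
    thus ?thesis unfolding Ln_one_minus_cis[OF t] by simp
  qed
  show ?thesis
  proof (cases "t > 0")
    case True thus ?thesis using pos[of t] t by auto
  next
    case False
    have "cis (t + 2 * pi) = cis t" by (simp add: complex_eq_iff)
    hence "sawtooth q (t + 2 * pi) = sawtooth q t" for q by (simp add: sawtooth_def)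
    thus ?thesis using pos[of "t + 2 * pi"] t False by (auto simp: add.commute)
  qed
qed

text \<open>The indicator of an interval is, off its end points, a constant plus a difference of two translated
  sawtooth functions, and these are bounded pointwise limits of Abel means of their sine series.\<close>

lemma trig_moments_interval:
  fixes G X :: "'a \<Rightarrow> real"
  assumes G: "integrable M G" and X [measurable]: "X \<in> borel_measurable M"
    and range: "\<And>x. x \<in> space M \<Longrightarrow> 0 \<le> X x \<and> X x \<le> 2 * pi"
    and atoms: "\<And>c. AE x in M. X x \<noteq> c"
    and cos0: "\<And>k. (\<integral>x. G x * cos (real k * X x) \<partial>M) = 0" and sin0: "\<And>k. (\<integral>x. G x * sin (real k * X x) \<partial>M) = 0"
  shows "(\<integral>x. G x * indicator {a<..<b} (X x) \<partial>M) = 0"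
proof -
  have [measurable]: "G \<in> borel_measurable M" using G by simp
  have Gb: "integrable M (\<lambda>x. G x * u x)" if "u \<in> borel_measurable M" "\<And>x. \<bar>u x\<bar> \<le> B" for u B
  proof (rule Bochner_Integration.integrable_bound)
    show "integrable M (\<lambda>x. B * G x)" using G by simp
    show "(\<lambda>x. G x * u x) \<in> borel_measurable M" using that by measurable
    have "\<bar>G x\<bar> * \<bar>u x\<bar> \<le> \<bar>G x\<bar> * \<bar>B\<bar>" for x using that(2)[of x] by (intro mult_left_mono) auto
    thus "AE x in M. norm (G x * u x) \<le> norm (B * G x)" by (intro AE_I2) (simp add: abs_mult mult.commute)
  qed
  have G0: "(\<integral>x. G x \<partial>M) = 0" using cos0[of 0] by simp
  have [measurable]: "(\<lambda>x. sawtooth r (X x - c)) \<in> borel_measurable M" if "0 \<le> r" "r < 1" for r c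
  proof -
    have "sawtooth r (X x - c) = (\<Sum>n. - (r ^ n * sin (real n * (X x - c)) / real n))" for x
      using sawtooth_sums[OF that, of "X x - c"] by (simp add: sums_iff)
    thus ?thesis by (simp only:) measurable
  qed
  \<comment> \<open>For \<open>r < 1\<close> the series converges absolutely and is integrated term
    by term; the addition formula splits each term into sine and cosine moments, which
    vanish.\<close>
  have saw0: "(\<integral>x. G x * sawtooth r (X x - c) \<partial>M) = 0" if r: "0 \<le> r" "r < 1" for r c
  proof -
    define q where "q n x = G x * (- (r ^ n * sin (real n * (X x - c)) / real n))" for n x
    have qb: "norm (q n x) \<le> \<bar>G x\<bar> * r ^ n" for n x
    proof -
      have "\<bar>- (r ^ n * sin (real n * (X x - c)) / real n)\<bar> \<le> r ^ n"
        using sawtooth_coeff_bound[OF r(1), of n "real n * (X x - c)"] by (simp only: abs_minus_cancel)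
      from mult_left_mono[OF this, of "\<bar>G x\<bar>"] show ?thesis by (simp only: q_def real_norm_def abs_mult[of "G x"] abs_ge_zero)
    qed
    have qi: "integrable M (q n)" for n
      unfolding q_def
    proof (rule Gb[where B = 1])
      fix x
      have "\<bar>- (r ^ n * sin (real n * (X x - c)) / real n)\<bar> \<le> r ^ n"
        using sawtooth_coeff_bound[OF r(1), of n "real n * (X x - c)"] by (simp only: abs_minus_cancel)
      also have "\<dots> \<le> 1" using r by (simp add: power_le_one)
      finally show "\<bar>- (r ^ n * sin (real n * (X x - c)) / real n)\<bar> \<le> 1" .
    qed measurable
    have sg: "summable (\<lambda>n. B * r ^ n)" for B using r by (intro summable_mult summable_geometric) auto
    have "(\<integral>x. G x * sawtooth r (X x - c) \<partial>M) = (\<integral>x. (\<Sum>n. q n x) \<partial>M)"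
    proof (intro Bochner_Integration.integral_cong refl)
      fix x
      show "G x * sawtooth r (X x - c) = (\<Sum>n. q n x)"
        using sums_mult[OF sawtooth_sums[OF r, of "X x - c"], of "G x"] by (simp add: q_def sums_iff)
    qed
    also have "\<dots> = (\<Sum>n. (\<integral>x. q n x \<partial>M))"
    proof (rule integral_suminf[OF qi])
      show "AE x in M. summable (\<lambda>n. norm (q n x))"
        by (intro AE_I2 summable_comparison_test'[OF sg, of 0]) (use qb in simp)
      show "summable (\<lambda>n. \<integral>x. norm (q n x) \<partial>M)"
      proof (rule summable_comparison_test'[OF sg, of 0])
        fix n
        have "(\<integral>x. norm (q n x) \<partial>M) \<le> (\<integral>x. \<bar>G x\<bar> * r ^ n \<partial>M)"
          by (rule integral_mono) (use qi G qb in auto)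
        also have "\<dots> = (\<integral>x. \<bar>G x\<bar> \<partial>M) * r ^ n" by simp
        finally show "norm (\<integral>x. norm (q n x) \<partial>M) \<le> (\<integral>x. \<bar>G x\<bar> \<partial>M) * r ^ n" by simp
      qed
    qed
    also have "\<dots> = (\<Sum>n. 0)"
    proof (intro suminf_cong)
      fix n
      have i: "integrable M (\<lambda>x. G x * sin (real n * X x))" by (rule Gb[where B = 1]) auto
      have i': "integrable M (\<lambda>x. G x * cos (real n * X x))" by (rule Gb[where B = 1]) auto
      have "(\<integral>x. q n x \<partial>M) = (\<integral>x. (- (r ^ n) * cos (real n * c) / real n) * (G x * sin (real n * X x)) + (r ^ n * sin (real n * c) / real n) * (G x * cos (real n * X x)) \<partial>M)"
        by (intro Bochner_Integration.integral_cong refl)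
           (simp add: q_def right_diff_distrib sin_diff diff_divide_distrib mult_ac)
      also have "\<dots> = (- (r ^ n) * cos (real n * c) / real n) * (\<integral>x. G x * sin (real n * X x) \<partial>M) + (r ^ n * sin (real n * c) / real n) * (\<integral>x. G x * cos (real n * X x) \<partial>M)"
        by (subst Bochner_Integration.integral_add) (use i i' in auto)
      finally show "(\<integral>x. q n x \<partial>M) = 0" by (simp add: cos0 sin0)
    qed
    finally show ?thesis by simp
  qed
  define rn where "rn n = 1 - inverse (real (Suc n))" for n
  have rn: "0 \<le> rn n" "rn n < 1" for n unfolding rn_def by (auto simp: field_simps)
  have rnl: "rn \<longlonglongrightarrow> 1" unfolding rn_def[abs_def]
    using tendsto_diff[OF tendsto_const LIMSEQ_inverse_real_of_nat, of 1] by simp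
  define \<sigma> where "\<sigma> t = (if t > 0 then (t - pi) / 2 else (t + pi) / 2)" for t :: real
  have [measurable]: "\<sigma> \<in> borel_measurable borel" unfolding \<sigma>_def by measurable
  have sig: "integrable M (\<lambda>x. G x * \<sigma> (X x - c)) \<and> (\<integral>x. G x * \<sigma> (X x - c) \<partial>M) = 0" if c: "0 \<le> c" "c \<le> 2 * pi" for c
  proof -
    have lim: "AE x in M. (\<lambda>n. G x * sawtooth (rn n) (X x - c)) \<longlonglongrightarrow> G x * \<sigma> (X x - c)"
      using atoms[of c] atoms[of 0] atoms[of "2 * pi"] AE_space
    proof eventually_elim
      fix x assume x: "X x \<noteq> c" "X x \<noteq> 0" "X x \<noteq> 2 * pi" "x \<in> space M"
      hence "0 < X x - c \<and> X x - c < 2 * pi \<or> - 2 * pi < X x - c \<and> X x - c < 0"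
        using range[of x] c by auto
      from tendsto_mult_left[OF sawtooth_limit[OF this rnl], of "G x"]
      show "(\<lambda>n. G x * sawtooth (rn n) (X x - c)) \<longlonglongrightarrow> G x * \<sigma> (X x - c)" by (simp add: \<sigma>_def)
    qed
    have m: "(\<lambda>x. G x * sawtooth (rn n) (X x - c)) \<in> borel_measurable M" for n using rn[of n] by measurable
    have dom: "AE x in M. norm (G x * sawtooth (rn n) (X x - c)) \<le> pi * \<bar>G x\<bar>" for n
    proof (intro AE_I2)
      fix x
      from mult_left_mono[OF sawtooth_bound[OF rn(1)[of n] rn(2)[of n], of "X x - c"], of "\<bar>G x\<bar>"]
      show "norm (G x * sawtooth (rn n) (X x - c)) \<le> pi * \<bar>G x\<bar>"
        by (simp only: real_norm_def abs_mult mult.commute[of pi] abs_ge_zero)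
    qed
    have w: "integrable M (\<lambda>x. pi * \<bar>G x\<bar>)" using G by auto
    have "(\<lambda>n. \<integral>x. G x * sawtooth (rn n) (X x - c) \<partial>M) \<longlonglongrightarrow> (\<integral>x. G x * \<sigma> (X x - c) \<partial>M)"
      by (rule integral_dominated_convergence[OF _ m w lim dom]) measurable
    hence "(\<integral>x. G x * \<sigma> (X x - c) \<partial>M) = 0"
      unfolding saw0[OF rn] using LIMSEQ_unique tendsto_const by blast
    moreover have "integrable M (\<lambda>x. G x * \<sigma> (X x - c))"
      by (rule integrable_dominated_convergence[OF _ m w lim dom]) measurable
    ultimately show ?thesis by simp
  qed
  have main: "(\<integral>x. G x * indicator {a<..<b} (X x) \<partial>M) = 0" if ab: "0 \<le> a" "a < b" "b \<le> 2 * pi" for a b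
  proof -
    have sa: "integrable M (\<lambda>x. G x * \<sigma> (X x - a))" "(\<integral>x. G x * \<sigma> (X x - a) \<partial>M) = 0"
      and sb: "integrable M (\<lambda>x. G x * \<sigma> (X x - b))" "(\<integral>x. G x * \<sigma> (X x - b) \<partial>M) = 0"
      using sig[of a] sig[of b] ab by auto
    have "AE x in M. G x * indicator {a<..<b} (X x) = (G x * \<sigma> (X x - b) - G x * \<sigma> (X x - a) + (b - a) / 2 * G x) / pi"
      using atoms[of a] atoms[of b]
    proof eventually_elim
      fix x assume x: "X x \<noteq> a" "X x \<noteq> b"
      \<comment> \<open>Both translates have slope 1/2, so their difference is piecewise constant,
        and \<open>\<sigma>\<close> drops by \<open>pi\<close> where its argument passes through
        0.\<close>
      have "pi * indicator {a<..<b} (X x) = \<sigma> (X x - b) - \<sigma> (X x - a) + (b - a) / 2"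
        using x ab by (auto simp: \<sigma>_def indicator_def field_simps)
      hence "G x * (pi * indicator {a<..<b} (X x)) = G x * (\<sigma> (X x - b) - \<sigma> (X x - a) + (b - a) / 2)" by simp
      thus "G x * indicator {a<..<b} (X x) = (G x * \<sigma> (X x - b) - G x * \<sigma> (X x - a) + (b - a) / 2 * G x) / pi"
        by (simp add: field_simps)
    qed
    hence "(\<integral>x. G x * indicator {a<..<b} (X x) \<partial>M) = (\<integral>x. (G x * \<sigma> (X x - b) - G x * \<sigma> (X x - a) + (b - a) / 2 * G x) / pi \<partial>M)"
      by (intro integral_cong_AE) measurable
    also have "\<dots> = ((\<integral>x. G x * \<sigma> (X x - b) \<partial>M) - (\<integral>x. G x * \<sigma> (X x - a) \<partial>M) + (b - a) / 2 * (\<integral>x. G x \<partial>M)) / pi"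
      by (simp add: sa(1) sb(1) G)
    finally show ?thesis by (simp add: sa sb G0)
  qed
  define a' b' where ab': "a' = max 0 a" "b' = min (2 * pi) b"
  have "AE x in M. G x * indicator {a<..<b} (X x) = G x * indicator {a'<..<b'} (X x)"
    using atoms[of 0] atoms[of "2 * pi"] AE_space
  proof eventually_elim
    fix x assume "X x \<noteq> 0" "X x \<noteq> 2 * pi" "x \<in> space M"
    thus "G x * indicator {a<..<b} (X x) = G x * indicator {a'<..<b'} (X x)"
      using range[of x] by (auto simp: ab' indicator_def)
  qed
  hence "(\<integral>x. G x * indicator {a<..<b} (X x) \<partial>M) = (\<integral>x. G x * indicator {a'<..<b'} (X x) \<partial>M)"
    by (intro integral_cong_AE) measurable
  also have "\<dots> = 0"
  proof (cases "a' < b'")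
    case True thus ?thesis by (intro main) (auto simp: ab')
  qed auto
  finally show ?thesis .
qed

lemma AE_torus_coordinates: "AE z in torus. fst z \<noteq> c" "AE z in torus. snd z \<noteq> c"
proof -
  have n1: "{c} \<times> (UNIV :: real set) \<in> null_sets (lborel \<Otimes>\<^sub>M lborel)"
    and n2: "(UNIV :: real set) \<times> {c} \<in> null_sets (lborel \<Otimes>\<^sub>M lborel)"
    by (rule null_setsI; auto simp: lborel.emeasure_pair_measure_Times)+
  have "AE z in lebesgue. z \<notin> {c} \<times> (UNIV :: real set)" "AE z in lebesgue. z \<notin> (UNIV :: real set) \<times> {c}"
    using AE_completion[OF AE_not_in[OF n1[unfolded lborel_prod]]] AE_completion[OF AE_not_in[OF n2[unfolded lborel_prod]]] .
  thus "AE z in torus. fst z \<noteq> c" "AE z in torus. snd z \<noteq> c"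
    by (subst AE_restrict_space_iff; auto elim: eventually_mono)+
qed

text \<open>The one-dimensional lemma is used once per variable: first in \<open>x\<close> with
  \<open>g * cos (l * y + t)\<close> as the integrand, then in \<open>y\<close> with
  \<open>g\<close> times an indicator in \<open>x\<close>. Thus \<open>g\<close> integrates to 0
  over every open box, and boxes determine a measure.\<close>

lemma Fourier_uniqueness_torus:
  assumes g: "integrable torus g"
    and coef: "\<And>k l s t. s \<in> {0, - (pi/2)} \<Longrightarrow> t \<in> {0, - (pi/2)} \<Longrightarrow>
      (\<integral>z. g z * (cos (real k * fst z + s) * cos (real l * snd z + t)) \<partial>torus) = 0"
  shows "AE z in torus. g z = 0"
proof -
  have gm [measurable]: "g \<in> borel_measurable torus" using g by simp
  have [measurable]: "(fst :: real \<times> real \<Rightarrow> real) \<in> borel_measurable torus" "(snd :: real \<times> real \<Rightarrow> real) \<in> borel_measurable torus"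
    by (intro measurable_torus borel_measurable_fst_real borel_measurable_snd_real)+
  have rng: "0 \<le> fst z \<and> fst z \<le> 2 * pi" "0 \<le> snd z \<and> snd z \<le> 2 * pi" if "z \<in> space torus" for z :: "real \<times> real"
    using that by (auto simp: period_square_def)
  have gb: "integrable torus (\<lambda>z. g z * u z)" if "u \<in> borel_measurable torus" "\<And>z. \<bar>u z\<bar> \<le> 1" for u
  proof (rule Bochner_Integration.integrable_bound[OF g])
    show "(\<lambda>z. g z * u z) \<in> borel_measurable torus" using that by measurable
    show "AE z in torus. norm (g z * u z) \<le> norm (g z)"
      using that(2) by (intro AE_I2) (simp add: abs_mult mult_left_le)
  qed
  have shift: "cos (y + - (pi/2)) = sin y" for y :: real by (simp add: cos_diff)
  have 1: "(\<integral>z. (g z * cos (real l * snd z + t)) * indicator {a<..<b} (fst z) \<partial>torus) = 0"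
    if t: "t \<in> {0, - (pi/2)}" for l t a b
  proof (rule trig_moments_interval)
    show "integrable torus (\<lambda>z. g z * cos (real l * snd z + t))" by (rule gb) auto
    show "(\<integral>z. g z * cos (real l * snd z + t) * cos (real k * fst z) \<partial>torus) = 0" for k
      using coef[OF _ t, of 0 k l] by (simp add: mult_ac)
    show "(\<integral>z. g z * cos (real l * snd z + t) * sin (real k * fst z) \<partial>torus) = 0" for k
      using coef[OF _ t, of "- (pi/2)" k l] unfolding shift by (simp add: mult_ac)
  qed (use rng AE_torus_coordinates in auto)
  have 2: "(\<integral>z. (g z * indicator {a<..<b} (fst z)) * indicator {c<..<d} (snd z) \<partial>torus) = 0" for a b c d
  proof (rule trig_moments_interval)
    show "integrable torus (\<lambda>z. g z * indicator {a<..<b} (fst z))" by (rule gb) (auto simp: indicator_def)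
    show "(\<integral>z. g z * indicator {a<..<b} (fst z) * cos (real k * snd z) \<partial>torus) = 0" for k
      using 1[of 0 k a b] by (simp add: mult_ac)
    show "(\<integral>z. g z * indicator {a<..<b} (fst z) * sin (real k * snd z) \<partial>torus) = 0" for k
      using 1[of "- (pi/2)" k a b] unfolding shift by (simp add: mult_ac)
  qed (use rng AE_torus_coordinates in auto)
  define F where "F z = indicator period_square z * g z" for z
  have iF: "integrable lebesgue F" using g by (simp add: F_def[abs_def] integrable_restrict_space)
  obtain G where G [measurable]: "G \<in> borel_measurable lborel" and FG: "AE z in lborel. F z = G z"
    using completion_ex_borel_measurable_real[of F lborel] iF by auto
  have FGl: "AE z in lebesgue. F z = G z" by (rule AE_completion[OF FG])
  have mG: "G \<in> borel_measurable lebesgue" by (rule measurable_completion) (rule G)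
  have "integrable lebesgue G"
    by (rule integrable_cong_AE[THEN iffD1, OF _ mG FGl iF]) (use iF in auto)
  hence iG: "integrable lborel G" using G by (subst (asm) integrable_completion) auto
  have box: "(\<integral>\<^sup>+z. ennreal (G z) * indicator (box x y) z \<partial>lborel) = (\<integral>\<^sup>+z. ennreal (- G z) * indicator (box x y) z \<partial>lborel)" for x y
  proof -
    obtain a c where x: "x = (a, c)" by (cases x)
    obtain b d where y: "y = (b, d)" by (cases y)
    have ib: "integrable lborel (\<lambda>z. G z * indicator (box x y) z)"
      using integrable_mult_indicator[OF _ iG, of "box x y"] by (simp add: mult.commute)
    have "(\<integral>z. G z * indicator (box x y) z \<partial>lborel) = (\<integral>z. G z * indicator (box x y) z \<partial>lebesgue)"
      by (rule integral_completion[symmetric]) measurable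
    also have "\<dots> = (\<integral>z. F z * indicator (box x y) z \<partial>lebesgue)"
    proof (rule integral_cong_AE)
      show "(\<lambda>z. G z * indicator (box x y) z) \<in> borel_measurable lebesgue"
        by (intro borel_measurable_times mG borel_measurable_indicator) auto
      show "(\<lambda>z. F z * indicator (box x y) z) \<in> borel_measurable lebesgue"
        by (intro borel_measurable_times borel_measurable_integrable[OF iF] borel_measurable_indicator) auto
      show "AE z in lebesgue. G z * indicator (box x y) z = F z * indicator (box x y) z"
        using FGl by eventually_elim simp
    qed
    also have "\<dots> = (\<integral>z. (g z * indicator {a<..<b} (fst z)) * indicator {c<..<d} (snd z) \<partial>torus)"
      unfolding integral_restrict_space[of period_square lebesgue, simplified]
      by (intro Bochner_Integration.integral_cong refl)
         (auto simp: F_def x y indicator_def box_def Basis_prod_def split: prod.splits)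
    also have "\<dots> = 0" by (rule 2)
    finally have 0: "(\<integral>z. G z * indicator (box x y) z \<partial>lborel) = 0" .
    have e: "(\<integral>\<^sup>+z. ennreal (G z) * indicator (box x y) z \<partial>lborel) = (\<integral>\<^sup>+z. ennreal (G z * indicator (box x y) z) \<partial>lborel)"
      "(\<integral>\<^sup>+z. ennreal (- G z) * indicator (box x y) z \<partial>lborel) = (\<integral>\<^sup>+z. ennreal (- (G z * indicator (box x y) z)) \<partial>lborel)"
      by (intro nn_integral_cong; auto simp: indicator_def)+
    have fin: "(\<integral>\<^sup>+z. ennreal (G z * indicator (box x y) z) \<partial>lborel) \<noteq> \<infinity>" "(\<integral>\<^sup>+z. ennreal (- (G z * indicator (box x y) z)) \<partial>lborel) \<noteq> \<infinity>"
      using ib unfolding real_integrable_def by auto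
    define A B where AB: "A = (\<integral>\<^sup>+z. ennreal (G z * indicator (box x y) z) \<partial>lborel)" "B = (\<integral>\<^sup>+z. ennreal (- (G z * indicator (box x y) z)) \<partial>lborel)"
    have eq: "enn2real A = enn2real B"
      using real_lebesgue_integral_def[OF ib] unfolding 0 AB by linarith
    have "A = ennreal (enn2real A)" using fin(1) unfolding AB[symmetric] by (subst ennreal_enn2real_if) simp
    also have "\<dots> = ennreal (enn2real B)" by (simp only: eq)
    also have "\<dots> = B" using fin(2) unfolding AB[symmetric] by (subst ennreal_enn2real_if) simp
    finally show ?thesis unfolding e AB .
  qed
  \<comment> \<open>\<open>ennreal\<close> truncates negative values to 0, so the two densities are
    the positive and the negative part of \<open>G\<close>. The measures agree on boxes, a generator
    closed under intersection, and hence coincide.\<close>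
  have "density lborel (\<lambda>z. ennreal (G z)) = density lborel (\<lambda>z. ennreal (- G z))"
  proof (rule measure_eqI_generator_eq)
    let ?E = "range (\<lambda>(a, b). box a b :: (real \<times> real) set)"
    show "Int_stable ?E" by (auto simp: Int_stable_def box_Int_box)
    show "?E \<subseteq> Pow UNIV" unfolding Pow_UNIV by (rule subset_UNIV)
    show "sets (density lborel (\<lambda>z. ennreal (G z))) = sigma_sets UNIV ?E" "sets (density lborel (\<lambda>z. ennreal (- G z))) = sigma_sets UNIV ?E"
      by (simp_all add: borel_eq_box)
    let ?A = "\<lambda>n::nat. box (- (real n *\<^sub>R One)) (real n *\<^sub>R One) :: (real \<times> real) set"
    show "range ?A \<subseteq> ?E" by auto
    show "(\<Union>i. ?A i) = UNIV" by (rule UN_box_eq_UNIV)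
    show "emeasure (density lborel (\<lambda>z. ennreal (G z))) (?A i) \<noteq> \<infinity>" for i
    proof -
      have "emeasure (density lborel (\<lambda>z. ennreal (G z))) (?A i) \<le> (\<integral>\<^sup>+z. ennreal (G z) \<partial>lborel)"
        by (subst emeasure_density) (auto intro!: nn_integral_mono simp: indicator_def)
      moreover have "(\<integral>\<^sup>+z. ennreal (G z) \<partial>lborel) \<noteq> \<infinity>" using iG unfolding real_integrable_def by blast
      ultimately show ?thesis by (auto simp: top_unique)
    qed
    fix A assume "A \<in> ?E"
    then obtain x y where "A = box x y" by auto
    thus "emeasure (density lborel (\<lambda>z. ennreal (G z))) A = emeasure (density lborel (\<lambda>z. ennreal (- G z))) A"
      using box[of x y] by (simp add: emeasure_density)
  qed
  hence "AE z in lborel. ennreal (G z) = ennreal (- G z)"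
    by (intro sigma_finite_measure.density_unique[OF sigma_finite_lborel]) auto
  hence "AE z in lborel. G z = 0"
  proof eventually_elim
    fix z assume *: "ennreal (G z) = ennreal (- G z)"
    show "G z = 0"
    proof (cases "G z \<ge> 0")
      case True
      hence "ennreal (- G z) = 0" by (simp add: ennreal_neg)
      thus ?thesis using * True by simp
    next
      case False
      hence "ennreal (G z) = 0" by (simp add: ennreal_neg)
      thus ?thesis using * False by simp
    qed
  qed
  with FG have "AE z in lborel. F z = 0" by eventually_elim simp
  hence "AE z in lebesgue. F z = 0" by (rule AE_completion)
  thus ?thesis by (subst AE_restrict_space_iff) (auto simp: F_def elim!: eventually_mono)
qed

section \<open>Abel sums of the Fourier series\<close>

definition mixed_diff :: "(nat \<Rightarrow> nat \<Rightarrow> real) \<Rightarrow> nat \<Rightarrow> nat \<Rightarrow> real" where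
  "mixed_diff a i j = (if i \<ge> 1 \<and> j \<ge> 1 then a i j - a (i + 1) j - a i (j + 1) + a (i + 1) (j + 1) else 0)"

text \<open>The default 0 at index 0 makes this true for all indices, as the general estimates
  demand of \<open>d\<close>, although \<open>a\<close> is unrestricted there.\<close>

lemma mixed_diff_nonneg: "mono_coeffs a \<Longrightarrow> mixed_diff a i j \<ge> 0"
  by (auto simp: mixed_diff_def mono_coeffs_def)

text \<open>Twofold telescoping. The three terms with an index \<open>N + 1\<close> are the defect
  against \<open>a k l\<close>; for monotone coefficients their total is at most 0 and tends to
  0.\<close>

lemma tail_sum_mixed_diff:
  assumes "1 \<le> k" "k \<le> N + 1" "1 \<le> l" "l \<le> N + 1"
  shows "tail_sum (mixed_diff a) N k l = a k l - a (N + 1) l - a k (N + 1) + a (N + 1) (N + 1)"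
proof -
  have tel: "(\<Sum>i=k..N. b i - b (i + 1)) = b k - b (N + 1)" if "k \<le> N + 1" for b :: "nat \<Rightarrow> real" and k
    using that
  proof (induction N)
    case 0
    hence "k = 0 \<or> k = 1" by auto
    thus ?case by auto
  next
    case (Suc N)
    thus ?case by (cases "k = Suc N + 1") (auto simp: sum.nat_ivl_Suc')
  qed
  have "tail_sum (mixed_diff a) N k l = (\<Sum>i=k..N. \<Sum>j=l..N. (a i j - a (i + 1) j) - (a i (j + 1) - a (i + 1) (j + 1)))"
    unfolding tail_sum_def using assms by (intro sum.cong refl) (auto simp: mixed_diff_def)
  also have "\<dots> = (\<Sum>i=k..N. (a i l - a (i + 1) l) - (a i (N + 1) - a (i + 1) (N + 1)))"
    using tel[of l "\<lambda>j. a i j - a (i + 1) j" for i] assms by (intro sum.cong refl) simp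
  also have "\<dots> = (\<Sum>i=k..N. (a i l - a i (N + 1)) - (a (i + 1) l - a (i + 1) (N + 1)))"
    by (intro sum.cong refl) simp
  also have "\<dots> = (a k l - a k (N + 1)) - (a (N + 1) l - a (N + 1) (N + 1))"
    using tel[of k "\<lambda>i. a i l - a i (N + 1)"] assms by simp
  finally show ?thesis by simp
qed

lemma tail_sum_mixed_diff_le:
  assumes "mono_coeffs a" "1 \<le> k" "k \<le> N" "1 \<le> l" "l \<le> N"
  shows "tail_sum (mixed_diff a) N k l \<le> a k l"
proof -
  have "a (N + 1) (N + 1) \<le> a (N + 1) l" by (rule mono_coeffs_antimono[OF assms(1)]) (use assms in auto)
  moreover have "0 \<le> a k (N + 1)" using assms by (auto simp: mono_coeffs_def)
  ultimately show ?thesis using assms by (subst tail_sum_mixed_diff) auto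
qed

lemma tail_sum_mixed_diff_limit:
  assumes "mono_coeffs a" "1 \<le> k" "1 \<le> l"
  shows "(\<lambda>N. tail_sum (mixed_diff a) N k l) \<longlonglongrightarrow> a k l"
proof -
  have lim1: "(\<lambda>N. a (N + 1) l) \<longlonglongrightarrow> 0" if "1 \<le> l" for l
    using assms(1) that unfolding mono_coeffs_def by (intro LIMSEQ_ignore_initial_segment) auto
  have lim2: "(\<lambda>N. a k (N + 1)) \<longlonglongrightarrow> 0"
    using assms unfolding mono_coeffs_def by (intro LIMSEQ_ignore_initial_segment) auto
  have lim3: "(\<lambda>N. a (N + 1) (N + 1)) \<longlonglongrightarrow> 0"
  proof (rule tendsto_sandwich[OF _ _ tendsto_const lim1[of 1]])
    show "eventually (\<lambda>N. 0 \<le> a (N + 1) (N + 1)) sequentially" using assms(1) by (auto simp: mono_coeffs_def)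
    show "eventually (\<lambda>N. a (N + 1) (N + 1) \<le> a (N + 1) 1) sequentially"
      by (intro always_eventually allI mono_coeffs_antimono[OF assms(1)]) auto
  qed simp
  have "(\<lambda>N. a k l - a (N + 1) l - a k (N + 1) + a (N + 1) (N + 1)) \<longlonglongrightarrow> a k l - 0 - 0 + 0"
    by (intro tendsto_intros lim1 lim2 lim3 assms)
  hence "(\<lambda>N. a k l - a (N + 1) l - a k (N + 1) + a (N + 1) (N + 1)) \<longlonglongrightarrow> a k l" by simp
  moreover have "eventually (\<lambda>N. a k l - a (N + 1) l - a k (N + 1) + a (N + 1) (N + 1) = tail_sum (mixed_diff a) N k l) sequentially"
    using eventually_ge_at_top[of "max k l"] by eventually_elim (subst tail_sum_mixed_diff, use assms in auto)
  ultimately show ?thesis by (rule Lim_transform_eventually)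
qed

text \<open>Not a rectangular partial sum of the Fourier series but the truncation after twofold
  Abel summation: for monotone coefficients its Fourier coefficients are at most those of
  \<open>f\<close>, and its weights on products of Dirichlet kernels stay nonnegative.\<close>

abbreviation Abel_sum :: "(nat \<Rightarrow> nat \<Rightarrow> real) \<Rightarrow> nat \<Rightarrow> real \<times> real \<Rightarrow> real" where
  "Abel_sum a N \<equiv> tensor_sum (mixed_diff a) N (cos_sum 0) (cos_sum 0)"

lemma Abel_sum_Lp: "p > 0 \<Longrightarrow> Abel_sum a N \<in> Lp_torus p"
proof -
  have nd: "nice_family (\<lambda>i. cos_sum 0 i)" by (rule nice_family_cos_sum)
  show "p > 0 \<Longrightarrow> Abel_sum a N \<in> Lp_torus p" by (rule tensor_sum_Lp[OF _ nd nd])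
qed

text \<open>With \<open>n = 1\<close> all weights \<open>psi\<close> are 1, and each kernel costs
  \<open>2 * 2 powr 2 = 8\<close>; hence the 64.\<close>

lemma Abel_sum_pointwise:
  assumes a: "mono_coeffs a"
  shows "\<bar>Abel_sum a N z\<bar> \<le> 64 * (\<Sum>k=1..N. \<Sum>l=1..N. a k l * kern2 k l z)"
proof -
  have th: "\<bar>cos_sum 0 i x\<bar> \<le> 8 * kern_sum 1 1 i x" for i x
    using cos_sum_kern_sum[of 1 1 i 0 x] by (cases "i \<ge> 1") (auto simp: cos_sum_def)
  have "\<bar>Abel_sum a N z\<bar> \<le> 8 * 8 * (\<Sum>k=1..N. \<Sum>l=1..N. (tail_sum (mixed_diff a) N k l * (psi 1 k powr 1 * psi 1 l powr 1)) * kern2 k l z)"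
    by (rule tensor_sum_pointwise) (use th mixed_diff_nonneg[OF a] in auto)
  also have "\<dots> \<le> 8 * 8 * (\<Sum>k=1..N. \<Sum>l=1..N. a k l * kern2 k l z)"
  proof (intro mult_left_mono sum_mono mult_right_mono)
    fix k l assume "k \<in> {1..N}" "l \<in> {1..N}"
    thus "tail_sum (mixed_diff a) N k l * (psi 1 k powr 1 * psi 1 l powr 1) \<le> a k l"
      using tail_sum_mixed_diff_le[OF a, of k N l] by (simp add: psi_def)
  qed auto
  finally show ?thesis by simp
qed

text \<open>Where \<open>rho\<close> is positive the Dirichlet kernels are bounded by
  \<open>2 / rho\<close> uniformly in the index, so the increments are dominated by those of the
  sums of \<open>mixed_diff a\<close>, which converge to \<open>a 1 1\<close>.\<close>

lemma Abel_sum_convergent: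
  assumes a: "mono_coeffs a" and z: "rho (fst z) > 0" "rho (snd z) > 0"
  shows "convergent (\<lambda>N. Abel_sum a N z)"
proof -
  define Q where "Q = (2 / rho (fst z)) * (2 / rho (snd z))"
  have Q0: "Q \<ge> 0" using z by (simp add: Q_def)
  define t where "t r = mixed_diff a (fst r) (snd r) * (cos_sum 0 (fst r) (fst z) * cos_sum 0 (snd r) (snd z))" for r
  define P where "P N = {1..N} \<times> {1..N}" for N :: nat
  define s where "s N = (\<Sum>r\<in>P N. mixed_diff a (fst r) (snd r))" for N
  have dkb: "\<bar>cos_sum 0 i x\<bar> \<le> 2 / rho x" if "rho x > 0" for i x
  proof (cases "i = 0")
    case False
    have "real i * kern i x \<le> real i * (1 / (real i * rho x))" using that False by (intro mult_left_mono kern_le_inv) auto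
    thus ?thesis using cos_sum_bound[of 0 i x] False that by simp
  qed (use that in \<open>auto simp: cos_sum_def\<close>)
  have tb: "\<bar>t r\<bar> \<le> Q * mixed_diff a (fst r) (snd r)" for r
  proof -
    have "\<bar>cos_sum 0 (fst r) (fst z)\<bar> * \<bar>cos_sum 0 (snd r) (snd z)\<bar> \<le> Q"
      unfolding Q_def using z by (intro mult_mono dkb) auto
    from mult_left_mono[OF this mixed_diff_nonneg[OF a, of "fst r" "snd r"]]
    show ?thesis using mixed_diff_nonneg[OF a, of "fst r" "snd r"] by (simp add: t_def abs_mult mult.commute)
  qed
  have PP: "P N \<subseteq> P (Suc N)" "finite (P N)" for N by (auto simp: P_def)
  have FNt: "Abel_sum a N z = (\<Sum>r\<in>P N. t r)" for N by (simp add: tensor_sum_def P_def t_def)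
  have diff: "\<bar>Abel_sum a (Suc N) z - Abel_sum a N z\<bar> \<le> Q * (s (Suc N) - s N)" for N
  proof -
    have "Abel_sum a (Suc N) z - Abel_sum a N z = (\<Sum>r\<in>P (Suc N) - P N. t r)"
      unfolding FNt by (subst sum_diff) (use PP in auto)
    also have "\<bar>\<dots>\<bar> \<le> (\<Sum>r\<in>P (Suc N) - P N. Q * mixed_diff a (fst r) (snd r))"
      by (intro order_trans[OF sum_abs] sum_mono tb)
    also have "\<dots> = Q * (s (Suc N) - s N)"
      unfolding s_def sum_distrib_left[symmetric] by (subst sum_diff) (use PP in auto)
    finally show ?thesis .
  qed
  have "s = (\<lambda>N. tail_sum (mixed_diff a) N 1 1)"
    by (simp add: fun_eq_iff s_def P_def tail_sum_def sum.cartesian_product case_prod_unfold)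
  hence "s \<longlonglongrightarrow> a 1 1" using tail_sum_mixed_diff_limit[OF a, of 1 1] by (simp only: order_refl)
  hence "summable (\<lambda>N. s (Suc N) - s N)" by (rule telescope_summable)
  hence "summable (\<lambda>N. Q * (s (Suc N) - s N))" by (rule summable_mult)
  hence "summable (\<lambda>N. Abel_sum a (Suc N) z - Abel_sum a N z)"
    by (rule summable_comparison_test'[where N = 0]) (use diff in simp)
  hence "convergent (\<lambda>N. \<Sum>n<N. Abel_sum a (Suc n) z - Abel_sum a n z)" by (simp only: summable_iff_convergent)
  hence "convergent (\<lambda>N. Abel_sum a N z - Abel_sum a 0 z)" by (simp only: sum_lessThan_telescope[of "\<lambda>n. Abel_sum a n z"])
  thus ?thesis by (subst (asm) convergent_diff_const_right_iff)
qed

lemma Abel_sum_coeff: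
  assumes s: "s \<in> {0, - (pi/2)}" and t: "t \<in> {0, - (pi/2)}"
  shows "(\<integral>z. Abel_sum a N z * (cos (real k * fst z + s) * cos (real l * snd z + t)) \<partial>torus) =
    (if k \<in> {1..N} \<and> l \<in> {1..N} then pi^2 * cos s * cos t * tail_sum (mixed_diff a) N k l else 0)"
proof -
  have c1: "(\<integral>x. cos_sum 0 i x * cos (real k * x + s) \<partial>circ) = (\<Sum>m=1..i. if m = k then pi * cos s else 0)" for i k s
  proof -
    have i: "integrable circ (\<lambda>x. cos (real m * x + 0) * cos (real k * x + s))" for m
      by (intro integrable_circ_continuous continuous_intros)
    have "(\<integral>x. cos_sum 0 i x * cos (real k * x + s) \<partial>circ) = (\<integral>x. (\<Sum>m=1..i. cos (real m * x + 0) * cos (real k * x + s)) \<partial>circ)"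
      by (simp add: cos_sum_def sum_distrib_right)
    also have "\<dots> = (\<Sum>m=1..i. (\<integral>x. cos (real m * x + 0) * cos (real k * x + s) \<partial>circ))"
      by (rule Bochner_Integration.integral_sum) (rule i)
    also have "\<dots> = (\<Sum>m=1..i. if m = k then pi * cos s else 0)"
      by (intro sum.cong refl, subst integral_circ_cos_cos) auto
    finally show ?thesis .
  qed
  have cu: "continuous_on UNIV (\<lambda>x. cos_sum 0 i x * cos (real k * x + s))" for i k s
    unfolding cos_sum_def by (intro continuous_intros)
  have i: "integrable torus (\<lambda>z. mixed_diff a i j * ((cos_sum 0 i (fst z) * cos (real k * fst z + s)) * (cos_sum 0 j (snd z) * cos (real l * snd z + t))))" for i j
    by (intro integrable_mult_right integral_torus_prod(1) cu)
  have "(\<integral>z. Abel_sum a N z * (cos (real k * fst z + s) * cos (real l * snd z + t)) \<partial>torus) =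
    (\<integral>z. (\<Sum>i=1..N. \<Sum>j=1..N. mixed_diff a i j * ((cos_sum 0 i (fst z) * cos (real k * fst z + s)) * (cos_sum 0 j (snd z) * cos (real l * snd z + t)))) \<partial>torus)"
    by (intro Bochner_Integration.integral_cong refl) (simp add: tensor_sum_double sum_distrib_left mult_ac)
  also have "\<dots> = (\<Sum>i=1..N. \<Sum>j=1..N. mixed_diff a i j * (\<integral>z. (cos_sum 0 i (fst z) * cos (real k * fst z + s)) * (cos_sum 0 j (snd z) * cos (real l * snd z + t)) \<partial>torus))"
  proof -
    have 1: "(\<integral>z. (\<Sum>j=1..N. mixed_diff a i j * ((cos_sum 0 i (fst z) * cos (real k * fst z + s)) * (cos_sum 0 j (snd z) * cos (real l * snd z + t)))) \<partial>torus) = (\<Sum>j=1..N. (\<integral>z. mixed_diff a i j * ((cos_sum 0 i (fst z) * cos (real k * fst z + s)) * (cos_sum 0 j (snd z) * cos (real l * snd z + t))) \<partial>torus))" for i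
      by (rule Bochner_Integration.integral_sum) (rule i)
    have 2: "(\<integral>z. (\<Sum>i=1..N. \<Sum>j=1..N. mixed_diff a i j * ((cos_sum 0 i (fst z) * cos (real k * fst z + s)) * (cos_sum 0 j (snd z) * cos (real l * snd z + t)))) \<partial>torus) = (\<Sum>i=1..N. (\<integral>z. (\<Sum>j=1..N. mixed_diff a i j * ((cos_sum 0 i (fst z) * cos (real k * fst z + s)) * (cos_sum 0 j (snd z) * cos (real l * snd z + t)))) \<partial>torus))"
      by (rule Bochner_Integration.integral_sum) (rule Bochner_Integration.integrable_sum, rule i)
    show ?thesis unfolding 2 1 integral_mult_right_zero ..
  qed
  also have "\<dots> = (\<Sum>i=1..N. \<Sum>j=1..N. mixed_diff a i j * ((\<Sum>m=1..i. if m = k then pi * cos s else 0) * (\<Sum>m=1..j. if m = l then pi * cos t else 0)))"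
    by (simp only: integral_torus_prod(2)[OF cu cu] c1)
  also have "\<dots> = (\<Sum>m=1..N. \<Sum>n=1..N. tail_sum (mixed_diff a) N m n * ((if m = k then pi * cos s else 0) * (if n = l then pi * cos t else 0)))"
    by (rule sum_partial_sums2)
  also have "\<dots> = (\<Sum>m=1..N. if m = k then (if l \<in> {1..N} then tail_sum (mixed_diff a) N m l * (pi * cos s * (pi * cos t)) else 0) else 0)"
  proof (intro sum.cong refl)
    fix m
    have "(\<Sum>n=1..N. tail_sum (mixed_diff a) N m n * ((if m = k then pi * cos s else 0) * (if n = l then pi * cos t else 0))) =
      (\<Sum>n=1..N. if n = l then (if m = k then tail_sum (mixed_diff a) N m n * (pi * cos s * (pi * cos t)) else 0) else 0)"
      by (intro sum.cong refl) auto
    thus "(\<Sum>n=1..N. tail_sum (mixed_diff a) N m n * ((if m = k then pi * cos s else 0) * (if n = l then pi * cos t else 0))) =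
      (if m = k then (if l \<in> {1..N} then tail_sum (mixed_diff a) N m l * (pi * cos s * (pi * cos t)) else 0) else 0)"
      by (simp add: sum.delta)
  qed
  also have "\<dots> = (if k \<in> {1..N} \<and> l \<in> {1..N} then pi^2 * cos s * cos t * tail_sum (mixed_diff a) N k l else 0)"
    by (auto simp: sum.delta power2_eq_square)
  finally show ?thesis .
qed

text \<open>Dominated convergence with a majorant built from the coefficients:
  \<open>lower_bound_angle\<close> with \<open>S = T = 0\<close> bounds the Hardy-Littlewood sum of
  \<open>a\<close> by the norm of \<open>f\<close>, and the first Schur test turns this into an
  integrable majorant. The limit has the Fourier coefficients of \<open>f\<close> and therefore
  equals \<open>f\<close> almost everywhere.\<close>

lemma Abel_sum_tendsto:
  assumes p: "p > 1" and f: "f \<in> Lp_torus p" and a: "has_cos_cos_Fourier_series f a" "mono_coeffs a"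
  shows "(\<lambda>N. Lp_int p (\<lambda>z. f z - Abel_sum a N z)) \<longlonglongrightarrow> 0"
proof -
  have p0: "p > 0" and p1: "p \<ge> 1" using p by auto
  obtain C1 where C1: "C1 > 0" "\<And>N b. (\<And>k l. b k l \<ge> 0) \<Longrightarrow>
    (\<integral>\<^sup>+z. ennreal ((\<Sum>k=1..N. \<Sum>l=1..N. b k l * kern2 k l z) powr p) \<partial>torus)
      \<le> ennreal (C1 * (\<Sum>k=1..N. \<Sum>l=1..N. b k l powr p * (real k * real l) powr (p - 2)))"
    using schur_series_to_function[OF p] by blast
  obtain C2 where C2: "C2 > 0" "\<And>R S T m1 m2. S \<in> Lp_torus p \<Longrightarrow> trig_poly_in_x m1 S \<Longrightarrow> T \<in> Lp_torus p \<Longrightarrow> trig_poly_in_y m2 T \<Longrightarrow>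
     (\<Sum>k=1..R. \<Sum>l=1..R. if 2 * m1 < k \<and> 2 * m2 < l then a k l powr p * (real k * real l) powr (p - 2) else 0)
       \<le> C2 * Lp_int p (\<lambda>z. f z - S z - T z)"
    using lower_bound_angle[OF p] f a by blast
  have zero: "(\<lambda>z :: real \<times> real. 0 :: real) \<in> Lp_torus p" by (simp add: Lp_torus_iff periodic2_def)
  have tz: "trig_poly_in_x 0 (\<lambda>z. 0)" "trig_poly_in_y 0 (\<lambda>z. 0)"
    unfolding trig_poly_in_x_def trig_poly_in_y_def by (auto intro!: exI[of _ "\<lambda>_ _. 0"])
  define X where "X = C2 * Lp_int p f"
  have X: "(\<Sum>k=1..N. \<Sum>l=1..N. a k l powr p * (real k * real l) powr (p - 2)) \<le> X" for N
  proof -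
    have "(\<Sum>k=1..N. \<Sum>l=1..N. a k l powr p * (real k * real l) powr (p - 2)) =
      (\<Sum>k=1..N. \<Sum>l=1..N. if 2 * 0 < k \<and> 2 * 0 < l then a k l powr p * (real k * real l) powr (p - 2) else 0)"
      by (intro sum.cong refl) auto
    also have "\<dots> \<le> X" using C2(2)[OF zero tz(1) zero tz(2), of N] by (simp add: X_def)
    finally show ?thesis .
  qed
  \<comment> \<open>The values \<open>a 0 l\<close> and \<open>a k 0\<close> are arbitrary, whereas
    the Schur test asks for nonnegative entries at all indices.\<close>
  define b where "b k l = (if k \<ge> 1 \<and> l \<ge> 1 then a k l else 0)" for k l
  have b0: "b k l \<ge> 0" for k l using a(2) by (auto simp: b_def mono_coeffs_def)
  define Gn where "Gn N z = (\<Sum>k=1..N. \<Sum>l=1..N. b k l * kern2 k l z)" for N z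
  have [measurable]: "Gn N \<in> borel_measurable borel" for N unfolding Gn_def[abs_def] by measurable
  have Gn0: "Gn N z \<ge> 0" for N z unfolding Gn_def using b0 by (intro sum_nonneg mult_nonneg_nonneg) auto
  have Gb: "(\<integral>\<^sup>+z. ennreal (Gn N z powr p) \<partial>torus) \<le> ennreal (C1 * X)" for N
  proof -
    have "(\<integral>\<^sup>+z. ennreal (Gn N z powr p) \<partial>torus) \<le> ennreal (C1 * (\<Sum>k=1..N. \<Sum>l=1..N. b k l powr p * (real k * real l) powr (p - 2)))"
      unfolding Gn_def by (rule C1(2)) (rule b0)
    also have "(\<Sum>k=1..N. \<Sum>l=1..N. b k l powr p * (real k * real l) powr (p - 2)) = (\<Sum>k=1..N. \<Sum>l=1..N. a k l powr p * (real k * real l) powr (p - 2))"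
      by (intro sum.cong refl) (auto simp: b_def)
    also have "ennreal (C1 * \<dots>) \<le> ennreal (C1 * X)" using C1(1) X by (intro ennreal_leI mult_left_mono) auto
    finally show ?thesis .
  qed
  have Gmono: "Gn N z \<le> Gn (Suc N) z" for N z
  proof -
    have "Gn N z \<le> (\<Sum>k=1..N. \<Sum>l=1..Suc N. b k l * kern2 k l z)"
      unfolding Gn_def by (intro sum_mono sum_mono2) (auto intro!: mult_nonneg_nonneg b0)
    also have "\<dots> \<le> Gn (Suc N) z"
      unfolding Gn_def by (intro sum_mono2) (auto intro!: mult_nonneg_nonneg b0 sum_nonneg simp del: sum.cl_ivl_Suc)
    finally show ?thesis .
  qed
  \<comment> \<open>The functions \<open>Gn N\<close> increase with \<open>N\<close>, so monotone
    convergence carries the uniform bound over to the supremum of their powers.\<close>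
  define H where "H z = (SUP N. ennreal (Gn N z powr p))" for z
  have [measurable]: "H \<in> borel_measurable borel" unfolding H_def[abs_def] by measurable
  have HI: "(\<integral>\<^sup>+z. H z \<partial>torus) \<le> ennreal (C1 * X)"
  proof -
    have "(\<integral>\<^sup>+z. H z \<partial>torus) = (SUP N. (\<integral>\<^sup>+z. ennreal (Gn N z powr p) \<partial>torus))"
      unfolding H_def
    proof (rule nn_integral_monotone_convergence_SUP)
      show "incseq (\<lambda>N z. ennreal (Gn N z powr p))"
        by (intro incseq_SucI le_funI ennreal_leI powr_mono2 Gmono Gn0) (use p0 in auto)
    qed measurable
    also have "\<dots> \<le> ennreal (C1 * X)" by (intro SUP_least Gb)
    finally show ?thesis .
  qed
  have "AE z in torus. H z \<noteq> \<infinity>"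
    by (rule nn_integral_PInf_AE) (use HI in \<open>auto simp: top_unique\<close>)
  hence GH: "AE z in torus. \<forall>N. Gn N z powr p \<le> enn2real (H z)"
  proof eventually_elim
    fix z assume fin: "H z \<noteq> \<infinity>"
    show "\<forall>N. Gn N z powr p \<le> enn2real (H z)"
    proof
      fix N
      have "ennreal (Gn N z powr p) \<le> H z" unfolding H_def by (rule SUP_upper) simp
      also have "H z = ennreal (enn2real (H z))" using fin by (subst ennreal_enn2real_if) simp
      finally show "Gn N z powr p \<le> enn2real (H z)" by (subst (asm) ennreal_le_iff) auto
    qed
  qed
  define h where "h z = 64 powr p * enn2real (H z)" for z
  have [measurable]: "h \<in> borel_measurable borel" unfolding h_def by measurable
  have h0: "h z \<ge> 0" for z by (simp add: h_def)
  have hint: "integrable torus h"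
  proof -
    have "integrable torus (\<lambda>z. enn2real (H z))"
    proof (rule integrableI_nonneg)
      have "(\<integral>\<^sup>+z. ennreal (enn2real (H z)) \<partial>torus) \<le> (\<integral>\<^sup>+z. H z \<partial>torus)"
        by (intro nn_integral_mono) (subst ennreal_enn2real_if, simp)
      also have "\<dots> < \<infinity>" using HI by (rule le_less_trans) simp
      finally show "(\<integral>\<^sup>+z. ennreal (enn2real (H z)) \<partial>torus) < \<infinity>" .
    qed auto
    thus ?thesis unfolding h_def[abs_def] by (rule integrable_mult_right)
  qed
  have Fh: "AE z in torus. \<forall>N. \<bar>Abel_sum a N z\<bar> powr p \<le> h z"
    using GH
  proof eventually_elim
    fix z assume g: "\<forall>N. Gn N z powr p \<le> enn2real (H z)"
    show "\<forall>N. \<bar>Abel_sum a N z\<bar> powr p \<le> h z"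
    proof
      fix N
      have "(\<Sum>k=1..N. \<Sum>l=1..N. a k l * kern2 k l z) = Gn N z" unfolding Gn_def by (intro sum.cong refl) (auto simp: b_def)
      hence "\<bar>Abel_sum a N z\<bar> powr p \<le> (64 * Gn N z) powr p"
        using Abel_sum_pointwise[OF a(2), of N z] p0 by (intro powr_mono2) auto
      also have "\<dots> = 64 powr p * Gn N z powr p" by (rule powr_mult)
      also have "\<dots> \<le> h z" unfolding h_def using g by (intro mult_left_mono) auto
      finally show "\<bar>Abel_sum a N z\<bar> powr p \<le> h z" .
    qed
  qed
  have nd: "nice_family (\<lambda>i. cos_sum 0 i)" by (rule nice_family_cos_sum)
  have FNm [measurable]: "Abel_sum a N \<in> borel_measurable borel" for N by (rule borel_measurable_tensor_sum[OF nd nd])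
  \<comment> \<open>Where the Abel sums diverge \<open>lim\<close> has no useful value, but
    \<open>F\<close> is measurable and periodic everywhere and is their limit almost
    everywhere.\<close>
  define F where "F z = lim (\<lambda>N. Abel_sum a N z)" for z
  have Fm [measurable]: "F \<in> borel_measurable borel" unfolding F_def[abs_def] by (rule borel_measurable_lim_metric) measurable
  have Flim: "AE z in torus. (\<lambda>N. Abel_sum a N z) \<longlonglongrightarrow> F z"
    using AE_torus_rho by eventually_elim (use Abel_sum_convergent[OF a(2)] in \<open>auto simp: F_def convergent_LIMSEQ_iff\<close>)
  have Fp: "AE z in torus. \<bar>F z\<bar> powr p \<le> h z"
    using Flim Fh
  proof eventually_elim
    fix z assume l: "(\<lambda>N. Abel_sum a N z) \<longlonglongrightarrow> F z" and b: "\<forall>N. \<bar>Abel_sum a N z\<bar> powr p \<le> h z"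
    have "(\<lambda>N. \<bar>Abel_sum a N z\<bar> powr p) \<longlonglongrightarrow> \<bar>F z\<bar> powr p"
      using p0 by (intro tendsto_powr' tendsto_rabs l tendsto_const) auto
    thus "\<bar>F z\<bar> powr p \<le> h z" by (rule tendsto_upperbound) (use b in auto)
  qed
  have FL: "F \<in> Lp_torus p"
  proof (rule Lp_torusI(1)[where X = "\<integral>z. h z \<partial>torus"])
    show "F \<in> borel_measurable lebesgue" by (rule measurable_completion) (simp add: Fm)
    show "periodic2 F" unfolding periodic2_def
    proof (intro ballI allI)
      fix e z assume "e \<in> axes"
      hence "Abel_sum a N (z + (2 * pi) *\<^sub>R e) = Abel_sum a N z" for N using periodic2D[OF Lp_torusD(2)[OF Abel_sum_Lp[OF p0]]] by metis
      thus "F (z + (2 * pi) *\<^sub>R e) = F z" by (simp only: F_def)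
    qed
    have "(\<integral>\<^sup>+z. ennreal (\<bar>F z\<bar> powr p) \<partial>torus) \<le> (\<integral>\<^sup>+z. ennreal (h z) \<partial>torus)"
      using Fp by (intro nn_integral_mono_AE) (auto elim!: eventually_mono intro: ennreal_leI)
    also have "\<dots> = ennreal (\<integral>z. h z \<partial>torus)" using hint h0 by (intro nn_integral_eq_integral) auto
    finally show "(\<integral>\<^sup>+z. ennreal (\<bar>F z\<bar> powr p) \<partial>torus) \<le> ennreal (\<integral>z. h z \<partial>torus)" .
    show "0 \<le> (\<integral>z. h z \<partial>torus)" using h0 by (intro Bochner_Integration.integral_nonneg)
  qed
  have FI: "(\<lambda>N. Lp_int p (\<lambda>z. F z - Abel_sum a N z)) \<longlonglongrightarrow> 0"
  proof -
    have "(\<lambda>N. \<integral>z. \<bar>F z - Abel_sum a N z\<bar> powr p \<partial>torus) \<longlonglongrightarrow> (\<integral>z. 0 \<partial>torus)"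
    proof (rule integral_dominated_convergence[where w = "\<lambda>z. 2 powr p * (h z + h z)"])
      show "AE z in torus. (\<lambda>N. \<bar>F z - Abel_sum a N z\<bar> powr p) \<longlonglongrightarrow> 0"
        using Flim
      proof eventually_elim
        fix z assume "(\<lambda>N. Abel_sum a N z) \<longlonglongrightarrow> F z"
        hence "(\<lambda>N. \<bar>F z - Abel_sum a N z\<bar>) \<longlonglongrightarrow> \<bar>F z - F z\<bar>" by (intro tendsto_intros)
        hence "(\<lambda>N. \<bar>F z - Abel_sum a N z\<bar> powr p) \<longlonglongrightarrow> \<bar>F z - F z\<bar> powr p"
          using p0 by (intro tendsto_powr' tendsto_const) auto
        thus "(\<lambda>N. \<bar>F z - Abel_sum a N z\<bar> powr p) \<longlonglongrightarrow> 0" by simp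
      qed
      show "AE z in torus. norm (\<bar>F z - Abel_sum a N z\<bar> powr p) \<le> 2 powr p * (h z + h z)" for N
        using Fp Fh
      proof eventually_elim
        fix z assume b: "\<bar>F z\<bar> powr p \<le> h z" "\<forall>N. \<bar>Abel_sum a N z\<bar> powr p \<le> h z"
        have "\<bar>F z - Abel_sum a N z\<bar> powr p \<le> 2 powr p * (\<bar>F z\<bar> powr p + \<bar>- Abel_sum a N z\<bar> powr p)"
          using powr_add_le[OF p0, of "F z" "- Abel_sum a N z"] by simp
        also have "\<dots> \<le> 2 powr p * (h z + h z)" using b by (intro mult_left_mono add_mono) auto
        finally show "norm (\<bar>F z - Abel_sum a N z\<bar> powr p) \<le> 2 powr p * (h z + h z)" by simp
      qed
      show "integrable torus (\<lambda>z. 2 powr p * (h z + h z))"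
        by (intro integrable_mult_right Bochner_Integration.integrable_add hint)
      show "(\<lambda>z. \<bar>F z - Abel_sum a N z\<bar> powr p) \<in> borel_measurable torus" for N
        by (rule measurable_torus) measurable
    qed simp
    thus ?thesis by (simp add: Lp_int_def)
  qed
  have shift: "cos (y + - (pi/2)) = sin y" for y :: real by (simp add: cos_diff)
  have coefF: "(\<integral>z. F z * (cos (real k * fst z + s) * cos (real l * snd z + t)) \<partial>torus) = (if k \<ge> 1 \<and> l \<ge> 1 then pi^2 * cos s * cos t * a k l else 0)"
    if st: "s \<in> {0, - (pi/2)}" "t \<in> {0, - (pi/2)}" for k l s t
  proof -
    have lim1: "(\<lambda>N. \<integral>z. Abel_sum a N z * (cos (real k * fst z + s) * cos (real l * snd z + t)) \<partial>torus) \<longlonglongrightarrow> (\<integral>z. F z * (cos (real k * fst z + s) * cos (real l * snd z + t)) \<partial>torus)"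
    proof (rule integral_dominated_convergence[where w = "\<lambda>z. 1 + h z"])
      show "AE z in torus. (\<lambda>N. Abel_sum a N z * (cos (real k * fst z + s) * cos (real l * snd z + t))) \<longlonglongrightarrow> F z * (cos (real k * fst z + s) * cos (real l * snd z + t))"
        using Flim by eventually_elim (intro tendsto_intros)
      show "AE z in torus. norm (Abel_sum a N z * (cos (real k * fst z + s) * cos (real l * snd z + t))) \<le> 1 + h z" for N
        using Fh
      proof eventually_elim
        fix z assume b: "\<forall>N. \<bar>Abel_sum a N z\<bar> powr p \<le> h z"
        have "\<bar>x\<bar> \<le> 1 + \<bar>x\<bar> powr p" for x :: real
        proof (cases "\<bar>x\<bar> \<le> 1")
          case False
          hence "\<bar>x\<bar> powr 1 \<le> \<bar>x\<bar> powr p" using p1 by (intro powr_mono) auto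
          thus ?thesis using False by simp
        qed (simp add: add_increasing2)
        hence "\<bar>Abel_sum a N z\<bar> \<le> 1 + h z" using b by (meson add_left_mono order_trans)
        moreover have "\<bar>Abel_sum a N z\<bar> * \<bar>cos (real k * fst z + s) * cos (real l * snd z + t)\<bar> \<le> \<bar>Abel_sum a N z\<bar> * 1"
          by (intro mult_left_mono) (auto simp: abs_mult mult_le_one)
        ultimately show "norm (Abel_sum a N z * (cos (real k * fst z + s) * cos (real l * snd z + t))) \<le> 1 + h z"
          unfolding real_norm_def abs_mult[of "Abel_sum a N z"] by linarith
      qed
      show "integrable torus (\<lambda>z. 1 + h z)" using hint by (intro Bochner_Integration.integrable_add) auto
      show "(\<lambda>z. F z * (cos (real k * fst z + s) * cos (real l * snd z + t))) \<in> borel_measurable torus"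
        "(\<lambda>z. Abel_sum a N z * (cos (real k * fst z + s) * cos (real l * snd z + t))) \<in> borel_measurable torus" for N
        by (rule measurable_torus, measurable)+
    qed
    have lim2: "(\<lambda>N. \<integral>z. Abel_sum a N z * (cos (real k * fst z + s) * cos (real l * snd z + t)) \<partial>torus) \<longlonglongrightarrow> (if k \<ge> 1 \<and> l \<ge> 1 then pi^2 * cos s * cos t * a k l else 0)"
    proof (cases "k \<ge> 1 \<and> l \<ge> 1")
      case True
      have "(\<lambda>N. pi^2 * cos s * cos t * tail_sum (mixed_diff a) N k l) \<longlonglongrightarrow> pi^2 * cos s * cos t * a k l"
        by (intro tendsto_mult_left tail_sum_mixed_diff_limit a) (use True in auto)
      moreover have "eventually (\<lambda>N. pi^2 * cos s * cos t * tail_sum (mixed_diff a) N k l = (\<integral>z. Abel_sum a N z * (cos (real k * fst z + s) * cos (real l * snd z + t)) \<partial>torus)) sequentially"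
        using eventually_ge_at_top[of "max k l"] by eventually_elim (subst Abel_sum_coeff[OF st], use True in auto)
      ultimately show ?thesis using True by (auto intro: Lim_transform_eventually)
    next
      case False
      thus ?thesis unfolding Abel_sum_coeff[OF st] by auto
    qed
    show ?thesis by (rule LIMSEQ_unique[OF lim1 lim2])
  qed
  have coeff: "(\<integral>z. f z * (cos (real k * fst z + s) * cos (real l * snd z + t)) \<partial>torus) = (if k \<ge> 1 \<and> l \<ge> 1 then pi^2 * cos s * cos t * a k l else 0)"
    if st: "s \<in> {0, - (pi/2)}" "t \<in> {0, - (pi/2)}" for k l s t
  proof -
    consider "s = 0" "t = 0" | "s = 0" "t = - (pi/2)" | "s = - (pi/2)" "t = 0" | "s = - (pi/2)" "t = - (pi/2)" using st by auto
    thus ?thesis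
    proof cases
      case 1 thus ?thesis using has_cos_cosD(1)[OF a(1), of k l] by simp
    next
      case 2 thus ?thesis using has_cos_cosD(2)[OF a(1), of k l] unfolding 2 shift by simp
    next
      case 3 thus ?thesis using has_cos_cosD(3)[OF a(1), of k l] unfolding 3 shift by simp
    next
      case 4 thus ?thesis using has_cos_cosD(4)[OF a(1), of k l] unfolding 4 shift by simp
    qed
  qed
  have "AE z in torus. f z - F z = 0"
  proof (rule Fourier_uniqueness_torus)
    have i1: "integrable torus (\<lambda>z. u z * 1)" if "u \<in> Lp_torus p" for u
      by (rule integrable_Lp_mult_bounded[OF p1 that, where B = 1]) auto
    show "integrable torus (\<lambda>z. f z - F z)" using i1[OF f] i1[OF FL] by simp
    fix k l :: nat and s t assume st: "s \<in> {0, - (pi/2)}" "t \<in> {0, - (pi/2)}"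
    have i: "integrable torus (\<lambda>z. u z * (cos (real k * fst z + s) * cos (real l * snd z + t)))" if "u \<in> Lp_torus p" for u
      by (rule integrable_Lp_mult_bounded[OF p1 that, where B = 1]) (auto simp: abs_mult mult_le_one)
    show "(\<integral>z. (f z - F z) * (cos (real k * fst z + s) * cos (real l * snd z + t)) \<partial>torus) = 0"
      unfolding left_diff_distrib Bochner_Integration.integral_diff[OF i[OF f] i[OF FL]] coeff[OF st] coefF[OF st] by simp
  qed
  hence "Lp_int p (\<lambda>z. f z - Abel_sum a N z) = Lp_int p (\<lambda>z. F z - Abel_sum a N z)" for N
    unfolding Lp_int_def
  proof (intro integral_cong_AE)
    show "AE z in torus. \<bar>f z - Abel_sum a N z\<bar> powr p = \<bar>F z - Abel_sum a N z\<bar> powr p"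
      using \<open>AE z in torus. f z - F z = 0\<close> by eventually_elim simp
    show "(\<lambda>z. \<bar>F z - Abel_sum a N z\<bar> powr p) \<in> borel_measurable torus" by (rule measurable_torus) measurable
    have "(\<lambda>z. f z - Abel_sum a N z) \<in> borel_measurable torus"
      by (intro borel_measurable_diff Lp_torusD(4)[OF f] measurable_torus FNm)
    thus "(\<lambda>z. \<bar>f z - Abel_sum a N z\<bar> powr p) \<in> borel_measurable torus" by measurable
  qed
  thus ?thesis using FI by simp
qed

section \<open>Angular approximation and the two-sided estimate\<close>

lemma psi_scaled: assumes "n \<ge> 1" shows "psi n k powr s * real n powr s = real (min n k) powr s"
proof -
  have "psi n k * real n = real (min n k)" using assms by (auto simp: psi_def min_def field_simps)
  thus ?thesis by (metis powr_mult)
qed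

text \<open>The condition \<open>2 * (v - 1) < k\<close> means \<open>v <= (k + 1) div 2\<close>, so
  the sum runs at least up to half of \<open>min n k\<close>. The base 4 accounts for this half and
  for the one in \<open>sum_powr_lower\<close>.\<close>

lemma weight_sum_lower:
  assumes s: "s > 0" and n: "n \<ge> 1" and k: "k \<ge> 1"
  shows "psi n k powr s * real n powr s \<le> 4 powr s * (\<Sum>v=1..n+1. if 2 * (v - 1) < k then real v powr (s - 1) else 0)"
proof -
  define m where "m = min (n + 1) ((k + 1) div 2)"
  have "min n k \<le> 2 * m" unfolding m_def min_def by auto
  hence "real (min n k) / 4 \<le> real m / 2" by linarith
  hence "(real (min n k) / 4) powr s \<le> (real m / 2) powr s" using s by (intro powr_mono2) auto
  also have "\<dots> \<le> (\<Sum>v=1..m. real v powr (s - 1))" by (rule sum_powr_lower[OF s])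
  also have "\<dots> = (\<Sum>v=1..m. if 2 * (v - 1) < k then real v powr (s - 1) else 0)"
    using k by (intro sum.cong refl) (auto simp: m_def)
  also have "\<dots> \<le> (\<Sum>v=1..n+1. if 2 * (v - 1) < k then real v powr (s - 1) else 0)"
    by (intro sum_mono2) (auto simp: m_def)
  finally have "4 powr s * (real (min n k) / 4) powr s \<le> 4 powr s * (\<Sum>v=1..n+1. if 2 * (v - 1) < k then real v powr (s - 1) else 0)"
    by (intro mult_left_mono) auto
  moreover have "4 powr s * (real (min n k) / 4) powr s = real (min n k) powr s" by (simp add: powr_divide)
  ultimately show ?thesis using psi_scaled[OF n, of k s] by simp
qed

text \<open>The doubled exponent \<open>2 * s\<close> is decisive: for \<open>v > k\<close> the
  terms are \<open>k powr (2 * s) * v powr (- s - 1)\<close>, with a sum of order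
  \<open>k powr s\<close>. With the exponent \<open>s\<close> they would be
  \<open>k powr s / v\<close>, and a logarithm would remain.\<close>

lemma weight_sum_upper:
  assumes s: "s > 0" and n: "n \<ge> 1" and k: "k \<ge> 1"
  shows "(\<Sum>v=1..n+1. real v powr (s - 1) * psi v k powr (2 * s)) \<le> (1 + 2 / s) * 2 powr s * (psi n k powr s * real n powr s)"
proof (cases "n \<le> k")
  case True
  have "(\<Sum>v=1..n+1. real v powr (s - 1) * psi v k powr (2 * s)) \<le> (\<Sum>v=1..n+1. real v powr (s - 1))"
    by (intro sum_mono mult_left_le powr_le1) (use s in auto)
  also have "\<dots> \<le> (1 + 1 / s) * real (n + 1) powr s" by (rule sum_powr_upper[OF s])
  also have "\<dots> \<le> (1 + 2 / s) * (2 * real n) powr s"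
    using s n by (intro mult_mono powr_mono2) (auto intro: divide_right_mono)
  also have "(2 * real n) powr s = 2 powr s * real n powr s" by (rule powr_mult)
  finally have "(\<Sum>v=1..n+1. real v powr (s - 1) * psi v k powr (2 * s)) \<le> (1 + 2 / s) * (2 powr s * real n powr s)" .
  moreover have "psi n k powr s * real n powr s = real n powr s" using psi_scaled[OF n, of k s] True by (simp only: min_absorb1)
  ultimately show ?thesis by (simp only: mult.assoc)
next
  case False
  have "(\<Sum>v=1..n+1. real v powr (s - 1) * psi v k powr (2 * s)) =
     (\<Sum>v\<in>{1..k} \<union> {k+1..n+1}. real v powr (s - 1) * psi v k powr (2 * s))"
    using False by (intro sum.cong) auto
  also have "\<dots> = (\<Sum>v=1..k. real v powr (s - 1) * psi v k powr (2 * s)) + (\<Sum>v=k+1..n+1. real v powr (s - 1) * psi v k powr (2 * s))"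
    by (intro sum.union_disjoint) auto
  also have "\<dots> \<le> (\<Sum>v=1..k. real v powr (s - 1)) + (\<Sum>v=k+1..n+1. real k powr (2 * s) * real v powr (- s - 1))"
  proof (intro add_mono sum_mono)
    fix v assume "v \<in> {1..k}"
    show "real v powr (s - 1) * psi v k powr (2 * s) \<le> real v powr (s - 1)"
      by (intro mult_left_le powr_le1) (use s in auto)
  next
    fix v assume v: "v \<in> {k+1..n+1}"
    hence "psi v k = real k / real v" by (simp add: psi_def)
    hence "psi v k powr (2 * s) = real k powr (2 * s) * real v powr (- (2 * s))"
      by (simp only: powr_divide powr_minus_divide times_divide_eq_right mult_1_right)
    hence "real v powr (s - 1) * psi v k powr (2 * s) = real k powr (2 * s) * (real v powr (s - 1) * real v powr (- (2 * s)))"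
      by (simp only: mult_ac)
    also have "real v powr (s - 1) * real v powr (- (2 * s)) = real v powr (- s - 1)"
      by (simp flip: powr_add)
    finally show "real v powr (s - 1) * psi v k powr (2 * s) \<le> real k powr (2 * s) * real v powr (- s - 1)" by simp
  qed
  also have "\<dots> \<le> (1 + 1 / s) * real k powr s + real k powr (2 * s) * (real k powr (- s) / s)"
    unfolding sum_distrib_left[symmetric]
    by (intro add_mono sum_powr_upper mult_left_mono sum_powr_tail) (use s k in auto)
  also have "real k powr (2 * s) * (real k powr (- s) / s) = (real k powr (2 * s) * real k powr (- s)) / s" by simp
  also have "real k powr (2 * s) * real k powr (- s) = real k powr s" by (simp flip: powr_add)
  also have "(1 + 1 / s) * real k powr s + real k powr s / s = (1 + 2 / s) * 1 * real k powr s" by (simp add: algebra_simps)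
  also have "\<dots> \<le> (1 + 2 / s) * 2 powr s * real k powr s"
    using s by (intro mult_mono ge_one_powr_ge_zero) auto
  finally show ?thesis using psi_scaled[OF n, of k s] False by (simp add: min_def)
qed

lemma best_angular_approx_nonneg: "0 \<le> best_angular_approx p m1 m2 f"
  unfolding best_angular_approx_def
proof (rule cInf_greatest)
  have zero: "(\<lambda>z :: real \<times> real. 0 :: real) \<in> Lp_torus p" by (simp add: Lp_torus_iff periodic2_def)
  have tz: "trig_poly_in_x m1 (\<lambda>z. 0)" "trig_poly_in_y m2 (\<lambda>z. 0)"
    unfolding trig_poly_in_x_def trig_poly_in_y_def by (auto intro!: exI[of _ "\<lambda>_ _. 0"])
  show "{Lp_norm p (\<lambda>z. f z - S z - T z) | S T. S \<in> Lp_torus p \<and> trig_poly_in_x m1 S \<and> T \<in> Lp_torus p \<and> trig_poly_in_y m2 T} \<noteq> {}"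
    using zero tz by blast
qed (auto simp: Lp_norm_def)

text \<open>The bound in \<open>lower_bound_angle\<close> is uniform in \<open>S\<close> and
  \<open>T\<close> and so passes to the infimum, after a root of order \<open>p\<close> because the
  infimum is over norms. The zero functions show that the set of norms is nonempty.\<close>

lemma best_angular_approx_lower:
  assumes p: "p > 1"
  shows "\<exists>C>0. \<forall>f a m1 m2 R. f \<in> Lp_torus p \<longrightarrow> has_cos_cos_Fourier_series f a \<longrightarrow> mono_coeffs a \<longrightarrow>
     (\<Sum>k=1..R. \<Sum>l=1..R. if 2 * m1 < k \<and> 2 * m2 < l then a k l powr p * (real k * real l) powr (p - 2) else 0)
       \<le> C * best_angular_approx p m1 m2 f powr p"
proof -
  obtain C where C: "C > 0" "\<And>f a S T m1 m2 R. f \<in> Lp_torus p \<Longrightarrow> has_cos_cos_Fourier_series f a \<Longrightarrow> mono_coeffs a \<Longrightarrow>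
     S \<in> Lp_torus p \<Longrightarrow> trig_poly_in_x m1 S \<Longrightarrow> T \<in> Lp_torus p \<Longrightarrow> trig_poly_in_y m2 T \<Longrightarrow>
     (\<Sum>k=1..R. \<Sum>l=1..R. if 2 * m1 < k \<and> 2 * m2 < l then a k l powr p * (real k * real l) powr (p - 2) else 0)
       \<le> C * Lp_int p (\<lambda>z. f z - S z - T z)"
    using lower_bound_angle[OF p] by blast
  have "(\<Sum>k=1..R. \<Sum>l=1..R. if 2 * m1 < k \<and> 2 * m2 < l then a k l powr p * (real k * real l) powr (p - 2) else 0)
       \<le> C * best_angular_approx p m1 m2 f powr p"
    if f: "f \<in> Lp_torus p" and a: "has_cos_cos_Fourier_series f a" "mono_coeffs a" for f a m1 m2 R
  proof -
    define X where "X = (\<Sum>k=1..R. \<Sum>l=1..R. if 2 * m1 < k \<and> 2 * m2 < l then a k l powr p * (real k * real l) powr (p - 2) else 0)"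
    have X0: "X \<ge> 0" unfolding X_def by (intro sum_nonneg) auto
    have zero: "(\<lambda>z :: real \<times> real. 0 :: real) \<in> Lp_torus p" by (simp add: Lp_torus_iff periodic2_def)
    have tz: "trig_poly_in_x m1 (\<lambda>z. 0)" "trig_poly_in_y m2 (\<lambda>z. 0)"
      unfolding trig_poly_in_x_def trig_poly_in_y_def by (auto intro!: exI[of _ "\<lambda>_ _. 0"])
    have "(X / C) powr (1 / p) \<le> best_angular_approx p m1 m2 f"
      unfolding best_angular_approx_def
    proof (rule cInf_greatest)
      show "{Lp_norm p (\<lambda>z. f z - S z - T z) | S T. S \<in> Lp_torus p \<and> trig_poly_in_x m1 S \<and> T \<in> Lp_torus p \<and> trig_poly_in_y m2 T} \<noteq> {}"
        using zero tz by blast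
      fix y assume "y \<in> {Lp_norm p (\<lambda>z. f z - S z - T z) | S T. S \<in> Lp_torus p \<and> trig_poly_in_x m1 S \<and> T \<in> Lp_torus p \<and> trig_poly_in_y m2 T}"
      then obtain S T where ST: "y = Lp_norm p (\<lambda>z. f z - S z - T z)" "S \<in> Lp_torus p" "trig_poly_in_x m1 S" "T \<in> Lp_torus p" "trig_poly_in_y m2 T"
        by blast
      have "X \<le> C * Lp_int p (\<lambda>z. f z - S z - T z)" unfolding X_def by (rule C(2)[OF f a ST(2-5)])
      hence "X / C \<le> Lp_int p (\<lambda>z. f z - S z - T z)" using C(1) by (simp add: pos_divide_le_eq mult.commute)
      thus "(X / C) powr (1 / p) \<le> y" unfolding ST(1) Lp_norm_Lp_int using p X0 C(1) by (intro powr_mono2) auto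
    qed
    hence "((X / C) powr (1 / p)) powr p \<le> best_angular_approx p m1 m2 f powr p"
      using p by (intro powr_mono2) auto
    hence "X / C \<le> best_angular_approx p m1 m2 f powr p" using p X0 C(1) by (simp add: powr_powr)
    thus ?thesis unfolding X_def[symmetric] using C(1) by (simp add: pos_divide_le_eq mult.commute)
  qed
  thus ?thesis using C(1) by (intro exI[of _ C]) blast
qed

lemma tensor_sum_trig_poly:
  shows "trig_poly_in_x m (tensor_sum d N (\<lambda>i. cos_sum 0 (min i m)) w)"
    and "trig_poly_in_y m (tensor_sum d N u (\<lambda>j. cos_sum 0 (min j m)))"
proof -
  have cos_sum: "cos_sum 0 (min i m) x = (\<Sum>k\<le>m. (if 1 \<le> k \<and> k \<le> i then 1 else 0) * cos (real k * x))" for i x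
  proof -
    have "(\<Sum>k\<le>m. (if 1 \<le> k \<and> k \<le> i then 1 else 0) * cos (real k * x)) = (\<Sum>k\<in>{1..min i m}. (if 1 \<le> k \<and> k \<le> i then 1 else 0) * cos (real k * x))"
      by (intro sum.mono_neutral_right) auto
    also have "\<dots> = cos_sum 0 (min i m) x" unfolding cos_sum_def by (intro sum.cong) auto
    finally show ?thesis by simp
  qed
  have "tensor_sum d N (\<lambda>i. cos_sum 0 (min i m)) w (x, y) = (\<Sum>k\<le>m. (\<Sum>t\<in>{1..N} \<times> {1..N}. d (fst t) (snd t) * ((if 1 \<le> k \<and> k \<le> fst t then 1 else 0) * w (snd t) y)) * cos (real k * x) + 0 * sin (real k * x))" for x y
    unfolding tensor_sum_def cos_sum fst_conv snd_conv sum_distrib_left sum_distrib_right mult_zero_left add_0_right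
    by (subst sum.swap) (simp only: mult_ac)
  thus "trig_poly_in_x m (tensor_sum d N (\<lambda>i. cos_sum 0 (min i m)) w)"
    unfolding trig_poly_in_x_def by (intro exI[of _ "\<lambda>k y. \<Sum>t\<in>{1..N} \<times> {1..N}. d (fst t) (snd t) * ((if 1 \<le> k \<and> k \<le> fst t then 1 else 0) * w (snd t) y)"] exI[of _ "\<lambda>_ _. 0"]) blast
  have "tensor_sum d N u (\<lambda>j. cos_sum 0 (min j m)) (x, y) = (\<Sum>k\<le>m. (\<Sum>t\<in>{1..N} \<times> {1..N}. d (fst t) (snd t) * (u (fst t) x * (if 1 \<le> k \<and> k \<le> snd t then 1 else 0))) * cos (real k * y) + 0 * sin (real k * y))" for x y
    unfolding tensor_sum_def cos_sum fst_conv snd_conv sum_distrib_left sum_distrib_right mult_zero_left add_0_right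
    by (subst sum.swap) (simp only: mult_ac)
  thus "trig_poly_in_y m (tensor_sum d N u (\<lambda>j. cos_sum 0 (min j m)))"
    unfolding trig_poly_in_y_def by (intro exI[of _ "\<lambda>k x. \<Sum>t\<in>{1..N} \<times> {1..N}. d (fst t) (snd t) * (u (fst t) x * (if 1 \<le> k \<and> k \<le> snd t then 1 else 0))"] exI[of _ "\<lambda>_ _. 0"]) blast
qed

text \<open>Splitting both kernels of the Abel sum exhibits admissible approximants:
  \<open>S\<close> takes the frequencies up to \<open>m1\<close> in \<open>x\<close>, and
  \<open>T\<close> those above \<open>m1\<close> in \<open>x\<close> and up to \<open>m2\<close> in
  \<open>y\<close>. What is left has both frequencies high.\<close>

lemma best_angular_approx_upper:
  assumes p: "p > 1" and f: "f \<in> Lp_torus p"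
  shows "best_angular_approx p m1 m2 f powr p \<le> 2 powr p * (Lp_int p (\<lambda>z. f z - Abel_sum a N z) + Lp_int p (tensor_sum (mixed_diff a) N (cos_sum m1) (cos_sum m2)))"
proof -
  have p0: "p > 0" using p by simp
  let ?d = "mixed_diff a"
  define S where "S = tensor_sum ?d N (\<lambda>i. cos_sum 0 (min i m1)) (\<lambda>j. cos_sum 0 j)"
  define T where "T = tensor_sum ?d N (\<lambda>i. cos_sum m1 i) (\<lambda>j. cos_sum 0 (min j m2))"
  have SL: "S \<in> Lp_torus p" unfolding S_def by (intro tensor_sum_Lp p0 nice_family_cos_sum)
  have TL: "T \<in> Lp_torus p" unfolding T_def by (intro tensor_sum_Lp p0 nice_family_cos_sum)
  have nd: "nice_family (\<lambda>i. cos_sum m i)" for m by (rule nice_family_cos_sum)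
  have RL: "tensor_sum ?d N (cos_sum m1) (cos_sum m2) \<in> Lp_torus p" by (rule tensor_sum_Lp[OF p0 nd nd])
  have split: "cos_sum 0 = (\<lambda>i x. cos_sum 0 (min i m) x + cos_sum m i x)" for m
  proof (intro ext)
    fix i x
    have "{0+1..i} = {0+1..min i m} \<union> {m+1..i}" by auto
    moreover have "sum g ({0+1..min i m} \<union> {m+1..i}) = sum g {0+1..min i m} + sum g {m+1..i}" for g :: "nat \<Rightarrow> real"
      by (rule sum.union_disjoint) auto
    ultimately show "cos_sum 0 i x = cos_sum 0 (min i m) x + cos_sum m i x" unfolding cos_sum_def by simp
  qed
  have FNe: "Abel_sum a N z = S z + (T z + tensor_sum ?d N (cos_sum m1) (cos_sum m2) z)" for z
    using tensor_sum_add1[of ?d N "\<lambda>i. cos_sum 0 (min i m1)" "cos_sum m1" "cos_sum 0" z] tensor_sum_add2[of ?d N "cos_sum m1" "\<lambda>j. cos_sum 0 (min j m2)" "cos_sum m2" z]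
    unfolding split[symmetric] by (simp add: S_def T_def)
  have "best_angular_approx p m1 m2 f \<le> Lp_norm p (\<lambda>z. f z - S z - T z)"
    unfolding best_angular_approx_def
  proof (rule cInf_lower)
    show "Lp_norm p (\<lambda>z. f z - S z - T z) \<in> {Lp_norm p (\<lambda>z. f z - S z - T z) | S T. S \<in> Lp_torus p \<and> trig_poly_in_x m1 S \<and> T \<in> Lp_torus p \<and> trig_poly_in_y m2 T}"
      using SL TL tensor_sum_trig_poly(1)[of m1 ?d N "\<lambda>j. cos_sum 0 j"] tensor_sum_trig_poly(2)[of m2 ?d N "\<lambda>i. cos_sum m1 i"]
      unfolding S_def[symmetric] T_def[symmetric] by blast
    show "bdd_below {Lp_norm p (\<lambda>z. f z - S z - T z) | S T. S \<in> Lp_torus p \<and> trig_poly_in_x m1 S \<and> T \<in> Lp_torus p \<and> trig_poly_in_y m2 T}"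
      by (rule bdd_belowI[of _ 0]) (auto simp: Lp_norm_def)
  qed
  hence "best_angular_approx p m1 m2 f powr p \<le> Lp_norm p (\<lambda>z. f z - S z - T z) powr p"
    using p0 best_angular_approx_nonneg by (intro powr_mono2) auto
  also have "\<dots> = Lp_int p (\<lambda>z. f z - S z - T z)" using p0 by (simp add: Lp_norm_Lp_int powr_powr)
  also have "(\<lambda>z. f z - S z - T z) = (\<lambda>z. (f z - Abel_sum a N z) + tensor_sum ?d N (cos_sum m1) (cos_sum m2) z)"
    unfolding FNe by (simp add: fun_eq_iff)
  also have "Lp_int p \<dots> \<le> 2 powr p * (Lp_int p (\<lambda>z. f z - Abel_sum a N z) + Lp_int p (tensor_sum ?d N (cos_sum m1) (cos_sum m2)))"
    by (rule Lp_torus_add(2)[OF p0 Lp_torus_diff(1)[OF p0 f Abel_sum_Lp[OF p0]] RL])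
  finally show ?thesis .
qed

section \<open>The weighted sum of angular approximations\<close>

definition weighted_sum :: "real \<Rightarrow> real \<Rightarrow> nat \<Rightarrow> nat \<Rightarrow> (nat \<Rightarrow> nat \<Rightarrow> real) \<Rightarrow> real" where
  "weighted_sum s1 s2 n1 n2 Y = (\<Sum>v1=1..n1+1. \<Sum>v2=1..n2+1. real v1 powr (s1 - 1) * real v2 powr (s2 - 1) * Y (v1 - 1) (v2 - 1))"

lemma weighted_sum_mono: "(\<And>m1 m2. Y m1 m2 \<le> Y' m1 m2) \<Longrightarrow> weighted_sum s1 s2 n1 n2 Y \<le> weighted_sum s1 s2 n1 n2 Y'"
  unfolding weighted_sum_def by (intro sum_mono mult_left_mono) auto

lemma weighted_sum_linear: "weighted_sum s1 s2 n1 n2 (\<lambda>m1 m2. c * (e + K * Y m1 m2)) = c * (e * weighted_sum s1 s2 n1 n2 (\<lambda>_ _. 1) + K * weighted_sum s1 s2 n1 n2 Y)"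
  unfolding weighted_sum_def by (simp add: sum_distrib_left sum.distrib algebra_simps)

lemma weighted_sum_cmult: "weighted_sum s1 s2 n1 n2 (\<lambda>m1 m2. c * Y m1 m2) = c * weighted_sum s1 s2 n1 n2 Y"
  unfolding weighted_sum_def sum_distrib_left by (intro sum.cong refl) simp

lemma weighted_sum_nonneg: "(\<And>m1 m2. 0 \<le> Y m1 m2) \<Longrightarrow> 0 \<le> weighted_sum s1 s2 n1 n2 Y"
  unfolding weighted_sum_def by (intro sum_nonneg mult_nonneg_nonneg) auto

text \<open>For each pair of frequencies the sum over the degrees factors into one sum per variable,
  which leads back to the one-dimensional lemmas \<open>weight_sum_lower\<close> and
  \<open>weight_sum_upper\<close>.\<close>

lemma weighted_sum_swap:
  fixes N :: nat
  shows "weighted_sum s1 s2 n1 n2 (\<lambda>m1 m2. \<Sum>k=1..N. \<Sum>l=1..N. W k l * (u k m1 * w l m2)) =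
   (\<Sum>k=1..N. \<Sum>l=1..N. W k l * ((\<Sum>v=1..n1+1. real v powr (s1 - 1) * u k (v - 1)) * (\<Sum>v=1..n2+1. real v powr (s2 - 1) * w l (v - 1))))"
proof -
  define P where "P = {1..N} \<times> {1..N}"
  define V where "V = {1..n1+1} \<times> {1..n2+1}"
  have P: "(\<Sum>k=1..N. \<Sum>l=1..N. g k l) = (\<Sum>r\<in>P. g (fst r) (snd r))" for g :: "nat \<Rightarrow> nat \<Rightarrow> real"
    by (simp only: P_def sum.cartesian_product case_prod_unfold)
  have V: "(\<Sum>v1=1..n1+1. \<Sum>v2=1..n2+1. g v1 v2) = (\<Sum>v\<in>V. g (fst v) (snd v))" for g :: "nat \<Rightarrow> nat \<Rightarrow> real"
    by (simp only: V_def sum.cartesian_product case_prod_unfold)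
  have "weighted_sum s1 s2 n1 n2 (\<lambda>m1 m2. \<Sum>k=1..N. \<Sum>l=1..N. W k l * (u k m1 * w l m2)) =
    (\<Sum>v\<in>V. \<Sum>r\<in>P. real (fst v) powr (s1 - 1) * real (snd v) powr (s2 - 1) * (W (fst r) (snd r) * (u (fst r) (fst v - 1) * w (snd r) (snd v - 1))))"
    by (simp only: weighted_sum_def P V sum_distrib_left)
  also have "\<dots> = (\<Sum>r\<in>P. \<Sum>v\<in>V. real (fst v) powr (s1 - 1) * real (snd v) powr (s2 - 1) * (W (fst r) (snd r) * (u (fst r) (fst v - 1) * w (snd r) (snd v - 1))))"
    by (rule sum.swap)
  also have "\<dots> = (\<Sum>r\<in>P. W (fst r) (snd r) * ((\<Sum>v=1..n1+1. real v powr (s1 - 1) * u (fst r) (v - 1)) * (\<Sum>v=1..n2+1. real v powr (s2 - 1) * w (snd r) (v - 1))))"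
  proof (intro sum.cong refl)
    fix r
    show "(\<Sum>v\<in>V. real (fst v) powr (s1 - 1) * real (snd v) powr (s2 - 1) * (W (fst r) (snd r) * (u (fst r) (fst v - 1) * w (snd r) (snd v - 1)))) =
      W (fst r) (snd r) * ((\<Sum>v=1..n1+1. real v powr (s1 - 1) * u (fst r) (v - 1)) * (\<Sum>v=1..n2+1. real v powr (s2 - 1) * w (snd r) (v - 1)))"
      unfolding sum_product V by (subst sum_distrib_left) (intro sum.cong refl, simp only: mult_ac)
  qed
  finally show ?thesis by (simp only: P)
qed

text \<open>The pair \<open>(k, l)\<close> is seen by the angular approximation of degrees
  \<open>m1\<close> and \<open>m2\<close> whenever \<open>2 * m1 < k\<close> and
  \<open>2 * m2 < l\<close>; adding over the degrees with the weights of the theorem recovers the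
  powers of \<open>psi\<close>.\<close>

lemma coeff_sum_le_weighted_sum:
  assumes p: "p > 1" and \<alpha>: "\<alpha>1 > 0" "\<alpha>2 > 0"
  shows "\<exists>C>0. \<forall>f a N n1 n2. f \<in> Lp_torus p \<longrightarrow> has_cos_cos_Fourier_series f a \<longrightarrow> mono_coeffs a \<longrightarrow> n1 \<ge> 1 \<longrightarrow> n2 \<ge> 1 \<longrightarrow>
    (real n1 powr (\<alpha>1 * p) * real n2 powr (\<alpha>2 * p)) * coeff_sum p (tail_sum (mixed_diff a) N) N n1 n2 \<alpha>1 \<alpha>2
      \<le> C * weighted_sum (\<alpha>1 * p) (\<alpha>2 * p) n1 n2 (\<lambda>m1 m2. best_angular_approx p m1 m2 f powr p)"
proof -
  define s1 s2 where "s1 = \<alpha>1 * p" and "s2 = \<alpha>2 * p"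
  have s: "s1 > 0" "s2 > 0" using p \<alpha> by (auto simp: s1_def s2_def)
  obtain C where C: "C > 0" "\<And>f a m1 m2 R. f \<in> Lp_torus p \<Longrightarrow> has_cos_cos_Fourier_series f a \<Longrightarrow> mono_coeffs a \<Longrightarrow>
     (\<Sum>k=1..R. \<Sum>l=1..R. if 2 * m1 < k \<and> 2 * m2 < l then a k l powr p * (real k * real l) powr (p - 2) else 0)
       \<le> C * best_angular_approx p m1 m2 f powr p"
    using best_angular_approx_lower[OF p] by blast
  define u :: "nat \<Rightarrow> nat \<Rightarrow> real" where "u k m = (if 2 * m < k then 1 else 0)" for k m
  have main: "(real n1 powr s1 * real n2 powr s2) * coeff_sum p (tail_sum (mixed_diff a) N) N n1 n2 \<alpha>1 \<alpha>2
      \<le> (4 powr s1 * 4 powr s2 * C) * weighted_sum s1 s2 n1 n2 (\<lambda>m1 m2. best_angular_approx p m1 m2 f powr p)"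
    if f: "f \<in> Lp_torus p" and a: "has_cos_cos_Fourier_series f a" "mono_coeffs a" and n: "n1 \<ge> 1" "n2 \<ge> 1" for f a N n1 n2
  proof -
    define W where "W k l = a k l powr p * (real k * real l) powr (p - 2)" for k l
    define S1 where "S1 k = (\<Sum>v=1..n1+1. real v powr (s1 - 1) * u k (v - 1))" for k
    define S2 where "S2 k = (\<Sum>v=1..n2+1. real v powr (s2 - 1) * u k (v - 1))" for k
    have S1: "psi n1 k powr s1 * real n1 powr s1 \<le> 4 powr s1 * S1 k" if "k \<ge> 1" for k
      using weight_sum_lower[OF s(1) n(1) that] by (simp add: S1_def u_def if_distrib cong: if_cong)
    have S2: "psi n2 k powr s2 * real n2 powr s2 \<le> 4 powr s2 * S2 k" if "k \<ge> 1" for k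
      using weight_sum_lower[OF s(2) n(2) that] by (simp add: S2_def u_def if_distrib cong: if_cong)
    have S0: "S1 k \<ge> 0" for k unfolding S1_def u_def by (intro sum_nonneg) auto
    have "(real n1 powr s1 * real n2 powr s2) * coeff_sum p (tail_sum (mixed_diff a) N) N n1 n2 \<alpha>1 \<alpha>2 =
       (\<Sum>k=1..N. \<Sum>l=1..N. (tail_sum (mixed_diff a) N k l powr p * (real k * real l) powr (p - 2)) *
          ((psi n1 k powr s1 * real n1 powr s1) * (psi n2 l powr s2 * real n2 powr s2)))"
      unfolding coeff_sum_def sum_distrib_left s1_def s2_def by (intro sum.cong refl) (simp only: mult_ac)
    also have "\<dots> \<le> (\<Sum>k=1..N. \<Sum>l=1..N. W k l * ((4 powr s1 * S1 k) * (4 powr s2 * S2 l)))"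
    proof (intro sum_mono)
      fix k l assume kl: "k \<in> {1..N}" "l \<in> {1..N}"
      have "tail_sum (mixed_diff a) N k l powr p \<le> a k l powr p"
        using p kl tail_sum_mixed_diff_le[OF a(2)] tail_sum_nonneg[OF mixed_diff_nonneg[OF a(2)]] by (intro powr_mono2) auto
      hence "tail_sum (mixed_diff a) N k l powr p * (real k * real l) powr (p - 2) \<le> W k l"
        unfolding W_def by (intro mult_right_mono) auto
      moreover have "(psi n1 k powr s1 * real n1 powr s1) * (psi n2 l powr s2 * real n2 powr s2)
          \<le> (4 powr s1 * S1 k) * (4 powr s2 * S2 l)"
        using kl S0 by (intro mult_mono S1 S2) auto
      ultimately show "(tail_sum (mixed_diff a) N k l powr p * (real k * real l) powr (p - 2)) *
          ((psi n1 k powr s1 * real n1 powr s1) * (psi n2 l powr s2 * real n2 powr s2)) \<le>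
          W k l * ((4 powr s1 * S1 k) * (4 powr s2 * S2 l))"
        by (rule mult_mono) (auto simp: W_def)
    qed
    also have "\<dots> = (4 powr s1 * 4 powr s2) * (\<Sum>k=1..N. \<Sum>l=1..N. W k l * (S1 k * S2 l))"
      unfolding sum_distrib_left by (intro sum.cong refl) (simp only: mult_ac)
    finally have 1: "(real n1 powr s1 * real n2 powr s2) * coeff_sum p (tail_sum (mixed_diff a) N) N n1 n2 \<alpha>1 \<alpha>2 \<le>
      (4 powr s1 * 4 powr s2) * (\<Sum>k=1..N. \<Sum>l=1..N. W k l * (S1 k * S2 l))" .
    have "(\<Sum>k=1..N. \<Sum>l=1..N. W k l * (S1 k * S2 l)) =
        weighted_sum s1 s2 n1 n2 (\<lambda>m1 m2. \<Sum>k=1..N. \<Sum>l=1..N. W k l * (u k m1 * u l m2))"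
      unfolding weighted_sum_swap S1_def S2_def by (rule refl)
    also have "\<dots> \<le> weighted_sum s1 s2 n1 n2 (\<lambda>m1 m2. C * best_angular_approx p m1 m2 f powr p)"
    proof (rule weighted_sum_mono)
      fix m1 m2
      have "(\<Sum>k=1..N. \<Sum>l=1..N. W k l * (u k m1 * u l m2)) =
        (\<Sum>k=1..N. \<Sum>l=1..N. if 2 * m1 < k \<and> 2 * m2 < l then a k l powr p * (real k * real l) powr (p - 2) else 0)"
        by (intro sum.cong refl) (auto simp: W_def u_def)
      also have "\<dots> \<le> C * best_angular_approx p m1 m2 f powr p" by (rule C(2)[OF f a])
      finally show "(\<Sum>k=1..N. \<Sum>l=1..N. W k l * (u k m1 * u l m2)) \<le> C * best_angular_approx p m1 m2 f powr p" .
    qed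
    also have "\<dots> = C * weighted_sum s1 s2 n1 n2 (\<lambda>m1 m2. best_angular_approx p m1 m2 f powr p)" by (rule weighted_sum_cmult)
    finally have "(4 powr s1 * 4 powr s2) * (\<Sum>k=1..N. \<Sum>l=1..N. W k l * (S1 k * S2 l)) \<le>
      (4 powr s1 * 4 powr s2) * (C * weighted_sum s1 s2 n1 n2 (\<lambda>m1 m2. best_angular_approx p m1 m2 f powr p))"
      by (intro mult_left_mono) auto
    with 1 show ?thesis unfolding mult.assoc by (rule order_trans)
  qed
  have "4 powr s1 * 4 powr s2 * C > 0" using C(1) by simp
  thus ?thesis using main unfolding s1_def s2_def by blast
qed

text \<open>The orders \<open>2 * \<alpha>1\<close> and \<open>2 * \<alpha>2\<close> come from the
  angular remainder and are chosen so that \<open>weight_sum_upper\<close> applies; summation over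
  the degrees halves them.\<close>

lemma weighted_sum_coeff_sum_le:
  assumes p: "p > 1" and \<alpha>: "\<alpha>1 > 0" "\<alpha>2 > 0"
  shows "\<exists>C>0. \<forall>A N n1 n2. n1 \<ge> 1 \<longrightarrow> n2 \<ge> 1 \<longrightarrow>
    weighted_sum (\<alpha>1 * p) (\<alpha>2 * p) n1 n2 (\<lambda>m1 m2. coeff_sum p A N (m1 + 1) (m2 + 1) (2 * \<alpha>1) (2 * \<alpha>2))
      \<le> C * ((real n1 powr (\<alpha>1 * p) * real n2 powr (\<alpha>2 * p)) * coeff_sum p A N n1 n2 \<alpha>1 \<alpha>2)"
proof -
  define s1 s2 where "s1 = \<alpha>1 * p" and "s2 = \<alpha>2 * p"
  have s: "s1 > 0" "s2 > 0" using p \<alpha> by (auto simp: s1_def s2_def)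
  define c1 c2 where "c1 = (1 + 2 / s1) * 2 powr s1" and "c2 = (1 + 2 / s2) * 2 powr s2"
  have c: "c1 > 0" "c2 > 0" using s by (auto simp: c1_def c2_def intro!: mult_pos_pos add_pos_pos)
  have main: "weighted_sum s1 s2 n1 n2 (\<lambda>m1 m2. coeff_sum p A N (m1 + 1) (m2 + 1) (2 * \<alpha>1) (2 * \<alpha>2))
      \<le> (c1 * c2) * ((real n1 powr s1 * real n2 powr s2) * coeff_sum p A N n1 n2 \<alpha>1 \<alpha>2)"
    if n: "n1 \<ge> 1" "n2 \<ge> 1" for A N n1 n2
  proof -
    define W where "W k l = A k l powr p * (real k * real l) powr (p - 2)" for k l
    define u1 where "u1 k m = psi (m + 1) k powr (2 * s1)" for k m
    define u2 where "u2 k m = psi (m + 1) k powr (2 * s2)" for k m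
    have S1: "(\<Sum>v=1..n1+1. real v powr (s1 - 1) * u1 k (v - 1)) \<le> c1 * (psi n1 k powr s1 * real n1 powr s1)" if "k \<ge> 1" for k
    proof -
      have "(\<Sum>v=1..n1+1. real v powr (s1 - 1) * u1 k (v - 1)) = (\<Sum>v=1..n1+1. real v powr (s1 - 1) * psi v k powr (2 * s1))"
        by (intro sum.cong refl) (simp add: u1_def)
      thus ?thesis using weight_sum_upper[OF s(1) n(1) that] by (simp only: c1_def)
    qed
    have S2: "(\<Sum>v=1..n2+1. real v powr (s2 - 1) * u2 k (v - 1)) \<le> c2 * (psi n2 k powr s2 * real n2 powr s2)" if "k \<ge> 1" for k
    proof -
      have "(\<Sum>v=1..n2+1. real v powr (s2 - 1) * u2 k (v - 1)) = (\<Sum>v=1..n2+1. real v powr (s2 - 1) * psi v k powr (2 * s2))"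
        by (intro sum.cong refl) (simp add: u2_def)
      thus ?thesis using weight_sum_upper[OF s(2) n(2) that] by (simp only: c2_def)
    qed
    have "weighted_sum s1 s2 n1 n2 (\<lambda>m1 m2. coeff_sum p A N (m1 + 1) (m2 + 1) (2 * \<alpha>1) (2 * \<alpha>2)) =
       weighted_sum s1 s2 n1 n2 (\<lambda>m1 m2. \<Sum>k=1..N. \<Sum>l=1..N. W k l * (u1 k m1 * u2 l m2))"
      by (simp only: coeff_sum_def W_def u1_def u2_def s1_def s2_def mult.assoc)
    also have "\<dots> = (\<Sum>k=1..N. \<Sum>l=1..N. W k l * ((\<Sum>v=1..n1+1. real v powr (s1 - 1) * u1 k (v - 1)) * (\<Sum>v=1..n2+1. real v powr (s2 - 1) * u2 l (v - 1))))"
      by (rule weighted_sum_swap)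
    also have "\<dots> \<le> (\<Sum>k=1..N. \<Sum>l=1..N. W k l * ((c1 * (psi n1 k powr s1 * real n1 powr s1)) * (c2 * (psi n2 l powr s2 * real n2 powr s2))))"
    proof (intro sum_mono mult_left_mono mult_mono)
      fix k l assume kl: "k \<in> {1..N}" "l \<in> {1..N}"
      show "(\<Sum>v=1..n1+1. real v powr (s1 - 1) * u1 k (v - 1)) \<le> c1 * (psi n1 k powr s1 * real n1 powr s1)"
        by (rule S1) (use kl in auto)
      show "(\<Sum>v=1..n2+1. real v powr (s2 - 1) * u2 l (v - 1)) \<le> c2 * (psi n2 l powr s2 * real n2 powr s2)"
        by (rule S2) (use kl in auto)
      show "0 \<le> c1 * (psi n1 k powr s1 * real n1 powr s1)" using c by simp
      show "0 \<le> (\<Sum>v=1..n2+1. real v powr (s2 - 1) * u2 l (v - 1))"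
        by (intro sum_nonneg mult_nonneg_nonneg) (auto simp: u2_def)
      show "0 \<le> W k l" by (simp add: W_def)
    qed
    also have "\<dots> = (c1 * c2) * ((real n1 powr s1 * real n2 powr s2) * coeff_sum p A N n1 n2 \<alpha>1 \<alpha>2)"
      unfolding coeff_sum_def sum_distrib_left W_def s1_def s2_def by (intro sum.cong refl) (simp only: mult_ac)
    finally show ?thesis .
  qed
  have "c1 * c2 > 0" using c by simp
  thus ?thesis using main unfolding s1_def s2_def by blast
qed

text \<open>The chain of estimates runs through an Abel sum of arbitrary length \<open>N\<close>.
  Its distance to \<open>f\<close> enters with a factor independent of \<open>N\<close> and
  disappears in the limit.\<close>

lemma Lp_int_frac_diff_le_weighted_sum:
  assumes p: "p > 1" and \<alpha>: "\<alpha>1 > 0" "\<alpha>2 > 0"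
  shows "\<exists>C>0. \<forall>f a n1 n2 h1 h2. f \<in> Lp_torus p \<longrightarrow> has_cos_cos_Fourier_series f a \<longrightarrow> mono_coeffs a \<longrightarrow> n1 \<ge> 1 \<longrightarrow> n2 \<ge> 1 \<longrightarrow>
    \<bar>h1\<bar> \<le> 1 / real n1 \<longrightarrow> \<bar>h2\<bar> \<le> 1 / real n2 \<longrightarrow>
    (real n1 powr (\<alpha>1 * p) * real n2 powr (\<alpha>2 * p)) * Lp_int p (frac_diff1 \<alpha>1 h1 (frac_diff2 \<alpha>2 h2 f))
      \<le> C * weighted_sum (\<alpha>1 * p) (\<alpha>2 * p) n1 n2 (\<lambda>m1 m2. best_angular_approx p m1 m2 f powr p)"
proof -
  have p0: "p > 0" using p by simp
  obtain C1 where C1: "C1 > 0" "\<And>d N n1 n2 h1 h2. (\<And>i j. d i j \<ge> 0) \<Longrightarrow> n1 \<ge> 1 \<Longrightarrow> n2 \<ge> 1 \<Longrightarrow> \<bar>h1\<bar> \<le> 1 / real n1 \<Longrightarrow> \<bar>h2\<bar> \<le> 1 / real n2 \<Longrightarrow>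
      Lp_int p (frac_diff1 \<alpha>1 h1 (frac_diff2 \<alpha>2 h2 (tensor_sum d N (cos_sum 0) (cos_sum 0)))) \<le> C1 * coeff_sum p (tail_sum d N) N n1 n2 \<alpha>1 \<alpha>2"
    using Lp_int_frac_diff_poly[OF p \<alpha>] by blast
  obtain C2 where C2: "C2 > 0" "\<And>f a N n1 n2. f \<in> Lp_torus p \<Longrightarrow> has_cos_cos_Fourier_series f a \<Longrightarrow> mono_coeffs a \<Longrightarrow> n1 \<ge> 1 \<Longrightarrow> n2 \<ge> 1 \<Longrightarrow>
    (real n1 powr (\<alpha>1 * p) * real n2 powr (\<alpha>2 * p)) * coeff_sum p (tail_sum (mixed_diff a) N) N n1 n2 \<alpha>1 \<alpha>2
      \<le> C2 * weighted_sum (\<alpha>1 * p) (\<alpha>2 * p) n1 n2 (\<lambda>m1 m2. best_angular_approx p m1 m2 f powr p)"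
    using coeff_sum_le_weighted_sum[OF p \<alpha>] by blast
  have main: "(real n1 powr (\<alpha>1 * p) * real n2 powr (\<alpha>2 * p)) * Lp_int p (frac_diff1 \<alpha>1 h1 (frac_diff2 \<alpha>2 h2 f))
      \<le> (2 powr p * C1 * C2) * weighted_sum (\<alpha>1 * p) (\<alpha>2 * p) n1 n2 (\<lambda>m1 m2. best_angular_approx p m1 m2 f powr p)"
    if f: "f \<in> Lp_torus p" and a: "has_cos_cos_Fourier_series f a" "mono_coeffs a" and n: "n1 \<ge> 1" "n2 \<ge> 1"
      and h: "\<bar>h1\<bar> \<le> 1 / real n1" "\<bar>h2\<bar> \<le> 1 / real n2" for f a n1 n2 h1 h2
  proof -
    define w where "w = real n1 powr (\<alpha>1 * p) * real n2 powr (\<alpha>2 * p)"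
    define Z where "Z = weighted_sum (\<alpha>1 * p) (\<alpha>2 * p) n1 n2 (\<lambda>m1 m2. best_angular_approx p m1 m2 f powr p)"
    define I where "I = Lp_int p (frac_diff1 \<alpha>1 h1 (frac_diff2 \<alpha>2 h2 f))"
    define c where "c = w * 2 powr p * (diff_coeff_sum \<alpha>1 powr p * diff_coeff_sum \<alpha>2 powr p)"
    have w: "w \<ge> 0" by (simp add: w_def)
    have le: "w * I \<le> (2 powr p * C1 * C2) * Z + c * Lp_int p (\<lambda>z. f z - Abel_sum a N z)" for N
    proof -
      have "(\<lambda>z. Abel_sum a N z + (f z - Abel_sum a N z)) = f" by simp
      hence "I \<le> 2 powr p * (Lp_int p (frac_diff1 \<alpha>1 h1 (frac_diff2 \<alpha>2 h2 (Abel_sum a N))) +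
          diff_coeff_sum \<alpha>1 powr p * diff_coeff_sum \<alpha>2 powr p * Lp_int p (\<lambda>z. f z - Abel_sum a N z))"
        using Lp_int_frac_diff_add[OF p \<alpha> Abel_sum_Lp[OF p0, of a N] Lp_torus_diff(1)[OF p0 f Abel_sum_Lp[OF p0, of a N]], of h1 h2]
        unfolding I_def by simp
      also have "\<dots> \<le> 2 powr p * (C1 * coeff_sum p (tail_sum (mixed_diff a) N) N n1 n2 \<alpha>1 \<alpha>2 +
          diff_coeff_sum \<alpha>1 powr p * diff_coeff_sum \<alpha>2 powr p * Lp_int p (\<lambda>z. f z - Abel_sum a N z))"
        by (intro mult_left_mono add_right_mono C1(2) mixed_diff_nonneg[OF a(2)] n h) simp
      finally have "w * I \<le> w * (2 powr p * (C1 * coeff_sum p (tail_sum (mixed_diff a) N) N n1 n2 \<alpha>1 \<alpha>2 +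
          diff_coeff_sum \<alpha>1 powr p * diff_coeff_sum \<alpha>2 powr p * Lp_int p (\<lambda>z. f z - Abel_sum a N z)))"
        using w by (rule mult_left_mono)
      also have "\<dots> = 2 powr p * C1 * (w * coeff_sum p (tail_sum (mixed_diff a) N) N n1 n2 \<alpha>1 \<alpha>2) + c * Lp_int p (\<lambda>z. f z - Abel_sum a N z)"
        unfolding c_def by (simp add: algebra_simps)
      also have "\<dots> \<le> 2 powr p * C1 * (C2 * Z) + c * Lp_int p (\<lambda>z. f z - Abel_sum a N z)"
        unfolding w_def Z_def using C1(1) by (intro add_right_mono mult_left_mono C2(2) f a n) simp
      finally show ?thesis by (simp only: mult.assoc)
    qed
    have "(\<lambda>N. (2 powr p * C1 * C2) * Z + c * Lp_int p (\<lambda>z. f z - Abel_sum a N z)) \<longlonglongrightarrow> (2 powr p * C1 * C2) * Z + c * 0"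
      by (intro tendsto_intros Abel_sum_tendsto p f a)
    hence "w * I \<le> (2 powr p * C1 * C2) * Z + c * 0"
      by (rule LIMSEQ_le_const) (use le in blast)
    thus ?thesis unfolding w_def I_def Z_def by simp
  qed
  have "2 powr p * C1 * C2 > 0" using C1(1) C2(1) by simp
  thus ?thesis using main by blast
qed

text \<open>\<open>X\<close> is any common bound for the differences, so the supremum enters only
  later. Both the differences and the angular approximations of \<open>f\<close> are compared with
  an Abel sum, and the errors vanish in the limit.\<close>

lemma weighted_sum_le_modulus:
  assumes p: "p > 1" and \<alpha>: "\<alpha>1 > 0" "\<alpha>2 > 0"
  shows "\<exists>C>0. \<forall>f a n1 n2 X. f \<in> Lp_torus p \<longrightarrow> has_cos_cos_Fourier_series f a \<longrightarrow> mono_coeffs a \<longrightarrow> n1 \<ge> 1 \<longrightarrow> n2 \<ge> 1 \<longrightarrow>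
    (\<forall>h1 h2. \<bar>h1\<bar> \<le> 1 / real n1 \<longrightarrow> \<bar>h2\<bar> \<le> 1 / real n2 \<longrightarrow> Lp_int p (frac_diff1 \<alpha>1 h1 (frac_diff2 \<alpha>2 h2 f)) \<le> X) \<longrightarrow>
    weighted_sum (\<alpha>1 * p) (\<alpha>2 * p) n1 n2 (\<lambda>m1 m2. best_angular_approx p m1 m2 f powr p)
      \<le> C * ((real n1 powr (\<alpha>1 * p) * real n2 powr (\<alpha>2 * p)) * X)"
proof -
  have p0: "p > 0" using p by simp
  obtain C1 where C1: "C1 > 0" "\<And>d N m1 m2. (\<And>i j. d i j \<ge> 0) \<Longrightarrow>
     Lp_int p (tensor_sum d N (cos_sum m1) (cos_sum m2)) \<le> C1 * coeff_sum p (tail_sum d N) N (m1 + 1) (m2 + 1) (2 * \<alpha>1) (2 * \<alpha>2)"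
    using Lp_int_angle_remainder[OF p, of "2 * \<alpha>1" "2 * \<alpha>2"] \<alpha> by auto
  obtain C2 where C2: "C2 > 0" "\<And>A N n1 n2. n1 \<ge> 1 \<Longrightarrow> n2 \<ge> 1 \<Longrightarrow>
    weighted_sum (\<alpha>1 * p) (\<alpha>2 * p) n1 n2 (\<lambda>m1 m2. coeff_sum p A N (m1 + 1) (m2 + 1) (2 * \<alpha>1) (2 * \<alpha>2))
      \<le> C2 * ((real n1 powr (\<alpha>1 * p) * real n2 powr (\<alpha>2 * p)) * coeff_sum p A N n1 n2 \<alpha>1 \<alpha>2)"
    using weighted_sum_coeff_sum_le[OF p \<alpha>] by blast
  obtain C3 where C3: "C3 > 0" "\<And>d N n1 n2 X. (\<And>i j. d i j \<ge> 0) \<Longrightarrow> n1 \<ge> 1 \<Longrightarrow> n2 \<ge> 1 \<Longrightarrow>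
     (\<And>h1 h2. \<bar>h1\<bar> \<le> 1 / real n1 \<Longrightarrow> \<bar>h2\<bar> \<le> 1 / real n2 \<Longrightarrow> Lp_int p (frac_diff1 \<alpha>1 h1 (frac_diff2 \<alpha>2 h2 (tensor_sum d N (cos_sum 0) (cos_sum 0)))) \<le> X) \<Longrightarrow>
     coeff_sum p (tail_sum d N) N n1 n2 \<alpha>1 \<alpha>2 \<le> C3 * X"
    using modulus_lower_poly[OF p \<alpha>] by blast
  define K where "K = 2 powr p * C1 * C2 * C3 * 2 powr p"
  have main: "weighted_sum (\<alpha>1 * p) (\<alpha>2 * p) n1 n2 (\<lambda>m1 m2. best_angular_approx p m1 m2 f powr p)
      \<le> K * ((real n1 powr (\<alpha>1 * p) * real n2 powr (\<alpha>2 * p)) * X)"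
    if f: "f \<in> Lp_torus p" and a: "has_cos_cos_Fourier_series f a" "mono_coeffs a" and n: "n1 \<ge> 1" "n2 \<ge> 1"
      and X: "\<forall>h1 h2. \<bar>h1\<bar> \<le> 1 / real n1 \<longrightarrow> \<bar>h2\<bar> \<le> 1 / real n2 \<longrightarrow> Lp_int p (frac_diff1 \<alpha>1 h1 (frac_diff2 \<alpha>2 h2 f)) \<le> X"
    for f a n1 n2 X
  proof -
    define w where "w = real n1 powr (\<alpha>1 * p) * real n2 powr (\<alpha>2 * p)"
    define b where "b = diff_coeff_sum \<alpha>1 powr p * diff_coeff_sum \<alpha>2 powr p"
    define Y where "Y = weighted_sum (\<alpha>1 * p) (\<alpha>2 * p) n1 n2"
    define e where "e N = Lp_int p (\<lambda>z. f z - Abel_sum a N z)" for N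
    define J where "J N = coeff_sum p (tail_sum (mixed_diff a) N) N n1 n2 \<alpha>1 \<alpha>2" for N
    have w: "w \<ge> 0" by (simp add: w_def)
    have J: "J N \<le> C3 * (2 powr p * (X + b * e N))" for N
      unfolding J_def
    proof (rule C3(2)[OF mixed_diff_nonneg[OF a(2)] n])
      fix h1 h2 :: real assume h: "\<bar>h1\<bar> \<le> 1 / real n1" "\<bar>h2\<bar> \<le> 1 / real n2"
      have eq: "(\<lambda>z. f z + - (f z - Abel_sum a N z)) = Abel_sum a N" by simp
      have D: "(\<lambda>z. f z - Abel_sum a N z) \<in> Lp_torus p" by (rule Lp_torus_diff(1)[OF p0 f Abel_sum_Lp[OF p0]])
      have "Lp_int p (frac_diff1 \<alpha>1 h1 (frac_diff2 \<alpha>2 h2 (\<lambda>z. f z + - (f z - Abel_sum a N z)))) \<le>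
          2 powr p * (Lp_int p (frac_diff1 \<alpha>1 h1 (frac_diff2 \<alpha>2 h2 f)) + b * e N)"
        using Lp_int_frac_diff_add[OF p \<alpha> f Lp_torus_minus(1)[OF D], of h1 h2]
        unfolding Lp_torus_minus(2)[OF D] b_def e_def .
      also have "\<dots> \<le> 2 powr p * (X + b * e N)" using X h by (intro mult_left_mono add_right_mono) auto
      finally show "Lp_int p (frac_diff1 \<alpha>1 h1 (frac_diff2 \<alpha>2 h2 (Abel_sum a N))) \<le> 2 powr p * (X + b * e N)"
        unfolding eq .
    qed
    \<comment> \<open>The error \<open>e N\<close> is multiplied by the total weight
      \<open>Y (\<lambda>_ _. 1)\<close>, which depends on \<open>n1\<close> and \<open>n2\<close>
      but not on \<open>N\<close>; only the limit removes it from the constant.\<close>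
    have le: "Y (\<lambda>m1 m2. best_angular_approx p m1 m2 f powr p) \<le>
        2 powr p * (e N * Y (\<lambda>_ _. 1) + C1 * (C2 * (w * (C3 * (2 powr p * (X + b * e N))))))" for N
    proof -
      have "Y (\<lambda>m1 m2. best_angular_approx p m1 m2 f powr p) \<le>
          Y (\<lambda>m1 m2. 2 powr p * (e N + C1 * coeff_sum p (tail_sum (mixed_diff a) N) N (m1 + 1) (m2 + 1) (2 * \<alpha>1) (2 * \<alpha>2)))"
        unfolding Y_def
      proof (rule weighted_sum_mono)
        fix m1 m2
        have "Lp_int p (tensor_sum (mixed_diff a) N (cos_sum m1) (cos_sum m2)) \<le> C1 * coeff_sum p (tail_sum (mixed_diff a) N) N (m1 + 1) (m2 + 1) (2 * \<alpha>1) (2 * \<alpha>2)"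
          by (rule C1(2)[OF mixed_diff_nonneg[OF a(2)]])
        hence "2 powr p * (e N + Lp_int p (tensor_sum (mixed_diff a) N (cos_sum m1) (cos_sum m2))) \<le>
          2 powr p * (e N + C1 * coeff_sum p (tail_sum (mixed_diff a) N) N (m1 + 1) (m2 + 1) (2 * \<alpha>1) (2 * \<alpha>2))"
          by (intro mult_left_mono add_left_mono) auto
        thus "best_angular_approx p m1 m2 f powr p \<le>
          2 powr p * (e N + C1 * coeff_sum p (tail_sum (mixed_diff a) N) N (m1 + 1) (m2 + 1) (2 * \<alpha>1) (2 * \<alpha>2))"
          using best_angular_approx_upper[OF p f, of m1 m2 a N] unfolding e_def by (rule order_trans[rotated])
      qed
      also have "\<dots> = 2 powr p * (e N * Y (\<lambda>_ _. 1) + C1 * Y (\<lambda>m1 m2. coeff_sum p (tail_sum (mixed_diff a) N) N (m1 + 1) (m2 + 1) (2 * \<alpha>1) (2 * \<alpha>2)))"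
        unfolding Y_def by (rule weighted_sum_linear)
      also have "\<dots> \<le> 2 powr p * (e N * Y (\<lambda>_ _. 1) + C1 * (C2 * (w * J N)))"
        unfolding Y_def w_def J_def using C1(1) by (intro mult_left_mono add_left_mono C2(2) n) auto
      also have "\<dots> \<le> 2 powr p * (e N * Y (\<lambda>_ _. 1) + C1 * (C2 * (w * (C3 * (2 powr p * (X + b * e N))))))"
        using C1(1) C2(1) w by (intro mult_left_mono add_left_mono J) auto
      finally show ?thesis .
    qed
    have e: "e \<longlonglongrightarrow> 0" unfolding e_def by (rule Abel_sum_tendsto[OF p f a])
    have "(\<lambda>N. 2 powr p * (e N * Y (\<lambda>_ _. 1) + C1 * (C2 * (w * (C3 * (2 powr p * (X + b * e N)))))))
       \<longlonglongrightarrow> 2 powr p * (0 * Y (\<lambda>_ _. 1) + C1 * (C2 * (w * (C3 * (2 powr p * (X + b * 0))))))"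
      by (intro tendsto_intros e)
    hence "Y (\<lambda>m1 m2. best_angular_approx p m1 m2 f powr p) \<le> 2 powr p * (0 * Y (\<lambda>_ _. 1) + C1 * (C2 * (w * (C3 * (2 powr p * (X + b * 0))))))"
      by (rule LIMSEQ_le_const) (use le in blast)
    also have "\<dots> = K * (w * X)" by (simp add: K_def)
    finally show ?thesis unfolding Y_def w_def .
  qed
  have "K > 0" using C1(1) C2(1) C3(1) by (simp add: K_def)
  thus ?thesis using main by blast
qed

theorem theorem9p2:
  fixes p \<alpha>1 \<alpha>2 :: real
  assumes "1 < p" and "\<alpha>1 > 0" and "\<alpha>2 > 0"
  shows "\<exists>C>0. \<forall>f \<in> class_M p. \<forall>n1\<ge>1. \<forall>n2\<ge>1.
    (let A = mixed_modulus p \<alpha>1 \<alpha>2 f (1 / real n1) (1 / real n2);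
         B = 1 / real n1 powr \<alpha>1 * (1 / real n2 powr \<alpha>2) *
             (\<Sum>\<nu>1 = 1..n1 + 1. \<Sum>\<nu>2 = 1..n2 + 1.
                real \<nu>1 powr (\<alpha>1 * p - 1) * real \<nu>2 powr (\<alpha>2 * p - 1) *
                best_angular_approx p (\<nu>1 - 1) (\<nu>2 - 1) f powr p) powr (1 / p)
     in inverse C * B \<le> A \<and> A \<le> C * B)"
proof -
  note p = assms(1) and \<alpha> = assms(2,3)
  have p0: "p > 0" using p by simp
  obtain C1 where C1: "C1 > 0" "\<And>f a n1 n2 h1 h2. f \<in> Lp_torus p \<Longrightarrow> has_cos_cos_Fourier_series f a \<Longrightarrow> mono_coeffs a \<Longrightarrow> n1 \<ge> 1 \<Longrightarrow> n2 \<ge> 1 \<Longrightarrow>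
    \<bar>h1\<bar> \<le> 1 / real n1 \<Longrightarrow> \<bar>h2\<bar> \<le> 1 / real n2 \<Longrightarrow>
    (real n1 powr (\<alpha>1 * p) * real n2 powr (\<alpha>2 * p)) * Lp_int p (frac_diff1 \<alpha>1 h1 (frac_diff2 \<alpha>2 h2 f))
      \<le> C1 * weighted_sum (\<alpha>1 * p) (\<alpha>2 * p) n1 n2 (\<lambda>m1 m2. best_angular_approx p m1 m2 f powr p)"
    using Lp_int_frac_diff_le_weighted_sum[OF p \<alpha>] by blast
  obtain C2 where C2: "C2 > 0" "\<And>f a n1 n2 X. f \<in> Lp_torus p \<Longrightarrow> has_cos_cos_Fourier_series f a \<Longrightarrow> mono_coeffs a \<Longrightarrow> n1 \<ge> 1 \<Longrightarrow> n2 \<ge> 1 \<Longrightarrow>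
    (\<And>h1 h2. \<bar>h1\<bar> \<le> 1 / real n1 \<Longrightarrow> \<bar>h2\<bar> \<le> 1 / real n2 \<Longrightarrow> Lp_int p (frac_diff1 \<alpha>1 h1 (frac_diff2 \<alpha>2 h2 f)) \<le> X) \<Longrightarrow>
    weighted_sum (\<alpha>1 * p) (\<alpha>2 * p) n1 n2 (\<lambda>m1 m2. best_angular_approx p m1 m2 f powr p)
      \<le> C2 * ((real n1 powr (\<alpha>1 * p) * real n2 powr (\<alpha>2 * p)) * X)"
    using weighted_sum_le_modulus[OF p \<alpha>] by blast
  \<comment> \<open>The preceding estimates concern \<open>p\<close>-th powers; the root of order
    \<open>p\<close> is taken here, and one constant serves both directions.\<close>
  define D where "D = max (C1 powr (1 / p)) (C2 powr (1 / p))"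
  have D: "D > 0" using C1(1) by (simp add: D_def less_max_iff_disj)
  have main: "inverse D * B \<le> A \<and> A \<le> D * B"
    if fM: "f \<in> class_M p" and n: "n1 \<ge> 1" "n2 \<ge> 1"
      and A: "A = mixed_modulus p \<alpha>1 \<alpha>2 f (1 / real n1) (1 / real n2)"
      and B: "B = 1 / real n1 powr \<alpha>1 * (1 / real n2 powr \<alpha>2) *
        weighted_sum (\<alpha>1 * p) (\<alpha>2 * p) n1 n2 (\<lambda>m1 m2. best_angular_approx p m1 m2 f powr p) powr (1 / p)"
    for f A B n1 n2
  proof -
    have f: "f \<in> Lp_torus p" using fM by (simp add: class_M_def Lp0_torus_def)
    obtain a where a: "has_cos_cos_Fourier_series f a" "mono_coeffs a" using class_M_coeffs[OF p fM] by blast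
    define Z where "Z = weighted_sum (\<alpha>1 * p) (\<alpha>2 * p) n1 n2 (\<lambda>m1 m2. best_angular_approx p m1 m2 f powr p)"
    define v where "v = real n1 powr \<alpha>1 * real n2 powr \<alpha>2"
    have v: "v > 0" using n by (simp add: v_def)
    have vp: "real n1 powr (\<alpha>1 * p) * real n2 powr (\<alpha>2 * p) = v powr p"
      by (simp add: v_def powr_mult powr_powr)
    have Z: "Z \<ge> 0" unfolding Z_def by (intro weighted_sum_nonneg) simp
    have Be: "B = Z powr (1 / p) / v" unfolding B Z_def v_def by simp
    define H where "H = {(h1, h2). \<bar>h1\<bar> \<le> 1 / real n1 \<and> \<bar>h2\<bar> \<le> 1 / real n2}"
    define L where "L = (\<lambda>(h1, h2). Lp_norm p (frac_diff1 \<alpha>1 h1 (frac_diff2 \<alpha>2 h2 f)))"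
    have AL: "A = (SUP h\<in>H. L h)" unfolding A mixed_modulus_def H_def L_def ..
    \<comment> \<open>The same bound shows that the supremum defining \<open>A\<close> is over a
      bounded set; otherwise the value of \<open>SUP\<close> on the reals would carry no
      information.\<close>
    have bound: "L h \<le> C1 powr (1 / p) * B" if "h \<in> H" for h
    proof -
      obtain h1 h2 where h: "h = (h1, h2)" "\<bar>h1\<bar> \<le> 1 / real n1" "\<bar>h2\<bar> \<le> 1 / real n2"
        using \<open>h \<in> H\<close> unfolding H_def by blast
      have "v powr p * Lp_int p (frac_diff1 \<alpha>1 h1 (frac_diff2 \<alpha>2 h2 f)) \<le> C1 * Z"
        using C1(2)[OF f a n h(2,3)] unfolding vp Z_def .
      hence "Lp_int p (frac_diff1 \<alpha>1 h1 (frac_diff2 \<alpha>2 h2 f)) \<le> C1 * Z / v powr p"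
        using v by (simp add: pos_le_divide_eq mult.commute)
      hence "Lp_norm p (frac_diff1 \<alpha>1 h1 (frac_diff2 \<alpha>2 h2 f)) \<le> (C1 * Z / v powr p) powr (1 / p)"
        unfolding Lp_norm_Lp_int using p0 by (intro powr_mono2) auto
      also have "\<dots> = C1 powr (1 / p) * B"
        using p0 v by (simp add: Be powr_divide powr_mult powr_powr)
      finally show ?thesis by (simp add: L_def h(1))
    qed
    \<comment> \<open>The zero steps make the index set nonempty and give
      \<open>A >= 0\<close>.\<close>
    have H0: "(0, 0) \<in> H" by (simp add: H_def)
    have bdd: "bdd_above (L ` H)" using bound by (intro bdd_aboveI2)
    have LA: "L h \<le> A" if "h \<in> H" for h unfolding AL by (rule cSUP_upper[OF that bdd])
    have "H \<noteq> {}" using H0 by blast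
    hence "A \<le> C1 powr (1 / p) * B" unfolding AL using bound by (rule cSUP_least)
    also have "\<dots> \<le> D * B" using v by (intro mult_right_mono) (simp_all add: Be D_def)
    finally have up: "A \<le> D * B" .
    have "0 \<le> L (0, 0)" by (simp add: L_def Lp_norm_def)
    hence A0: "A \<ge> 0" using LA[OF H0] by linarith
    \<comment> \<open>Here \<open>A powr p\<close> plays the part of the common bound
      \<open>X\<close>, since every difference with admissible steps is below the supremum.\<close>
    have "Z \<le> C2 * (v powr p * A powr p)"
      unfolding Z_def vp[symmetric]
    proof (rule C2(2)[OF f a n])
      fix h1 h2 :: real assume "\<bar>h1\<bar> \<le> 1 / real n1" "\<bar>h2\<bar> \<le> 1 / real n2"
      hence "L (h1, h2) \<le> A" by (intro LA) (simp add: H_def)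
      hence "Lp_int p (frac_diff1 \<alpha>1 h1 (frac_diff2 \<alpha>2 h2 f)) powr (1 / p) \<le> A"
        by (simp add: L_def Lp_norm_Lp_int)
      hence "(Lp_int p (frac_diff1 \<alpha>1 h1 (frac_diff2 \<alpha>2 h2 f)) powr (1 / p)) powr p \<le> A powr p"
        using p0 by (intro powr_mono2) auto
      thus "Lp_int p (frac_diff1 \<alpha>1 h1 (frac_diff2 \<alpha>2 h2 f)) \<le> A powr p"
        using p0 by (simp add: powr_powr)
    qed
    hence "Z powr (1 / p) \<le> (C2 * (v powr p * A powr p)) powr (1 / p)"
      using p0 Z by (intro powr_mono2) auto
    also have "\<dots> = C2 powr (1 / p) * (v * A)"
      using p0 v A0 by (simp add: powr_mult powr_powr)
    also have "\<dots> \<le> D * (v * A)" using v A0 by (intro mult_right_mono) (auto simp: D_def)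
    finally have "B \<le> D * A" unfolding Be using v by (simp add: pos_divide_le_eq mult_ac)
    hence "B / D \<le> A" using D by (simp add: pos_divide_le_eq mult.commute)
    hence "inverse D * B \<le> A" by (simp only: divide_inverse mult.commute)
    with up show ?thesis by blast
  qed
  show ?thesis
    unfolding Let_def
    using D main[unfolded weighted_sum_def, OF _ _ _ refl refl] by (intro exI[of _ D]) blast
qed

end
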